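(* Let $D\subset\mathbb R^3$ be the open unit ball centered at the origin, with elastic parameters $(\tilde\lambda,\tilde\mu,\tilde\rho)$, embedded in the homogeneous elastic medium $(\mathbb R^3\setminus\overline D;\lambda,\mu,\rho)$, and let $B_R\supseteq D$ be the ball of radius $R$ centered at the origin. Assume $\tilde\lambda=\lambda/\delta$, $\tilde\mu=\mu/\delta$, $\tilde\rho=\rho/\epsilon$ with constants $0<\delta\ll1$, $0<\epsilon\ll1$, $\tau=\sqrt{\delta/\epsilon}<1$; $\lambda,\mu,\rho=\mathcal O(1)$; and $\omega=o(1)$. Let the incident wave be $$\mathbf u^i(\mathbf x)=\sum_{m=-n}^n f_{n,m}\,j_n(k_s|\mathbf x|)\,\mathcal T_n^m(\theta,\varphi),$$ with $(f_{n,-n},\dots,f_{n,n})\in\mathbb C^{2n+1}$ nonzero, and let $\mathbf u$ in $D$ and $\mathbf u^s$ in $\mathbb R^3\setminus\overline D$ be the internal total field and external scattered field of the elastic scattering problem described in the context. Fix $\gamma_1\in(0,1)$, $\gamma_2\in(1,R)$ and a (sufficiently small) boundary localization level $\varepsilon>0$ with $\varepsilon<\gamma_1$. If $$\delta\le\beta:=\min\left\{\frac{2\ln\gamma_1}{\ln\varepsilon-\ln\gamma_1},\ \frac{2\ln\gamma_2}{3\ln\gamma_2-\ln\varepsilon}\right\}$$ and the index $n$ of $\mathbf u^i$ satisfies $n\ge 1/\delta$, then $$\frac{\|\mathbf u\|^2_{L^2(D\setminus\mathcal M_-^{1-\gamma_1}(\partial D))^3}}{\|\mathbf u\|^2_{L^2(D)^3}}\le\varepsilon+\mathcal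 O(\varepsilon\omega^2)\ll1,\qquad \frac{\|\mathbf u^s\|^2_{L^2((B_R\setminus\overline D)\setminus\mathcal M_+^{\gamma_2-1}(\partial D))^3}}{\|\mathbf u^s\|^2_{L^2(B_R\setminus\overline D)^3}}\le\varepsilon+\mathcal O(\varepsilon\omega^2)\ll1 .$$
   Context: Scattering problem. $\omega>0$ is the angular frequency. $\mathcal L_{\lambda,\mu}=\mu\Delta+(\lambda+\mu)\nabla\nabla\cdot$ is the Lamé operator; $\lambda,\mu$ are real with $\mu>0$, $3\lambda+2\mu>0$, likewise $\tilde\mu>0$, $3\tilde\lambda+2\tilde\mu>0$; the densities $\rho,\tilde\rho$ are positive. The incident field $\mathbf u^i$ is an entire solution of $\mathcal L_{\lambda,\mu}\mathbf u^i+\omega^2\rho\mathbf u^i=0$ in $\mathbb R^3$. The total field $\mathbf u$ (with $\mathbf u=\mathbf u^i+\mathbf u^s$ outside $D$) satisfies $\mathcal L_{\tilde\lambda,\tilde\mu}\mathbf u+\omega^2\tilde\rho\mathbf u=0$ in $D$; $\mathcal L_{\lambda,\mu}\mathbf u+\omega^2\rho\mathbf u=0$ in $\mathbb R^3\setminus\overline D$; $\mathbf u|_-=\mathbf u|_+$ and $\partial_{\nu,\tilde\lambda,\tilde\mu}\mathbf u|_-=\partial_{\nu,\lambda,\mu}\mathbf u|_+$ on $\partial D$ ($\pm$ = limits from outside/inside $D$), where $\partial_{\nu,\lambda,\mu}\mathbf u=\lambda(\nabla\cdot\mathbf u)\nu+\mu(\nabla\mathbf u+\nabla\mathbf u^\top)\nu$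 and $\nu$ is the outward unit normal; and $\mathbf u^s$ satisfies the radiation condition, as $|\mathbf x|\to\infty$, $(\nabla\times\nabla\times\mathbf u^s)\times\frac{\mathbf x}{|\mathbf x|}-\mathrm i k_s\nabla\times\mathbf u^s=\mathcal O(|\mathbf x|^{-2})$ and $\frac{\mathbf x}{|\mathbf x|}\cdot\nabla(\nabla\cdot\mathbf u^s)-\mathrm i k_p\nabla\cdot\mathbf u^s=\mathcal O(|\mathbf x|^{-2})$. Here $k_s=\omega\sqrt{\rho/\mu}$, $k_p=\omega\sqrt{\rho/(\lambda+2\mu)}$. Special functions. $n\ge1$ is an integer; $(\theta,\varphi)$ are the spherical angles of $\mathbf x$; $j_n$ is the spherical Bessel function of order $n$; $Y_n^m(\theta,\varphi)=C_n^mP_n^{|m|}(\cos\theta)e^{\mathrm i m\varphi}$ with $C_n^m=\sqrt{\frac{2n+1}{4\pi}\frac{(n-|m|)!}{(n+|m|)!}}$ and $P_n^{|m|}$ the associated Legendre functions; $\mathcal T_n^m=\nabla_{\mathbb S^2}Y_n^m\wedge\nu$ ($\wedge$ the cross product, $\nu=\mathbf x/|\mathbf x|$, $\nabla_{\mathbb S^2}$ the surface gradient). Boundary layers. $\mathcal M_-^{\xi}(\partial D)=\{\mathbf x\in D:\ d_{\partial D}(\mathbf x)<\xi\}$ and $\mathcal M_+^{\xi}(\partial D)=\{\mathbf x\in B_R\setminus\overline D:\ d_{\partial D}(\mathbf x)<\xi\}$, with $d_{\partial D}$ the Euclidean distance to $\partial D$. Asymptotics. $\mathcal O(\cdot)$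 and $o(\cdot)$ refer to the regime $\omega\to0$; $a\ll1$ means $a$ is sufficiently small. $\delta$ is the Lamé contrast and $\epsilon$ the density contrast; $\varepsilon$ (a different symbol) is the boundary localization level. *)

theory Defs
  imports "HOL-Analysis.Analysis" "HOL-Computational_Algebra.Polynomial"
begin

section \<open>Vector calculus for complex-valued fields on $R^3$\<close>

definition partial :: "3 \<Rightarrow> (real^3 \<Rightarrow> 'b::real_normed_vector) \<Rightarrow> real^3 \<Rightarrow> 'b" where
  "partial j f x = vector_derivative (\<lambda>t. f (x + t *\<^sub>R axis j 1)) (at 0)"

definition C2_on :: "(real^3 \<Rightarrow> 'b::real_normed_vector) \<Rightarrow> (real^3) set \<Rightarrow> bool" where
  "C2_on f S \<longleftrightarrow>
     (\<forall>x\<in>S. f differentiable (at x)) \<and>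
     (\<forall>j. \<forall>x\<in>S. partial j f differentiable (at x)) \<and>
     (\<forall>i j. continuous_on S (partial i (partial j f)))"

text \<open>The field and all its first derivatives have limits at every boundary point
  of the open set \<open>S\<close>, taken from within \<open>S\<close>.\<close>

definition C1_up_to_boundary :: "(real^3 \<Rightarrow> 'b::real_normed_vector) \<Rightarrow> (real^3) set \<Rightarrow> bool" where
  "C1_up_to_boundary f S \<longleftrightarrow>
     (\<forall>x\<in>frontier S. (\<exists>l. (f \<longlongrightarrow> l) (at x within S)) \<and>
                     (\<forall>j. \<exists>l. (partial j f \<longlongrightarrow> l) (at x within S)))"

definition cvec :: "real^3 \<Rightarrow> complex^3" where
  "cvec x = (\<chi> i. complex_of_real (x $ i))"

definition ccross :: "complex^3 \<Rightarrow> complex^3 \<Rightarrow> complex^3" where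
  "ccross a b = vector [a$2 * b$3 - a$3 * b$2, a$3 * b$1 - a$1 * b$3, a$1 * b$2 - a$2 * b$1]"

definition cgrad :: "(real^3 \<Rightarrow> complex) \<Rightarrow> real^3 \<Rightarrow> complex^3" where
  "cgrad f x = (\<chi> i. partial i f x)"

definition cdiv :: "(real^3 \<Rightarrow> complex^3) \<Rightarrow> real^3 \<Rightarrow> complex" where
  "cdiv u x = (\<Sum>i\<in>UNIV. partial i (\<lambda>y. u y $ i) x)"

definition ccurl :: "(real^3 \<Rightarrow> complex^3) \<Rightarrow> real^3 \<Rightarrow> complex^3" where
  "ccurl u x = vector
     [partial 2 (\<lambda>y. u y $ 3) x - partial 3 (\<lambda>y. u y $ 2) x,
      partial 3 (\<lambda>y. u y $ 1) x - partial 1 (\<lambda>y. u y $ 3) x,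
      partial 1 (\<lambda>y. u y $ 2) x - partial 2 (\<lambda>y. u y $ 1) x]"

definition cjac :: "(real^3 \<Rightarrow> complex^3) \<Rightarrow> real^3 \<Rightarrow> complex^3^3" where
  "cjac u x = (\<chi> i j. partial j (\<lambda>y. u y $ i) x)"

definition laplacian :: "(real^3 \<Rightarrow> 'b::real_normed_vector) \<Rightarrow> real^3 \<Rightarrow> 'b" where
  "laplacian u x = (\<Sum>j\<in>UNIV. partial j (partial j u) x)"


section \<open>The elastic scattering problem\<close>

definition lame :: "real \<Rightarrow> real \<Rightarrow> (real^3 \<Rightarrow> complex^3) \<Rightarrow> real^3 \<Rightarrow> complex^3" where
  "lame lam \<mu> u x = \<mu> *\<^sub>R laplacian u x + (lam + \<mu>) *\<^sub>R cgrad (cdiv u) x"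

definition traction ::
  "real \<Rightarrow> real \<Rightarrow> (real^3 \<Rightarrow> complex^3) \<Rightarrow> real^3 \<Rightarrow> real^3 \<Rightarrow> complex^3" where
  "traction lam \<mu> u \<nu> x =
     lam *\<^sub>R (cdiv u x *s cvec \<nu>) + \<mu> *\<^sub>R ((cjac u x + transpose (cjac u x)) *v cvec \<nu>)"

definition k_s :: "real \<Rightarrow> real \<Rightarrow> real \<Rightarrow> real" where
  "k_s \<mu> \<rho> \<omega> = \<omega> * sqrt (\<rho> / \<mu>)"

definition k_p :: "real \<Rightarrow> real \<Rightarrow> real \<Rightarrow> real \<Rightarrow> real" where
  "k_p lam \<mu> \<rho> \<omega> = \<omega> * sqrt (\<rho> / (lam + 2 * \<mu>))"

definition radiation_condition ::
  "real \<Rightarrow> real \<Rightarrow> real \<Rightarrow> real \<Rightarrow> (real^3 \<Rightarrow> complex^3) \<Rightarrow> bool" where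
  "radiation_condition lam \<mu> \<rho> \<omega> us \<longleftrightarrow>
     (\<lambda>x. norm (ccross (ccurl (ccurl us) x) (cvec (sgn x))
                - (\<i> * complex_of_real (k_s \<mu> \<rho> \<omega>)) *s ccurl us x))
       \<in> O[at_infinity](\<lambda>x. 1 / norm x ^ 2) \<and>
     (\<lambda>x. norm ((\<Sum>i\<in>UNIV. cvec (sgn x) $ i * cgrad (cdiv us) x $ i)
                - \<i> * complex_of_real (k_p lam \<mu> \<rho> \<omega>) * cdiv us x))
       \<in> O[at_infinity](\<lambda>x. 1 / norm x ^ 2)"

text \<open>
  Classical solutions: \<open>u\<close> is $C^2$ in \<open>D\<close> and in the exterior, and $C^1$ up to
  \<open>\<partial>D\<close> from either side. The transmission conditions say that the one-sided limits from
  \<open>D\<close> and from the exterior agree; \<open>\<nu> x\<close> is the outward unit normal of \<open>D\<close> at \<open>x\<close>. The values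
  of \<open>u\<close> on \<open>\<partial>D\<close>, and those of \<open>us\<close> on the closure of \<open>D\<close>, are irrelevant.
\<close>

definition scattering_solution ::
  "(real^3) set \<Rightarrow> (real^3 \<Rightarrow> real^3) \<Rightarrow> real \<Rightarrow> real \<Rightarrow> real \<Rightarrow> real \<Rightarrow> real \<Rightarrow> real \<Rightarrow> real \<Rightarrow>
   (real^3 \<Rightarrow> complex^3) \<Rightarrow> (real^3 \<Rightarrow> complex^3) \<Rightarrow> (real^3 \<Rightarrow> complex^3) \<Rightarrow> bool" where
  "scattering_solution D \<nu> lam \<mu> \<rho> lam' \<mu>' \<rho>' \<omega> ui u us \<longleftrightarrow>
     C2_on u D \<and> C2_on u (- closure D) \<and>
     C1_up_to_boundary u D \<and> C1_up_to_boundary u (- closure D) \<and>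
     (\<forall>x\<in>D. lame lam' \<mu>' u x + (\<omega>\<^sup>2 * \<rho>') *\<^sub>R u x = 0) \<and>
     (\<forall>x\<in>- closure D. lame lam \<mu> u x + (\<omega>\<^sup>2 * \<rho>) *\<^sub>R u x = 0) \<and>
     (\<forall>x\<in>frontier D. \<exists>l. (u \<longlongrightarrow> l) (at x within D) \<and>
                         (u \<longlongrightarrow> l) (at x within - closure D)) \<and>
     (\<forall>x\<in>frontier D. \<exists>l. (traction lam' \<mu>' u (\<nu> x) \<longlongrightarrow> l) (at x within D) \<and>
                         (traction lam \<mu> u (\<nu> x) \<longlongrightarrow> l) (at x within - closure D)) \<and>
     (\<forall>x\<in>- closure D. u x = ui x + us x) \<and>
     radiation_condition lam \<mu> \<rho> \<omega> us"


section \<open>Special functions and the incident field\<close>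

text \<open>Power series $j_n(t) = \sum_p (-1)^p t^{n+2p} / (2^p\, p!\; 1\cdot 3\cdots(2n+2p+1))$.\<close>

definition spherical_bessel_j :: "nat \<Rightarrow> real \<Rightarrow> real" where
  "spherical_bessel_j n t =
     (\<Sum>p. (-1) ^ p * t ^ (n + 2 * p) / (2 ^ p * fact p * (\<Prod>i\<le>n + p. real (2 * i + 1))))"

text \<open>Rodrigues' formula.\<close>

definition legendre_poly :: "nat \<Rightarrow> real poly" where
  "legendre_poly n = smult (1 / (2 ^ n * fact n)) ((pderiv ^^ n) ([:-1, 0, 1:] ^ n))"

text \<open>$P_n^m(t) = (1-t^2)^{m/2} P_n^{(m)}(t)$, without the Condon--Shortley sign.\<close>

definition assoc_legendre :: "nat \<Rightarrow> nat \<Rightarrow> real \<Rightarrow> real" where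
  "assoc_legendre n m t = sqrt (1 - t\<^sup>2) ^ m * poly ((pderiv ^^ m) (legendre_poly n)) t"

definition sph_harm :: "nat \<Rightarrow> int \<Rightarrow> real \<Rightarrow> real \<Rightarrow> complex" where
  "sph_harm n m \<theta> \<phi> =
     complex_of_real
       (sqrt ((2 * real n + 1) / (4 * pi) * (fact (n - nat \<bar>m\<bar>) / fact (n + nat \<bar>m\<bar>))) *
        assoc_legendre n (nat \<bar>m\<bar>) (cos \<theta>)) * cis (of_int m * \<phi>)"

definition polar_angle :: "real^3 \<Rightarrow> real" where
  "polar_angle x = arccos (x $ 3 / norm x)"

text \<open>With values in $(-\pi,\pi]$, and $0$ on the $x_3$-axis.\<close>

definition azimuth :: "real^3 \<Rightarrow> real" where
  "azimuth x = Arg (Complex (x $ 1) (x $ 2))"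

text \<open>The surface gradient on the unit sphere is the gradient of the radially constant extension;
  unlike the formula in the angles, this also covers the poles.\<close>

definition surface_grad :: "(real^3 \<Rightarrow> complex) \<Rightarrow> real^3 \<Rightarrow> complex^3" where
  "surface_grad g \<nu> = cgrad (\<lambda>x. g (sgn x)) \<nu>"

definition T_sph :: "nat \<Rightarrow> int \<Rightarrow> real^3 \<Rightarrow> complex^3" where
  "T_sph n m x =
     ccross (surface_grad (\<lambda>y. sph_harm n m (polar_angle y) (azimuth y)) (sgn x)) (cvec (sgn x))"

definition incident_field :: "nat \<Rightarrow> (int \<Rightarrow> complex) \<Rightarrow> real \<Rightarrow> real^3 \<Rightarrow> complex^3" where
  "incident_field n f k x =
     (\<Sum>m\<in>{- int n..int n}. (f m * complex_of_real (spherical_bessel_j n (k * norm x))) *s T_sph n m x)"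


section \<open>Boundary layers and energies\<close>

definition inner_layer :: "(real^3) set \<Rightarrow> real \<Rightarrow> (real^3) set" where
  "inner_layer D \<xi> = {x\<in>D. infdist x (frontier D) < \<xi>}"

definition outer_layer :: "(real^3) set \<Rightarrow> real \<Rightarrow> real \<Rightarrow> (real^3) set" where
  "outer_layer D R \<xi> = {x\<in>ball 0 R - closure D. infdist x (frontier D) < \<xi>}"

definition L2_norm_sq :: "(real^3 \<Rightarrow> complex^3) \<Rightarrow> (real^3) set \<Rightarrow> real" where
  "L2_norm_sq u S = (LINT x:S|lborel. (norm (u x))\<^sup>2)"

end

theory Submission
  imports Defs
begin

text \<open>
  A field is tested on the sphere of radius \<open>r\<close> against \<open>\<phi> x\<close>, the surface gradient of \<open>\<phi>\<close> and the cross product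
  of the latter with \<open>x\<close>, where \<open>\<phi>(x) = (x \<bullet> y)\<^sup>d\<close> for a fixed vector \<open>y\<close>. For a solution of the Navier equation
  these moments satisfy linear ordinary differential equations in \<open>r\<close>, coupled only to the moments of degree
  \<open>d - 2\<close>. By induction on \<open>d\<close>, the spheroidal moments solve a homogeneous transmission problem; the
  imaginary part of their energy flux is constant in \<open>r\<close>, zero at the origin and continuous across the interface,
  so the radiation condition forces them to vanish. The same argument applies to the difference of the toroidal
  moments and those of the explicit candidates \<open>a j\<^sub>n(k' r) T\<close> inside and \<open>b h\<^sub>n(k r) T\<close> outside. By
  Stone-Weierstrass and a Hodge-type identity the moments determine the field, hence \<open>u\<close> and \<open>u\<^sup>s\<close> are these
  candidates, and a Sturm comparison shows that \<open>a\<close> and \<open>b\<close> are not zero. Since \<open>j\<^sub>n\<close> grows like \<open>r\<^sup>n\<close>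
  and \<open>h\<^sub>n\<close> decays like \<open>r\<^sup>-\<^sup>n\<^sup>-\<^sup>1\<close> at small frequency, the substitution \<open>x \<mapsto> \<gamma> x\<close> bounds the two energy
  ratios by \<open>\<gamma>\<^sub>1\<^sup>2\<^sup>n\<^sup>+\<^sup>1\<close> and \<open>\<gamma>\<^sub>2\<^sup>3\<^sup>-\<^sup>2\<^sup>n\<close>, and the bound on \<open>\<delta>\<close> is what makes both at most
  the localization level when \<open>n \<ge> 1 / \<delta>\<close>.
\<close>
section \<open>Partial derivatives\<close>

text \<open>The assertion concerns every classical solution, so its core is a uniqueness proof. The
  obstacle is that the radiation condition controls the divergence and the curl of
  \<open>us\<close>, not \<open>us\<close> itself. The exterior argument therefore runs on the
  potentials r P and r S, formed from divergence and curl moments: they solve scalar radial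
  equations with wave numbers \<open>k_p\<close> and \<open>k_s\<close>, and the imaginary part of
  the elastic flux is, up to a factor, a sum of their Wronskians with nonnegative weights. Powers of
  x\<bullet>y stand in for spherical harmonics because Cartesian fields have no singularity at the
  poles. Nonzero amplitudes are required since the ratios would otherwise be 0/0. As to the
  exponents: the squared field contributes \<gamma>^(2n) inside and \<gamma>^(-2n-2) outside, the
  substitution the Jacobian \<gamma>^3, and one factor \<gamma> per amplitude, so \<gamma>^2 in the
  square, is given up to absorb the deviation of the radial functions from their leading terms.
  These deviations are bounded uniformly in n, which is why a single frequency threshold serves all
  n.\<close>

notation (input) tendsto (infixr "--->" 55)

notation (input) has_vector_derivative (infix "hvd" 50)

lemmas hvd_add = has_vector_derivative_add and hvd_diff = has_vector_derivative_diff and hvd_mult_right = has_vector_derivative_mult_right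
  and hvd_mult_left = has_vector_derivative_mult_left and hvd_mult = has_vector_derivative_mult and hvd_cnj = has_vector_derivative_cnj
  and hvd_minus = has_vector_derivative_minus and hvd_divide = has_vector_derivative_divide and hvd_sum = has_vector_derivative_sum
  and hvd_at_within = has_vector_derivative_at_within and hvd_transform_within_open = has_vector_derivative_transform_within_open

type_synonym sfield = "real^3 => complex"
type_synonym vfield = "real^3 => complex^3"

abbreviation (input) contS :: "(real^3 => 'a::topological_space) => bool" where
  "contS \<equiv> continuous_on (sphere 0 1)"

abbreviation (input) cmp :: "vfield => 3 => sfield" where
  "cmp w i \<equiv> %x. w x $ i"

abbreviation (input) cdot :: "(3 => sfield) => (3 => sfield) => sfield" where
  "cdot G H \<equiv> %x. \<Sum>i\<in>UNIV. G i x * H i x"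

lemma partial_has_derivative:
  assumes "(f has_derivative f') (at x)"
  shows "partial j f x = f' (axis j 1)"
proof -
  have "((%t::real. x + t *\<^sub>R axis j (1::real)) has_derivative (%t. t *\<^sub>R axis j 1)) (at 0)"
    by (auto intro!: derivative_eq_intros)
  moreover have "(f has_derivative f') (at (x + 0 *\<^sub>R axis j (1::real)))" using assms by simp
  ultimately have "((%t. f (x + t *\<^sub>R axis j 1)) has_derivative (%t. f' (t *\<^sub>R axis j 1))) (at 0)"
    by (rule has_derivative_compose)
  hence "((%t. f (x + t *\<^sub>R axis j 1)) hvd f' (axis j 1)) (at 0)"
    unfolding has_vector_derivative_def
    using linear_scale[OF has_derivative_linear[OF assms]] by simp
  thus ?thesis unfolding partial_def by (rule vector_derivative_at)
qed

lemma partial_along_line: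
  assumes "f differentiable (at (x + s *\<^sub>R axis j 1))"
  shows "((%t. f (x + t *\<^sub>R axis j 1)) hvd partial j f (x + s *\<^sub>R axis j 1)) (at s)"
proof -
  obtain f' where f': "(f has_derivative f') (at (x + s *\<^sub>R axis j 1))"
    using assms differentiable_def by blast
  have "((%t::real. x + t *\<^sub>R axis j (1::real)) has_derivative (%t. t *\<^sub>R axis j 1)) (at s)"
    by (auto intro!: derivative_eq_intros)
  from has_derivative_compose[OF this f']
  show ?thesis unfolding has_vector_derivative_def partial_has_derivative[OF f']
    using linear_scale[OF has_derivative_linear[OF f']] by simp
qed

lemma has_derivative_partials:
  fixes f :: "real^3 => 'b::real_normed_vector"
  assumes "f differentiable (at x)"
  shows "(f has_derivative (%v. \<Sum>j\<in>UNIV. (v $ j) *\<^sub>R partial j f x)) (at x)"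
proof -
  obtain f' where f': "(f has_derivative f') (at x)" using assms differentiable_def by blast
  have "f' v = (\<Sum>j\<in>UNIV. (v $ j) *\<^sub>R partial j f x)" for v
  proof -
    have "f' v = f' (\<Sum>j\<in>UNIV. (v $ j) *\<^sub>R axis j 1)"
      by (metis (no_types) basis_expansion scalar_mult_eq_scaleR)
    also have "\<dots> = (\<Sum>j\<in>UNIV. (v $ j) *\<^sub>R f' (axis j 1))"
      using has_derivative_linear[OF f'] by (simp add: linear_sum linear_scale)
    finally show ?thesis by (simp add: partial_has_derivative[OF f'])
  qed
  thus ?thesis using f' by (metis (no_types, lifting) ext)
qed

lemma partial_cong:
  assumes "open S" "x \<in> S" "\<And>y. y \<in> S ==> f y = g y"
  shows "partial j f x = partial j g x"
proof -
  have "((%t::real. x + t *\<^sub>R axis j 1) ---> x + 0 *\<^sub>R axis j 1) (nhds 0)"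
    by (intro tendsto_intros filterlim_ident)
  hence "\<forall>\<^sub>F t in nhds (0::real). x + t *\<^sub>R axis j 1 \<in> S"
    using assms(1,2) by (simp add: topological_tendstoD)
  hence "\<forall>\<^sub>F t in nhds (0::real). f (x + t *\<^sub>R axis j 1) = g (x + t *\<^sub>R axis j 1)"
    by eventually_elim (use assms(3) in auto)
  thus ?thesis unfolding partial_def
    by (intro vector_derivative_cong_eq) auto
qed

lemma partial_const [simp]: "partial j (%x. c) x = 0"
  by (subst partial_has_derivative[where f'="%_. 0"]) auto

lemma partial_add:
  assumes "f differentiable (at x)" "g differentiable (at x)"
  shows "partial j (%x. f x + g x) x = partial j f x + partial j g x"
  by (subst partial_has_derivative[OF has_derivative_add[OF assms[THEN has_derivative_partials]]])
     (simp add: axis_def if_distrib[of "%a. a *\<^sub>R _"] cong: if_cong)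

lemma partial_diff:
  assumes "f differentiable (at x)" "g differentiable (at x)"
  shows "partial j (%x. f x - g x) x = partial j f x - partial j g x"
  by (subst partial_has_derivative[OF has_derivative_diff[OF assms[THEN has_derivative_partials]]])
     (simp add: axis_def if_distrib[of "%a. a *\<^sub>R _"] cong: if_cong)

lemma partial_minus:
  assumes "f differentiable (at x)"
  shows "partial j (%x. - f x) x = - partial j f x"
  by (subst partial_has_derivative[OF has_derivative_minus[OF assms[THEN has_derivative_partials]]])
     (simp add: axis_def if_distrib[of "%a. a *\<^sub>R _"] cong: if_cong)

lemma partial_mult:
  fixes f g :: "real^3 => 'b::real_normed_algebra"
  assumes "f differentiable (at x)" "g differentiable (at x)"
  shows "partial j (%x. f x * g x) x = f x * partial j g x + partial j f x * g x"
  by (subst partial_has_derivative[OF has_derivative_mult[OF assms[THEN has_derivative_partials]]])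
     (simp add: axis_def if_distrib[of "%a. a *\<^sub>R _"] cong: if_cong)

lemma partial_sum:
  assumes "\<And>i. i \<in> I ==> f i differentiable (at x)"
  shows "partial j (%x. \<Sum>i\<in>I. f i x) x = (\<Sum>i\<in>I. partial j (f i) x)"
proof -
  have "((%x. \<Sum>i\<in>I. f i x) has_derivative
          (%v. \<Sum>i\<in>I. \<Sum>j\<in>UNIV. (v $ j) *\<^sub>R partial j (f i) x)) (at x)"
    by (intro has_derivative_sum has_derivative_partials assms)
  from partial_has_derivative[OF this, of j] show ?thesis
    by (simp add: axis_def if_distrib[of "%a. a *\<^sub>R _"] cong: if_cong)
qed

abbreviation cx :: "3 => sfield" where "cx i x \<equiv> complex_of_real (x $ i)"

lemma has_derivative_cx: "(cx i has_derivative cx i) (at x)"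
  by (intro bounded_linear_imp_has_derivative bounded_linear_compose[OF bounded_linear_of_real]
      bounded_linear_vec_nth)

lemma differentiable_cx [simp]: "cx i differentiable (at x)"
  using has_derivative_cx differentiable_def by blast

lemma partial_cx [simp]: "partial j (cx i) x = (if i = j then 1 else 0)"
  by (simp add: partial_has_derivative[OF has_derivative_cx] axis_def)

lemma partial_power:
  fixes f :: "sfield"
  assumes "f differentiable (at x)"
  shows "partial j (%x. f x ^ n) x = of_nat n * f x ^ (n - 1) * partial j f x"
  by (subst partial_has_derivative[OF has_derivative_power[OF assms[THEN has_derivative_partials]]])
     (simp add: axis_def if_distrib[of "%a. a *\<^sub>R _"] cong: if_cong)

lemma partial_vec_nth:
  fixes w :: "vfield"
  assumes "w differentiable (at x)"
  shows "partial j (cmp w i) x = partial j w x $ i"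
  by (subst partial_has_derivative[OF bounded_linear.has_derivative[OF bounded_linear_vec_nth
        has_derivative_partials[OF assms]]])
     (simp add: axis_def if_distrib[of "%a. a *\<^sub>R _"] cong: if_cong)

lemma differentiable_vec_nth:
  assumes "w differentiable F" shows "(cmp w i) differentiable F"
  using assms bounded_linear.has_derivative[OF bounded_linear_vec_nth]
  unfolding differentiable_def by blast

section \<open>Calculus of C^1 and C^2 fields on open sets\<close>

definition C1_on :: "(real^3 => 'b::real_normed_vector) => (real^3) set => bool" where
  "C1_on f S \<longleftrightarrow> (\<forall>x\<in>S. f differentiable (at x)) \<and> (\<forall>j. continuous_on S (partial j f))"

lemma C1_onD: "C1_on f S ==> x \<in> S ==> f differentiable (at x)"
  "C1_on f S ==> continuous_on S (partial j f)"
  by (auto simp: C1_on_def)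

lemma C1_on_subset: "C1_on f S ==> T \<subseteq> S ==> C1_on f T"
  by (auto simp: C1_on_def intro: continuous_on_subset)

lemma C1_on_imp_continuous_on: "C1_on f S ==> continuous_on S f"
  by (intro differentiable_imp_continuous_on)
     (auto simp: C1_on_def differentiable_on_def differentiable_at_withinI)

lemma C1_on_const [simp]: "C1_on (%x. c) S" by (auto simp: C1_on_def)

lemma C1_on_cx [simp]: "C1_on (cx i) S" by (auto simp: C1_on_def)

lemma C1_on_add: assumes "C1_on f S" "C1_on g S" shows "C1_on (%x. f x + g x) S"
proof -
  have "continuous_on S (%x. partial j f x + partial j g x)" for j
    using assms by (intro continuous_intros) (auto simp: C1_on_def)
  hence "continuous_on S (partial j (%x. f x + g x))" for j
    by (rule continuous_on_eq) (use assms in \<open>auto simp: C1_on_def partial_add\<close>)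
  thus ?thesis using assms by (auto simp: C1_on_def)
qed

lemma C1_on_minus: assumes "C1_on f S" shows "C1_on (%x. - f x) S"
proof -
  have "continuous_on S (%x. - partial j f x)" for j
    using assms by (intro continuous_intros) (auto simp: C1_on_def)
  hence "continuous_on S (partial j (%x. - f x))" for j
    by (rule continuous_on_eq) (use assms in \<open>auto simp: C1_on_def partial_minus\<close>)
  thus ?thesis using assms by (auto simp: C1_on_def)
qed

lemma C1_on_diff: "C1_on f S ==> C1_on g S ==> C1_on (%x. f x - g x) S"
  using C1_on_add[of f S "%x. - g x"] C1_on_minus[of g S] by simp

lemma C1_on_mult:
  fixes f g :: "real^3 => 'b::real_normed_algebra"
  assumes "C1_on f S" "C1_on g S" shows "C1_on (%x. f x * g x) S"
proof -
  have "continuous_on S (%x. f x * partial j g x + partial j f x * g x)" for j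
    using assms C1_on_imp_continuous_on[OF assms(1)] C1_on_imp_continuous_on[OF assms(2)]
    by (intro continuous_intros) (auto simp: C1_on_def)
  hence "continuous_on S (partial j (%x. f x * g x))" for j
    by (rule continuous_on_eq) (use assms in \<open>auto simp: C1_on_def partial_mult\<close>)
  thus ?thesis using assms by (auto simp: C1_on_def)
qed

lemma C1_on_power:
  fixes f :: "sfield"
  assumes "C1_on f S" shows "C1_on (%x. f x ^ n) S"
  by (induction n) (auto intro!: C1_on_mult assms)

lemma C1_on_sum:
  assumes "\<And>i. i \<in> I ==> C1_on (f i) S" shows "C1_on (%x. \<Sum>i\<in>I. f i x) S"
  using assms by (induction I rule: infinite_finite_induct) (auto intro!: C1_on_add)

lemma C1_on_cong:
  assumes "C1_on f S" "open S" "\<And>x. x \<in> S ==> f x = g x" shows "C1_on g S"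
proof -
  have "g differentiable (at x)" if x: "x \<in> S" for x
    using C1_onD(1)[OF assms(1) x] assms(2,3) x unfolding differentiable_def
    by (metis has_derivative_transform_within_open)
  moreover have "continuous_on S (partial j g)" for j
    using C1_onD(2)[OF assms(1), of j]
    by (rule continuous_on_eq) (use assms partial_cong[of S _ f g] in auto)
  ultimately show ?thesis by (auto simp: C1_on_def)
qed

lemma C2_on_iff: "C2_on f S \<longleftrightarrow> (\<forall>x\<in>S. f differentiable (at x)) \<and> (\<forall>j. C1_on (partial j f) S)"
  by (auto simp: C2_on_def C1_on_def)

lemma C2_on_C1: "C2_on f S ==> C1_on f S"
  unfolding C2_on_iff C1_on_def[of f] by (auto intro: C1_on_imp_continuous_on)

lemma C2_on_partial: "C2_on f S ==> C1_on (partial j f) S"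
  by (auto simp: C2_on_iff)

lemma C2_on_cong:
  assumes "C2_on f S" "open S" "\<And>x. x \<in> S ==> f x = g x" shows "C2_on g S"
proof -
  have "C1_on g S" using C1_on_cong[OF C2_on_C1[OF assms(1)] assms(2,3)] by simp
  moreover have "C1_on (partial j g) S" for j
    using C1_on_cong[OF C2_on_partial[OF assms(1), of j] assms(2)] partial_cong[of S _ f g] assms
    by auto
  ultimately show ?thesis by (auto simp: C2_on_iff C1_on_def)
qed

lemma C2_on_const [simp]: "C2_on (%x. c) S"
proof -
  have "partial j (%x. c) = (%x. 0)" for j by auto
  thus ?thesis by (auto simp: C2_on_iff)
qed

lemma C2_on_cx [simp]: "C2_on (cx i) S"
proof -
  have "partial j (cx i) = (%x. if i = j then 1 else 0)" for j by auto
  thus ?thesis by (auto simp: C2_on_iff)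
qed

lemma C2_on_add:
  assumes "open S" "C2_on f S" "C2_on g S" shows "C2_on (%x. f x + g x) S"
proof -
  have "C1_on (partial j (%x. f x + g x)) S" for j
    by (rule C1_on_cong[of "%x. partial j f x + partial j g x"])
       (use assms in \<open>auto simp: partial_add C2_on_iff intro!: C1_on_add\<close>)
  thus ?thesis using assms by (auto simp: C2_on_iff)
qed

lemma C2_on_mult:
  fixes f g :: "real^3 => 'b::real_normed_algebra"
  assumes "open S" "C2_on f S" "C2_on g S" shows "C2_on (%x. f x * g x) S"
proof -
  have "C1_on (partial j (%x. f x * g x)) S" for j
    by (rule C1_on_cong[of "%x. f x * partial j g x + partial j f x * g x"])
       (use assms C2_on_C1 in \<open>auto simp: partial_mult C2_on_iff intro!: C1_on_add C1_on_mult\<close>)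
  thus ?thesis using assms by (auto simp: C2_on_iff)
qed

lemma C2_on_minus:
  fixes f :: "real^3 => 'b::real_normed_algebra_1"
  shows "open S ==> C2_on f S ==> C2_on (%x. - f x) S"
  using C2_on_mult[of S "%x. -1" f] by simp

lemma C2_on_diff:
  fixes f :: "real^3 => 'b::real_normed_algebra_1"
  shows "open S ==> C2_on f S ==> C2_on g S ==> C2_on (%x. f x - g x) S"
  using C2_on_add[of S f "%x. - g x"] C2_on_minus[of S g] by simp

lemma C2_on_sum:
  assumes "open S" "\<And>i. i \<in> I ==> C2_on (f i) S" shows "C2_on (%x. \<Sum>i\<in>I. f i x) S"
  using assms(2) by (induction I rule: infinite_finite_induct) (auto intro!: C2_on_add assms(1))

lemma C2_on_power:
  fixes f :: "sfield"
  assumes "open S" "C2_on f S" shows "C2_on (%x. f x ^ n) S"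
  by (induction n) (auto intro!: C2_on_mult assms)

lemma C2_on_vec_nth:
  fixes w :: "vfield"
  assumes "open S" "C2_on w S" shows "C2_on (cmp w i) S"
proof -
  have C1: "C1_on (cmp v i) S" if "C1_on v S" for v :: "vfield"
  proof -
    have "continuous_on S (partial j (cmp v i))" for j
      by (rule continuous_on_eq[of S "%x. partial j v x $ i"])
         (use that in \<open>auto simp: C1_on_def partial_vec_nth intro!: continuous_intros\<close>)
    thus ?thesis using that by (auto simp: C1_on_def differentiable_vec_nth)
  qed
  have "C1_on (partial j (cmp w i)) S" for j
    by (rule C1_on_cong[OF C1[OF C2_on_partial[OF assms(2), of j]] assms(1)])
       (use assms in \<open>auto simp: C2_on_iff partial_vec_nth\<close>)
  thus ?thesis using C1[OF C2_on_C1[OF assms(2)]] by (auto simp: C2_on_iff C1_on_def)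
qed

lemma partial_partial_vec_nth:
  fixes w :: "vfield"
  assumes "open S" "C2_on w S" "x \<in> S"
  shows "partial k (partial j (cmp w i)) x = partial k (partial j w) x $ i"
proof -
  have "partial k (partial j (cmp w i)) x = partial k (%y. partial j w y $ i) x"
    using assms by (intro partial_cong[of S]) (auto simp: C2_on_iff partial_vec_nth)
  thus ?thesis using assms by (auto simp: C2_on_def partial_vec_nth)
qed

text \<open>The increment of f along the second direction is an integral of
  \<open>partial j f\<close>. Differentiating it in the first direction, once directly and once
  under the integral sign, gives \<open>int_eq\<close>; the one-sided derivative of
  \<open>int_eq\<close> at t = 0 is the symmetry.\<close>

lemma partial_commute:
  fixes f :: "real^3 => 'b::banach"
  assumes S: "open S" "x \<in> S" and f: "C2_on f S"
  shows "partial i (partial j f) x = partial j (partial i f) x"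
proof -
  define a :: "real^3" where "a = axis i 1"
  define b :: "real^3" where "b = axis j 1"
  have na: "norm a = 1" "norm b = 1" by (auto simp: a_def b_def)
  obtain e where e: "e > 0" "\<And>y. dist y x < e ==> y \<in> S"
    using S openE[of S x] by (metis dist_commute mem_ball subset_iff)
  define h where "h = e / 4"
  have h: "h > 0" using e by (simp add: h_def)
  have in_S: "x + s *\<^sub>R a + t *\<^sub>R b \<in> S" if "s \<in> {-h..h}" "t \<in> {-h..h}" for s t
  proof (rule e(2))
    have "dist (x + s *\<^sub>R a + t *\<^sub>R b) x \<le> \<bar>s\<bar> + \<bar>t\<bar>"
      using norm_triangle_ineq[of "s *\<^sub>R a" "t *\<^sub>R b"] na by (simp add: dist_norm)
    moreover have "\<bar>s\<bar> \<le> h" "\<bar>t\<bar> \<le> h" using that by auto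
    moreover have "h + h < e" using e by (simp add: h_def)
    ultimately show "dist (x + s *\<^sub>R a + t *\<^sub>R b) x < e" by linarith
  qed
  let ?p = "%s t. x + s *\<^sub>R a + t *\<^sub>R b"
  have contp: "continuous_on ({-h..h} \<times> {-h..h}) (%(s, t). g (?p s t))"
    if "continuous_on S g" for g :: "real^3 => 'b"
    unfolding split_beta
    by (rule continuous_on_compose2[OF that]) (auto intro!: continuous_intros in_S)
  have fd: "\<And>y. y \<in> S ==> f differentiable (at y)"
    and pd: "\<And>y k. y \<in> S ==> partial k f differentiable (at y)"
    using f by (auto simp: C2_on_def)
  have dt: "((%t. g (?p s t)) hvd partial j g (?p s t)) (at t)"
    if "s \<in> {-h..h}" "t \<in> {-h..h}" "\<And>y. y \<in> S ==> g differentiable (at y)" for g :: "real^3 => 'b" and s t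
    unfolding b_def by (rule partial_along_line) (use that in_S in \<open>simp add: b_def\<close>)
  have ds: "((%s. g (?p s t)) hvd partial i g (?p s t)) (at s)"
    if "s \<in> {-h..h}" "t \<in> {-h..h}" "\<And>y. y \<in> S ==> g differentiable (at y)" for g :: "real^3 => 'b" and s t
  proof -
    have eq: "x + t *\<^sub>R b + u *\<^sub>R axis i 1 = ?p u t" for u
      unfolding a_def by (simp only: add.assoc add.commute[of "t *\<^sub>R b"])
    have "g differentiable (at (x + t *\<^sub>R b + s *\<^sub>R axis i 1))" unfolding eq using that in_S by blast
    from partial_along_line[OF this] show ?thesis unfolding eq .
  qed
  have int_eq: "partial i f (?p 0 t) - partial i f (?p 0 0)
      = integral {0..t} (%\<tau>. partial i (partial j f) (?p 0 \<tau>))" if t: "t \<in> {0..h}" for t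
  proof -
    have ftc: "integral {0..t} (%\<tau>. partial j f (?p s \<tau>)) = f (?p s t) - f (?p s 0)" if "s \<in> {-h..h}" for s
    proof (rule integral_unique, rule fundamental_theorem_of_calculus[where f="%t. f (?p s t)"])
      fix \<tau> assume "\<tau> \<in> {0..t}"
      thus "((%t. f (?p s t)) hvd partial j f (?p s \<tau>)) (at \<tau> within {0..t})"
        using t that fd by (intro hvd_at_within[OF dt]) auto
    qed (use t in auto)
    have L: "((%s. integral (cbox 0 t) (%\<tau>. partial j f (?p s \<tau>))) hvd
           integral (cbox 0 t) (%\<tau>. partial i (partial j f) (?p 0 \<tau>))) (at 0 within {-h..h})"
    proof (rule leibniz_rule_vector_derivative)
      fix s \<tau> assume "s \<in> {-h..h}" "\<tau> \<in> cbox 0 t"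
      thus "((%s. partial j f (?p s \<tau>)) hvd partial i (partial j f) (?p s \<tau>))
          (at s within {-h..h})"
        using t by (intro hvd_at_within[OF ds] pd) auto
    next
      fix s assume s: "s \<in> {-h..h}"
      have "continuous_on {0..t} (%\<tau>. partial j f (?p s \<tau>))"
        by (rule continuous_on_compose2[OF C1_on_imp_continuous_on[OF C2_on_partial[OF f]]])
           (use s t in \<open>auto intro!: continuous_intros in_S\<close>)
      thus "(%\<tau>. partial j f (?p s \<tau>)) integrable_on cbox 0 t"
        by (simp add: integrable_continuous_real)
    next
      show "continuous_on ({-h..h} \<times> cbox 0 t) (%(s, \<tau>). partial i (partial j f) (?p s \<tau>))"
        using f by (intro continuous_on_subset[OF contp]) (use t in \<open>auto simp: C2_on_def\<close>)
    qed (use h in auto)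
    have R: "((%s. f (?p s t) - f (?p s 0)) hvd
        (partial i f (?p 0 t) - partial i f (?p 0 0))) (at 0 within {-h..h})"
      using t h by (intro hvd_at_within[OF hvd_diff] ds fd) auto
    have "((%s. f (?p s t) - f (?p s 0)) hvd
           integral (cbox 0 t) (%\<tau>. partial i (partial j f) (?p 0 \<tau>))) (at 0 within {-h..h})"
      by (rule has_vector_derivative_transform[OF _ _ L]) (use h ftc in auto)
    moreover have "at 0 within {-h..h} \<noteq> bot"
    proof -
      have "at 0 within {-h..h} = at (0::real)" by (rule at_within_interior) (use h in auto)
      thus ?thesis by simp
    qed
    ultimately show ?thesis
      using R by (simp add: vector_derivative_unique_within)
  qed
  have "((%u. integral {0..u} (%\<tau>. partial i (partial j f) (?p 0 \<tau>))) hvd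
      partial i (partial j f) (?p 0 0)) (at 0 within {0..h})"
  proof (rule integral_has_vector_derivative)
    show "continuous_on {0..h} (%\<tau>. partial i (partial j f) (?p 0 \<tau>))"
      by (rule continuous_on_compose2[of S]) (use f h in_S[of 0] in \<open>auto simp: C2_on_def intro!: continuous_intros\<close>)
  qed (use h in auto)
  hence "((%t. partial i f (?p 0 t) - partial i f (?p 0 0)) hvd
      partial i (partial j f) (?p 0 0)) (at 0 within {0..h})"
    by (rule has_vector_derivative_transform[rotated 2]) (use h int_eq in auto)
  moreover have "((%t. partial i f (?p 0 t) - partial i f (?p 0 0)) hvd
      partial j (partial i f) (?p 0 0)) (at 0 within {0..h})"
  proof -
    have "((%t. partial i f (?p 0 t)) hvd partial j (partial i f) (?p 0 0)) (at 0 within {0..h})"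
      using h pd by (intro hvd_at_within[OF dt]) auto
    from hvd_diff[OF this has_vector_derivative_const] show ?thesis by simp
  qed
  moreover have "at 0 within {0..h} \<noteq> bot"
    using h by (simp add: at_within_Icc_at_right trivial_limit_at_right_real)
  ultimately have "partial i (partial j f) (?p 0 0) = partial j (partial i f) (?p 0 0)"
    using vector_derivative_unique_within by blast
  thus ?thesis by simp
qed

section \<open>Integration over the unit sphere\<close>

text \<open>\<open>sph\<close>, \<open>eth\<close>, \<open>eph\<close> are position, polar and
  azimuthal direction in spherical coordinates. \<open>eph\<close> is the \<phi>-derivative of
  \<open>sph\<close> divided by sin \<theta>, which keeps it regular at the poles.\<close>

definition sph :: "real => real => real^3" where
  "sph \<theta> \<phi> = (sin \<theta> * cos \<phi>) *\<^sub>R axis 1 1 + (sin \<theta> * sin \<phi>) *\<^sub>R axis 2 1 + cos \<theta> *\<^sub>R axis 3 1"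

definition eth :: "real => real => real^3" where
  "eth \<theta> \<phi> = (cos \<theta> * cos \<phi>) *\<^sub>R axis 1 1 + (cos \<theta> * sin \<phi>) *\<^sub>R axis 2 1 - sin \<theta> *\<^sub>R axis 3 1"

definition eph :: "real => real^3" where
  "eph \<phi> = (- sin \<phi>) *\<^sub>R axis 1 1 + cos \<phi> *\<^sub>R axis 2 1"

text \<open>The surface integral is taken over the closed parameter rectangle with density sin
  \<theta>, so that Fubini, differentiation under the integral and limits are those of continuous
  functions on a compact box, without an exceptional set at the poles.\<close>

definition sI :: "(sfield) => complex" where
  "sI f = integral (cbox (0, 0) (pi, 2 * pi)) (%p. of_real (sin (fst p)) * f (sph (fst p) (snd p)))"

abbreviation (input) cinner :: "(3 => sfield) => (3 => sfield) => complex" where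
  "cinner G H \<equiv> \<Sum>i\<in>UNIV. sI (%x. G i x * H i x)"

text \<open>On the unit sphere this is the i-th Cartesian component of the surface gradient, the
  tangential projection of the full gradient. Cartesian components stay smooth where the angular
  frame degenerates.\<close>

definition tg :: "3 => (sfield) => sfield" where
  "tg i f x = partial i f x - cx i x * (\<Sum>j\<in>UNIV. cx j x * partial j f x)"

lemma frame_nth [simp]:
  "sph \<theta> \<phi> $ 1 = sin \<theta> * cos \<phi>" "sph \<theta> \<phi> $ 2 = sin \<theta> * sin \<phi>" "sph \<theta> \<phi> $ 3 = cos \<theta>"
  "eth \<theta> \<phi> $ 1 = cos \<theta> * cos \<phi>" "eth \<theta> \<phi> $ 2 = cos \<theta> * sin \<phi>" "eth \<theta> \<phi> $ 3 = - sin \<theta>"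
  "eph \<phi> $ 1 = - sin \<phi>" "eph \<phi> $ 2 = cos \<phi>" "eph \<phi> $ 3 = 0"
  by (simp_all add: sph_def eth_def eph_def axis_def)

text \<open>Resolves the tangential projection in the moving frame; this turns \<open>tg\<close>
  into derivatives along \<open>eth\<close> and \<open>eph\<close>, which are integrable in the
  angles.\<close>

lemma frame: "(if i = j then 1 else 0) - sph \<theta> \<phi> $ i * sph \<theta> \<phi> $ j = eth \<theta> \<phi> $ i * eth \<theta> \<phi> $ j + eph \<phi> $ i * eph \<phi> $ j"
proof -
  have a: "cos t * cos t = 1 - sin t * sin t" for t :: real
    by (simp add: cos_squared_eq flip: power2_eq_square)
  have b: "cos t * (cos t * z) = z - sin t * (sin t * z)" for t z :: real
    by (simp only: mult.assoc[symmetric] a left_diff_distrib mult_1_left)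
  show ?thesis
    using exhaust_3[of i] exhaust_3[of j] by (elim disjE) (simp_all add: algebra_simps a b)
qed
lemma tg_eq: "tg i f x = (\<Sum>j\<in>UNIV. of_real ((if i = j then 1 else 0) - x $ i * x $ j) * partial j f x)"
  unfolding tg_def sum_3 using exhaust_3[of i]
  by (elim disjE) (simp_all add: algebra_simps)
lemma norm3_eq: "norm (x::real^3) ^ 2 = (x $ 1)\<^sup>2 + (x $ 2)\<^sup>2 + (x $ 3)\<^sup>2"
  by (simp only: power2_norm_eq_inner inner_vec_def sum_3) (simp add: power2_eq_square)

lemma norm_sph [simp]: "norm (sph \<theta> \<phi>) = 1"
proof -
  have "norm (sph \<theta> \<phi>) ^ 2 = (sin \<theta>)\<^sup>2 * ((cos \<phi>)\<^sup>2 + (sin \<phi>)\<^sup>2) + (cos \<theta>)\<^sup>2"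
    unfolding norm3_eq by (simp add: power_mult_distrib distrib_left del: sin_cos_squared_add sin_cos_squared_add2)
  also have "\<dots> = 1" by (simp only: sin_cos_squared_add2 mult_1_right sin_cos_squared_add)
  finally show ?thesis by (simp add: power2_eq_1_iff) (metis norm_ge_zero not_one_le_zero neg_0_le_iff_le)
qed

lemma sph_surj:
  assumes "norm x = 1"
  obtains \<theta> \<phi> where "0 \<le> \<theta>" "\<theta> \<le> pi" "0 \<le> \<phi>" "\<phi> \<le> 2 * pi" "x = sph \<theta> \<phi>"
proof -
  have x: "(x $ 1)\<^sup>2 + (x $ 2)\<^sup>2 + (x $ 3)\<^sup>2 = 1" using norm3_eq[of x] assms by simp
  hence "(x $ 3)\<^sup>2 \<le> 1" by (smt (verit) zero_le_power2)
  hence x3: "-1 \<le> x $ 3" "x $ 3 \<le> 1" by (auto simp: abs_square_le_1 abs_le_iff)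
  define \<theta> where "\<theta> = arccos (x $ 3)"
  have \<theta>: "0 \<le> \<theta>" "\<theta> \<le> pi" "cos \<theta> = x $ 3" using x3 by (auto simp: \<theta>_def arccos)
  have st: "sin \<theta> \<ge> 0" using \<theta> by (intro sin_ge_zero)
  have s2: "(x $ 1)\<^sup>2 + (x $ 2)\<^sup>2 = (sin \<theta>)\<^sup>2" using x \<theta>(3) sin_cos_squared_add[of \<theta>] by simp
  show ?thesis
  proof (cases "sin \<theta> = 0")
    case True
    hence "x $ 1 = 0" "x $ 2 = 0" using s2 by (auto simp: sum_power2_eq_zero_iff)
    hence "x = sph \<theta> 0" using True \<theta> by (simp add: vec_eq_iff forall_3)
    with \<theta> that[of \<theta> 0] show ?thesis by simp
  next
    case False
    hence "(x $ 1 / sin \<theta>)\<^sup>2 + (x $ 2 / sin \<theta>)\<^sup>2 = 1"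
      using s2 by (simp add: power_divide add_divide_distrib[symmetric])
    then obtain \<phi> where "0 \<le> \<phi>" "\<phi> < 2 * pi" "x $ 1 / sin \<theta> = cos \<phi>" "x $ 2 / sin \<theta> = sin \<phi>"
      by (rule sincos_total_2pi)
    moreover from this have "x = sph \<theta> \<phi>"
      using False \<theta> by (simp add: vec_eq_iff forall_3 field_simps)
    ultimately show ?thesis using that \<theta> by auto
  qed
qed

lemma continuous_sph: "continuous_on A (%p. sph (fst p) (snd p))"
  unfolding sph_def by (intro continuous_intros)

lemma continuous_on_sph_compose:
  assumes "contS f"
  shows "continuous_on A (%p. f (sph (fst p) (snd p)))"
  by (rule continuous_on_compose2[OF assms continuous_sph]) auto

lemma sI_integrable:
  fixes f :: "sfield"
  assumes "contS f"
  shows "(%p. of_real (sin (fst p)) * f (sph (fst p) (snd p))) integrable_on cbox (0, 0) (pi, 2 * pi)"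
  by (intro integrable_continuous continuous_intros continuous_on_sph_compose assms)

lemma sI_add:
  assumes "contS f" "contS g"
  shows "sI (%x. f x + g x) = sI f + sI g"
  unfolding sI_def integral_add[OF sI_integrable[OF assms(1)] sI_integrable[OF assms(2)], symmetric]
  by (simp add: distrib_left)

lemma sI_cmult: "sI (%x. c * f x) = c * sI f"
  unfolding sI_def by (subst integral_mult_right[symmetric]) (simp add: algebra_simps)

lemma sI_minus: "sI (%x. - f x) = - sI f"
  using sI_cmult[of "-1" f] by simp

lemma sI_diff:
  assumes "contS f" "contS g"
  shows "sI (%x. f x - g x) = sI f - sI g"
  using sI_add[of f "%x. - g x"] assms by (simp add: sI_minus continuous_on_minus)

lemma sI_zero [simp]: "sI (%x. 0) = 0" by (simp add: sI_def)

lemma sI_sum: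
  assumes "finite I" "\<And>i. i \<in> I ==> contS (f i)"
  shows "sI (%x. \<Sum>i\<in>I. f i x) = (\<Sum>i\<in>I. sI (f i))"
  using assms by (induction I rule: finite_induct) (auto simp: sI_add continuous_on_sum)

lemma sI_cong: "(\<And>x. norm x = 1 ==> f x = g x) ==> sI f = sI g"
  unfolding sI_def by (intro integral_cong) simp

text \<open>The factor is the area of the parameter rectangle, with sin \<theta> estimated by 1,
  rather than the area 4 pi of the sphere. The bound serves for limits, where the constant is
  immaterial.\<close>

lemma norm_sI_le:
  assumes "contS f" "\<And>x. norm x = 1 ==> norm (f x) \<le> B"
  shows "norm (sI f) \<le> 2 * pi\<^sup>2 * B"
proof -
  have B: "B \<ge> 0" by (rule order_trans[OF norm_ge_zero assms(2)[of "sph 0 0"]]) simp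
  have "norm (sI f) \<le> B * measure lborel (cbox (0::real, 0::real) (pi, 2 * pi))"
    unfolding sI_def
  proof (rule integrable_bound[OF B sI_integrable[OF assms(1)]])
    fix p :: "real \<times> real"
    have "norm (complex_of_real (sin (fst p)) * f (sph (fst p) (snd p))) \<le> 1 * B"
      unfolding norm_mult by (intro mult_mono assms) auto
    thus "norm (complex_of_real (sin (fst p)) * f (sph (fst p) (snd p))) \<le> B" by simp
  qed
  also have "measure lborel (cbox (0::real, 0::real) (pi, 2 * pi)) = 2 * pi\<^sup>2"
    by (simp add: content_Pair power2_eq_square)
  finally show ?thesis by (simp add: mult.commute)
qed

text \<open>The density sin \<theta> vanishes at the poles, so the integral yields g = 0 for 0 <
  \<theta> < pi first; continuity along a meridian then covers the poles.\<close>

lemma sI_nonneg_eq_0D: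
  assumes g: "contS g" "\<And>x. norm x = 1 ==> (0::real) \<le> g x"
    and I: "sI (%x. of_real (g x)) = 0" and x: "norm x = 1"
  shows "g x = 0"
proof -
  let ?B = "cbox (0::real, 0::real) (pi, 2 * pi)"
  let ?h = "%p. sin (fst p) * g (sph (fst p) (snd p))"
  have cont: "continuous_on ?B ?h"
    by (intro continuous_intros continuous_on_sph_compose g)
  have nn: "?h p \<ge> 0" if "p \<in> ?B" for p
    using that by (intro mult_nonneg_nonneg sin_ge_zero g) (auto simp: cbox_Pair_eq)
  have "complex_of_real (integral ?B ?h) = integral ?B (%p. complex_of_real (?h p))"
    by (rule integral_unique[symmetric], rule has_integral_of_real)
       (intro integrable_integral integrable_continuous cont)
  also have "\<dots> = 0" using I unfolding sI_def by simp
  finally have "complex_of_real (integral ?B ?h) = 0" .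
  hence "integral ?B ?h = 0" by simp
  hence "(?h has_integral 0) ?B"
    using integrable_integral[OF integrable_continuous[OF cont]] by simp
  moreover have "box (0::real, 0::real) (pi, 2 * pi) \<noteq> {}"
    by (simp add: box_ne_empty Basis_prod_def)
  ultimately have h0: "?h p = 0" if "p \<in> ?B" for p
    using has_integral_0_cbox_imp_0[OF cont nn _ _ that] box_subset_cbox[of "(0::real, 0::real)" "(pi, 2 * pi)"] by blast
  have nz: "g (sph \<theta> \<phi>) = 0" if "0 < \<theta>" "\<theta> < pi" "0 \<le> \<phi>" "\<phi> \<le> 2 * pi" for \<theta> \<phi>
    using h0[of "(\<theta>, \<phi>)"] sin_gt_zero[of \<theta>] that by (auto simp: cbox_Pair_eq)
  obtain \<theta> \<phi> where *: "0 \<le> \<theta>" "\<theta> \<le> pi" "0 \<le> \<phi>" "\<phi> \<le> 2 * pi" "x = sph \<theta> \<phi>"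
    using sph_surj[OF x] by blast
  have "continuous_on UNIV (%t. sph t \<phi>)" unfolding sph_def by (intro continuous_intros)
  hence "continuous_on UNIV (%t. g (sph t \<phi>))"
    by (rule continuous_on_compose2[OF g(1)]) auto
  hence "g (sph \<theta> \<phi>) = 0"
    by (rule continuous_constant_on_closure[of "{0<..<pi}", OF continuous_on_subset])
       (use * nz in auto)
  thus ?thesis using * by simp
qed

lemma complex_of_real_sph_algebra:
  "s * (e * P + p * Q - 2 * (x * F)) = s * e * P + (c * e - s * x) * F + (p * (s * Q) - (s * x + c * e) * F)"
  for s :: complex
  by algebra

text \<open>Divergence theorem on the closed surface, with no boundary term; the factor 2 is the sum
  of the principal curvatures of the unit sphere. All later integrations by parts rest on
  this.\<close>

lemma sI_tg:
  assumes f: "C1_on f (sphere 0 1)"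
  shows "sI (tg i f) = 2 * sI (%x. cx i x * f x)"
proof -
  let ?B = "cbox (0::real, 0::real) (pi, 2 * pi)"
  let ?D = "%\<theta> \<phi> v. \<Sum>j\<in>UNIV. of_real (v $ j) * partial j f (sph \<theta> \<phi>)"
  define F where "F \<theta> \<phi> = f (sph \<theta> \<phi>)" for \<theta> \<phi>
  \<comment> \<open>\<open>A\<close> is the \<theta>-derivative of sin \<theta> times f times the
    i-th component of \<open>eth\<close>, and \<open>B\<close> the \<phi>-derivative of f times that
    of \<open>eph\<close>; \<open>key\<close> shows that they add up to sin \<theta> times the
    integrand.\<close>
  define A where "A \<theta> \<phi> = of_real (sin \<theta> * eth \<theta> \<phi> $ i) * ?D \<theta> \<phi> (eth \<theta> \<phi>)
      + of_real (cos \<theta> * eth \<theta> \<phi> $ i - sin \<theta> * sph \<theta> \<phi> $ i) * F \<theta> \<phi>" for \<theta> \<phi>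
  define B where "B \<theta> \<phi> = of_real (eph \<phi> $ i) * ?D \<theta> \<phi> (sin \<theta> *\<^sub>R eph \<phi>)
      - of_real (sin \<theta> * sph \<theta> \<phi> $ i + cos \<theta> * eth \<theta> \<phi> $ i) * F \<theta> \<phi>" for \<theta> \<phi>
  have d: "(f has_derivative (%v. \<Sum>j\<in>UNIV. (v $ j) *\<^sub>R partial j f (sph \<theta> \<phi>))) (at (sph \<theta> \<phi>))" for \<theta> \<phi>
    by (rule has_derivative_partials) (use f in \<open>auto simp: C1_on_def\<close>)
  have lin: "(%s. \<Sum>j\<in>UNIV. (s *\<^sub>R v) $ j *\<^sub>R g j) = (%s. s *\<^sub>R (\<Sum>j\<in>UNIV. of_real (v $ j) * g j))"
    for v :: "real^3" and g :: "3 => complex"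
    by (rule ext) (simp only: vector_scaleR_component real_scaleR_def scaleR_sum_right scaleR_scaleR[symmetric]
        scaleR_conv_of_real[of "v $ _" "g _"])
  have dF1: "((%t. F t \<phi>) hvd ?D \<theta> \<phi> (eth \<theta> \<phi>)) (at \<theta>)" for \<theta> \<phi>
  proof -
    have "((%t. sph t \<phi>) has_derivative (%s. s *\<^sub>R eth \<theta> \<phi>)) (at \<theta>)"
      unfolding sph_def eth_def by (auto intro!: derivative_eq_intros simp: algebra_simps)
    from has_derivative_compose[OF this d] show ?thesis
      unfolding has_vector_derivative_def F_def lin .
  qed
  have dF2: "((%t. F \<theta> t) hvd ?D \<theta> \<phi> (sin \<theta> *\<^sub>R eph \<phi>)) (at \<phi>)" for \<theta> \<phi>
  proof -
    have "((%t. sph \<theta> t) has_derivative (%s. s *\<^sub>R (sin \<theta> *\<^sub>R eph \<phi>))) (at \<phi>)"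
      unfolding sph_def eph_def by (auto intro!: derivative_eq_intros simp: algebra_simps)
    from has_derivative_compose[OF this d] show ?thesis
      unfolding has_vector_derivative_def F_def lin .
  qed
  have deth: "((%t. eth t \<phi> $ i) has_real_derivative - (sph \<theta> \<phi> $ i)) (at \<theta>)" for \<theta> \<phi>
    using exhaust_3[of i] by (auto intro!: derivative_eq_intros)
  have deph: "((%t. eph t $ i) has_real_derivative - (sin \<theta> * sph \<theta> \<phi> $ i + cos \<theta> * eth \<theta> \<phi> $ i)) (at \<phi>)" for \<theta> \<phi>
  proof -
    have "sin \<theta> * (sin \<theta> * a) + cos \<theta> * (cos \<theta> * a) = a" for a
      by (simp add: mult.assoc[symmetric] distrib_right[symmetric] power2_eq_square[symmetric])
    note e = this
    have "((%t. - sin t) has_real_derivative - cos \<phi>) (at \<phi>)" "(cos has_real_derivative - sin \<phi>) (at \<phi>)"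
      by (auto intro!: derivative_eq_intros)
    thus ?thesis using exhaust_3[of i] by (elim disjE) (simp_all add: e)
  qed
  have dA: "((%t. of_real (sin t * eth t \<phi> $ i) * F t \<phi>) hvd A \<theta> \<phi>) (at \<theta>)" for \<theta> \<phi>
  proof -
    have "((%t. sin t * eth t \<phi> $ i) has_real_derivative cos \<theta> * eth \<theta> \<phi> $ i - sin \<theta> * sph \<theta> \<phi> $ i) (at \<theta>)"
      using DERIV_mult[OF DERIV_sin deth[of \<phi> \<theta>]] by (simp add: mult.commute)
    from hvd_mult[OF has_vector_derivative_of_real[OF this] dF1[of \<phi> \<theta>]]
    show ?thesis unfolding A_def .
  qed
  have dB: "((%t. of_real (eph t $ i) * F \<theta> t) hvd B \<theta> \<phi>) (at \<phi>)" for \<theta> \<phi>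
    using hvd_mult[OF has_vector_derivative_of_real[OF deph[of \<theta> \<phi>]] dF2[of \<theta> \<phi>]]
    unfolding B_def by (simp only: of_real_minus mult_minus_left add_uminus_conv_diff)
  have cF: "continuous_on ?B (%p. F (fst p) (snd p))"
    unfolding F_def by (intro continuous_on_sph_compose C1_on_imp_continuous_on f)
  have cp: "continuous_on ?B (%p. partial j f (sph (fst p) (snd p)))" for j
    by (intro continuous_on_sph_compose C1_onD(2)[OF f])
  have csph: "continuous_on ?B (%p. sph (fst p) (snd p) $ j)" "continuous_on ?B (%p. eth (fst p) (snd p) $ j)"
     "continuous_on ?B (%p. eph (snd p) $ j)" for j
    unfolding sph_def eth_def eph_def by (intro continuous_intros)+
  have csc: "continuous_on ?B (%p. sin (fst p))" "continuous_on ?B (%p. cos (fst p))"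
    by (intro continuous_intros)+
  note cr = continuous_on_add continuous_on_diff continuous_on_mult continuous_on_of_real continuous_on_sum
     cF cp csph csc
  have cA: "continuous_on ?B (%p. A (fst p) (snd p))"
    unfolding A_def by (intro cr)
  have cB: "continuous_on ?B (%p. B (fst p) (snd p))"
    unfolding B_def vector_scaleR_component real_scaleR_def by (intro cr)
  \<comment> \<open>The order of integration is exchanged so that the \<theta>-integral is
    innermost; its endpoint values carry sin 0 = sin pi = 0.\<close>
  have IA: "integral ?B (%p. A (fst p) (snd p)) = 0"
  proof -
    have "integral ?B (%p. A (fst p) (snd p))
        = integral (cbox 0 pi) (%\<theta>. integral (cbox 0 (2 * pi)) (%\<phi>. A \<theta> \<phi>))"
      using integral_prod_continuous[OF cA] by simp
    also have "\<dots> = integral (cbox 0 (2 * pi)) (%\<phi>. integral (cbox 0 pi) (%\<theta>. A \<theta> \<phi>))"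
      by (rule integral_swap_continuous) (use cA in \<open>simp add: split_beta\<close>)
    also have "\<dots> = integral (cbox 0 (2 * pi)) (%\<phi>. 0)"
    proof (rule integral_cong)
      fix \<phi>
      have "((%\<theta>. A \<theta> \<phi>) has_integral of_real (sin pi * eth pi \<phi> $ i) * F pi \<phi>
              - of_real (sin 0 * eth 0 \<phi> $ i) * F 0 \<phi>) {0..pi}"
        by (rule fundamental_theorem_of_calculus)
           (auto intro!: hvd_at_within[OF dA] simp del: of_real_mult)
      thus "integral (cbox 0 pi) (%\<theta>. A \<theta> \<phi>) = 0" by (simp add: integral_unique)
    qed
    finally show ?thesis by simp
  qed
  \<comment> \<open>Here the inner integral vanishes by 2 pi-periodicity in \<phi>.\<close>
  have IB: "integral ?B (%p. B (fst p) (snd p)) = 0"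
  proof -
    have "integral ?B (%p. B (fst p) (snd p))
        = integral (cbox 0 pi) (%\<theta>. integral (cbox 0 (2 * pi)) (%\<phi>. B \<theta> \<phi>))"
      using integral_prod_continuous[OF cB] by simp
    also have "\<dots> = integral (cbox 0 pi) (%\<theta>. 0)"
    proof (rule integral_cong)
      fix \<theta>
      have "((%\<phi>. B \<theta> \<phi>) has_integral of_real (eph (2 * pi) $ i) * F \<theta> (2 * pi)
              - of_real (eph 0 $ i) * F \<theta> 0) {0..2 * pi}"
        by (rule fundamental_theorem_of_calculus)
           (auto intro!: hvd_at_within[OF dB] simp del: of_real_mult)
      moreover have "F \<theta> (2 * pi) = F \<theta> 0" "eph (2 * pi) = eph 0"
        by (simp_all add: F_def sph_def eph_def)
      ultimately show "integral (cbox 0 (2 * pi)) (%\<phi>. B \<theta> \<phi>) = 0" by (simp add: integral_unique)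
    qed
    finally show ?thesis by simp
  qed
  have key: "of_real (sin \<theta>) * (tg i f (sph \<theta> \<phi>) - 2 * (cx i (sph \<theta> \<phi>) * f (sph \<theta> \<phi>))) = A \<theta> \<phi> + B \<theta> \<phi>"
    for \<theta> \<phi>
  proof -
    have "tg i f (sph \<theta> \<phi>) = (\<Sum>j\<in>UNIV. of_real ((if i = j then 1 else 0) - sph \<theta> \<phi> $ i * sph \<theta> \<phi> $ j) * partial j f (sph \<theta> \<phi>))"
      by (rule tg_eq)
    also have "\<dots> = of_real (eth \<theta> \<phi> $ i) * ?D \<theta> \<phi> (eth \<theta> \<phi>) + of_real (eph \<phi> $ i) * ?D \<theta> \<phi> (eph \<phi>)"
      unfolding frame of_real_add of_real_mult distrib_right sum.distrib sum_distrib_left mult.assoc ..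
    finally have tg: "tg i f (sph \<theta> \<phi>) = of_real (eth \<theta> \<phi> $ i) * ?D \<theta> \<phi> (eth \<theta> \<phi>) + of_real (eph \<phi> $ i) * ?D \<theta> \<phi> (eph \<phi>)" .
    have D: "?D \<theta> \<phi> (sin \<theta> *\<^sub>R eph \<phi>) = of_real (sin \<theta>) * ?D \<theta> \<phi> (eph \<phi>)"
      unfolding vector_scaleR_component real_scaleR_def of_real_mult sum_distrib_left mult.assoc ..
    show ?thesis
      unfolding A_def B_def F_def D tg of_real_add of_real_mult of_real_diff
      by (rule complex_of_real_sph_algebra)
  qed
  have "sI (tg i f) - sI (%x. 2 * (cx i x * f x)) = integral ?B (%p. A (fst p) (snd p) + B (fst p) (snd p))"
  proof -
    have "contS (tg i f)"
      unfolding tg_def using f by (intro continuous_intros) (auto simp: C1_on_def)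
    thus ?thesis
      using C1_on_imp_continuous_on[OF f]
      by (subst sI_diff[symmetric])
         (auto intro!: continuous_intros simp: sI_def key[symmetric])
  qed
  also have "\<dots> = 0"
    by (subst integral_add) (auto intro!: integrable_continuous cA cB simp: IA IB)
  finally show ?thesis by (simp add: sI_cmult)
qed

section \<open>Tangential derivatives of products and of x\<bullet>y\<close>

lemma tg_mult:
  assumes "f differentiable (at x)" "g differentiable (at x)"
  shows "tg i (%x. f x * g x) x = f x * tg i g x + tg i f x * g x"
  unfolding tg_def partial_mult[OF assms] sum_3 by algebra

lemma tg_add:
  assumes "f differentiable (at x)" "g differentiable (at x)"
  shows "tg i (%x. f x + g x) x = tg i f x + tg i g x"
  unfolding tg_def partial_add[OF assms] sum_3 by algebra

lemma tg_diff:
  assumes "f differentiable (at x)" "g differentiable (at x)"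
  shows "tg i (%x. f x - g x) x = tg i f x - tg i g x"
  unfolding tg_def partial_diff[OF assms] sum_3 by algebra

lemma tg_power:
  assumes "f differentiable (at x)"
  shows "tg i (%x. f x ^ n) x = of_nat n * f x ^ (n - 1) * tg i f x"
  unfolding tg_def partial_power[OF assms] sum_3 by algebra

lemma tg_const [simp]: "tg i (%x. c) x = 0"
  unfolding tg_def by simp

lemma tg_cx [simp]: "tg i (cx k) x = (if i = k then 1 else 0) - cx i x * cx k x"
  unfolding tg_def by (simp add: if_distrib[of "%a. _ * a"] cong: if_cong)

definition dt :: "real^3 => sfield" where
  "dt y x = cx 1 y * cx 1 x + cx 2 y * cx 2 x + cx 3 y * cx 3 x"

lemma dt_differentiable [simp]: "dt y differentiable (at x)"
  unfolding dt_def[abs_def] by (intro differentiable_add differentiable_mult differentiable_cx differentiable_const)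

lemma C1_on_dt: "C1_on (dt y) S"
  unfolding dt_def[abs_def] by (intro C1_on_add C1_on_mult C1_on_cx C1_on_const)

lemma tg_dt [simp]: "tg i (dt y) x = cx i y - cx i x * dt y x"
  unfolding dt_def[abs_def] using exhaust_3[of i]
  by (elim disjE) (simp_all add: tg_add tg_mult differentiable_mult algebra_simps)

text \<open>At a unit vector \<open>x\<close>, with \<open>\<phi> = (x \<bullet> y)\<^sup>d\<close>: \<open>gX\<close> is \<open>\<phi> x\<close>, \<open>gS\<close> is the surface gradient of \<open>\<phi>\<close>,
  \<open>gL\<close> is its cross product with \<open>x\<close>, and \<open>lap\<close> is the Laplace-Beltrami operator applied to \<open>\<phi>\<close>.\<close>

definition ph :: "real^3 => nat => sfield" where
  "ph y d x = dt y x ^ d"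

definition gX :: "real^3 => nat => 3 => sfield" where
  "gX y d i x = cx i x * ph y d x"

definition gS :: "real^3 => nat => 3 => sfield" where
  "gS y d i x = of_nat d * dt y x ^ (d - 1) * (cx i y - cx i x * dt y x)"

definition xcr :: "3 => real^3 => sfield" where
  "xcr i x y = (if i = 1 then cx 2 x * cx 3 y - cx 3 x * cx 2 y
    else if i = 2 then cx 3 x * cx 1 y - cx 1 x * cx 3 y else cx 1 x * cx 2 y - cx 2 x * cx 1 y)"

definition gL :: "real^3 => nat => 3 => sfield" where
  "gL y d i x = of_nat d * dt y x ^ (d - 1) * xcr i x y"

definition lap :: "real^3 => nat => sfield" where
  "lap y d x = of_nat (d * (d - 1)) * of_real ((norm y)\<^sup>2) * ph y (d - 2) x - of_nat (d * (d + 1)) * ph y d x"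

lemma xcr_simps [simp]:
  "xcr 1 x y = cx 2 x * cx 3 y - cx 3 x * cx 2 y"
  "xcr 2 x y = cx 3 x * cx 1 y - cx 1 x * cx 3 y"
  "xcr 3 x y = cx 1 x * cx 2 y - cx 2 x * cx 1 y"
  by (simp_all add: xcr_def)

lemma xcr_differentiable [simp]: "(%x. xcr i x y) differentiable (at x)"
  using exhaust_3[of i]
  by (elim disjE) (simp_all add: differentiable_diff differentiable_mult)

lemma C1_on_xcr: "C1_on (%x. xcr i x y) S"
  using exhaust_3[of i] by (elim disjE) (auto intro!: C1_on_diff C1_on_mult)

lemma differentiable_power_c [simp]:
  fixes f :: "sfield"
  shows "f differentiable (at x) ==> (%x. f x ^ n) differentiable (at x)"
  by (induction n) (auto intro: differentiable_mult)

lemma C1_on_test: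
  "C1_on (ph y d) S" "C1_on (gX y d i) S" "C1_on (gS y d i) S" "C1_on (gL y d i) S" "C1_on (lap y d) S"
  unfolding ph_def[abs_def] gX_def[abs_def] gS_def[abs_def] gL_def[abs_def] lap_def[abs_def]
  by (intro C1_on_add C1_on_diff C1_on_mult C1_on_power C1_on_dt C1_on_cx C1_on_const C1_on_xcr)+

lemma tg_ph: "tg i (ph y d) x = gS y d i x"
  unfolding ph_def[abs_def] gS_def by (simp add: tg_power)

lemma tg_gX: "tg j (gX y d i) x = cx i x * gS y d j x + ((if j = i then 1 else 0) - cx j x * cx i x) * ph y d x"
  unfolding gX_def[abs_def]
  by (subst tg_mult) (simp_all add: tg_ph, simp add: ph_def[abs_def])

lemma tg_gS: "tg j (gS y d i) x = of_nat (d * (d - 1)) * dt y x ^ (d - 2) * (cx j y - cx j x * dt y x) * (cx i y - cx i x * dt y x)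
    - of_nat d * dt y x ^ (d - 1) * (cx i x * (cx j y - cx j x * dt y x) + ((if j = i then 1 else 0) - cx j x * cx i x) * dt y x)"
proof -
  have A: "tg j (%x. cx i y - cx i x * dt y x) x = - (cx i x * (cx j y - cx j x * dt y x) + ((if j = i then 1 else 0) - cx j x * cx i x) * dt y x)"
    by (subst tg_diff) (simp_all add: tg_mult differentiable_mult)
  have B: "tg j (%x. of_nat d * dt y x ^ (d - 1)) x = of_nat (d * (d - 1)) * dt y x ^ (d - 2) * (cx j y - cx j x * dt y x)"
    by (subst tg_mult) (simp_all add: tg_power numeral_2_eq_2)
  have "tg j (gS y d i) x = of_nat d * dt y x ^ (d - 1) * tg j (%x. cx i y - cx i x * dt y x) x
      + tg j (%x. of_nat d * dt y x ^ (d - 1)) x * (cx i y - cx i x * dt y x)"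
    unfolding gS_def[abs_def]
    by (rule tg_mult) (simp_all add: differentiable_diff differentiable_mult)
  thus ?thesis unfolding A B mult_minus_right by (simp only: uminus_add_conv_diff)
qed

lemma tg_gL: "tg j (gL y d i) x = of_nat (d * (d - 1)) * dt y x ^ (d - 2) * (cx j y - cx j x * dt y x) * xcr i x y
    + of_nat d * dt y x ^ (d - 1) * tg j (%x. xcr i x y) x"
proof -
  have "tg j (%x. of_nat d * dt y x ^ (d - 1)) x = of_nat (d * (d - 1)) * dt y x ^ (d - 2) * (cx j y - cx j x * dt y x)"
    by (subst tg_mult) (simp_all add: tg_power numeral_2_eq_2)
  thus ?thesis unfolding gL_def[abs_def]
    by (subst tg_mult) (simp_all add: differentiable_mult)
qed

lemma tg_xcr:
  "tg j (%x. xcr 1 x y) x = ((if j = 2 then 1 else 0) - cx j x * cx 2 x) * cx 3 y - ((if j = 3 then 1 else 0) - cx j x * cx 3 x) * cx 2 y"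
  "tg j (%x. xcr 2 x y) x = ((if j = 3 then 1 else 0) - cx j x * cx 3 x) * cx 1 y - ((if j = 1 then 1 else 0) - cx j x * cx 1 x) * cx 3 y"
  "tg j (%x. xcr 3 x y) x = ((if j = 1 then 1 else 0) - cx j x * cx 1 x) * cx 2 y - ((if j = 2 then 1 else 0) - cx j x * cx 2 x) * cx 1 y"
  by (simp_all add: tg_diff tg_mult differentiable_mult)

section \<open>Pointwise vector identities for the test fields on the unit sphere\<close>

context
  fixes x y :: "real^3" and d :: nat
  assumes x: "norm x = 1"
begin

lemma num3_neq: "((1::3) = 2) = False" "((1::3) = 3) = False" "((2::3) = 1) = False"
    "((2::3) = 3) = False" "((3::3) = 1) = False" "((3::3) = 2) = False"
  by simp_all

lemma dt_xy: "dt y x = cx 1 y * cx 1 x + cx 2 y * cx 2 x + cx 3 y * cx 3 x"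
  by (simp add: dt_def)

lemma unit3: "cx 1 x * cx 1 x + cx 2 x * cx 2 x + cx 3 x * cx 3 x = 1"
  using norm3_eq[of x] x by (simp add: power2_eq_square flip: of_real_mult of_real_add)

lemma ny3: "of_real ((norm y)\<^sup>2) = cx 1 y * cx 1 y + cx 2 y * cx 2 y + cx 3 y * cx 3 y"
  unfolding norm3_eq by (simp add: power2_eq_square)

lemma x_dot_gS: "cdot cx (gS y d) x = 0"
proof -
    have "x1 * (Q * (y1 - x1 * z)) + x2 * (Q * (y2 - x2 * z)) + x3 * (Q * (y3 - x3 * z)) = 0"
      if "x1 * x1 + x2 * x2 + x3 * x3 = 1" "z = y1 * x1 + y2 * x2 + y3 * x3" for Q z x1 x2 x3 y1 y2 y3 :: complex
      using that by algebra
    from this[OF unit3 dt_xy, where Q = "of_nat d * dt y x ^ (d - 1)"]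
    show ?thesis
      unfolding gS_def sum_3 .
qed

lemma x_dot_gL: "cdot cx (gL y d) x = 0"
  unfolding gL_def sum_3 xcr_simps by algebra

text \<open>The bracket |y|^2 - (x\<bullet>y)^2 is the squared surface gradient of x\<bullet>y, so
  this is the chain rule form of the Laplacian of a power; regrouping its terms gives
  \<open>lap\<close>. For d < 2 the truncated exponents are multiplied by 0.\<close>

lemma lap_eq: "lap y d x = of_nat (d * (d - 1)) * dt y x ^ (d - 2) *
     (cx 1 y * cx 1 y + cx 2 y * cx 2 y + cx 3 y * cx 3 y - dt y x * dt y x)
   - of_nat d * dt y x ^ (d - 1) * (2 * dt y x)"
proof (cases "d \<ge> 2")
  case True
  then obtain e where d: "d = Suc (Suc e)" by (metis Suc_diff_Suc Suc_1 less_eq_Suc_le le_add_diff_inverse plus_1_eq_Suc add_Suc)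
  show ?thesis unfolding lap_def ph_def ny3 d by (simp add: algebra_simps)
next
  case False
  hence "d = 0 \<or> d = 1" by auto
  thus ?thesis by (auto simp: lap_def ph_def)
qed

lemma div_gS: "(\<Sum>i\<in>UNIV. tg i (gS y d i) x) = lap y d x"
proof -
    \<comment> \<open>The powers of x\<bullet>y with their coefficients become free variables P and
      Q; what remains is a polynomial identity modulo |x| = 1 and the definition of x\<bullet>y. The
      same device is used for the other identities.\<close>
    have "(P * (y1 - x1 * z) * (y1 - x1 * z) - Q * (x1 * (y1 - x1 * z) + (1 - x1 * x1) * z)) + (P * (y2 - x2 * z) * (y2 - x2 * z) - Q * (x2 * (y2 - x2 * z) + (1 - x2 * x2) * z)) + (P * (y3 - x3 * z) * (y3 - x3 * z) - Q * (x3 * (y3 - x3 * z) + (1 - x3 * x3) * z)) = P * (y1 * y1 + y2 * y2 + y3 * y3 - z * z) - Q * (2 * z)"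
      if "x1 * x1 + x2 * x2 + x3 * x3 = 1" "z = y1 * x1 + y2 * x2 + y3 * x3" for P Q z x1 x2 x3 y1 y2 y3 :: complex
      using that by algebra
    from this[OF unit3 dt_xy, where P = "of_nat (d * (d - 1)) * dt y x ^ (d - 2)" and Q = "of_nat d * dt y x ^ (d - 1)"]
    show ?thesis
      unfolding tg_gS sum_3 lap_eq num3_neq if_True if_False simp_thms(6) .
qed

lemma div_gL: "(\<Sum>i\<in>UNIV. tg i (gL y d i) x) = 0"
proof -
    have "(P * (y1 - x1 * z) * (x2 * y3 - x3 * y2) + Q * ((0 - x1 * x2) * y3 - (0 - x1 * x3) * y2)) + (P * (y2 - x2 * z) * (x3 * y1 - x1 * y3) + Q * ((0 - x2 * x3) * y1 - (0 - x2 * x1) * y3)) + (P * (y3 - x3 * z) * (x1 * y2 - x2 * y1) + Q * ((0 - x3 * x1) * y2 - (0 - x3 * x2) * y1)) = 0"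
      for P Q z x1 x2 x3 y1 y2 y3 :: complex
      by algebra
    from this[where P = "of_nat (d * (d - 1)) * dt y x ^ (d - 2)" and Q = "of_nat d * dt y x ^ (d - 1)"]
    show ?thesis
      unfolding tg_gL sum_3 tg_xcr unfolding xcr_simps num3_neq if_True if_False simp_thms(6) .
qed

text \<open>The second and third component of a vector identity are cyclic images of the first;
  these are the correspondingly permuted premises.\<close>

lemma cyclic3:
  "cx 2 x * cx 2 x + cx 3 x * cx 3 x + cx 1 x * cx 1 x = 1" "cx 3 x * cx 3 x + cx 1 x * cx 1 x + cx 2 x * cx 2 x = 1"
  "dt y x = cx 2 y * cx 2 x + cx 3 y * cx 3 x + cx 1 y * cx 1 x" "dt y x = cx 3 y * cx 3 x + cx 1 y * cx 1 x + cx 2 y * cx 2 x"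
  using unit3 by (simp_all add: dt_def ac_simps)

lemma gL_cross_x:
  "gL y d 2 x * cx 3 x - gL y d 3 x * cx 2 x = gS y d 1 x"
  "gL y d 3 x * cx 1 x - gL y d 1 x * cx 3 x = gS y d 2 x"
  "gL y d 1 x * cx 2 x - gL y d 2 x * cx 1 x = gS y d 3 x"
proof -
  have "Q * (x3 * y1 - x1 * y3) * x3 - Q * (x1 * y2 - x2 * y1) * x2 = Q * (y1 - x1 * z)"
    if "x1 * x1 + x2 * x2 + x3 * x3 = 1" "z = y1 * x1 + y2 * x2 + y3 * x3" for Q z x1 x2 x3 y1 y2 y3 :: complex
    using that by algebra
  note a = this[where Q = "of_nat d * dt y x ^ (d - 1)"]
  show "gL y d 2 x * cx 3 x - gL y d 3 x * cx 2 x = gS y d 1 x"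
    "gL y d 3 x * cx 1 x - gL y d 1 x * cx 3 x = gS y d 2 x"
    "gL y d 1 x * cx 2 x - gL y d 2 x * cx 1 x = gS y d 3 x"
    unfolding gL_def gS_def xcr_simps
    by (rule a[OF unit3 dt_xy] a[OF cyclic3(1,3)] a[OF cyclic3(2,4)])+
qed

lemma gS_cross_x:
  "gS y d 2 x * cx 3 x - gS y d 3 x * cx 2 x = - gL y d 1 x"
  "gS y d 3 x * cx 1 x - gS y d 1 x * cx 3 x = - gL y d 2 x"
  "gS y d 1 x * cx 2 x - gS y d 2 x * cx 1 x = - gL y d 3 x"
  unfolding gL_def gS_def xcr_simps
  by algebra+

lemma tgcurl_gS:
  "tg 2 (gS y d 3) x - tg 3 (gS y d 2) x = gL y d 1 x"
  "tg 3 (gS y d 1) x - tg 1 (gS y d 3) x = gL y d 2 x"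
  "tg 1 (gS y d 2) x - tg 2 (gS y d 1) x = gL y d 3 x"
  unfolding tg_gS gL_def xcr_simps num3_neq if_True if_False simp_thms(6)
  by algebra+

lemma tgcurl_gX:
  "tg 2 (gX y d 3) x - tg 3 (gX y d 2) x = - gL y d 1 x"
  "tg 3 (gX y d 1) x - tg 1 (gX y d 3) x = - gL y d 2 x"
  "tg 1 (gX y d 2) x - tg 2 (gX y d 1) x = - gL y d 3 x"
  unfolding tg_gX gS_cross_x[symmetric] num3_neq if_True if_False simp_thms(6)
  by algebra+

lemma div_gX: "(\<Sum>i\<in>UNIV. tg i (gX y d i) x) = 2 * ph y d x"
proof -
  have "(\<Sum>i\<in>UNIV. tg i (gX y d i) x) = (cdot cx (gS y d) x) +
     (3 - (cx 1 x * cx 1 x + cx 2 x * cx 2 x + cx 3 x * cx 3 x)) * ph y d x"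
    unfolding tg_gX sum_3 num3_neq if_True if_False simp_thms(6) by algebra
  thus ?thesis unfolding x_dot_gS unit3 by simp
qed

text \<open>The radial part of the curl of \<open>gL\<close> is the Laplacian of the test function.
  This is the place where the coupling of degree d to degree d - 2 enters the equations for
  tangential moments.\<close>

lemma tgcurl_gL:
  "tg 2 (gL y d 3) x - tg 3 (gL y d 2) x = cx 1 x * lap y d x - gS y d 1 x"
  "tg 3 (gL y d 1) x - tg 1 (gL y d 3) x = cx 2 x * lap y d x - gS y d 2 x"
  "tg 1 (gL y d 2) x - tg 2 (gL y d 1) x = cx 3 x * lap y d x - gS y d 3 x"
proof -
  have "P * (y2 - x2 * z) * (x1 * y2 - x2 * y1) + Q * ((0 - x2 * x1) * y2 - (1 - x2 * x2) * y1)
      - (P * (y3 - x3 * z) * (x3 * y1 - x1 * y3) + Q * ((1 - x3 * x3) * y1 - (0 - x3 * x1) * y3))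
      = x1 * (P * (N - z * z) - Q * (2 * z)) - Q * (y1 - x1 * z)"
    if "x1 * x1 + x2 * x2 + x3 * x3 = 1" "z = y1 * x1 + y2 * x2 + y3 * x3" "N = y1 * y1 + y2 * y2 + y3 * y3"
    for P Q z N x1 x2 x3 y1 y2 y3 :: complex
    using that by algebra
  note a = this[where P = "of_nat (d * (d - 1)) * dt y x ^ (d - 2)" and Q = "of_nat d * dt y x ^ (d - 1)"]
  have "N1 + N2 + N3 = N2 + N3 + N1" "N1 + N2 + N3 = N3 + N1 + N2" for N1 N2 N3 :: complex by simp_all
  note c = this[of "cx 1 y * cx 1 y" "cx 2 y * cx 2 y" "cx 3 y * cx 3 y"]
  show "tg 2 (gL y d 3) x - tg 3 (gL y d 2) x = cx 1 x * lap y d x - gS y d 1 x"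
    "tg 3 (gL y d 1) x - tg 1 (gL y d 3) x = cx 2 x * lap y d x - gS y d 2 x"
    "tg 1 (gL y d 2) x - tg 2 (gL y d 1) x = cx 3 x * lap y d x - gS y d 3 x"
    unfolding tg_gL tg_xcr unfolding xcr_simps gS_def lap_eq num3_neq if_True if_False simp_thms(6)
    by (rule a[OF unit3 dt_xy refl] a[OF cyclic3(1,3) c(1)] a[OF cyclic3(2,4) c(2)])+
qed

end

section \<open>Moments over spheres\<close>

text \<open>The pairing is bilinear, without conjugation: the field is sampled at radius r, the test
  function lives on the unit sphere, and no area factor r^2 is included.\<close>

definition mom :: "(sfield) => (sfield) => real => complex" where
  "mom f g r = sI (%x. f (r *\<^sub>R x) * g x)"

definition vm :: "vfield => (3 => sfield) => real => complex" where
  "vm w G r = (\<Sum>i\<in>UNIV. mom (cmp w i) (G i) r)"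

text \<open>\<open>T\<close> is an open interval of radii and \<open>S\<close> an open set
  containing the spheres with these radii, so that moments may be differentiated in r. The two
  instances are the punctured range (0,1) with the unit ball and (1,\<infinity>) with the
  exterior.\<close>

definition shell :: "real set => (real^3) set => bool" where
  "shell T S \<longleftrightarrow> open T \<and> convex T \<and> T \<subseteq> {0<..} \<and> open S \<and> (\<forall>r\<in>T. \<forall>x. norm x = 1 \<longrightarrow> r *\<^sub>R x \<in> S)"

lemma mom_continuous_on:
  assumes f: "continuous_on S f" and g: "contS g"
    and S: "\<And>r x. r \<in> T ==> norm x = 1 ==> r *\<^sub>R x \<in> S"
  shows "continuous_on T (mom f g)"
proof -
  have csph: "continuous_on A (%q. sph (fst (snd q)) (snd (snd q)))" for A :: "(real \<times> real \<times> real) set"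
    unfolding sph_def by (intro continuous_intros)
  have "continuous_on (T \<times> cbox (0, 0) (pi, 2 * pi))
      (%q. of_real (sin (fst (snd q))) * (f (fst q *\<^sub>R sph (fst (snd q)) (snd (snd q))) * g (sph (fst (snd q)) (snd (snd q)))))"
  proof (intro continuous_on_mult)
    show "continuous_on (T \<times> cbox (0, 0) (pi, 2 * pi)) (%q. f (fst q *\<^sub>R sph (fst (snd q)) (snd (snd q))))"
      by (rule continuous_on_compose2[OF f])
         (auto intro!: continuous_on_scaleR continuous_on_fst continuous_on_id csph S)
    show "continuous_on (T \<times> cbox (0, 0) (pi, 2 * pi)) (%q. g (sph (fst (snd q)) (snd (snd q))))"
      by (rule continuous_on_compose2[OF g csph]) auto
    show "continuous_on (T \<times> cbox (0, 0) (pi, 2 * pi)) (%q. complex_of_real (sin (fst (snd q))))"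
      by (intro continuous_intros)
  qed
  thus ?thesis
    unfolding mom_def sI_def
    by (intro integral_continuous_on_param) (simp add: split_beta)
qed

lemma mom_has_vector_derivative:
  assumes sh: "shell T S" and f: "C1_on f S" and g: "contS g" and r: "r \<in> T"
  shows "(mom f g hvd sI (%x. (\<Sum>j\<in>UNIV. cx j x * partial j f (r *\<^sub>R x)) * g x)) (at r)"
proof -
  have S: "\<And>r x. r \<in> T ==> norm x = 1 ==> r *\<^sub>R x \<in> S" using sh by (auto simp: shell_def)
  have csph: "continuous_on A (%q. sph (fst (snd q)) (snd (snd q)))" for A :: "(real \<times> real \<times> real) set"
    unfolding sph_def by (intro continuous_intros)
  let ?B = "cbox (0, 0) (pi, 2 * pi)"
  let ?s = "%p. sph (fst p) (snd p)"
  have cf: "continuous_on (T \<times> ?B) (%q. h (fst q *\<^sub>R sph (fst (snd q)) (snd (snd q))))"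
    if "continuous_on S h" for h :: "sfield"
    by (rule continuous_on_compose2[OF that])
       (auto intro!: continuous_on_scaleR continuous_on_fst continuous_on_id csph S)
  have cg: "continuous_on (T \<times> ?B) (%q. g (sph (fst (snd q)) (snd (snd q))))"
    by (rule continuous_on_compose2[OF g csph]) auto
  have "((%r. integral ?B (%p. of_real (sin (fst p)) * (f (r *\<^sub>R ?s p) * g (?s p)))) hvd
      integral ?B (%p. of_real (sin (fst p)) * ((\<Sum>j\<in>UNIV. cx j (?s p) * partial j f (r *\<^sub>R ?s p)) * g (?s p))))
      (at r within T)"
  proof (rule leibniz_rule_vector_derivative)
    fix t p assume t: "t \<in> T" and "p \<in> ?B"
    have "((%t. t *\<^sub>R ?s p) has_derivative (%h. h *\<^sub>R ?s p)) (at t)"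
      by (auto intro!: derivative_eq_intros)
    from has_derivative_compose[OF this has_derivative_partials] S[OF t norm_sph] f
    have "((%t. f (t *\<^sub>R ?s p)) has_derivative (%h. \<Sum>j\<in>UNIV. (h *\<^sub>R ?s p) $ j *\<^sub>R partial j f (t *\<^sub>R ?s p))) (at t)"
      by (auto simp: C1_on_def)
    hence "((%t. f (t *\<^sub>R ?s p)) hvd (\<Sum>j\<in>UNIV. cx j (?s p) * partial j f (t *\<^sub>R ?s p))) (at t)"
      unfolding has_vector_derivative_def
      by (simp only: vector_scaleR_component real_scaleR_def scaleR_sum_right scaleR_scaleR[symmetric]
        scaleR_conv_of_real[of "?s p $ _"])
    hence "((%t. of_real (sin (fst p)) * (f (t *\<^sub>R ?s p) * g (?s p))) hvd
       of_real (sin (fst p)) * ((\<Sum>j\<in>UNIV. cx j (?s p) * partial j f (t *\<^sub>R ?s p)) * g (?s p))) (at t)"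
      by (intro hvd_mult_left hvd_mult_right)
    thus "((%t. of_real (sin (fst p)) * (f (t *\<^sub>R ?s p) * g (?s p))) hvd
       of_real (sin (fst p)) * ((\<Sum>j\<in>UNIV. cx j (?s p) * partial j f (t *\<^sub>R ?s p)) * g (?s p))) (at t within T)"
      by (rule hvd_at_within)
  next
    fix t assume t: "t \<in> T"
    have "contS (%x. f (t *\<^sub>R x) * g x)"
      by (intro continuous_on_mult g continuous_on_compose2[OF C1_on_imp_continuous_on[OF f]])
         (auto intro!: continuous_intros S t)
    from sI_integrable[OF this]
    show "(%p. of_real (sin (fst p)) * (f (t *\<^sub>R ?s p) * g (?s p))) integrable_on ?B" .
  next
    have cxs: "continuous_on (T \<times> ?B) (%q. cx j (sph (fst (snd q)) (snd (snd q))))" for j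
      by (intro continuous_on_of_real continuous_on_component csph)
    have "continuous_on (T \<times> ?B) (%q. of_real (sin (fst (snd q))) * ((\<Sum>j\<in>UNIV. cx j (sph (fst (snd q)) (snd (snd q))) *
         partial j f (fst q *\<^sub>R sph (fst (snd q)) (snd (snd q)))) * g (sph (fst (snd q)) (snd (snd q)))))"
      using f by (intro continuous_on_mult continuous_on_sum cf cg cxs continuous_on_of_real continuous_on_sin
          continuous_on_fst continuous_on_snd continuous_on_id) (auto simp: C1_on_def)
    thus "continuous_on (T \<times> ?B) (%(t, p). of_real (sin (fst p)) * ((\<Sum>j\<in>UNIV. cx j (?s p) * partial j f (t *\<^sub>R ?s p)) * g (?s p)))"
      by (simp add: split_beta)
  qed (use r sh in \<open>auto simp: shell_def\<close>)
  moreover have "at r within T = at r" using r sh unfolding shell_def by (intro at_within_open) auto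
  moreover have "mom f g = (%r. integral ?B (%p. of_real (sin (fst p)) * (f (r *\<^sub>R ?s p) * g (?s p))))"
    by (rule ext) (simp only: mom_def sI_def)
  ultimately show ?thesis unfolding sI_def by (simp only:)
qed

text \<open>On a sphere of radius r the derivative \<partial>_i f splits into x_i times the radial
  derivative and 1/r times a tangential derivative of the restriction. The tangential part is moved
  to g by \<open>sI_tg\<close>, at the cost of the curvature term 2 x_i g.\<close>

lemma mom_partial:
  assumes sh: "shell T S" and f: "C1_on f S" and g: "C1_on g UNIV" and r: "r \<in> T"
  shows "(mom f (%x. cx i x * g x) hvd
     mom (partial i f) g r - (1 / of_real r) * mom f (%x. 2 * (cx i x * g x) - tg i g x) r) (at r)"
proof -
  have S: "\<And>x. norm x = 1 ==> r *\<^sub>R x \<in> S" and r0: "r > 0" using sh r by (auto simp: shell_def)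
  define F where "F x = f (r *\<^sub>R x)" for x
  define E where "E x = (\<Sum>j\<in>UNIV. cx j x * partial j f (r *\<^sub>R x))" for x
  have dF: "(F has_derivative (%v. \<Sum>j\<in>UNIV. (r *\<^sub>R v) $ j *\<^sub>R partial j f (r *\<^sub>R x))) (at x)" if "norm x = 1" for x
  proof -
    have "((%x. r *\<^sub>R x) has_derivative (%v. r *\<^sub>R v)) (at x)" by (auto intro!: derivative_eq_intros)
    from has_derivative_compose[OF this has_derivative_partials[of f]] show ?thesis
      using f S[OF that] unfolding F_def by (auto simp: C1_on_def)
  qed
  have pF: "partial j F x = of_real r * partial j f (r *\<^sub>R x)" if "norm x = 1" for j x
  proof -
    have "(r *\<^sub>R axis j (1::real)) $ k = (if k = j then r else 0)" for k by (simp add: axis_def)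
    thus ?thesis unfolding partial_has_derivative[OF dF[OF that]]
      by (subst sum.remove[of UNIV j]) (auto simp: scaleR_conv_of_real[where 'a=complex])
  qed
  have cp: "contS (%x. h (r *\<^sub>R x))" if "continuous_on S h" for h :: "sfield"
  proof (rule continuous_on_compose2[OF that])
    show "contS (%x::real^3. r *\<^sub>R x)" by (intro continuous_intros)
    show "(%x. r *\<^sub>R x) ` sphere 0 1 \<subseteq> S" using S by auto
  qed
  have cpf: "contS (%x. partial j f (r *\<^sub>R x))" for j
    using f by (intro cp) (auto simp: C1_on_def)
  have C1F: "C1_on F (sphere 0 1)"
  proof -
    have "contS (partial j F)" for j
      by (rule continuous_on_eq[of _ "%x. of_real r * partial j f (r *\<^sub>R x)"])
         (auto intro!: continuous_intros cpf simp: pF)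
    moreover have "F differentiable (at x)" if "norm x = 1" for x
      using dF[OF that] unfolding differentiable_def by blast
    ultimately show ?thesis by (simp add: C1_on_def)
  qed
  have C1g: "C1_on g (sphere 0 1)" using g by (rule C1_on_subset) auto
  note cF = C1_on_imp_continuous_on[OF C1F]
  note cg = C1_on_imp_continuous_on[OF C1g]
  have cE: "contS E"
    unfolding E_def by (intro continuous_intros cpf)
  have ctg: "contS (tg i g)"
    unfolding tg_def using C1g by (intro continuous_intros) (auto simp: C1_on_def)
  \<comment> \<open>The divergence theorem is applied to the product of g with the rescaled
    restriction \<open>F\<close>, whose derivatives carry the factor r.\<close>
  have "2 * sI (%x. cx i x * (F x * g x)) = sI (tg i (%x. F x * g x))"
    by (rule sI_tg[symmetric], rule C1_on_mult[OF C1F C1g])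
  also have "\<dots> = sI (%x. F x * tg i g x + (of_real r * (partial i f (r *\<^sub>R x) * g x) - of_real r * (E x * (cx i x * g x))))"
  proof (rule sI_cong)
    fix x :: "real^3" assume x: "norm x = 1"
    have "tg i (%x. F x * g x) x = F x * tg i g x + tg i F x * g x"
      using C1F C1g x by (intro tg_mult) (auto simp: C1_on_def)
    also have "tg i F x = of_real r * partial i f (r *\<^sub>R x) - cx i x * (of_real r * E x)"
      unfolding tg_def E_def sum_distrib_left pF[OF x] by (simp add: mult.left_commute)
    finally show "tg i (%x. F x * g x) x = F x * tg i g x + (of_real r * (partial i f (r *\<^sub>R x) * g x) - of_real r * (E x * (cx i x * g x)))"
      by (simp add: algebra_simps)
  qed
  also have "\<dots> = sI (%x. F x * tg i g x) + (of_real r * mom (partial i f) g r - of_real r * sI (%x. E x * (cx i x * g x)))"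
    by (subst sI_add, (intro continuous_intros cF ctg cpf cg cE)+, subst sI_diff,
        (intro continuous_intros cF ctg cpf cg cE)+) (simp add: sI_cmult mom_def)
  finally have "sI (%x. E x * (cx i x * g x)) = mom (partial i f) g r
      - (1 / of_real r) * (2 * sI (%x. cx i x * (F x * g x)) - sI (%x. F x * tg i g x))"
    using r0 by (simp add: field_simps)
  also have "2 * sI (%x. cx i x * (F x * g x)) - sI (%x. F x * tg i g x) = mom f (%x. 2 * (cx i x * g x) - tg i g x) r"
  proof -
    have "mom f (%x. 2 * (cx i x * g x) - tg i g x) r = sI (%x. 2 * (cx i x * (F x * g x)) - F x * tg i g x)"
      unfolding mom_def F_def by (rule sI_cong) (simp add: algebra_simps)
    also have "\<dots> = 2 * sI (%x. cx i x * (F x * g x)) - sI (%x. F x * tg i g x)"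
      by (subst sI_diff, (intro continuous_intros cF ctg cg)+) (simp add: sI_cmult)
    finally show ?thesis by simp
  qed
  finally have *: "sI (%x. E x * (cx i x * g x)) = mom (partial i f) g r
      - (1 / of_real r) * mom f (%x. 2 * (cx i x * g x) - tg i g x) r" .
  have "contS (%x. cx i x * g x)" by (intro continuous_intros cg)
  from mom_has_vector_derivative[OF sh f this r] show ?thesis unfolding *[symmetric] E_def .
qed

lemma mom_cong: "(\<And>x. norm x = 1 ==> g x = h x) ==> mom f g r = mom f h r"
  unfolding mom_def by (rule sI_cong) simp

lemma mom_cong_left: "(\<And>x. norm x = 1 ==> f (r *\<^sub>R x) = f' (r *\<^sub>R x)) ==> mom f g r = mom f' g r"
  unfolding mom_def by (rule sI_cong) simp

lemma mom_cmult_right: "mom f (%x. c * g x) r = c * mom f g r"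
  unfolding mom_def by (subst sI_cmult[symmetric]) (rule sI_cong, simp)

lemma mom_minus_right: "mom f (%x. - g x) r = - mom f g r"
  using mom_cmult_right[of f "-1"] by simp

lemma mom_zero_right [simp]: "mom f (%x. 0) r = 0"
  unfolding mom_def by simp

lemma mom_cmult_left: "mom (%x. c * f x) g r = c * mom f g r"
  unfolding mom_def by (subst sI_cmult[symmetric]) (rule sI_cong, simp)

section \<open>Linearity of scalar and vector moments\<close>

definition conts :: "(sfield) => real => bool" where
  "conts f r \<longleftrightarrow> contS (%x. f (r *\<^sub>R x))"

lemma contsI:
  assumes "shell T S" "r \<in> T" "continuous_on S f"
  shows "conts f r"
  unfolding conts_def
proof (rule continuous_on_compose2[OF assms(3)])
  show "contS (%x::real^3. r *\<^sub>R x)" by (intro continuous_intros)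
  show "(%x. r *\<^sub>R x) ` sphere 0 1 \<subseteq> S" using assms(1,2) unfolding shell_def by auto
qed

lemma conts_C1: "shell T S ==> r \<in> T ==> C1_on f S ==> conts f r"
  "shell T S ==> r \<in> T ==> C1_on f S ==> conts (partial j f) r"
  by (rule contsI[OF _ _ C1_on_imp_continuous_on], assumption+) (rule contsI[OF _ _ C1_onD(2)], assumption+)

lemma mom_add_right:
  assumes "conts f r" "contS g" "contS h"
  shows "mom f (%x. g x + h x) r = mom f g r + mom f h r"
  using assms unfolding mom_def conts_def distrib_left by (intro sI_add continuous_on_mult)

lemma mom_diff_right:
  assumes "conts f r" "contS g" "contS h"
  shows "mom f (%x. g x - h x) r = mom f g r - mom f h r"
  using assms unfolding mom_def conts_def right_diff_distrib by (intro sI_diff continuous_on_mult)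

lemma mom_add_left:
  assumes "conts f r" "conts f' r" "contS g"
  shows "mom (%x. f x + f' x) g r = mom f g r + mom f' g r"
  using assms unfolding mom_def conts_def distrib_right by (intro sI_add continuous_on_mult)

lemma mom_diff_left:
  assumes "conts f r" "conts f' r" "contS g"
  shows "mom (%x. f x - f' x) g r = mom f g r - mom f' g r"
  using assms unfolding mom_def conts_def left_diff_distrib by (intro sI_diff continuous_on_mult)

lemma vm_cong: "(\<And>i x. norm x = 1 ==> G i x = H i x) ==> vm w G r = vm w H r"
  unfolding vm_def by (intro sum.cong mom_cong refl) simp

lemma vm_cmult: "vm w (%i x. c * G i x) r = c * vm w G r"
  unfolding vm_def by (simp add: mom_cmult_right sum_distrib_left)

lemma vm_minus: "vm w (%i x. - G i x) r = - vm w G r"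
  using vm_cmult[of w "-1"] by simp

lemma vm_add:
  assumes "\<And>i. conts (cmp w i) r" "\<And>i. contS (G i)" "\<And>i. contS (H i)"
  shows "vm w (%i x. G i x + H i x) r = vm w G r + vm w H r"
  unfolding vm_def by (simp add: mom_add_right[OF assms] sum.distrib)

lemma vm_diff:
  assumes "\<And>i. conts (cmp w i) r" "\<And>i. contS (G i)" "\<And>i. contS (H i)"
  shows "vm w (%i x. G i x - H i x) r = vm w G r - vm w H r"
  unfolding vm_def by (simp add: mom_diff_right[OF assms] sum_subtractf)

text \<open>The components of G \<times> x. This is the test field dual to the radial part of a
  curl, since the radial derivative in G\<bullet>curl w occurs as \<partial>_r w paired with G
  \<times> x; \<open>tcurl\<close> below is the curl formed with tangential derivatives.\<close>

definition crx :: "(3 => sfield) => 3 => sfield" where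
  "crx G i x = (if i = 1 then cx 3 x * G 2 x - cx 2 x * G 3 x
     else if i = 2 then cx 1 x * G 3 x - cx 3 x * G 1 x else cx 2 x * G 1 x - cx 1 x * G 2 x)"

definition tcurl :: "(3 => sfield) => 3 => sfield" where
  "tcurl G i x = (if i = 1 then tg 2 (G 3) x - tg 3 (G 2) x
     else if i = 2 then tg 3 (G 1) x - tg 1 (G 3) x else tg 1 (G 2) x - tg 2 (G 1) x)"

section \<open>Moments of a curl, a divergence and a gradient\<close>

lemma C1_tg_cont: "C1_on g UNIV ==> continuous_on A (tg i g)"
  unfolding tg_def C1_on_def
  by (intro continuous_intros) (auto intro: continuous_on_subset)

lemma C1_cont: "C1_on g UNIV ==> continuous_on A g"
  by (rule continuous_on_subset[OF C1_on_imp_continuous_on]) auto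

lemma curl_algebra:
  fixes k :: complex
  shows "(c1 - b2) + (a1 - c2) + (b1 - a2) - k * ((p1 - p2) + (q1 - q2) + (r1 - r2))
    = ((a1 - k * p1) - (a2 - k * p2)) + ((b1 - k * q1) - (b2 - k * q2)) + ((c1 - k * r1) - (c2 - k * r2))"
  by (simp add: algebra_simps)

text \<open>\<open>mom_partial\<close> applied to the six terms of the curl. It is used with G
  running through the three test families, for which G \<times> x is again, up to sign, one of them
  or zero.\<close>

lemma vm_curl:
  assumes sh: "shell T S" and w: "\<And>i. C1_on (cmp w i) S" and G: "\<And>i. C1_on (G i) UNIV" and r: "r \<in> T"
  shows "(vm w (crx G) hvd
     vm (ccurl w) G r - (1 / of_real r) * vm w (%i x. 2 * crx G i x + tcurl G i x) r) (at r)"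
proof -
  note mp = mom_partial[OF sh w G r]
  note cG = C1_cont[OF G]
  note ct = C1_tg_cont[OF G]
  have cxx: "continuous_on A (cx i)" for A i by (intro continuous_intros)
  note ci = continuous_on_mult continuous_on_diff continuous_on_add cxx cG ct continuous_on_const
  let ?D = "%i j k. mom (partial i (cmp w j)) (G k) r - (1 / of_real r) * mom (cmp w j) (%x. 2 * (cx i x * G k x) - tg i (G k) x) r"
  define M where "M t = (mom (cmp w 1) (%x. cx 3 x * G 2 x) t - mom (cmp w 1) (%x. cx 2 x * G 3 x) t)
     + (mom (cmp w 2) (%x. cx 1 x * G 3 x) t - mom (cmp w 2) (%x. cx 3 x * G 1 x) t)
     + (mom (cmp w 3) (%x. cx 2 x * G 1 x) t - mom (cmp w 3) (%x. cx 1 x * G 2 x) t)" for t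
  have eq: "vm w (crx G) t = M t" if t: "t \<in> T" for t
  proof -
    have "mom (cmp w i) (%x. cx j x * G k x - cx l x * G m x) t
      = mom (cmp w i) (%x. cx j x * G k x) t - mom (cmp w i) (%x. cx l x * G m x) t" for i j k l m
      by (intro mom_diff_right conts_C1(1)[OF sh t w] ci)
    thus ?thesis unfolding vm_def sum_3 crx_def M_def by simp
  qed
  have A: "vm (ccurl w) G r = (mom (partial 2 (cmp w 3)) (G 1) r - mom (partial 3 (cmp w 2)) (G 1) r)
     + (mom (partial 3 (cmp w 1)) (G 2) r - mom (partial 1 (cmp w 3)) (G 2) r)
     + (mom (partial 1 (cmp w 2)) (G 3) r - mom (partial 2 (cmp w 1)) (G 3) r)"
    unfolding vm_def sum_3 ccurl_def by (simp add: mom_diff_left[OF conts_C1(2)[OF sh r w] conts_C1(2)[OF sh r w] cG])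
  have B: "vm w (%i x. 2 * crx G i x + tcurl G i x) r =
     (mom (cmp w 1) (%x. 2 * (cx 3 x * G 2 x) - tg 3 (G 2) x) r - mom (cmp w 1) (%x. 2 * (cx 2 x * G 3 x) - tg 2 (G 3) x) r)
     + (mom (cmp w 2) (%x. 2 * (cx 1 x * G 3 x) - tg 1 (G 3) x) r - mom (cmp w 2) (%x. 2 * (cx 3 x * G 1 x) - tg 3 (G 1) x) r)
     + (mom (cmp w 3) (%x. 2 * (cx 2 x * G 1 x) - tg 2 (G 1) x) r - mom (cmp w 3) (%x. 2 * (cx 1 x * G 2 x) - tg 1 (G 2) x) r)"
    unfolding vm_def sum_3
    by (subst mom_diff_right[OF conts_C1(1)[OF sh r w], symmetric], (intro ci)+)+
       (intro arg_cong2[of _ _ _ _ "(+)"] mom_cong; simp add: crx_def tcurl_def algebra_simps)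
  have val: "vm (ccurl w) G r - (1 / of_real r) * vm w (%i x. 2 * crx G i x + tcurl G i x) r =
     (?D 3 1 2
      - ?D 2 1 3)
     + (?D 1 2 3
      - ?D 3 2 1)
     + (?D 2 3 1
      - ?D 1 3 2)"
    unfolding A B by (rule curl_algebra)
  show ?thesis unfolding val
  proof (rule hvd_transform_within_open[of M _ _ T])
    show "(M hvd (?D 3 1 2
      - ?D 2 1 3)
     + (?D 1 2 3
      - ?D 3 2 1)
     + (?D 2 3 1
      - ?D 1 3 2)) (at r)"
      unfolding M_def by (intro hvd_add hvd_diff mp)
    show "r \<in> T" by fact
    show "open T" using sh by (simp add: shell_def)
    show "M t = vm w (crx G) t" if "t \<in> T" for t using eq[OF that] by simp
  qed
qed

lemma mom_div:
  assumes sh: "shell T S" and w: "\<And>i. C1_on (cmp w i) S" and g: "C1_on g UNIV" and r: "r \<in> T"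
  shows "(vm w (%i x. cx i x * g x) hvd
     mom (cdiv w) g r - (1 / of_real r) * vm w (%i x. 2 * (cx i x * g x) - tg i g x) r) (at r)"
proof -
  have "mom (cdiv w) g r = (\<Sum>i\<in>UNIV. mom (partial i (cmp w i)) g r)"
  proof -
    have "contS (%x. partial i (cmp w i) (r *\<^sub>R x) * g x)" for i
      by (intro continuous_on_mult conts_C1(2)[OF sh r w, unfolded conts_def] C1_cont[OF g])
    from sI_sum[OF finite this] show ?thesis
      unfolding mom_def cdiv_def sum_distrib_right .
  qed
  hence val: "mom (cdiv w) g r - (1 / of_real r) * vm w (%i x. 2 * (cx i x * g x) - tg i g x) r =
    (\<Sum>i\<in>UNIV. mom (partial i (cmp w i)) g r - (1 / of_real r) * mom (cmp w i) (%x. 2 * (cx i x * g x) - tg i g x) r)"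
    by (simp add: vm_def sum_subtractf sum_distrib_left)
  show ?thesis unfolding val unfolding vm_def[abs_def]
    by (intro hvd_sum mom_partial[OF sh w g r])
qed

lemma vm_grad:
  assumes sh: "shell T S" and p: "C1_on p S" and G: "\<And>i. C1_on (G i) UNIV" and r: "r \<in> T"
  shows "(mom p (cdot cx G) hvd
     vm (cgrad p) G r - (1 / of_real r) * mom p (%x. 2 * (cdot cx G x) - (\<Sum>i\<in>UNIV. tg i (G i) x)) r) (at r)"
proof -
  note cG = C1_cont[OF G]
  note ct = C1_tg_cont[OF G]
  have sumr: "mom p (%x. \<Sum>i\<in>UNIV. H i x) t = (\<Sum>i\<in>UNIV. mom p (H i) t)"
    if "t \<in> T" "\<And>i. contS (H i)" for H :: "3 => sfield" and t
  proof -
    have "contS (%x. p (t *\<^sub>R x) * H i x)" for i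
      by (intro continuous_on_mult conts_C1(1)[OF sh that(1) p, unfolded conts_def] that(2))
    from sI_sum[OF finite this] show ?thesis unfolding mom_def sum_distrib_left .
  qed
  have "mom p (%x. 2 * (cdot cx G x) - (\<Sum>i\<in>UNIV. tg i (G i) x)) r
      = (\<Sum>i\<in>UNIV. mom p (%x. 2 * (cx i x * G i x) - tg i (G i) x) r)"
  proof -
    have "contS (%x. 2 * (cx i x * G i x) - tg i (G i) x)" for i
      by (intro continuous_intros cG ct)
    from sumr[OF r this] show ?thesis by (simp add: sum_subtractf sum_distrib_left)
  qed
  hence val: "vm (cgrad p) G r - (1 / of_real r) * mom p (%x. 2 * (cdot cx G x) - (\<Sum>i\<in>UNIV. tg i (G i) x)) r
     = (\<Sum>i\<in>UNIV. mom (partial i p) (G i) r - (1 / of_real r) * mom p (%x. 2 * (cx i x * G i x) - tg i (G i) x) r)"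
    by (simp add: vm_def cgrad_def sum_subtractf sum_distrib_left)
  show ?thesis unfolding val
  proof (rule hvd_transform_within_open[of "%t. \<Sum>i\<in>UNIV. mom p (%x. cx i x * G i x) t" _ _ T])
    show "((%t. \<Sum>i\<in>UNIV. mom p (%x. cx i x * G i x) t) hvd
      (\<Sum>i\<in>UNIV. mom (partial i p) (G i) r - (1 / of_real r) * mom p (%x. 2 * (cx i x * G i x) - tg i (G i) x) r)) (at r)"
      by (intro hvd_sum mom_partial[OF sh p G r])
    show "r \<in> T" by fact
    show "open T" using sh by (simp add: shell_def)
    have "contS (%x. cx i x * G i x)" for i by (intro continuous_intros cG)
    from sumr[OF _ this] show "(\<Sum>i\<in>UNIV. mom p (%x. cx i x * G i x) t) = mom p (cdot cx G) t"
      if "t \<in> T" for t using that by simp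
  qed
qed

text \<open>\<open>mU\<close> pairs the test function with the radial component. The minus signs in
  \<open>mD\<close> and \<open>mX\<close> come from integration by parts: on a sphere they are the
  moments of the surface divergence and the surface curl of the tangential part, and
  \<open>mP\<close> is the moment of the full divergence.\<close>

definition mU :: "vfield => real^3 => nat => real => complex" where
  "mU w y d r = vm w (gX y d) r"

definition mD :: "vfield => real^3 => nat => real => complex" where
  "mD w y d r = - vm w (gS y d) r"

definition mX :: "vfield => real^3 => nat => real => complex" where
  "mX w y d r = - vm w (gL y d) r"

definition mP :: "vfield => real^3 => nat => real => complex" where
  "mP w y d r = mom (cdiv w) (ph y d) r"

text \<open>The Laplace-Beltrami operator transported to a sequence F of moments indexed by the
  degree. For d < 2 the coefficient d(d-1) vanishes, so the truncated index d - 2 does no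
  harm.\<close>

definition lc :: "real^3 => nat => (nat => complex) => complex" where
  "lc y d F = of_nat (d * (d - 1)) * of_real ((norm y)\<^sup>2) * F (d - 2) - of_nat (d * (d + 1)) * F d"

lemmas test_cont = C1_on_test[THEN C1_cont]

lemma mom_lap:
  assumes "conts p r"
  shows "mom p (lap y d) r = lc y d (%e. mom p (ph y e) r)"
  unfolding lap_def[abs_def] lc_def mult.assoc[of _ "of_real _"]
  by (subst mom_diff_right[OF assms], (intro continuous_on_mult continuous_on_const test_cont)+)
     (simp only: mom_cmult_right)

lemma vm_xlap:
  assumes "\<And>i. conts (cmp w i) r"
  shows "vm w (%i x. cx i x * lap y d x) r = lc y d (%e. mU w y e r)"
proof -
  have "vm w (%i x. cx i x * lap y d x) r = vm w (%i x. of_nat (d * (d - 1)) * of_real ((norm y)\<^sup>2) * gX y (d - 2) i x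
      - of_nat (d * (d + 1)) * gX y d i x) r"
    by (rule vm_cong) (simp add: lap_def gX_def algebra_simps)
  also have "\<dots> = vm w (%i x. of_nat (d * (d - 1)) * of_real ((norm y)\<^sup>2) * gX y (d - 2) i x) r
      - vm w (%i x. of_nat (d * (d + 1)) * gX y d i x) r"
    by (rule vm_diff[OF assms]) (intro continuous_on_mult continuous_on_const test_cont)+
  finally show ?thesis unfolding vm_cmult lc_def mU_def .
qed

lemma has_vector_derivative_rhs:
  "(f hvd a) F ==> a = b ==> (f hvd b) F"
  by simp

context
  fixes T :: "real set" and S :: "(real^3) set" and w :: "vfield" and y :: "real^3" and d :: nat and r :: real
  assumes sh: "shell T S" and w: "\<And>i. C1_on (cmp w i) S" and r: "r \<in> T"
begin

lemma cw: "conts (cmp w i) r"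
  by (rule conts_C1(1)[OF sh r w])

lemma r0: "complex_of_real r \<noteq> 0"
  using sh r by (auto simp: shell_def)

text \<open>The divergence in spherical coordinates: radial derivative plus 2/r times the radial
  component plus 1/r times the surface divergence, here solved for the radial derivative.\<close>

lemma mU_deriv:
  "(mU w y d hvd mP w y d r - 2 / of_real r * mU w y d r - 1 / of_real r * mD w y d r) (at r)"
proof -
  have eq: "vm w (%i x. 2 * (cx i x * ph y d x) - tg i (ph y d) x) r = 2 * mU w y d r + mD w y d r"
  proof -
    have "vm w (%i x. 2 * (cx i x * ph y d x) - tg i (ph y d) x) r = vm w (%i x. 2 * gX y d i x - gS y d i x) r"
      by (rule vm_cong) (simp add: gX_def tg_ph)
    also have "\<dots> = vm w (%i x. 2 * gX y d i x) r - vm w (gS y d) r"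
      by (rule vm_diff[OF cw]) (intro continuous_on_mult continuous_on_const test_cont)+
    finally show ?thesis unfolding vm_cmult mU_def mD_def by simp
  qed
  have "vm w (%i x. cx i x * ph y d x) = mU w y d"
    by (rule ext) (simp add: mU_def gX_def[abs_def])
  with mom_div[OF sh w C1_on_test(1)[of y d] r] show ?thesis
    unfolding eq mP_def by (simp add: algebra_simps)
qed

text \<open>Obtained by testing the curl with \<open>gL\<close>, because \<open>gL\<close> \<times>
  x is \<open>gS\<close>; the Laplacian term of \<open>tgcurl_gL\<close> produces the radial
  moments.\<close>

lemma mD_deriv:
  "(mD w y d hvd mX (ccurl w) y d r - 1 / of_real r * mD w y d r + 1 / of_real r * lc y d (%e. mU w y e r)) (at r)"
proof -
  have 1: "vm w (crx (gL y d)) t = - mD w y d t" for t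
    unfolding mD_def minus_minus
  proof (rule vm_cong)
    fix i :: 3 and x :: "real^3" assume "norm x = 1"
    from gL_cross_x[OF this, where y = y and d = d] show "crx (gL y d) i x = gS y d i x"
      using exhaust_3[of i] by (auto simp: crx_def mult.commute)
  qed
  have 2: "vm w (%i x. 2 * crx (gL y d) i x + tcurl (gL y d) i x) r = lc y d (%e. mU w y e r) - mD w y d r"
  proof -
    have "vm w (%i x. 2 * crx (gL y d) i x + tcurl (gL y d) i x) r = vm w (%i x. cx i x * lap y d x + gS y d i x) r"
    proof (rule vm_cong)
      fix i :: 3 and x :: "real^3" assume x: "norm x = 1"
      show "2 * crx (gL y d) i x + tcurl (gL y d) i x = cx i x * lap y d x + gS y d i x"
        using exhaust_3[of i] gL_cross_x[OF x, where y = y and d = d] tgcurl_gL[OF x, where y = y and d = d] by (auto simp: crx_def tcurl_def mult.commute)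
    qed
    also have "\<dots> = vm w (%i x. cx i x * lap y d x) r + vm w (gS y d) r"
      by (rule vm_add[OF cw]) (intro continuous_on_mult continuous_on_of_real continuous_on_component continuous_on_id test_cont)+
    finally show ?thesis unfolding vm_xlap[OF cw] mD_def by simp
  qed
  have "((%t. - vm w (crx (gL y d)) t) hvd
    - (vm (ccurl w) (gL y d) r - 1 / of_real r * (lc y d (%e. mU w y e r) - mD w y d r))) (at r)"
    using vm_curl[where G = "gL y d", OF sh w C1_on_test(4) r] unfolding 2 by (rule hvd_minus)
  thus ?thesis unfolding 1 minus_minus by (rule has_vector_derivative_rhs) (simp add: mX_def algebra_simps)
qed

lemma mX_deriv:
  "(mX w y d hvd - mD (ccurl w) y d r - 1 / of_real r * mX w y d r) (at r)"
proof -
  have 1: "vm w (crx (gS y d)) t = mX w y d t" for t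
    unfolding mX_def vm_minus[symmetric]
  proof (rule vm_cong)
    fix i :: 3 and x :: "real^3" assume x: "norm x = 1"
    from gS_cross_x[OF x, where y = y and d = d] show "crx (gS y d) i x = - gL y d i x"
      using exhaust_3[of i] by (auto simp: crx_def mult.commute)
  qed
  have 2: "vm w (%i x. 2 * crx (gS y d) i x + tcurl (gS y d) i x) r = mX w y d r"
    unfolding mX_def vm_minus[symmetric]
  proof (rule vm_cong)
    fix i :: 3 and x :: "real^3" assume x: "norm x = 1"
    have "crx (gS y d) i x = - gL y d i x" "tcurl (gS y d) i x = gL y d i x"
      using exhaust_3[of i] gS_cross_x[OF x, where y = y and d = d] tgcurl_gS[OF x, where y = y and d = d] by (auto simp: crx_def tcurl_def mult.commute)
    thus "2 * crx (gS y d) i x + tcurl (gS y d) i x = - gL y d i x" by simp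
  qed
  have "(vm w (crx (gS y d)) hvd
    (vm (ccurl w) (gS y d) r - 1 / of_real r * mX w y d r)) (at r)"
    using vm_curl[where G = "gS y d", OF sh w C1_on_test(3) r] unfolding 2 .
  thus ?thesis unfolding 1[abs_def] by (simp add: mD_def)
qed

text \<open>\<open>gX\<close> is parallel to x, so its cross product with x vanishes and
  \<open>vm_curl\<close> degenerates to an algebraic relation: the radial component of a curl
  contains no radial derivative.\<close>

lemma mU_curl: "mU (ccurl w) y d r = 1 / of_real r * mX w y d r"
proof -
  have 1: "vm w (crx (gX y d)) = (%t. 0)"
  proof
    fix t
    have "vm w (crx (gX y d)) t = vm w (%i x. 0) t"
    proof (rule vm_cong)
      fix i :: 3 and x :: "real^3"
      show "crx (gX y d) i x = 0" using exhaust_3[of i] by (auto simp: crx_def gX_def)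
    qed
    thus "vm w (crx (gX y d)) t = 0" by (simp add: vm_def)
  qed
  have 2: "vm w (%i x. 2 * crx (gX y d) i x + tcurl (gX y d) i x) r = mX w y d r"
    unfolding mX_def vm_minus[symmetric]
  proof (rule vm_cong)
    fix i :: 3 and x :: "real^3" assume x: "norm x = 1"
    show "2 * crx (gX y d) i x + tcurl (gX y d) i x = - gL y d i x"
      using exhaust_3[of i] tgcurl_gX[OF x, where y = y and d = d] by (auto simp: crx_def tcurl_def gX_def)
  qed
  have "((%t. 0) hvd
    (vm (ccurl w) (gX y d) r - 1 / of_real r * mX w y d r)) (at r)"
    using vm_curl[where G = "gX y d", OF sh w C1_on_test(2) r] unfolding 2 1 .
  hence "vm (ccurl w) (gX y d) r - 1 / of_real r * mX w y d r = 0"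
    by (rule vector_derivative_unique_at[OF _ has_vector_derivative_const])
  thus ?thesis unfolding mU_def by simp
qed

text \<open>The radial test field yields a genuine derivative. For \<open>gS\<close> and
  \<open>gL\<close>, which are tangential, the differentiated moment is identically zero, so the two
  tangential moments of a gradient come out algebraically.\<close>

lemma grad_moments:
  assumes p: "C1_on p S"
  shows "(mom p (ph y d) hvd vm (cgrad p) (gX y d) r) (at r)"
    and "vm (cgrad p) (gS y d) r = - (1 / of_real r * lc y d (%e. mom p (ph y e) r))"
    and "vm (cgrad p) (gL y d) r = 0"
proof -
  have cp: "conts p r" by (rule conts_C1(1)[OF sh r p])
  note g = vm_grad[OF sh p _ r]
  have z: "mom p (cdot cx G) = (%t. 0)" if "\<And>x. norm x = 1 ==> (cdot cx G x) = 0" for G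
  proof
    fix t
    have "mom p (cdot cx G) t = mom p (%x. 0) t" by (rule mom_cong) (simp add: that)
    thus "mom p (cdot cx G) t = 0" by simp
  qed
  have zS: "mom p (cdot cx (gS y d)) = (%t. 0)" by (rule z) (rule x_dot_gS)
  have zL: "mom p (cdot cx (gL y d)) = (%t. 0)" by (rule z) (rule x_dot_gL)
  have sX: "cdot cx (gX y d) x = ph y d x" if "norm x = 1" for x
    using unit3[OF that] unfolding gX_def sum_3 by (simp add: mult.assoc[symmetric] distrib_right[symmetric])
  have m: "mom p (cdot cx (gX y d)) = mom p (ph y d)"
    by (rule ext, rule mom_cong) (rule sX)
  have "mom p (%x. 2 * (cdot cx (gX y d) x) - (\<Sum>i\<in>UNIV. tg i (gX y d i) x)) r = mom p (%x. 0) r"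
    by (rule mom_cong) (simp add: sX div_gX)
  with g[where G = "gX y d", OF C1_on_test(2)] show "(mom p (ph y d) hvd vm (cgrad p) (gX y d) r) (at r)"
    unfolding m by simp
  have "mom p (%x. 2 * (cdot cx (gS y d) x) - (\<Sum>i\<in>UNIV. tg i (gS y d i) x)) r = mom p (%x. - lap y d x) r"
    by (rule mom_cong) (simp add: x_dot_gS div_gS)
  with g[where G = "gS y d", OF C1_on_test(3)] have "((%t. 0) hvd
     vm (cgrad p) (gS y d) r + 1 / of_real r * lc y d (%e. mom p (ph y e) r)) (at r)"
    unfolding zS by (simp add: mom_minus_right mom_lap[OF cp])
  hence "vm (cgrad p) (gS y d) r + 1 / of_real r * lc y d (%e. mom p (ph y e) r) = 0"
    by (rule vector_derivative_unique_at[OF _ has_vector_derivative_const])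
  thus "vm (cgrad p) (gS y d) r = - (1 / of_real r * lc y d (%e. mom p (ph y e) r))"
    by (simp add: eq_neg_iff_add_eq_0)
  have "mom p (%x. 2 * (cdot cx (gL y d) x) - (\<Sum>i\<in>UNIV. tg i (gL y d i) x)) r = mom p (%x. 0) r"
    by (rule mom_cong) (simp add: x_dot_gL div_gL)
  with g[where G = "gL y d", OF C1_on_test(4)] have "((%t. 0) hvd vm (cgrad p) (gL y d) r) (at r)"
    unfolding zL by simp
  thus "vm (cgrad p) (gL y d) r = 0"
    by (rule vector_derivative_unique_at[OF _ has_vector_derivative_const])
qed

end

section \<open>The Navier equation in divergence and curl form\<close>

lemma C1_on_cdiv:
  assumes "open S" "C2_on w S" shows "C1_on (cdiv w) S"
  unfolding cdiv_def[abs_def] using C2_on_partial[OF C2_on_vec_nth[OF assms]] by (intro C1_on_sum)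

lemma ccurl_nth [simp]:
  "ccurl w x $ 1 = partial 2 (cmp w 3) x - partial 3 (cmp w 2) x"
  "ccurl w x $ 2 = partial 3 (cmp w 1) x - partial 1 (cmp w 3) x"
  "ccurl w x $ 3 = partial 1 (cmp w 2) x - partial 2 (cmp w 1) x"
  by (simp_all add: ccurl_def)

lemma C1_on_ccurl:
  assumes "\<And>i. C2_on (cmp w i) S" shows "C1_on (cmp (ccurl w) i) S"
  using exhaust_3[of i] C2_on_partial[OF assms] by (elim disjE) (simp_all add: C1_on_diff)

text \<open>The vector Laplacian is grad div - curl curl, by exchanging mixed derivatives. This
  separates the pressure and shear parts with coefficients \<open>lam + 2 * \<mu>\<close> and
  \<open>\<mu>\<close>.\<close>

lemma lame_nth:
  assumes S: "open S" "C2_on w S" "x \<in> S"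
  shows "lame lam \<mu> w x $ i = of_real (lam + 2 * \<mu>) * partial i (cdiv w) x - of_real \<mu> * ccurl (ccurl w) x $ i"
proof -
  define f where "f i = (cmp w i)" for i
  have f: "C2_on (f i) S" for i unfolding f_def by (rule C2_on_vec_nth[OF S(1,2)])
  have pd: "partial j (f i) differentiable (at x)" for i j
    using C1_onD(1)[OF C2_on_partial[OF f] S(3)] .
  have com: "partial j (partial k (f i)) x = partial k (partial j (f i)) x" for i j k
    by (rule partial_commute[OF S(1,3) f])
  have L: "laplacian w x $ i = (\<Sum>j\<in>UNIV. partial j (partial j (f i)) x)" for i
    unfolding laplacian_def f_def sum_component by (simp add: partial_partial_vec_nth[OF S])
  have D: "partial i (cdiv w) x = (\<Sum>j\<in>UNIV. partial i (partial j (f j)) x)" for i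
    unfolding cdiv_def[abs_def] f_def[symmetric] by (rule partial_sum) (rule pd)
  have c: "(cmp (ccurl w) 1) = (%y. partial 2 (f 3) y - partial 3 (f 2) y)"
    "(cmp (ccurl w) 2) = (%y. partial 3 (f 1) y - partial 1 (f 3) y)"
    "(cmp (ccurl w) 3) = (%y. partial 1 (f 2) y - partial 2 (f 1) y)"
    by (simp_all add: f_def)
  have C: "ccurl (ccurl w) x $ i = partial i (cdiv w) x - laplacian w x $ i"
    using exhaust_3[of i]
  proof (elim disjE)
    assume i: "i = 1"
    show ?thesis
      unfolding L D sum_3 i ccurl_nth(1)[of "ccurl w"] c partial_diff[OF pd pd] com[of 1 2] com[of 1 3] com[of 2 3] by simp
  next
    assume i: "i = 2"
    show ?thesis
      unfolding L D sum_3 i ccurl_nth(2)[of "ccurl w"] c partial_diff[OF pd pd] com[of 1 2] com[of 1 3] com[of 2 3] by simp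
  next
    assume i: "i = 3"
    show ?thesis
      unfolding L D sum_3 i ccurl_nth(3)[of "ccurl w"] c partial_diff[OF pd pd] com[of 1 2] com[of 1 3] com[of 2 3] by simp
  qed
  show ?thesis
    unfolding lame_def C by (simp add: cgrad_def) (simp add: scaleR_conv_of_real algebra_simps)
qed

lemma vm_lame:
  fixes a m k :: complex
  assumes sh: "shell T S" and w: "C2_on w S" and G: "\<And>i. contS (G i)" and r: "r \<in> T"
    and eq: "\<And>x i. x \<in> S ==> a * partial i (cdiv w) x - m * ccurl (ccurl w) x $ i + k * w x $ i = 0"
  shows "a * vm (cgrad (cdiv w)) G r - m * vm (ccurl (ccurl w)) G r + k * vm w G r = 0"
proof -
  have S: "open S" "\<And>x. norm x = 1 ==> r *\<^sub>R x \<in> S" using sh r by (auto simp: shell_def)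
  have c1: "conts (partial i (cdiv w)) r" for i by (rule conts_C1(2)[OF sh r C1_on_cdiv[OF S(1) w]])
  have c3: "conts (cmp w i) r" for i
    by (rule conts_C1(1)[OF sh r C2_on_C1[OF C2_on_vec_nth[OF S(1) w]]])
  have C1c: "C1_on (cmp (ccurl w) i) S" for i by (rule C1_on_ccurl[OF C2_on_vec_nth[OF S(1) w]])
  have c2: "conts (cmp (ccurl (ccurl w)) i) r" for i
    using exhaust_3[of i]
  proof (elim disjE)
    assume i: "i = 1"
    show ?thesis unfolding i conts_def ccurl_nth(1)[of "ccurl w"]
      by (intro continuous_on_diff conts_C1(2)[OF sh r C1c, unfolded conts_def])
  next
    assume i: "i = 2"
    show ?thesis unfolding i conts_def ccurl_nth(2)[of "ccurl w"]
      by (intro continuous_on_diff conts_C1(2)[OF sh r C1c, unfolded conts_def])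
  next
    assume i: "i = 3"
    show ?thesis unfolding i conts_def ccurl_nth(3)[of "ccurl w"]
      by (intro continuous_on_diff conts_C1(2)[OF sh r C1c, unfolded conts_def])
  qed
  have cm: "conts (%x. c * f x) r" if "conts f r" for c f
    using that unfolding conts_def by (intro continuous_on_mult continuous_on_const)
  have cd: "conts (%x. f x - g x) r" if "conts f r" "conts g r" for f g
    using that unfolding conts_def by (intro continuous_on_diff)
  have "a * mom (partial i (cdiv w)) (G i) r - m * mom (cmp (ccurl (ccurl w)) i) (G i) r + k * mom (cmp w i) (G i) r = 0" for i
  proof -
    have "a * mom (partial i (cdiv w)) (G i) r - m * mom (cmp (ccurl (ccurl w)) i) (G i) r + k * mom (cmp w i) (G i) r
      = mom (%x. a * partial i (cdiv w) x - m * ccurl (ccurl w) x $ i + k * w x $ i) (G i) r"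
      by (subst mom_add_left[OF cd[OF cm[OF c1] cm[OF c2]] cm[OF c3] G], subst mom_diff_left[OF cm[OF c1] cm[OF c2] G])
         (simp only: mom_cmult_left)
    also have "\<dots> = mom (%x. 0) (G i) r" by (rule mom_cong_left) (simp add: eq S)
    finally show ?thesis by (simp add: mom_def)
  qed
  hence "(\<Sum>i\<in>UNIV. a * mom (partial i (cdiv w)) (G i) r - m * mom (cmp (ccurl (ccurl w)) i) (G i) r + k * mom (cmp w i) (G i) r) = 0"
    by simp
  thus ?thesis
    by (simp add: vm_def cgrad_def sum.distrib sum_subtractf sum_distrib_left)
qed

text \<open>The equation tested with the three families. The gradient of the divergence contributes
  a derivative only against \<open>gX\<close>; against \<open>gS\<close> and \<open>gL\<close> the
  equation just expresses second-curl moments by lower ones.\<close>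

lemma lame_moments:
  fixes a m k :: complex
  assumes sh: "shell T S" and w: "C2_on w S" and r: "r \<in> T" and a: "a \<noteq> 0"
    and eq: "\<And>x i. x \<in> S ==> a * partial i (cdiv w) x - m * ccurl (ccurl w) x $ i + k * w x $ i = 0"
  shows "(mP w y d hvd (m / of_real r * mX (ccurl w) y d r - k * mU w y d r) / a) (at r)"
    and "m * mD (ccurl (ccurl w)) y d r = a / of_real r * lc y d (%e. mP w y e r) + k * mD w y d r"
    and "m * mX (ccurl (ccurl w)) y d r = k * mX w y d r"
proof -
  have S: "open S" using sh by (auto simp: shell_def)
  have C1w: "C1_on (cmp w i) S" for i by (rule C2_on_C1[OF C2_on_vec_nth[OF S(1) w]])
  have C1c: "C1_on (cmp (ccurl w) i) S" for i by (rule C1_on_ccurl[OF C2_on_vec_nth[OF S(1) w]])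
  note gm = grad_moments[OF sh C1w r C1_on_cdiv[OF S w], of y d]
  note L = vm_lame[OF sh w _ r eq]
  have "a * vm (cgrad (cdiv w)) (gX y d) r - m * vm (ccurl (ccurl w)) (gX y d) r + k * vm w (gX y d) r = 0"
    by (rule L[OF test_cont(2)])
  hence "vm (cgrad (cdiv w)) (gX y d) r = (m / of_real r * mX (ccurl w) y d r - k * mU w y d r) / a"
    using mU_curl[OF sh C1c r, of y d] a unfolding mU_def by (simp add: field_simps)
  with gm(1) show "(mP w y d hvd (m / of_real r * mX (ccurl w) y d r - k * mU w y d r) / a) (at r)"
    by (simp add: mP_def[abs_def])
  have "a * vm (cgrad (cdiv w)) (gS y d) r - m * vm (ccurl (ccurl w)) (gS y d) r + k * vm w (gS y d) r = 0"
    by (rule L[OF test_cont(3)])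
  thus "m * mD (ccurl (ccurl w)) y d r = a / of_real r * lc y d (%e. mP w y e r) + k * mD w y d r"
    unfolding gm(2) mD_def mP_def by (simp add: algebra_simps)
  have "a * vm (cgrad (cdiv w)) (gL y d) r - m * vm (ccurl (ccurl w)) (gL y d) r + k * vm w (gL y d) r = 0"
    by (rule L[OF test_cont(4)])
  thus "m * mX (ccurl (ccurl w)) y d r = k * mX w y d r"
    unfolding gm(3) mX_def by (simp add: algebra_simps)
qed

section \<open>Radial equations and the energy flux\<close>

lemma has_real_derivative_norm_sq:
  fixes f :: "real => complex"
  assumes "(f hvd f') (at r)"
  shows "((%r. (cmod (f r))\<^sup>2) has_real_derivative 2 * Re (cnj (f r) * f')) (at r)"
proof -
  have "((%r. cnj (f r) * f r) hvd (cnj (f r) * f' + cnj f' * f r)) (at r)"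
    using assms by (intro hvd_mult hvd_cnj)
  hence "((%r. Re (cnj (f r) * f r)) hvd Re (cnj (f r) * f' + cnj f' * f r)) (at r)"
    by (rule bounded_linear.has_vector_derivative[OF bounded_linear_Re])
  moreover have "Re (cnj (f r) * f r) = (cmod (f r))\<^sup>2" for r
    unfolding cmod_power2 by (simp add: power2_eq_square)
  ultimately show ?thesis
    by (simp add: has_real_derivative_iff_has_vector_derivative algebra_simps)
qed

lemma const_of_zero_derivative:
  fixes f :: "real => real"
  assumes "convex T" "\<And>r. r \<in> T ==> (f has_real_derivative 0) (at r)"
  shows "\<exists>c. \<forall>r\<in>T. f r = c"
  by (rule has_field_derivative_zero_constant[OF assms(1)])
     (rule has_field_derivative_at_within, rule assms(2))

text \<open>The common end of the Gronwall arguments below: an energy times an integrating factor is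
  nondecreasing and tends to 0 at the far end, hence is nonpositive before.\<close>

lemma mono_limit_nonpos:
  fixes h :: "real => real"
  assumes d: "\<And>r. r \<in> T ==> (h has_real_derivative h' r) (at r)" "\<And>r. r \<in> T ==> h' r \<ge> 0"
    and T: "convex T" and lim: "(h ---> 0) F" "F \<noteq> bot" "\<forall>\<^sub>F s in F. s \<in> T \<and> r \<le> s" and r: "r \<in> T"
  shows "h r \<le> 0"
proof (rule tendsto_lowerbound[OF lim(1) _ lim(2)])
  have "h r \<le> h s" if "s \<in> T" "r \<le> s" for s
  proof (rule DERIV_nonneg_imp_nondecreasing[OF that(2)])
    fix t assume "r \<le> t" "t \<le> s"
    hence "t \<in> T" using T r that(1) mem_is_interval_1_I[of T r s t] by (simp add: is_interval_convex_1)
    from d[OF this] show "\<exists>y. (h has_real_derivative y) (at t) \<and> 0 \<le> y" by (intro exI conjI)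
  qed
  thus "\<forall>\<^sub>F s in F. h r \<le> h s" by (intro eventually_mono[OF lim(3)]) simp
qed

text \<open>Uniqueness for a linear system with zero data at the right endpoint. The data are limits
  because the equations hold in the open interval only. The squared norm satisfies E' \<ge> -K E, so
  E exp(K r) is nondecreasing with limit 0.\<close>

lemma linear_system_zero:
  fixes f g :: "nat => real => complex"
  assumes d: "\<And>i r. i < N ==> r \<in> {a<..<b} ==> (f i hvd g i r) (at r)"
    and g: "\<And>i r. i < N ==> r \<in> {a<..<b} ==> cmod (g i r) \<le> M * (\<Sum>j<N. cmod (f j r))"
    and lim: "\<And>i. i < N ==> (f i ---> 0) (at_left b)"
    and r: "r \<in> {a<..<b}" and i: "i < N"
  shows "f i r = 0"
proof -
  define E where "E r = (\<Sum>i<N. (cmod (f i r))\<^sup>2)" for r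
  define E' where "E' r = (\<Sum>i<N. 2 * Re (cnj (f i r) * g i r))" for r
  \<comment> \<open>By Cauchy-Schwarz the square of the sum of N moduli is at most N times E, which
    explains the factor N.\<close>
  define K where "K = 2 * \<bar>M\<bar> * real N"
  have dE: "(E has_real_derivative E' r) (at r)" if "r \<in> {a<..<b}" for r
    unfolding E_def[abs_def] E'_def using that by (intro DERIV_sum has_real_derivative_norm_sq d) auto
  have bE: "- K * E r \<le> E' r" if r: "r \<in> {a<..<b}" for r
  proof -
    let ?s = "\<Sum>j<N. cmod (f j r)"
    have "- (2 * \<bar>M\<bar> * ?s * cmod (f i r)) \<le> 2 * Re (cnj (f i r) * g i r)" if "i < N" for i
    proof -
      have "cmod (g i r) \<le> \<bar>M\<bar> * ?s"
        by (rule order_trans[OF g[OF that r]]) (intro mult_right_mono sum_nonneg; simp)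
      hence "cmod (f i r) * cmod (g i r) \<le> cmod (f i r) * (\<bar>M\<bar> * ?s)" by (rule mult_left_mono) simp
      moreover have "\<bar>Re (cnj (f i r) * g i r)\<bar> \<le> cmod (f i r) * cmod (g i r)"
        using abs_Re_le_cmod[of "cnj (f i r) * g i r"] by (simp add: norm_mult)
      ultimately show ?thesis by (simp add: mult_ac)
    qed
    hence "(\<Sum>i<N. - (2 * \<bar>M\<bar> * ?s * cmod (f i r))) \<le> E' r" unfolding E'_def by (intro sum_mono) simp
    hence "- (2 * \<bar>M\<bar> * ?s\<^sup>2) \<le> E' r"
      by (simp only: sum_negf sum_distrib_left[symmetric] power2_eq_square mult.assoc)
    moreover have "2 * \<bar>M\<bar> * ?s\<^sup>2 \<le> 2 * \<bar>M\<bar> * (E r * real N)"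
      using sum_squared_le_sum_of_squares[of "%j. cmod (f j r)" "{..<N}"] unfolding E_def by (intro mult_left_mono) simp_all
    ultimately show ?thesis unfolding K_def by (simp add: mult_ac)
  qed
  have "E r * exp (K * r) \<le> 0"
  proof (rule mono_limit_nonpos[where h = "%r. E r * exp (K * r)" and T = "{a<..<b}" and F = "at_left b" and h' = "%r. (E' r + K * E r) * exp (K * r)"])
    show "((%r. E r * exp (K * r)) has_real_derivative (E' r + K * E r) * exp (K * r)) (at r)" if "r \<in> {a<..<b}" for r
      by (auto intro!: derivative_eq_intros dE that simp: algebra_simps)
    show "0 \<le> (E' r + K * E r) * exp (K * r)" if "r \<in> {a<..<b}" for r
      using bE[OF that] by simp
    have "((%r. E r * exp (K * r)) ---> (\<Sum>i<N. (cmod 0)\<^sup>2) * exp (K * b)) (at_left b)"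
      unfolding E_def by (intro tendsto_intros lim) auto
    thus "((%r. E r * exp (K * r)) ---> 0) (at_left b)" by simp
    show "\<forall>\<^sub>F s in at_left b. s \<in> {a<..<b} \<and> r \<le> s"
      unfolding eventually_at_left[of a b, OF less_trans[of a r b]] using r
      by (subst eventually_at_left[of r]) (auto intro!: exI[of _ r])
  qed (use r in auto)
  hence "E r \<le> 0" by (simp add: mult_le_0_iff)
  moreover have "(cmod (f i r))\<^sup>2 \<le> E r"
    unfolding E_def by (rule member_le_sum) (use i in auto)
  ultimately have "(cmod (f i r))\<^sup>2 \<le> 0" by linarith
  thus ?thesis by simp
qed

lemma limit_const:
  fixes F :: "'a => 'b::t2_space"
  shows "(F ---> f) G ==> \<forall>\<^sub>F r in G. F r = c ==> G \<noteq> bot ==> f = c"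
  using tendsto_unique[OF _ _ tendsto_eventually] by blast

lemma unit_limits:
  fixes F :: "real => 'a::t2_space"
  shows "(F ---> f) (at_left 1) ==> (\<And>r. 0 < r ==> r < 1 ==> F r = c) ==> f = c"
    "(F ---> f) (at_right 1) ==> (\<And>r. 1 < r ==> F r = c) ==> f = c"
    "(F ---> f) (at_right 0) ==> (\<And>r. 0 < r ==> r < 1 ==> F r = c) ==> f = c"
  by (erule limit_const, (rule eventually_at_leftI[of 0] eventually_at_rightI[of 1 2] eventually_at_rightI[of 0 1]; simp), simp)+

text \<open>The coefficient q is real, so the second-order term and the squared derivative
  contribute real quantities to the derivative of the conjugate product.\<close>

lemma wronskian_const:
  fixes P P' :: "real => complex"
  assumes "convex T" and d: "\<And>r. r \<in> T ==> (P hvd P' r) (at r)"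
      "\<And>r. r \<in> T ==> (P' hvd of_real (q r) * P r) (at r)"
  shows "\<exists>c. \<forall>r\<in>T. Im (cnj (P r) * P' r) = c"
proof (rule const_of_zero_derivative[OF assms(1)])
  fix r assume r: "r \<in> T"
  have "((%r. Im (cnj (P r) * P' r)) hvd
      Im (cnj (P r) * (of_real (q r) * P r) + cnj (P' r) * P' r)) (at r)"
    by (intro bounded_linear.has_vector_derivative[OF bounded_linear_Im] hvd_mult
        hvd_cnj d r)
  moreover have "Im (cnj (P r) * (of_real (q r) * P r) + cnj (P' r) * P' r) = 0"
    by (simp add: algebra_simps)
  ultimately show "((%r. Im (cnj (P r) * P' r)) has_real_derivative 0) (at r)"
    by (simp add: has_real_derivative_iff_has_vector_derivative)
qed

text \<open>In E' the wave number terms cancel and the centrifugal term l / r^2 is left. As 1 / r^2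
  is integrable at infinity, E varies at most by factors exp(c/r) with c = l / k; the two
  inequalities serve decay and boundedness.\<close>

lemma radial_energy:
  fixes P P' :: "real => complex" and k l r :: real
  defines "E \<equiv> %r. (cmod (P' r))\<^sup>2 + k\<^sup>2 * (cmod (P r))\<^sup>2" and "E' \<equiv> 2 * (l / r\<^sup>2) * Re (cnj (P' r) * P r)"
  assumes k: "k > 0" and l: "l \<ge> 0"
    and d: "(P hvd P' r) (at r)" "(P' hvd of_real (l / r\<^sup>2 - k\<^sup>2) * P r) (at r)"
  shows "(E has_real_derivative E') (at r)" "- (l / k / r\<^sup>2) * E r \<le> E'" "E' \<le> l / k / r\<^sup>2 * E r"
proof -
  have "2 * Re (cnj (P' r) * (of_real (l / r\<^sup>2 - k\<^sup>2) * P r)) + k\<^sup>2 * (2 * Re (cnj (P r) * P' r)) = E'"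
    unfolding E'_def by (simp add: algebra_simps add_divide_distrib)
  moreover have "(E has_real_derivative 2 * Re (cnj (P' r) * (of_real (l / r\<^sup>2 - k\<^sup>2) * P r)) + k\<^sup>2 * (2 * Re (cnj (P r) * P' r))) (at r)"
    unfolding E_def by (intro DERIV_add DERIV_cmult has_real_derivative_norm_sq d)
  ultimately show "(E has_real_derivative E') (at r)" by simp
  have "\<bar>Re (cnj (P' r) * P r)\<bar> \<le> cmod (P' r) * cmod (P r)"
    using abs_Re_le_cmod[of "cnj (P' r) * P r"] by (simp add: norm_mult)
  moreover have "2 * k * (cmod (P' r) * cmod (P r)) \<le> E r"
    using zero_le_power2[of "cmod (P' r) - k * cmod (P r)"]
    unfolding E_def by (simp add: power2_eq_square algebra_simps)
  ultimately have "2 * k * \<bar>Re (cnj (P' r) * P r)\<bar> \<le> E r"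
    using k by (smt (verit) mult_left_mono)
  hence "l / (k * r\<^sup>2) * (2 * k * \<bar>Re (cnj (P' r) * P r)\<bar>) \<le> l / (k * r\<^sup>2) * E r"
    using k l by (intro mult_left_mono) auto
  moreover have "l / (k * r\<^sup>2) * (2 * k * x) = 2 * (l / r\<^sup>2) * x" "l / (k * r\<^sup>2) = l / k / r\<^sup>2" for x
    using k by simp_all
  moreover have "\<bar>E'\<bar> = 2 * (l / r\<^sup>2) * \<bar>Re (cnj (P' r) * P r)\<bar>" using l by (simp add: E'_def abs_mult)
  ultimately have "\<bar>E'\<bar> \<le> l / k / r\<^sup>2 * E r" by (simp only:)
  thus "- (l / k / r\<^sup>2) * E r \<le> E'" "E' \<le> l / k / r\<^sup>2 * E r" unfolding mult_minus_left by linarith+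
qed

text \<open>The Wronskian of a solution with its conjugate is constant, the radiation condition makes it
  nonnegative, and if it vanishes the energy \<open>|P'|\<^sup>2 + k\<^sup>2 |P|\<^sup>2\<close>, which decays no faster than
  \<open>exp (c / r)\<close>, tends to zero.\<close>

lemma radial_radiating:
  fixes P P' :: "real => complex" and k l :: real
  assumes k: "k > 0" and l: "l \<ge> 0"
    and d: "\<And>r. r > 1 ==> (P hvd P' r) (at r)"
      "\<And>r. r > 1 ==> (P' hvd of_real (l / r\<^sup>2 - k\<^sup>2) * P r) (at r)"
    and rad: "((%r. P' r - \<i> * of_real k * P r) ---> 0) at_top"
  shows "\<exists>W\<ge>0. (\<forall>r>1. Im (cnj (P r) * P' r) = W) \<and> (W = 0 \<longrightarrow> (\<forall>r>1. P r = 0))"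
proof -
  obtain W where "\<forall>r\<in>{1<..}. Im (cnj (P r) * P' r) = W"
    using wronskian_const[of "{1<..}" P P' "%r. l / r\<^sup>2 - k\<^sup>2"] d by auto
  hence W: "Im (cnj (P r) * P' r) = W" if "r > 1" for r using that by blast
  define E where "E r = (cmod (P' r))\<^sup>2 + k\<^sup>2 * (cmod (P r))\<^sup>2" for r
  \<comment> \<open>The cross term of the expanded square is 2 k times the constant Wronskian. Hence
    E tends to 2 k W, and E \<ge> 0 gives W \<ge> 0.\<close>
  have E: "E r = (cmod (P' r - \<i> * of_real k * P r))\<^sup>2 + 2 * k * W" if "r > 1" for r
    unfolding E_def W[OF that, symmetric] cmod_power2 by (simp add: power2_eq_square algebra_simps)
  have limE: "(E ---> 2 * k * W) at_top"
  proof -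
    have "((%r. (cmod (P' r - \<i> * of_real k * P r))\<^sup>2 + 2 * k * W) ---> (cmod 0)\<^sup>2 + 2 * k * W) at_top"
      by (intro tendsto_intros rad)
    hence "((%r. (cmod (P' r - \<i> * of_real k * P r))\<^sup>2 + 2 * k * W) ---> 2 * k * W) at_top" by simp
    moreover have "\<forall>\<^sub>F r in at_top. (cmod (P' r - \<i> * of_real k * P r))\<^sup>2 + 2 * k * W = E r"
      using eventually_gt_at_top[of 1] by (rule eventually_mono) (simp add: E)
    ultimately show ?thesis by (rule Lim_transform_eventually)
  qed
  have "0 \<le> 2 * k * W"
    by (rule tendsto_lowerbound[OF limE]) (auto simp: E_def)
  hence W0: "W \<ge> 0" using k by (simp add: zero_le_mult_iff)
  have "P r = 0" if "W = 0" and r: "r > 1" for r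
  proof -
    define E' where "E' r = 2 * (l / r\<^sup>2) * Re (cnj (P' r) * P r)" for r
    define c where "c = l / k"
    have dE: "(E has_real_derivative E' r) (at r)" and bE: "- (c / r\<^sup>2) * E r \<le> E' r" if "r > 1" for r
      using radial_energy(1,2)[OF k l d[OF that]] unfolding E_def[abs_def] E'_def c_def by simp_all
    have "E r * exp (- c / r) \<le> 0"
    proof (rule mono_limit_nonpos[where h = "%r. E r * exp (- c / r)" and T = "{1<..}" and F = at_top
          and h' = "%r. (E' r + c / r\<^sup>2 * E r) * exp (- c / r)"])
      show "((%r. E r * exp (- c / r)) has_real_derivative (E' r + c / r\<^sup>2 * E r) * exp (- c / r)) (at r)" if "r \<in> {1<..}" for r
        using that by (auto intro!: derivative_eq_intros dE simp: algebra_simps power2_eq_square)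
      show "0 \<le> (E' r + c / r\<^sup>2 * E r) * exp (- c / r)" if "r \<in> {1<..}" for r
        using bE[of r] that by simp
      have "((%r. - c / r) ---> 0) at_top"
        by (rule tendsto_divide_0[OF tendsto_const]) (simp add: filterlim_at_top_imp_at_infinity filterlim_ident)
      hence "((%r. E r * exp (- c / r)) ---> (2 * k * W) * exp 0) at_top"
        by (intro tendsto_intros limE)
      thus "((%r. E r * exp (- c / r)) ---> 0) at_top" using \<open>W = 0\<close> by simp
      show "\<forall>\<^sub>F s in at_top. s \<in> {1<..} \<and> r \<le> s"
        using eventually_ge_at_top[of r] by eventually_elim (use r in auto)
    qed (use r in auto)
    hence "E r \<le> 0" by (simp add: mult_le_0_iff)
    hence "k\<^sup>2 * (cmod (P r))\<^sup>2 \<le> 0" unfolding E_def by (smt (verit) zero_le_power2)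
    thus "P r = 0" using k by (simp add: mult_le_0_iff)
  qed
  with W W0 show ?thesis by (intro exI[of _ W]) simp
qed

text \<open>The opposite energy estimate: E exp(c/r) is nonincreasing, so P is bounded. In the
  application P is r times the divergence moment, and the statement disposes of the lower-order term
  by which (r p)' differs from r p'.\<close>

lemma radial_bounded:
  fixes P P' :: "real => complex" and k l :: real
  assumes k: "k > 0" and l: "l \<ge> 0"
    and d: "\<And>r. r > 1 ==> (P hvd P' r) (at r)"
      "\<And>r. r > 1 ==> (P' hvd of_real (l / r\<^sup>2 - k\<^sup>2) * P r) (at r)"
  shows "((%r. P r / of_real r) ---> 0) at_top"
proof -
  define E where "E r = (cmod (P' r))\<^sup>2 + k\<^sup>2 * (cmod (P r))\<^sup>2" for r
  define E' where "E' r = 2 * (l / r\<^sup>2) * Re (cnj (P' r) * P r)" for r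
  define c where "c = l / k"
  have dE: "(E has_real_derivative E' r) (at r)" and bE: "E' r \<le> (c / r\<^sup>2) * E r" if "r > 1" for r
    using radial_energy(1,3)[OF k l d[OF that]] unfolding E_def[abs_def] E'_def c_def by simp_all
  have c: "c \<ge> 0" using k l by (simp add: c_def)
  have mono: "E r * exp (c / r) \<le> E 2 * exp (c / 2)" if r: "r \<ge> 2" for r
  proof (rule DERIV_nonpos_imp_nonincreasing[OF r, where f = "%r. E r * exp (c / r)"])
    fix t :: real assume "2 \<le> t" "t \<le> r"
    hence t: "t > 1" by simp
    have "((%r. E r * exp (c / r)) has_real_derivative (E' t - c / t\<^sup>2 * E t) * exp (c / t)) (at t)"
      using t by (auto intro!: derivative_eq_intros dE simp: algebra_simps power2_eq_square)
    moreover have "(E' t - c / t\<^sup>2 * E t) * exp (c / t) \<le> 0"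
      using bE[OF t] by (simp add: mult_le_0_iff)
    ultimately show "\<exists>y. ((%r. E r * exp (c / r)) has_real_derivative y) (at t) \<and> y \<le> 0" by blast
  qed
  define B where "B = sqrt (E 2 * exp (c / 2)) / k"
  have PB: "cmod (P r) \<le> B" if r: "r \<ge> 2" for r
  proof -
    have "E r \<ge> 0" by (simp add: E_def)
    hence "E r * 1 \<le> E r * exp (c / r)" using c r by (intro mult_left_mono) auto
    hence "(k * cmod (P r))\<^sup>2 \<le> E 2 * exp (c / 2)"
      using mono[OF r] unfolding E_def by (simp add: power_mult_distrib) (smt (verit) zero_le_power2)
    hence "k * cmod (P r) \<le> sqrt (E 2 * exp (c / 2))" by (rule real_le_rsqrt)
    thus ?thesis using k by (simp add: B_def pos_le_divide_eq mult.commute)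
  qed
  show ?thesis
  proof (rule Lim_null_comparison)
    show "\<forall>\<^sub>F r in at_top. norm (P r / of_real r) \<le> B / r"
      using eventually_ge_at_top[of 2]
      by eventually_elim (use PB in \<open>auto simp: norm_divide intro!: divide_right_mono\<close>)
    show "((%r. B / r) ---> 0) at_top"
      by (rule tendsto_divide_0[OF tendsto_const]) (simp add: filterlim_at_top_imp_at_infinity filterlim_ident)
  qed
qed

section \<open>Uniqueness for the spheroidal radial system\<close>

lemma complex_mult_cnj_norm: "z * cnj z = (complex_of_real (cmod z))\<^sup>2"
  using complex_norm_square[of z] by simp

lemma spheroidal_flux_algebra:
  fixes r U D P S Uc Dc Pc Sc :: complex
  assumes "r \<noteq> 0" "a \<noteq> 0" "m \<noteq> 0"
  shows "r\<^sup>2 * (\<alpha> * a * (P * (Pc - 2 / r * Uc - 1 / r * Dc) + (m / r * S - k * U) / a * Uc)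
       + \<beta> * m * (S * (Sc - 1 / r * Dc - l / r * Uc) + ((a * l / r * P - k * D) / m - 1 / r * S) * Dc))
     + (2 * r) * (\<alpha> * a * (P * Uc) + \<beta> * m * (S * Dc))
   = r\<^sup>2 * (\<alpha> * a * (P * Pc) - \<alpha> * k * (U * Uc) + \<beta> * m * (S * Sc) - \<beta> * k * (D * Dc))
     + (\<alpha> - \<beta> * l) * r * (m * (S * Uc) - a * (P * Dc))"
  using assms by (simp add: field_simps power2_eq_square)

text \<open>The surface pairing of the field, mode by mode, with the natural boundary terms of a
  grad div - m curl curl. Since D is a surface divergence, a tangential mode with eigenvalue l
  carries energy |D|^2 / l; this is the origin of the weights \<alpha> = \<beta> l used
  below.\<close>

definition flux :: "real => real => real => real => (real => complex) => (real => complex) => (real => complex) => (real => complex) => real => complex" where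
  "flux \<alpha> \<beta> a m U D P S r = (of_real r)\<^sup>2 * (of_real \<alpha> * of_real a * (P r * cnj (U r)) + of_real \<beta> * of_real m * (S r * cnj (D r)))"

text \<open>The closed first-order system of one degree, with U the radial, D the tangential, P the
  divergence and S the curl moment. In use a = \<open>lam + 2 * \<mu>\<close>, m =
  \<open>\<mu>\<close>, l = d(d+1), and k = \<omega>^2 \<rho>, which is not a wave number.\<close>

definition spheroidal :: "real set => real => real => real => real => (real => complex) => (real => complex) => (real => complex) => (real => complex) => bool" where
  "spheroidal T a m k l U D P S \<longleftrightarrow> (\<forall>r\<in>T.
     (U hvd (P r - 2 / of_real r * U r - 1 / of_real r * D r)) (at r) \<and>
     (D hvd (S r - 1 / of_real r * D r - of_real l / of_real r * U r)) (at r) \<and>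
     (P hvd ((of_real m / of_real r * S r - of_real k * U r) / of_real a)) (at r) \<and>
     (S hvd ((of_real a * of_real l / of_real r * P r - of_real k * D r) / of_real m - 1 / of_real r * S r)) (at r))"

lemma spheroidalD:
  assumes "spheroidal T a m k l U D P S" "r \<in> T"
  shows "(U hvd (P r - 2 / of_real r * U r - 1 / of_real r * D r)) (at r)"
    "(D hvd (S r - 1 / of_real r * D r - of_real l / of_real r * U r)) (at r)"
    "(P hvd ((of_real m / of_real r * S r - of_real k * U r) / of_real a)) (at r)"
    "(S hvd ((of_real a * of_real l / of_real r * P r - of_real k * D r) / of_real m - 1 / of_real r * S r)) (at r)"
  using assms by (auto simp: spheroidal_def)

text \<open>The derivative of the flux is real apart from a term with the factor \<alpha> - \<beta>
  l. The second alternative in \<open>w\<close> covers l = 0, where there is no tangential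
  part.\<close>

lemma flux_const:
  assumes sp: "spheroidal T a m k l U D P S" and T: "convex T" "T \<subseteq> {0<..}" and pos: "a > 0" "m > 0"
    and w: "\<alpha> = \<beta> * l \<or> (\<forall>r\<in>T. S r = 0 \<and> D r = 0)"
  shows "\<exists>c. \<forall>r\<in>T. Im (flux \<alpha> \<beta> a m U D P S r) = c"
proof (rule const_of_zero_derivative[OF T(1)])
  fix r assume r: "r \<in> T"
  hence r0: "complex_of_real r \<noteq> 0" using T by auto
  let ?U' = "P r - 2 / of_real r * U r - 1 / of_real r * D r"
  let ?D' = "S r - 1 / of_real r * D r - of_real l / of_real r * U r"
  let ?P' = "(of_real m / of_real r * S r - of_real k * U r) / of_real a"
  let ?S' = "(of_real a * of_real l / of_real r * P r - of_real k * D r) / of_real m - 1 / of_real r * S r"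
  let ?lhs = "(of_real r)\<^sup>2 * (of_real \<alpha> * of_real a * (P r * cnj ?U' + ?P' * cnj (U r))
         + of_real \<beta> * of_real m * (S r * cnj ?D' + ?S' * cnj (D r)))
       + 2 * of_real r * (of_real \<alpha> * of_real a * (P r * cnj (U r)) + of_real \<beta> * of_real m * (S r * cnj (D r)))"
  note d = spheroidalD[OF sp r]
  have dr: "((%r. (complex_of_real r)\<^sup>2) hvd 2 * of_real r) (at r)"
  proof -
    have "((%r. r\<^sup>2) has_real_derivative 2 * r) (at r)" by (auto intro!: derivative_eq_intros)
    from has_vector_derivative_of_real[OF this, where 'a = complex] show ?thesis by simp
  qed
  have "(flux \<alpha> \<beta> a m U D P S hvd
      (?lhs)) (at r)"
    unfolding flux_def[abs_def]
    by (intro hvd_mult[OF dr] hvd_add hvd_mult_right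
        hvd_mult[OF d(3)] hvd_mult[OF d(4)] hvd_cnj d)
  hence A: "((%r. Im (flux \<alpha> \<beta> a m U D P S r)) hvd
      Im (?lhs)) (at r)"
    by (rule bounded_linear.has_vector_derivative[OF bounded_linear_Im])
  have B: "?lhs
     = of_real (r\<^sup>2 * (\<alpha> * a * (cmod (P r))\<^sup>2 - \<alpha> * k * (cmod (U r))\<^sup>2 + \<beta> * m * (cmod (S r))\<^sup>2 - \<beta> * k * (cmod (D r))\<^sup>2))
       + (of_real \<alpha> - of_real \<beta> * of_real l) * of_real r * (of_real m * (S r * cnj (U r)) - of_real a * (P r * cnj (D r)))"
    (is "_ = of_real ?R + ?Z")
    using spheroidal_flux_algebra[of "of_real r" "of_real a" "of_real m" "of_real \<alpha>" "P r" "cnj (P r)" "cnj (U r)" "cnj (D r)" "S r" "of_real k" "U r" "of_real \<beta>" "cnj (S r)" "of_real l" "D r"] r0 pos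
    by (simp add: complex_mult_cnj_norm)
  have C: "?Z = 0"
  proof -
    have "complex_of_real \<alpha> - of_real \<beta> * of_real l = 0 \<or> S r = 0 \<and> D r = 0"
      using w r by (auto simp flip: of_real_mult)
    thus ?thesis by auto
  qed
  have "Im ?lhs = 0" unfolding B C add_0_right Im_complex_of_real ..
  thus "((%r. Im (flux \<alpha> \<beta> a m U D P S r)) has_real_derivative 0) (at r)"
    using A unfolding has_real_derivative_iff_has_vector_derivative by (simp only:)
qed

text \<open>The first two identities say that r P and r S solve scalar radial equations with squared
  wave numbers k/a and k/m; the other two rewrite their first derivatives without derivatives of U
  and D.\<close>

lemma spheroidal_potentials_algebra:
  fixes r U D P S :: complex
  assumes "r \<noteq> 0" "a \<noteq> 0" "m \<noteq> 0"
  shows "(m / r * S - k * U) / a + (m * ((a * l / r * P - k * D) / m - 1 / r * S) - k * (r * (P - 2 / r * U - 1 / r * D) + U)) / a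
       = (l / r\<^sup>2 - k / a) * (r * P)"
    and "(a * l * ((m / r * S - k * U) / a) - k * (r * (S - 1 / r * D - l / r * U) + D)) / m = (l / r\<^sup>2 - k / m) * (r * S)"
    and "r * ((a * l / r * P - k * D) / m - 1 / r * S) + S = (a * l * P - k * (r * D)) / m"
    and "r * ((m / r * S - k * U) / a) + P = P + (m * S - k * (r * U)) / a"
  using assms by (simp_all add: field_simps power2_eq_square)

text \<open>Links the elastic flux with the Wronskians of the two potentials. The extra terms are
  real when \<alpha> = \<beta> l, so a flux with zero imaginary part makes the weighted sum of the
  Wronskians vanish.\<close>

lemma spheroidal_flux_wronskians:
  fixes r U D P S Uc Dc Pc Sc :: complex
  assumes "r \<noteq> 0" "a \<noteq> 0" "m \<noteq> 0"
  shows "\<alpha> * a\<^sup>2 * (r * P * (Pc + (m * Sc - k * (r * Uc)) / a)) + \<beta> * m\<^sup>2 * (r * S * ((a * l * Pc - k * (r * Dc)) / m))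
    = - k * (r\<^sup>2 * (\<alpha> * a * (P * Uc) + \<beta> * m * (S * Dc)))
      + r * (\<alpha> * a\<^sup>2 * (P * Pc)) + r * a * m * (\<alpha> * (P * Sc) + \<beta> * l * (S * Pc))"
  using assms by (simp add: field_simps power2_eq_square)

text \<open>The Wronskians of r P and r S are nonnegative by radiation and their weighted sum is
  zero, so both vanish with their potentials; when \<beta> = 0, S is zero by assumption. U and D are
  then read off from the derivatives of the potentials.\<close>

lemma spheroidal_exterior:
  fixes U D P S :: "real => complex"
  assumes sp: "spheroidal {1<..} a m k l U D P S" and pos: "a > 0" "m > 0" "k > 0" "l \<ge> 0"
    and ab: "\<alpha> > 0" "\<beta> \<ge> 0" "\<alpha> = \<beta> * l \<or> \<beta> = 0 \<and> (\<forall>r>1. S r = 0 \<and> D r = 0)"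
    and rad: "((%r. of_real r * ((of_real m / of_real r * S r - of_real k * U r) / of_real a - \<i> * of_real (sqrt (k / a)) * P r)) ---> 0) at_top"
      "((%r. (of_real a * of_real l * P r - of_real k * (of_real r * D r)) / of_real m - \<i> * of_real (sqrt (k / m)) * (of_real r * S r)) ---> 0) at_top"
    and fl: "\<And>r. r > 1 ==> Im (flux \<alpha> \<beta> a m U D P S r) = 0"
    and r: "r > 1"
  shows "U r = 0 \<and> D r = 0 \<and> P r = 0 \<and> S r = 0"
proof -
  let ?P' = "%r. (of_real m / of_real r * S r - of_real k * U r) / of_real a"
    and ?S' = "%r. (of_real a * of_real l / of_real r * P r - of_real k * D r) / of_real m - 1 / of_real r * S r"
    and ?U' = "%r. P r - 2 / of_real r * U r - 1 / of_real r * D r" and ?D' = "%r. S r - 1 / of_real r * D r - of_real l / of_real r * U r"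
  define Ph where "Ph r = of_real r * P r" for r
  define Ph' where "Ph' r = P r + (of_real m * S r - of_real k * (of_real r * U r)) / of_real a" for r
  define Sh where "Sh r = of_real r * S r" for r
  define Sh' where "Sh' r = (of_real a * of_real l * P r - of_real k * (of_real r * D r)) / of_real m" for r
  have dr: "(complex_of_real hvd 1) (at r)" for r
    using has_vector_derivative_of_real[OF DERIV_ident, where 'a = complex] by simp
  have d: "spheroidal {1<..} a m k l U D P S" "r > 1 ==> r \<in> {1<..}" for r using sp by auto
  note d = spheroidalD[OF d]
  have nz: "complex_of_real a \<noteq> 0" "complex_of_real m \<noteq> 0" "r > 1 ==> complex_of_real r \<noteq> 0" for r
    using pos by auto
  note alg = spheroidal_potentials_algebra[OF nz(3) nz(1,2)]
  have dPh: "(Ph hvd Ph' r) (at r)" if "r > 1" for r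
    using hvd_mult[OF dr d(3)[OF that]]
    unfolding Ph_def[abs_def] Ph'_def mult_1_left alg(4)[OF that] .
  have dSh: "(Sh hvd Sh' r) (at r)" if "r > 1" for r
    using hvd_mult[OF dr d(4)[OF that]]
    unfolding Sh_def[abs_def] Sh'_def mult_1_left alg(3)[OF that] .
  have kk: "(sqrt (k / a))\<^sup>2 = k / a" "(sqrt (k / m))\<^sup>2 = k / m" "sqrt (k / a) > 0" "sqrt (k / m) > 0"
    using pos by auto
  have dPh': "(Ph' hvd of_real (l / r\<^sup>2 - (sqrt (k / a))\<^sup>2) * Ph r) (at r)" if "r > 1" for r
  proof -
    have "(Ph' hvd (?P' r
       + (of_real m * ?S' r
       - of_real k * (of_real r * ?U' r + 1 * U r)) / of_real a)) (at r)"
      unfolding Ph'_def[abs_def]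
      by (intro hvd_add hvd_diff hvd_divide
          hvd_mult_right hvd_mult[OF dr] d that)
    thus ?thesis unfolding kk mult_1_left alg(1)[OF that] by (simp add: Ph_def)
  qed
  have dSh': "(Sh' hvd of_real (l / r\<^sup>2 - (sqrt (k / m))\<^sup>2) * Sh r) (at r)" if "r > 1" for r
  proof -
    have "(Sh' hvd ((of_real a * of_real l * ?P' r
       - of_real k * (of_real r * ?D' r + 1 * D r)) / of_real m)) (at r)"
      unfolding Sh'_def[abs_def]
      by (intro hvd_diff hvd_divide
          hvd_mult_right hvd_mult[OF dr] d that)
    thus ?thesis unfolding kk mult_1_left alg(2)[OF that] by (simp add: Sh_def)
  qed
  \<comment> \<open>Since (r P)' = r P' + P, the assumed condition leaves the extra term P =
    \<open>Ph\<close> / r, which tends to 0 because \<open>Ph\<close> is bounded.\<close>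
  have radP: "((%r. Ph' r - \<i> * of_real (sqrt (k / a)) * Ph r) ---> 0) at_top"
  proof -
    let ?Q = "%r. Ph r / of_real r + of_real r * (?P' r - \<i> * of_real (sqrt (k / a)) * P r)"
    have "((%r. ?Q r) ---> 0 + 0) at_top"
      by (intro tendsto_add rad radial_bounded[OF kk(3) pos(4) dPh dPh'])
    hence "((%r. ?Q r) ---> 0) at_top"
      by simp
    moreover have "\<forall>\<^sub>F r in at_top. ?Q r
        = Ph' r - \<i> * of_real (sqrt (k / a)) * Ph r"
      using eventually_gt_at_top[of 1]
    proof (rule eventually_mono)
      fix r :: real assume r: "r > 1"
      show "?Q r
        = Ph' r - \<i> * of_real (sqrt (k / a)) * Ph r"
        unfolding Ph_def Ph'_def alg(4)[OF r, symmetric] using nz(3)[OF r]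
        by (simp add: right_diff_distrib)
    qed
    ultimately show ?thesis by (rule Lim_transform_eventually)
  qed
  obtain W1 where W1': "W1 \<ge> 0" "\<forall>r>1. Im (cnj (Ph r) * Ph' r) = W1" "W1 = 0 \<longrightarrow> (\<forall>r>1. Ph r = 0)"
    using radial_radiating[OF kk(3) pos(4) dPh dPh' radP] by blast
  note W1 = W1'(1) W1'(2)[rule_format] W1'(3)[rule_format]
  have radS: "((%r. Sh' r - \<i> * of_real (sqrt (k / m)) * Sh r) ---> 0) at_top"
    using rad(2) unfolding Sh_def Sh'_def .
  obtain W2 where W2': "W2 \<ge> 0" "\<forall>r>1. Im (cnj (Sh r) * Sh' r) = W2" "W2 = 0 \<longrightarrow> (\<forall>r>1. Sh r = 0)"
    using radial_radiating[OF kk(4) pos(4) dSh dSh' radS] by blast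
  note W2 = W2'(1) W2'(2)[rule_format] W2'(3)[rule_format]
  \<comment> \<open>Flux and Wronskians are constant in r, so the identity is evaluated at a single
    exterior radius, taken to be 2.\<close>
  have "\<alpha> * a\<^sup>2 * W1 + \<beta> * m\<^sup>2 * W2 = 0"
  proof -
    have two: "(2::real) > 1" by simp
    let ?r = "complex_of_real 2"
    let ?A = "of_real \<alpha> * (of_real a)\<^sup>2 * (?r * P 2 * cnj (Ph' 2)) + of_real \<beta> * (of_real m)\<^sup>2 * (?r * S 2 * cnj (Sh' 2))"
    have "?A = - of_real k * flux \<alpha> \<beta> a m U D P S 2
      + ?r * (of_real \<alpha> * (of_real a)\<^sup>2 * (P 2 * cnj (P 2))) + ?r * of_real a * of_real m * (of_real \<alpha> * (P 2 * cnj (S 2)) + of_real \<beta> * of_real l * (S 2 * cnj (P 2)))"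
      using spheroidal_flux_wronskians[OF nz(3)[OF two] nz(1,2)] unfolding flux_def Ph'_def Sh'_def
      by (simp only: complex_cnj_add complex_cnj_diff complex_cnj_mult complex_cnj_divide complex_cnj_complex_of_real)
    \<comment> \<open>The relation \<alpha> = \<beta> l pairs the two mixed terms to a number plus
      its conjugate.\<close>
    moreover have "of_real \<alpha> * (P 2 * cnj (S 2)) + of_real \<beta> * of_real l * (S 2 * cnj (P 2)) = of_real (\<alpha> * 2 * Re (P 2 * cnj (S 2)))"
    proof -
      have c: "P 2 * cnj (S 2) + S 2 * cnj (P 2) = of_real (2 * Re (P 2 * cnj (S 2)))"
        by (simp add: complex_eq_iff)
      have "of_real \<beta> * of_real l * (S 2 * cnj (P 2)) = of_real \<alpha> * (S 2 * cnj (P 2))"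
        using ab(3) two by auto
      thus ?thesis using c by (simp only: distrib_left[symmetric] of_real_mult mult.assoc)
    qed
    ultimately have "?A = - of_real k * flux \<alpha> \<beta> a m U D P S 2 + of_real (2 * (\<alpha> * a\<^sup>2 * (cmod (P 2))\<^sup>2) + 2 * a * m * (\<alpha> * 2 * Re (P 2 * cnj (S 2))))"
      by (simp add: complex_mult_cnj_norm)
    hence "Im ?A = - k * Im (flux \<alpha> \<beta> a m U D P S 2)"
      by (simp only: plus_complex.sel Im_complex_of_real add_0_right uminus_complex.sel times_complex.sel Re_complex_of_real mult_zero_left minus_mult_left[symmetric])
    hence "Im ?A = 0" using fl[OF two] by simp
    moreover have "Im ?A = - (\<alpha> * a\<^sup>2 * Im (cnj (Ph 2) * Ph' 2) + \<beta> * m\<^sup>2 * Im (cnj (Sh 2) * Sh' 2))"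
    proof -
      have imr: "Im (of_real x * z) = x * Im z" for x z by simp
      have i: "Im (z * cnj w) = - Im (cnj z * w)" for z w by simp
      have "?A = of_real (\<alpha> * a\<^sup>2) * (Ph 2 * cnj (Ph' 2)) + of_real (\<beta> * m\<^sup>2) * (Sh 2 * cnj (Sh' 2))"
        by (simp add: Ph_def Sh_def)
      hence "Im ?A = \<alpha> * a\<^sup>2 * Im (Ph 2 * cnj (Ph' 2)) + \<beta> * m\<^sup>2 * Im (Sh 2 * cnj (Sh' 2))"
        by (simp only: plus_complex.sel imr)
      thus ?thesis unfolding i by (simp only: mult_minus_right minus_add_distrib)
    qed
    ultimately show ?thesis unfolding W1(2)[OF two] W2(2)[OF two] by linarith
  qed
  moreover have "\<alpha> * a\<^sup>2 * W1 \<ge> 0" "\<beta> * m\<^sup>2 * W2 \<ge> 0" using ab W1(1) W2(1) by auto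
  ultimately have z: "\<alpha> * a\<^sup>2 * W1 = 0" "\<beta> * m\<^sup>2 * W2 = 0" by linarith+
  have "W1 = 0" using z(1) ab(1) pos by simp
  hence P0: "P r = 0" if "r > 1" for r using W1(3)[OF _ that] that by (simp add: Ph_def)
  have S0: "S r = 0" if "r > 1" for r
  proof (cases "\<beta> = 0")
    case True thus ?thesis using ab(1,3) that by auto
  next
    case False
    hence "W2 = 0" using z(2) pos by simp
    thus ?thesis using W2(3)[OF _ that] that by (simp add: Sh_def)
  qed
  have "Ph' r = 0"
  proof (rule vector_derivative_unique_at[OF dPh[OF r]])
    show "(Ph hvd 0) (at r)"
      by (rule hvd_transform_within_open[of "%_. 0" _ _ "{1<..}"]) (use r P0 in \<open>auto simp: Ph_def\<close>)
  qed
  hence "U r = 0" using P0[OF r] S0[OF r] pos r by (simp add: Ph'_def)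
  moreover have "Sh' r = 0"
  proof (rule vector_derivative_unique_at[OF dSh[OF r]])
    show "(Sh hvd 0) (at r)"
      by (rule hvd_transform_within_open[of "%_. 0" _ _ "{1<..}"]) (use r S0 in \<open>auto simp: Sh_def\<close>)
  qed
  hence "D r = 0" using P0[OF r] S0[OF r] pos r by (simp add: Sh'_def)
  ultimately show ?thesis using P0[OF r] S0[OF r] by simp
qed

text \<open>Zero data at the interface propagate inwards. The coefficients are singular at the
  origin only, so for a given r the system is considered between r/2 and 1.\<close>

lemma spheroidal_interior_zero:
  assumes sp: "spheroidal {0<..<1} a m k l U D P S" and pos: "a > 0" "m > 0" "k > 0" "l \<ge> 0"
    and lim: "(U ---> 0) (at_left 1)" "(D ---> 0) (at_left 1)" "(P ---> 0) (at_left 1)" "(S ---> 0) (at_left 1)"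
    and r: "0 < r" "r < 1"
  shows "U r = 0 \<and> D r = 0 \<and> P r = 0 \<and> S r = 0"
proof -
  define e where "e = r / 2"
  have e: "e > 0" "e < r" using r by (auto simp: e_def)
  define q where "q = 1 / e"
  \<comment> \<open>A sum of upper bounds for all coefficients of the system between r/2 and 1,
    where 1/t is at most q.\<close>
  define M where "M = 1 + 2 * q + l * q + m * q / a + k / a + a * l * q / m + k / m"
  have q0: "q > 0" using e by (simp add: q_def)
  have nn: "0 \<le> l * q" "0 \<le> m * q / a" "0 \<le> k / a" "0 \<le> a * l * q / m" "0 \<le> k / m" using q0 pos by auto
  define f where "f i t = [U t, D t, P t, S t] ! i" for i t
  define g where "g i t = [P t - 2 / of_real t * U t - 1 / of_real t * D t, S t - 1 / of_real t * D t - of_real l / of_real t * U t,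
    (of_real m / of_real t * S t - of_real k * U t) / of_real a,
    (of_real a * of_real l / of_real t * P t - of_real k * D t) / of_real m - 1 / of_real t * S t] ! i" for i t
  have i4: "i = 0 \<or> i = 1 \<or> i = 2 \<or> i = 3" if "i < 4" for i :: nat using that by linarith
  have z: "f i r = 0" if "i < 4" for i
  proof (rule linear_system_zero[where N = 4 and f = f and g = g and a = e and b = 1 and M = M])
    fix i :: nat assume i: "i < 4"
    show "(f i ---> 0) (at_left 1)" using i4[OF i] lim by (auto simp: f_def[abs_def])
    fix t assume t: "t \<in> {e<..<1}"
    hence t0: "t > 0" "t \<in> {0<..<1}" using e by auto
    show "(f i hvd g i t) (at t)"
      using i4[OF i] spheroidalD[OF sp t0(2)] by (auto simp: f_def[abs_def] g_def)
    have "1 / t \<le> q" using t e by (auto simp: q_def intro!: divide_left_mono)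
    hence lq: "c / t \<le> c * q" if "c \<ge> 0" for c using mult_left_mono[OF _ that] by fastforce
    have "m / t / a \<le> m * q / a" "a * l / t / m \<le> a * l * q / m"
      using divide_right_mono[OF lq[of m], of a] divide_right_mono[OF lq[of "a * l"], of m] pos by auto
    hence "2 / t \<le> M" "1 / t \<le> M" "l / t \<le> M" "m / t / a \<le> M" "a * l / t / m \<le> M" "1 \<le> M" "k / a \<le> M" "k / m \<le> M"
      using lq[of 2] lq[of 1] lq[of l] nn q0 pos unfolding M_def by linarith+
    hence c: "cmod (c * x) \<le> M * cmod x"
      if "c \<in> {0, 1, 2 / of_real t, 1 / of_real t, of_real l / of_real t, of_real m / of_real t / of_real a,
        of_real k / of_real a, of_real a * of_real l / of_real t / of_real m, of_real k / of_real m}" for c x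
      using that t0 pos unfolding norm_mult by (intro mult_right_mono) (auto simp: norm_divide norm_mult)
    have tri: "cmod (c1 * x - c2 * y - c3 * z) \<le> M * cmod x + M * cmod y + M * cmod z"
      if "cmod (c1 * x) \<le> M * cmod x" "cmod (c2 * y) \<le> M * cmod y" "cmod (c3 * z) \<le> M * cmod z" for c1 c2 c3 x y z
      using that norm_triangle_ineq4[of "c1 * x - c2 * y" "c3 * z"] norm_triangle_ineq4[of "c1 * x" "c2 * y"] by linarith
    have g: "g 0 t = 1 * P t - 2 / of_real t * U t - 1 / of_real t * D t"
      "g 1 t = 1 * S t - 1 / of_real t * D t - of_real l / of_real t * U t"
      "g 2 t = of_real m / of_real t / of_real a * S t - of_real k / of_real a * U t - 0 * D t"
      "g 3 t = of_real a * of_real l / of_real t / of_real m * P t - of_real k / of_real m * D t - 1 / of_real t * S t"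
      by (simp_all add: g_def diff_divide_distrib)
    have s: "M * (\<Sum>j<4. cmod (f j t)) = M * cmod (U t) + M * cmod (D t) + M * cmod (P t) + M * cmod (S t)"
      by (simp add: f_def lessThan_nat_numeral distrib_left)
    have "cmod (0 * x) \<le> M * cmod x" for x using c by blast
    hence n: "0 \<le> M * cmod x" for x by simp
    have "cmod (g 0 t) \<le> M * cmod (P t) + M * cmod (U t) + M * cmod (D t)" unfolding g by (intro tri c) auto
    moreover have "cmod (g 1 t) \<le> M * cmod (S t) + M * cmod (D t) + M * cmod (U t)" unfolding g by (intro tri c) auto
    moreover have "cmod (g 2 t) \<le> M * cmod (S t) + M * cmod (U t) + M * cmod (D t)" unfolding g by (intro tri c) auto
    moreover have "cmod (g 3 t) \<le> M * cmod (P t) + M * cmod (D t) + M * cmod (S t)" unfolding g by (intro tri c) auto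
    ultimately show "cmod (g i t) \<le> M * (\<Sum>j<4. cmod (f j t))"
      using i4[OF i] n[of "U t"] n[of "D t"] n[of "P t"] n[of "S t"] unfolding s by (elim disjE) simp_all
  qed (use e r that in auto)
  show ?thesis using z[of 0] z[of 1] z[of 2] z[of 3] by (simp add: f_def)
qed

text \<open>The flux is zero at the origin through the factor r^2 and \<open>bdd\<close>. After its
  transfer across the interface the exterior solution vanishes first; its limits together with
  \<open>tr\<close> then supply zero data for the interior.\<close>

lemma spheroidal_unique:
  fixes U1 D1 P1 S1 U2 D2 P2 S2 :: "real => complex"
  assumes sp1: "spheroidal {0<..<1} a1 m1 k1 l U1 D1 P1 S1" and pos1: "a1 > 0" "m1 > 0" "k1 > 0" "l \<ge> 0"
    and sp2: "spheroidal {1<..} a2 m2 k2 l U2 D2 P2 S2" and pos2: "a2 > 0" "m2 > 0" "k2 > 0"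
    and l0: "l = 0 ==> (\<forall>r. S1 r = 0 \<and> D1 r = 0 \<and> S2 r = 0 \<and> D2 r = 0)"
    and lim1: "(U1 ---> u) (at_left 1)" "(D1 ---> v) (at_left 1)" "(P1 ---> p1) (at_left 1)" "(S1 ---> s1) (at_left 1)"
    and lim2: "(U2 ---> u) (at_right 1)" "(D2 ---> v) (at_right 1)" "(P2 ---> p2) (at_right 1)" "(S2 ---> s2) (at_right 1)"
    and tr: "of_real a1 * p1 - 2 * of_real m1 * (2 * u + v) = of_real a2 * p2 - 2 * of_real m2 * (2 * u + v)"
      "of_real m1 * s1 - 2 * of_real m1 * (v + of_real l * u) = of_real m2 * s2 - 2 * of_real m2 * (v + of_real l * u)"
    and bdd: "\<And>r. 0 < r ==> r < 1/2 ==> cmod (U1 r) \<le> B \<and> cmod (D1 r) \<le> B \<and> cmod (P1 r) \<le> B \<and> cmod (S1 r) \<le> B"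
    and rad: "((%r. of_real r * ((of_real m2 / of_real r * S2 r - of_real k2 * U2 r) / of_real a2 - \<i> * of_real (sqrt (k2 / a2)) * P2 r)) ---> 0) at_top"
      "((%r. (of_real a2 * of_real l * P2 r - of_real k2 * (of_real r * D2 r)) / of_real m2 - \<i> * of_real (sqrt (k2 / m2)) * (of_real r * S2 r)) ---> 0) at_top"
  shows "(\<forall>r. 0 < r \<and> r < 1 \<longrightarrow> U1 r = 0 \<and> D1 r = 0 \<and> P1 r = 0 \<and> S1 r = 0)
       \<and> (\<forall>r>1. U2 r = 0 \<and> D2 r = 0 \<and> P2 r = 0 \<and> S2 r = 0)"
proof -
  \<comment> \<open>For l = 0 there is no tangential part: \<beta> = 0, and \<alpha> = 1 keeps the
    radial weight positive. Otherwise \<beta> = 1 and \<alpha> = l.\<close>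
  define \<alpha> where "\<alpha> = (if l = 0 then 1 else l)"
  define \<beta> where "\<beta> = (if l = 0 then 0 else 1 :: real)"
  let ?F1 = "flux \<alpha> \<beta> a1 m1 U1 D1 P1 S1" and ?F2 = "flux \<alpha> \<beta> a2 m2 U2 D2 P2 S2" and ?R = "(\<alpha> * a1 + \<beta> * m1) * (B * B)"
  let ?f1 = "of_real \<alpha> * of_real a1 * (p1 * cnj u) + of_real \<beta> * of_real m1 * (s1 * cnj v)"
    and ?f2 = "of_real \<alpha> * of_real a2 * (p2 * cnj u) + of_real \<beta> * of_real m2 * (s2 * cnj v)"
  have ab: "\<alpha> > 0" "\<beta> \<ge> 0" using pos1 by (auto simp: \<alpha>_def \<beta>_def)
  have w1: "\<alpha> = \<beta> * l \<or> (\<forall>r\<in>{0<..<1}. S1 r = 0 \<and> D1 r = 0)" using l0 by (auto simp: \<alpha>_def \<beta>_def)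
  have w2: "\<alpha> = \<beta> * l \<or> (\<forall>r\<in>{1<..}. S2 r = 0 \<and> D2 r = 0)" using l0 by (auto simp: \<alpha>_def \<beta>_def)
  have w3: "\<alpha> = \<beta> * l \<or> \<beta> = 0 \<and> (\<forall>r>1. S2 r = 0 \<and> D2 r = 0)" using l0 by (auto simp: \<alpha>_def \<beta>_def)
  have v0: "v = 0" if "l = 0"
  proof -
    have "D1 = (%r. 0)" using l0[OF that] by auto
    thus ?thesis using lim1(2) tendsto_unique[OF _ lim1(2), of 0] by simp
  qed
  obtain c1 where c1: "\<forall>r\<in>{0<..<1}. Im (?F1 r) = c1"
  proof -
    have "{0<..<1} \<subseteq> {0::real<..}" by auto
    from flux_const[OF sp1 _ this pos1(1,2) w1] show ?thesis using that by auto
  qed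
  obtain c2 where c2: "\<forall>r\<in>{1<..}. Im (?F2 r) = c2"
  proof -
    have "{1<..} \<subseteq> {0::real<..}" by auto
    from flux_const[OF sp2 _ this pos2(1,2) w2] show ?thesis using that by auto
  qed
  have "c1 = 0"
  proof -
    have fb: "cmod (?F1 r) \<le> r\<^sup>2 * (?R)" if r: "0 < r" "r < 1/2" for r
    proof -
      have B: "B \<ge> 0" using bdd[OF r] norm_ge_zero order_trans by blast
      have "cmod (of_real \<alpha> * of_real a1 * (P1 r * cnj (U1 r)) + of_real \<beta> * of_real m1 * (S1 r * cnj (D1 r)))
        \<le> \<alpha> * a1 * (B * B) + \<beta> * m1 * (B * B)"
        using ab pos1 bdd[OF r] B
        by (intro order_trans[OF norm_triangle_ineq] add_mono) (auto simp: norm_mult intro!: mult_left_mono mult_mono)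
      thus ?thesis unfolding flux_def norm_mult norm_power norm_of_real by (simp add: distrib_right mult_left_mono)
    qed
    have "((%r. ?F1 r) ---> 0) (at_right 0)"
    proof (rule Lim_null_comparison)
      show "\<forall>\<^sub>F r in at_right 0. cmod (?F1 r) \<le> r\<^sup>2 * (?R)"
        by (rule eventually_at_rightI[of 0 "1/2"]) (use fb in auto)
      have "((%r. r\<^sup>2 * (?R)) ---> 0\<^sup>2 * (?R)) (at_right 0)"
        by (intro tendsto_intros)
      thus "((%r. r\<^sup>2 * (?R)) ---> 0) (at_right 0)" by simp
    qed
    from unit_limits(3)[OF tendsto_Im[OF this], of c1] show ?thesis using c1 by simp
  qed
  have flim: "((%r. Im (flux \<alpha> \<beta> a m U D P S r)) ---> Im (of_real \<alpha> * of_real a * (p * cnj u) + of_real \<beta> * of_real m * (s * cnj v))) F"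
    if "(U ---> u) F" "(D ---> v) F" "(P ---> p) F" "(S ---> s) F" "((%r. r) ---> 1) F" for a m U D P S p s F
  proof -
    have "((%r. flux \<alpha> \<beta> a m U D P S r) ---> (of_real 1)\<^sup>2 * (of_real \<alpha> * of_real a * (p * cnj u) + of_real \<beta> * of_real m * (s * cnj v))) F"
      unfolding flux_def by (intro tendsto_intros that)
    thus ?thesis by (intro tendsto_Im) simp
  qed
  have f1: "Im (?f1) = 0"
    by (rule unit_limits(1)[OF flim[OF lim1]]) (use c1 \<open>c1 = 0\<close> in \<open>auto intro: tendsto_ident_at\<close>)
  have f2: "Im (?f2) = c2"
    by (rule unit_limits(2)[OF flim[OF lim2]]) (use c2 in \<open>auto intro: tendsto_ident_at\<close>)
  \<comment> \<open>By \<open>tr\<close> the quantities a p and m s jump by 2 (m2 - m1) times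
    displacement terms. Paired with the conjugate displacement these jumps form a Hermitian
    expression with real coefficients, so the imaginary part is continuous.\<close>
  have "c2 = 0"
  proof -
    have e1: "of_real a2 * p2 = of_real a1 * p1 + of_real (2 * (m2 - m1)) * (2 * u + v)"
      using tr(1) by (simp add: algebra_simps)
    have e2: "of_real m2 * s2 = of_real m1 * s1 + of_real (2 * (m2 - m1)) * (v + of_real l * u)"
      using tr(2) by (simp add: algebra_simps)
    have "?f2
      = of_real \<alpha> * (of_real a2 * p2) * cnj u + of_real \<beta> * (of_real m2 * s2) * cnj v" by (simp add: algebra_simps)
    also have "\<dots> = (?f1)
       + of_real (2 * (m2 - m1)) * (of_real (2 * \<alpha>) * (u * cnj u) + of_real \<alpha> * (v * cnj u) + of_real \<beta> * (v * cnj v) + of_real (\<beta> * l) * (u * cnj v))"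
      unfolding e1 e2 by (simp add: algebra_simps)
    also have "of_real \<alpha> * (v * cnj u) + of_real (\<beta> * l) * (u * cnj v) = of_real (\<alpha> * (2 * Re (v * cnj u)))"
    proof (cases "l = 0")
      case True thus ?thesis using v0 by simp
    next
      case False hence "\<alpha> = \<beta> * l" by (simp add: \<alpha>_def \<beta>_def)
      moreover have "v * cnj u + u * cnj v = of_real (2 * Re (v * cnj u))" by (simp add: complex_eq_iff)
      ultimately show ?thesis by (simp only: distrib_left[symmetric] of_real_mult)
    qed
    hence "of_real (2 * \<alpha>) * (u * cnj u) + of_real \<alpha> * (v * cnj u) + of_real \<beta> * (v * cnj v) + of_real (\<beta> * l) * (u * cnj v)
      = of_real (2 * \<alpha> * (cmod u)\<^sup>2 + \<beta> * (cmod v)\<^sup>2 + \<alpha> * (2 * Re (v * cnj u)))"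
      by (simp add: complex_mult_cnj_norm)
    finally have "?f2
      = (?f1)
       + of_real (2 * (m2 - m1) * (2 * \<alpha> * (cmod u)\<^sup>2 + \<beta> * (cmod v)\<^sup>2 + \<alpha> * (2 * Re (v * cnj u))))"
      by (simp only: of_real_mult)
    thus ?thesis using f1 f2 by (simp only: plus_complex.sel Im_complex_of_real)
  qed
  have ext: "U2 r = 0 \<and> D2 r = 0 \<and> P2 r = 0 \<and> S2 r = 0" if "r > 1" for r
    by (rule spheroidal_exterior[OF sp2 pos2 pos1(4) ab w3 rad _ that]) (use c2 \<open>c2 = 0\<close> in auto)
  have z0: "u = 0" "v = 0" "p2 = 0" "s2 = 0" using lim2[THEN unit_limits(2), of 0] ext by auto
  hence "p1 = 0" "s1 = 0" using tr pos1 by auto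
  with lim1 z0 have "U1 r = 0 \<and> D1 r = 0 \<and> P1 r = 0 \<and> S1 r = 0" if "0 < r" "r < 1" for r
    using that by (intro spheroidal_interior_zero[OF sp1 pos1]) auto
  with ext show ?thesis by blast
qed

text \<open>Z stands for r times a toroidal moment, for which the traction at r = 1 is m (Z' - 2 Z)
  up to sign; its jump changes the Wronskian by a real multiple of |z|^2. The bounds Z = O(r) and Z'
  = O(1) make the Wronskian vanish at the origin, so radiation kills Z outside and zero data kill it
  inside.\<close>

lemma toroidal_unique:
  fixes Z1 Z1' Z2 Z2' :: "real => complex"
  assumes d1: "\<And>r. 0 < r ==> r < 1 ==> (Z1 hvd Z1' r) (at r)"
      "\<And>r. 0 < r ==> r < 1 ==> (Z1' hvd of_real (l / r\<^sup>2 - \<kappa>) * Z1 r) (at r)"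
    and d2: "\<And>r. r > 1 ==> (Z2 hvd Z2' r) (at r)"
      "\<And>r. r > 1 ==> (Z2' hvd of_real (l / r\<^sup>2 - k\<^sup>2) * Z2 r) (at r)"
    and pos: "m1 > 0" "m2 > 0" "k > 0" "l \<ge> 0"
    and lim1: "(Z1 ---> z) (at_left 1)" "(Z1' ---> z1) (at_left 1)"
    and lim2: "(Z2 ---> z) (at_right 1)" "(Z2' ---> z2) (at_right 1)"
    and tr: "of_real m1 * (z1 - 2 * z) = of_real m2 * (z2 - 2 * z)"
    and bdd: "\<And>r. 0 < r ==> r < 1/2 ==> cmod (Z1 r) \<le> B * r \<and> cmod (Z1' r) \<le> B"
    and rad: "((%r. Z2' r - \<i> * of_real k * Z2 r) ---> 0) at_top"
  shows "(\<forall>r. 0 < r \<and> r < 1 \<longrightarrow> Z1 r = 0) \<and> (\<forall>r>1. Z2 r = 0)"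
proof -
  obtain W where W: "W \<ge> 0" "\<forall>r>1. Im (cnj (Z2 r) * Z2' r) = W" "W = 0 \<longrightarrow> (\<forall>r>1. Z2 r = 0)"
    using radial_radiating[OF pos(3,4) d2 rad] by blast
  obtain c where c: "\<forall>r\<in>{0<..<1}. Im (cnj (Z1 r) * Z1' r) = c"
    using wronskian_const[of "{0<..<1}" Z1 Z1' "%r. l / r\<^sup>2 - \<kappa>"] d1 by auto
  have "c = 0"
  proof -
    have "((%r. cnj (Z1 r) * Z1' r) ---> 0) (at_right 0)"
    proof (rule Lim_null_comparison)
      have "cmod (cnj (Z1 r) * Z1' r) \<le> B * r * B" if "0 < r" "r < 1/2" for r
        unfolding norm_mult complex_mod_cnj using bdd[OF that] order_trans[OF norm_ge_zero, of "Z1 r"]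
        by (intro mult_mono) auto
      thus "\<forall>\<^sub>F r in at_right 0. cmod (cnj (Z1 r) * Z1' r) \<le> B * r * B"
        by (intro eventually_at_rightI[of 0 "1/2"]) auto
      have "((%r. B * r * B) ---> B * 0 * B) (at_right 0)" by (intro tendsto_intros)
      thus "((%r. B * r * B) ---> 0) (at_right 0)" by simp
    qed
    from unit_limits(3)[OF tendsto_Im[OF this], of c] show ?thesis using c by simp
  qed
  have f1: "Im (cnj z * z1) = 0"
    by (rule unit_limits(1)[of "%r. Im (cnj (Z1 r) * Z1' r)"]) (use c \<open>c = 0\<close> in \<open>auto intro!: tendsto_intros lim1\<close>)
  have f2: "Im (cnj z * z2) = W"
    by (rule unit_limits(2)[of "%r. Im (cnj (Z2 r) * Z2' r)"]) (use W(2) in \<open>auto intro!: tendsto_intros lim2\<close>)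
  have "W = 0"
  proof -
    have imr: "Im (of_real x * w) = x * Im w" for x w by simp
    have "of_real m2 * (cnj z * z2) = of_real m1 * (cnj z * z1) + of_real (2 * (m2 - m1)) * (z * cnj z)"
    proof -
      have "of_real m2 * z2 = of_real m1 * z1 + of_real (2 * (m2 - m1)) * z" using tr by (simp add: algebra_simps)
      hence "cnj z * (of_real m2 * z2) = cnj z * (of_real m1 * z1 + of_real (2 * (m2 - m1)) * z)" by simp
      thus ?thesis by (simp only: distrib_left mult.left_commute mult.commute mult.assoc)
    qed
    hence "Im (of_real m2 * (cnj z * z2)) = Im (of_real m1 * (cnj z * z1) + of_real (2 * (m2 - m1) * (cmod z)\<^sup>2))"
      by (simp only: complex_mult_cnj_norm of_real_mult of_real_power)
    hence "m2 * Im (cnj z * z2) = m1 * Im (cnj z * z1)"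
      by (simp only: plus_complex.sel imr Im_complex_of_real add_0_right)
    thus ?thesis using f1 f2 pos by simp
  qed
  hence Z2: "Z2 r = 0" if "r > 1" for r using W(3) that by blast
  have Z2': "Z2' r = 0" if "r > 1" for r
  proof (rule vector_derivative_unique_at[OF d2(1)[OF that]])
    show "(Z2 hvd 0) (at r)"
      by (rule hvd_transform_within_open[of "%_. 0" _ _ "{1<..}"]) (use that Z2 in auto)
  qed
  have z0: "z = 0" "z2 = 0" using unit_limits(2)[OF lim2(1) Z2] unit_limits(2)[OF lim2(2) Z2'] by auto
  hence "z1 = 0" using tr pos by simp
  have "Z1 r = 0" if r: "0 < r" "r < 1" for r
  proof -
    define e where "e = r / 2"
    have e: "e > 0" "e < r" using r by (auto simp: e_def)
    define M where "M = 1 + l / e\<^sup>2 + \<bar>\<kappa>\<bar>"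
    have b: "\<bar>l / t\<^sup>2 - \<kappa>\<bar> \<le> M" if "t \<in> {e<..<1}" for t
    proof -
      have "e\<^sup>2 \<le> t\<^sup>2" using that e by (intro power_mono) auto
      hence "l / t\<^sup>2 \<le> l / e\<^sup>2" using pos e that by (intro divide_left_mono) auto
      moreover have "0 \<le> l / t\<^sup>2" using pos by simp
      ultimately show ?thesis unfolding M_def by linarith
    qed
    have M1: "1 \<le> M" using pos by (simp add: M_def)
    have i2: "i = 0 \<or> i = 1" if "i < 2" for i :: nat using that by linarith
    have "[Z1 r, Z1' r] ! 0 = 0"
    proof (rule linear_system_zero[where N = 2 and f = "%i t. [Z1 t, Z1' t] ! i" and a = e and b = 1 and M = M
          and g = "%i t. [Z1' t, of_real (l / t\<^sup>2 - \<kappa>) * Z1 t] ! i"])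
      fix i :: nat assume i: "i < 2"
      show "((%t. [Z1 t, Z1' t] ! i) ---> 0) (at_left 1)" using i2[OF i] lim1 z0 \<open>z1 = 0\<close> by auto
      fix t assume t: "t \<in> {e<..<1}"
      show "((%t. [Z1 t, Z1' t] ! i) hvd [Z1' t, of_real (l / t\<^sup>2 - \<kappa>) * Z1 t] ! i) (at t)"
        using i2[OF i] d1[of t] t e by auto
      have "cmod (of_real (l / t\<^sup>2 - \<kappa>) * Z1 t) \<le> M * cmod (Z1 t)" "cmod (Z1' t) \<le> M * cmod (Z1' t)"
        unfolding norm_mult norm_of_real using M1 mult_right_mono[OF M1, of "cmod (Z1' t)"] by (auto intro!: mult_right_mono b t)
      moreover have "0 \<le> M * cmod (Z1 t)" "0 \<le> M * cmod (Z1' t)" using M1 by auto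
      ultimately show "cmod ([Z1' t, of_real (l / t\<^sup>2 - \<kappa>) * Z1 t] ! i) \<le> M * (\<Sum>j<2. cmod ([Z1 t, Z1' t] ! j))"
        using i2[OF i] by (auto simp: numeral_2_eq_2 lessThan_Suc distrib_left)
    qed (use e r in auto)
    thus ?thesis by simp
  qed
  with Z2 show ?thesis by blast
qed

section \<open>Radial Bessel and Hankel functions\<close>

text \<open>Coefficients of t^(-n) j_n(t) as a power series in s = t^2. Splitting off t^n leaves an
  entire function \<open>bF n\<close> of s that is positive near 0, which makes the growth rate of
  j_n explicit.\<close>

definition bc :: "nat => nat => real" where
  "bc n p = (-1) ^ p / (2 ^ p * fact p * (\<Prod>i\<le>n + p. real (2 * i + 1)))"

definition bF :: "nat => real => real" where "bF n s = (\<Sum>p. bc n p * s ^ p)"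
definition bF' :: "nat => real => real" where "bF' n s = (\<Sum>p. diffs (bc n) p * s ^ p)"
definition bF'' :: "nat => real => real" where "bF'' n s = (\<Sum>p. diffs (diffs (bc n)) p * s ^ p)"

lemma bc_Suc: "bc n (Suc p) * (2 * real (Suc p) * real (2 * n + 2 * p + 3)) = - bc n p"
proof -
  have "(\<Prod>i\<le>n + Suc p. real (2 * i + 1)) = (\<Prod>i\<le>n + p. real (2 * i + 1)) * real (2 * n + 2 * p + 3)"
    by (simp add: algebra_simps)
  moreover have "(\<Prod>i\<le>n + p. real (2 * i + 1)) > 0" by (intro prod_pos) auto
  ultimately show ?thesis unfolding bc_def by (simp add: divide_simps del: prod.atMost_Suc)
qed

lemma bc0_pos: "bc n 0 > 0"
  unfolding bc_def by (auto intro!: divide_pos_pos prod_pos)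

text \<open>Consecutive coefficients shrink by 2 (p+1) (2n+2p+3), which is at least 6 (p+1). The
  bound relative to \<open>bc n 0\<close> does not involve n; this is the source of all uniformity
  in n inside the ball.\<close>

lemma abs_bc_le: "real (fact p) * \<bar>bc n p\<bar> \<le> bc n 0 * (1/6) ^ p"
proof (induction p)
  case 0 thus ?case using bc0_pos[of n] by simp
next
  case (Suc p)
  have "\<bar>bc n (Suc p)\<bar> * (2 * real (Suc p) * real (2 * n + 2 * p + 3)) = \<bar>bc n p\<bar>"
    using arg_cong[OF bc_Suc[of n p], of abs] by (simp add: abs_mult)
  moreover have "\<bar>bc n (Suc p)\<bar> * (2 * real (Suc p) * 3) \<le> \<bar>bc n (Suc p)\<bar> * (2 * real (Suc p) * real (2 * n + 2 * p + 3))"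
    by (intro mult_left_mono) auto
  ultimately have "6 * (real (Suc p) * \<bar>bc n (Suc p)\<bar>) \<le> \<bar>bc n p\<bar>" by (simp add: algebra_simps)
  hence "fact p * (6 * (real (Suc p) * \<bar>bc n (Suc p)\<bar>)) \<le> fact p * \<bar>bc n p\<bar>" by (rule mult_left_mono) simp
  with Suc.IH have "6 * (real (fact (Suc p)) * \<bar>bc n (Suc p)\<bar>) \<le> bc n 0 * (1/6) ^ p"
    by (simp add: algebra_simps)
  thus ?case by simp
qed

lemma bc_summable: "summable (%p. bc n p * s ^ p)"
proof (rule summable_comparison_test')
  show "summable (%p. bc n 0 * (inverse (fact p) * \<bar>s\<bar> ^ p))"
    by (intro summable_mult summable_exp)
  fix p
  have "\<bar>bc n p\<bar> \<le> bc n 0 * inverse (fact p)"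
  proof -
    have "real (fact p) * \<bar>bc n p\<bar> \<le> bc n 0 * 1"
      using abs_bc_le[of p n] bc0_pos[of n] mult_left_mono[of "(1/6::real) ^ p" 1 "bc n 0"] power_le_one[of "1/6::real" p] by linarith
    thus ?thesis by (simp add: field_simps)
  qed
  thus "norm (bc n p * s ^ p) \<le> bc n 0 * (inverse (fact p) * \<bar>s\<bar> ^ p)"
    by (simp add: abs_mult power_abs mult.assoc[symmetric] mult_right_mono)
qed

lemma diffs_summable:
  fixes c :: "nat => real"
  assumes "\<And>s. summable (%p. c p * s ^ p)" shows "summable (%p. diffs c p * s ^ p)"
  by (rule termdiff_converges_all) (rule assms)

lemma bF_deriv: "(bF n has_real_derivative bF' n s) (at s)" "(bF' n has_real_derivative bF'' n s) (at s)"
proof -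
  note s1 = bc_summable[of n]
  have s2: "summable (%p. diffs (bc n) p * s ^ p)" for s by (rule diffs_summable[OF s1])
  show "(bF n has_real_derivative bF' n s) (at s)"
    unfolding bF_def[abs_def] bF'_def by (rule termdiffs_strong_converges_everywhere[OF s1])
  show "(bF' n has_real_derivative bF'' n s) (at s)"
    unfolding bF'_def[abs_def] bF''_def by (rule termdiffs_strong_converges_everywhere[OF s2])
qed

text \<open>Bessel's equation after removing t^n and substituting s = t^2; on coefficients it is the
  recursion \<open>bc_Suc\<close>.\<close>

lemma bF_ode: "4 * s * bF'' n s + real (4 * n + 6) * bF' n s + bF n s = 0"
proof -
  note s1 = bc_summable[of n]
  have s2: "summable (%p. diffs (bc n) p * s ^ p)" for s by (rule diffs_summable[OF s1])
  have s3: "summable (%p. diffs (diffs (bc n)) p * s ^ p)" by (rule diffs_summable[OF s2])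
  have "(%p. real p * diffs (bc n) p * s ^ (p - Suc 0)) sums bF'' n s"
    unfolding bF''_def by (rule diffs_equiv[OF s3])
  hence "(%p. (4 * s) * (real p * diffs (bc n) p * s ^ (p - Suc 0))) sums ((4 * s) * bF'' n s)"
    by (rule sums_mult)
  moreover have "(%p. (4 * s) * (real p * diffs (bc n) p * s ^ (p - Suc 0))) = (%p. 4 * real p * diffs (bc n) p * s ^ p)"
  proof
    fix p show "(4 * s) * (real p * diffs (bc n) p * s ^ (p - Suc 0)) = 4 * real p * diffs (bc n) p * s ^ p"
      by (cases p) (simp_all add: algebra_simps)
  qed
  ultimately have "(%p. 4 * real p * diffs (bc n) p * s ^ p) sums ((4 * s) * bF'' n s)" by simp
  moreover have "(%p. real (4 * n + 6) * (diffs (bc n) p * s ^ p)) sums (real (4 * n + 6) * bF' n s)"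
    unfolding bF'_def by (intro sums_mult summable_sums s2)
  moreover have "(%p. bc n p * s ^ p) sums bF n s" unfolding bF_def by (intro summable_sums s1)
  ultimately have "(%p. 4 * real p * diffs (bc n) p * s ^ p + real (4 * n + 6) * (diffs (bc n) p * s ^ p) + bc n p * s ^ p)
     sums ((4 * s) * bF'' n s + real (4 * n + 6) * bF' n s + bF n s)"
    by (intro sums_add)
  moreover have "4 * real p * diffs (bc n) p * s ^ p + real (4 * n + 6) * (diffs (bc n) p * s ^ p) + bc n p * s ^ p = 0" for p
  proof -
    have "4 * real p * diffs (bc n) p + real (4 * n + 6) * diffs (bc n) p = bc n (Suc p) * (2 * real (Suc p) * real (2 * n + 2 * p + 3))"
      unfolding diffs_def by (simp add: algebra_simps)
    hence "4 * real p * diffs (bc n) p + real (4 * n + 6) * diffs (bc n) p + bc n p = 0" unfolding bc_Suc by simp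
    hence "(4 * real p * diffs (bc n) p + real (4 * n + 6) * diffs (bc n) p + bc n p) * s ^ p = 0" by simp
    thus ?thesis by (simp add: algebra_simps)
  qed
  ultimately have "(%p. 0) sums ((4 * s) * bF'' n s + real (4 * n + 6) * bF' n s + bF n s)" by simp
  thus ?thesis using sums_unique2[OF sums_zero] by simp
qed

text \<open>Comparison with the geometric series of ratio s/6, whose sum is at most 6/5; with the
  prefactor 1/6 this gives 1/5.\<close>

lemma bF_bound:
  assumes s: "0 \<le> s" "s \<le> 1"
  shows "\<bar>bF n s - bc n 0\<bar> \<le> bc n 0 * s / 5" and "\<bar>bF' n s\<bar> \<le> bc n 0 / 5"
proof -
  have geo: "(%p. (s / 6) ^ p) sums (1 / (1 - s / 6))" using s by (intro geometric_sums) auto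
  have g5: "1 / (1 - s / 6) \<le> 6 / 5" using s by (simp add: divide_simps)
  have "bF n s = bc n 0 + (\<Sum>p. bc n (Suc p) * s ^ Suc p)"
    unfolding bF_def by (subst suminf_split_head[OF bc_summable]) simp
  moreover have "\<bar>\<Sum>p. bc n (Suc p) * s ^ Suc p\<bar> \<le> (\<Sum>p. bc n 0 * (s / 6) * (s / 6) ^ p)"
  proof -
    have b: "\<bar>bc n (Suc p) * s ^ Suc p\<bar> \<le> bc n 0 * (s / 6) * (s / 6) ^ p" for p
    proof -
      have "\<bar>bc n (Suc p)\<bar> \<le> real (fact (Suc p)) * \<bar>bc n (Suc p)\<bar>"
        using mult_right_mono[OF fact_ge_1[of "Suc p", where 'a = real], of "\<bar>bc n (Suc p)\<bar>"] by (simp del: fact_Suc)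
      also have "\<dots> \<le> bc n 0 * (1/6) ^ Suc p" by (rule abs_bc_le)
      finally have "\<bar>bc n (Suc p)\<bar> * s ^ Suc p \<le> bc n 0 * (1/6) ^ Suc p * s ^ Suc p" using s by (intro mult_right_mono) auto
      thus ?thesis using s by (simp add: abs_mult power_divide power_mult_distrib algebra_simps)
    qed
    have sm: "summable (%p. bc n 0 * (s / 6) * (s / 6) ^ p)" using geo by (intro summable_mult sums_summable)
    have sa: "summable (%p. \<bar>bc n (Suc p) * s ^ Suc p\<bar>)"
      by (rule summable_comparison_test'[OF sm]) (use b in auto)
    have "\<bar>\<Sum>p. bc n (Suc p) * s ^ Suc p\<bar> \<le> (\<Sum>p. \<bar>bc n (Suc p) * s ^ Suc p\<bar>)" by (rule summable_rabs[OF sa])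
    also have "\<dots> \<le> (\<Sum>p. bc n 0 * (s / 6) * (s / 6) ^ p)" by (intro suminf_le b sa sm)
    finally show ?thesis .
  qed
  moreover have "(\<Sum>p. bc n 0 * (s / 6) * (s / 6) ^ p) = bc n 0 * (s / 6) * (1 / (1 - s / 6))"
    using geo by (intro sums_unique[symmetric] sums_mult)
  moreover have "bc n 0 * (s / 6) * (1 / (1 - s / 6)) \<le> bc n 0 * (s / 6) * (6 / 5)"
    using g5 s bc0_pos[of n] by (intro mult_left_mono) auto
  moreover have "bc n 0 * (s / 6) * (6 / 5) = bc n 0 * s / 5" by simp
  ultimately show "\<bar>bF n s - bc n 0\<bar> \<le> bc n 0 * s / 5" by linarith
  have b: "\<bar>diffs (bc n) p * s ^ p\<bar> \<le> bc n 0 / 6 * (s / 6) ^ p" for p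
  proof -
    have "\<bar>diffs (bc n) p\<bar> = real (Suc p) * \<bar>bc n (Suc p)\<bar>" by (simp add: diffs_def abs_mult)
    also have "\<dots> \<le> real (fact (Suc p)) * \<bar>bc n (Suc p)\<bar>"
    proof (rule mult_right_mono)
      have "real (Suc p) * 1 \<le> real (Suc p) * fact p" by (rule mult_left_mono[OF fact_ge_1]) simp
      thus "real (Suc p) \<le> real (fact (Suc p))" by (simp add: distrib_right)
    qed simp
    also have "\<dots> \<le> bc n 0 * (1/6) ^ Suc p" by (rule abs_bc_le)
    finally have "\<bar>diffs (bc n) p\<bar> * s ^ p \<le> bc n 0 * (1/6) ^ Suc p * s ^ p" using s by (intro mult_right_mono) auto
    thus ?thesis using s by (simp add: abs_mult power_divide power_mult_distrib algebra_simps)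
  qed
  have sm: "summable (%p. bc n 0 / 6 * (s / 6) ^ p)" using geo by (intro summable_mult sums_summable)
  have sa: "summable (%p. \<bar>diffs (bc n) p * s ^ p\<bar>)"
    by (rule summable_comparison_test'[OF sm]) (use b in auto)
  have "\<bar>bF' n s\<bar> \<le> (\<Sum>p. \<bar>diffs (bc n) p * s ^ p\<bar>)" unfolding bF'_def by (rule summable_rabs[OF sa])
  also have "\<dots> \<le> (\<Sum>p. bc n 0 / 6 * (s / 6) ^ p)" by (intro suminf_le b sa sm)
  also have "\<dots> = bc n 0 / 6 * (1 / (1 - s / 6))" using geo by (intro sums_unique[symmetric] sums_mult)
  also have "\<dots> \<le> bc n 0 / 6 * (6 / 5)" using g5 bc0_pos[of n] by (intro mult_left_mono) auto
  finally show "\<bar>bF' n s\<bar> \<le> bc n 0 / 5" by simp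
qed

lemma spherical_bessel_j_eq: "spherical_bessel_j n t = t ^ n * bF n (t\<^sup>2)"
proof -
  have "spherical_bessel_j n t = (\<Sum>p. t ^ n * (bc n p * (t\<^sup>2) ^ p))"
    unfolding spherical_bessel_j_def bc_def
    by (intro suminf_cong) (simp add: power_add power_mult)
  thus ?thesis unfolding bF_def by (simp add: suminf_mult[OF bc_summable])
qed

text \<open>The factor r removes the first-order term of the radial equation and leaves y'' =
  (n(n+1)/r^2 - k^2) y, the form required by the Wronskian arguments. \<open>Zj'\<close> is the
  derivative, written through \<open>bF\<close> so that it makes sense at r = 0.\<close>

definition Zj :: "nat => real => real => real" where
  "Zj n k r = r * spherical_bessel_j n (k * r)"

definition Zj' :: "nat => real => real => real" where
  "Zj' n k r = (k * r) ^ n * (real (Suc n) * bF n ((k * r)\<^sup>2) + 2 * (k * r)\<^sup>2 * bF' n ((k * r)\<^sup>2))"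

lemma Zj_eq: "Zj n k r = k ^ n * r ^ Suc n * bF n ((k * r)\<^sup>2)"
  by (simp add: Zj_def spherical_bessel_j_eq power_mult_distrib)

lemma Zj_deriv:
  assumes n: "n \<ge> 1"
  shows "(Zj n k has_real_derivative Zj' n k r) (at r)"
    and "r \<noteq> 0 ==> (Zj' n k has_real_derivative (real (n * (n + 1)) / r\<^sup>2 - k\<^sup>2) * Zj n k r) (at r)"
    and "isCont (Zj' n k) r"
proof -
  have dq: "((%r. (k * r)\<^sup>2) has_real_derivative 2 * k\<^sup>2 * r) (at r)"
    by (auto intro!: derivative_eq_intros simp: power2_eq_square)
  have d1: "((%r. bF n ((k * r)\<^sup>2)) has_real_derivative bF' n ((k * r)\<^sup>2) * (2 * k\<^sup>2 * r)) (at r)"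
    by (rule DERIV_chain2[OF bF_deriv(1) dq])
  have d2: "((%r. bF' n ((k * r)\<^sup>2)) has_real_derivative bF'' n ((k * r)\<^sup>2) * (2 * k\<^sup>2 * r)) (at r)"
    by (rule DERIV_chain2[OF bF_deriv(2) dq])
  have "((%r. k ^ n * r ^ Suc n * bF n ((k * r)\<^sup>2)) has_real_derivative
     k ^ n * (real (Suc n) * r ^ n) * bF n ((k * r)\<^sup>2) + k ^ n * r ^ Suc n * (bF' n ((k * r)\<^sup>2) * (2 * k\<^sup>2 * r))) (at r)"
    by (rule derivative_eq_intros d1 refl | simp)+
  thus "(Zj n k has_real_derivative Zj' n k r) (at r)"
    unfolding Zj_eq[abs_def] Zj'_def by (simp add: power_mult_distrib algebra_simps power2_eq_square)
  have dn: "((%r. (k * r) ^ n) has_real_derivative real n * k ^ n * r ^ (n - 1)) (at r)"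
    unfolding power_mult_distrib by (auto intro!: derivative_eq_intros)
  have D: "(Zj' n k has_real_derivative
     real n * k ^ n * r ^ (n - 1) * (real (Suc n) * bF n ((k * r)\<^sup>2) + 2 * (k * r)\<^sup>2 * bF' n ((k * r)\<^sup>2))
     + (k * r) ^ n * (real (Suc n) * (bF' n ((k * r)\<^sup>2) * (2 * k\<^sup>2 * r))
        + (2 * (2 * k\<^sup>2 * r) * bF' n ((k * r)\<^sup>2) + 2 * (k * r)\<^sup>2 * (bF'' n ((k * r)\<^sup>2) * (2 * k\<^sup>2 * r))))) (at r)"
    unfolding Zj'_def[abs_def]
    by (rule DERIV_cong, (rule DERIV_mult dn DERIV_add DERIV_cmult d1 d2 dq)+) (simp add: algebra_simps)
  thus "isCont (Zj' n k) r" by (rule DERIV_isCont)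
  assume r: "r \<noteq> 0"
  obtain m where m: "n = Suc m" using n by (cases n) auto
  let ?F = "bF n ((k * r)\<^sup>2)" and ?F' = "bF' n ((k * r)\<^sup>2)" and ?F'' = "bF'' n ((k * r)\<^sup>2)"
  have ode: "?F = - (4 * (k * r)\<^sup>2 * ?F'' + real (4 * n + 6) * ?F')" using bF_ode[of "(k * r)\<^sup>2" n] by linarith
  have "real n * k ^ n * r ^ (n - 1) * (real (Suc n) * ?F + 2 * (k * r)\<^sup>2 * ?F')
     + (k * r) ^ n * (real (Suc n) * (?F' * (2 * k\<^sup>2 * r))
        + (2 * (2 * k\<^sup>2 * r) * ?F' + 2 * (k * r)\<^sup>2 * (?F'' * (2 * k\<^sup>2 * r))))
     = k ^ n * r ^ m * (real (n * (n + 1)) * ?F + (k * r)\<^sup>2 * (4 * (k * r)\<^sup>2 * ?F'' + real (4 * n + 6) * ?F'))"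
    unfolding m by (simp add: power_mult_distrib algebra_simps power2_eq_square)
  also have "\<dots> = k ^ n * r ^ m * (real (n * (n + 1)) * ?F - (k * r)\<^sup>2 * ?F)"
    using bF_ode[of "(k * r)\<^sup>2" n] by (simp add: eq_neg_iff_add_eq_0[symmetric])
  also have "\<dots> = (real (n * (n + 1)) / r\<^sup>2 - k\<^sup>2) * Zj n k r"
    using r unfolding Zj_eq m by (simp add: field_simps power2_eq_square)
  finally show "(Zj' n k has_real_derivative (real (n * (n + 1)) / r\<^sup>2 - k\<^sup>2) * Zj n k r) (at r)"
    using D by simp
qed

lemma Zj_pos:
  assumes "0 < r" "0 < k" "k * r \<le> 1"
  shows "Zj n k r > 0"
proof -
  have s: "0 \<le> (k * r)\<^sup>2" "(k * r)\<^sup>2 \<le> 1" using assms by (auto simp: power_le_one)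
  have "bF n ((k * r)\<^sup>2) > 0"
    using bF_bound(1)[OF s, of n] bc0_pos[of n] mult_left_mono[OF s(2), of "bc n 0"] by linarith
  thus ?thesis unfolding Zj_eq using assms by simp
qed

text \<open>The leading coefficient of Z' - 2 Z is n - 1, so n \<ge> 2 gives at least 4/5 of
  \<open>bc n 0\<close>, against at most 2/5 from the derivative of \<open>bF\<close>. This sign
  lets \<open>matching_coefficients\<close> exploit \<delta> < 1.\<close>

lemma Zj_traction_pos:
  assumes n: "n \<ge> 2" and k: "0 < k" "k \<le> 1"
  shows "Zj' n k 1 > 2 * Zj n k 1"
proof -
  have s: "0 \<le> k\<^sup>2" "k\<^sup>2 \<le> 1" using k by (auto simp: power_le_one)
  let ?c = "bc n 0"
  have c: "?c > 0" by (rule bc0_pos)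
  have "bF n (k\<^sup>2) \<ge> 4 / 5 * ?c" using bF_bound(1)[OF s, of n] mult_left_mono[OF s(2), of ?c] c by linarith
  hence 1: "real (n - 1) * bF n (k\<^sup>2) \<ge> 1 * (4 / 5 * ?c)" using n c by (intro mult_mono) auto
  have "\<bar>k\<^sup>2 * bF' n (k\<^sup>2)\<bar> \<le> 1 * (?c / 5)" unfolding abs_mult using s bF_bound(2)[OF s, of n] by (intro mult_mono) auto
  hence "real (n - 1) * bF n (k\<^sup>2) + 2 * k\<^sup>2 * bF' n (k\<^sup>2) > 0" using 1 c by linarith
  hence "k ^ n * (real (n - 1) * bF n (k\<^sup>2) + 2 * k\<^sup>2 * bF' n (k\<^sup>2)) > 0" using k by simp
  moreover have "Zj' n k 1 - 2 * Zj n k 1 = k ^ n * (real (n - 1) * bF n (k\<^sup>2) + 2 * k\<^sup>2 * bF' n (k\<^sup>2))"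
    using n unfolding Zj_eq Zj'_def by (simp add: algebra_simps of_nat_diff)
  ultimately show ?thesis by linarith
qed

text \<open>The Wronskian of the two solutions is 0 at the origin and has derivative (k2^2 - k1^2)
  times a positive product. In other words the logarithmic derivative at 1 decreases with the wave
  number.\<close>

lemma Zj_sturm:
  assumes n: "n \<ge> 1" and k: "0 < k1" "k1 < k2" "k2 \<le> 1"
  shows "Zj n k1 1 * Zj' n k2 1 < Zj' n k1 1 * Zj n k2 1"
proof -
  define W where "W r = Zj' n k1 r * Zj n k2 r - Zj n k1 r * Zj' n k2 r" for r
  have "W 0 < W 1"
  proof (rule DERIV_pos_imp_increasing_open[of 0 1])
    fix r :: real assume r: "0 < r" "r < 1"
    have "(W has_real_derivative (real (n * (n + 1)) / r\<^sup>2 - k1\<^sup>2) * Zj n k1 r * Zj n k2 r + Zj' n k2 r * Zj' n k1 r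
       - (Zj' n k1 r * Zj' n k2 r + (real (n * (n + 1)) / r\<^sup>2 - k2\<^sup>2) * Zj n k2 r * Zj n k1 r)) (at r)"
      unfolding W_def[abs_def] using r n by (intro DERIV_diff DERIV_mult Zj_deriv) auto
    moreover have "(real (n * (n + 1)) / r\<^sup>2 - k1\<^sup>2) * Zj n k1 r * Zj n k2 r + Zj' n k2 r * Zj' n k1 r
       - (Zj' n k1 r * Zj' n k2 r + (real (n * (n + 1)) / r\<^sup>2 - k2\<^sup>2) * Zj n k2 r * Zj n k1 r)
       = (k2\<^sup>2 - k1\<^sup>2) * (Zj n k1 r * Zj n k2 r)" by (simp add: algebra_simps)
    moreover have "(k2\<^sup>2 - k1\<^sup>2) * (Zj n k1 r * Zj n k2 r) > 0"
    proof (intro mult_pos_pos Zj_pos)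
      show "k2\<^sup>2 - k1\<^sup>2 > 0" using power_strict_mono[of k1 k2 2] k by simp
      show "k1 * r \<le> 1" "k2 * r \<le> 1" using mult_mono[of k1 1 r 1] mult_mono[of k2 1 r 1] k r by auto
    qed (use k r in auto)
    ultimately show "\<exists>y. (W has_real_derivative y) (at r) \<and> y > 0" by auto
  next
    have "continuous_on {0..1} (Zj n k)" for k
      by (intro continuous_at_imp_continuous_on ballI DERIV_isCont[OF Zj_deriv(1)[OF n]])
    moreover have "continuous_on {0..1} (Zj' n k)" for k
      by (intro continuous_at_imp_continuous_on ballI Zj_deriv(3) n)
    ultimately show "continuous_on {0..1} W" unfolding W_def by (intro continuous_intros)
  qed simp
  moreover have "W 0 = 0" using n by (simp add: W_def Zj_eq)
  ultimately show ?thesis by (simp add: W_def)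
qed

text \<open>Both values of \<open>bF\<close> lie within the fraction k r / 5 of
  \<open>bc n 0\<close>, because (k r)^2 \<le> k r; the power factors have quotient exactly
  \<open>g ^ n\<close>.\<close>

lemma Zj_ratio:
  assumes k: "0 < k" "k * r \<le> 1" "0 < r" and g: "0 < g" "g \<le> 1"
  shows "Zj n k (g * r) / (g * r) * (1 - k * r / 5) \<le> g ^ n * (1 + k * r / 5) * (Zj n k r / r)"
proof -
  have t: "0 < k * r" using k by simp
  have kr: "0 \<le> k * r" using t by simp
  have s1: "0 \<le> (k * r)\<^sup>2" by simp
  have s1': "(k * r)\<^sup>2 \<le> 1" by (rule power_le_one[OF kr k(2)])
  have s1'': "(k * r)\<^sup>2 \<le> k * r" unfolding power2_eq_square by (rule mult_left_le[OF k(2) kr])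
  note s1 = s1 s1' s1''
  have "g * (k * r) \<le> 1 * (k * r)" by (rule mult_right_mono[OF g(2) kr])
  moreover have "0 \<le> g * (k * r)" using g kr by simp
  moreover have "k * (g * r) = g * (k * r)" by simp
  ultimately have gt: "k * (g * r) \<le> k * r" "0 \<le> k * (g * r)" by linarith+
  have s2: "0 \<le> (k * (g * r))\<^sup>2" by simp
  have s2': "(k * (g * r))\<^sup>2 \<le> (k * r)\<^sup>2" by (rule power_mono[OF gt])
  note s2 = s2 s2'
  let ?c = "bc n 0"
  have c: "?c > 0" by (rule bc0_pos)
  have A: "bF n ((k * (g * r))\<^sup>2) \<le> ?c * (1 + k * r / 5)"
  proof -
    have "?c * (k * (g * r))\<^sup>2 \<le> ?c * (k * r)" using s1 s2 c by (intro mult_left_mono) auto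
    moreover have "\<bar>bF n ((k * (g * r))\<^sup>2) - ?c\<bar> \<le> ?c * (k * (g * r))\<^sup>2 / 5"
      by (rule bF_bound(1)) (use s1 s2 in linarith)+
    moreover have "?c * (1 + k * r / 5) = ?c + ?c * (k * r) / 5" by (simp add: distrib_left)
    ultimately show ?thesis by linarith
  qed
  have B: "?c * (1 - k * r / 5) \<le> bF n ((k * r)\<^sup>2)"
  proof -
    have "?c * (k * r)\<^sup>2 \<le> ?c * (k * r)" using s1 c by (intro mult_left_mono) auto
    moreover have "\<bar>bF n ((k * r)\<^sup>2) - ?c\<bar> \<le> ?c * (k * r)\<^sup>2 / 5"
      by (rule bF_bound(1)) (use s1 in linarith)+
    moreover have "?c * (1 - k * r / 5) = ?c - ?c * (k * r) / 5" by (simp add: right_diff_distrib)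
    ultimately show ?thesis by linarith
  qed
  have x1: "0 \<le> 1 - k * r / 5" using k by simp
  have "bF n ((k * (g * r))\<^sup>2) * (1 - k * r / 5) * ?c \<le> ?c * (1 + k * r / 5) * (1 - k * r / 5) * ?c"
    using A x1 c by (intro mult_right_mono) auto
  also have "\<dots> = ?c * (1 - k * r / 5) * ((1 + k * r / 5) * ?c)" by (simp only: mult.commute mult.left_commute)
  also have "\<dots> \<le> bF n ((k * r)\<^sup>2) * ((1 + k * r / 5) * ?c)"
    using t c by (intro mult_right_mono B) auto
  finally have "bF n ((k * (g * r))\<^sup>2) * (1 - k * r / 5) * ?c \<le> bF n ((k * r)\<^sup>2) * (1 + k * r / 5) * ?c"
    by (simp only: mult.assoc)
  hence "bF n ((k * (g * r))\<^sup>2) * (1 - k * r / 5) \<le> bF n ((k * r)\<^sup>2) * (1 + k * r / 5)" using c by simp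
  hence *: "k ^ n * r ^ n * g ^ n * (bF n ((k * (g * r))\<^sup>2) * (1 - k * r / 5)) \<le> k ^ n * r ^ n * g ^ n * (bF n ((k * r)\<^sup>2) * (1 + k * r / 5))"
    by (rule mult_left_mono) (use k g in auto)
  have e: "Zj n k x / x = k ^ n * x ^ n * bF n ((k * x)\<^sup>2)" if "x > 0" for x
    using that by (simp add: Zj_eq)
  have gr: "g * r > 0" using k g by simp
  show ?thesis
    unfolding e[OF gr] e[OF k(3)] power_mult_distrib[of g r] using * by (simp only: mult.commute mult.left_commute)
qed

section \<open>The outgoing radial function\<close>

text \<open>\<open>Zh n k r\<close> is, up to a constant factor, \<open>r h\<^sub>n\<^sup>(\<^sup>1\<^sup>)(k r)\<close>: the spherical Hankel function is
  elementary, and \<open>ha\<close> lists the coefficients of its polynomial part in \<open>\<i> / (k r)\<close>.\<close>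

fun ha :: "nat => nat => real" where
  "ha n 0 = 1"
| "ha n (Suc j) = ha n j * (real (n * (n + 1)) - real (j * (j + 1))) / (2 * real (Suc j))"

definition hb :: "nat => real => nat => complex" where
  "hb n k j = of_real (ha n j) * (\<i> / of_real k) ^ j"

definition hw :: "nat => real => real => complex" where
  "hw n k r = (\<Sum>j\<le>n. hb n k j * of_real (1 / r) ^ j)"

definition hw' :: "nat => real => real => complex" where
  "hw' n k r = (\<Sum>j\<le>n. - (of_nat j * hb n k j * of_real (1 / r) ^ (j + 1)))"

definition hw'' :: "nat => real => real => complex" where
  "hw'' n k r = (\<Sum>j\<le>n. of_nat (j * (j + 1)) * hb n k j * of_real (1 / r) ^ (j + 2))"

definition Zh :: "nat => real => real => complex" where
  "Zh n k r = cis (k * r) * hw n k r"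

definition Zh' :: "nat => real => real => complex" where
  "Zh' n k r = cis (k * r) * (hw' n k r + \<i> * of_real k * hw n k r)"

text \<open>The quotient of consecutive coefficients is (n - j)(n + j + 1) / (2 (j + 1)), at least 1
  for j < n. Thus the top coefficient is the largest, for every n.\<close>

lemma ha_mono: "j < n ==> 0 < ha n j \<and> ha n j \<le> ha n (Suc j)"
proof (induction j)
  case 0
  thus ?case using mult_mono[of 1 "real n" 1 "real n"] by (simp add: algebra_simps)
next
  case (Suc j)
  hence p: "0 < ha n (Suc j)" by auto
  have "2 * (Suc j + 1) \<le> (n - Suc j) * (n + Suc j + 1)"
    using Suc.prems mult_le_mono[of 1 "n - Suc j" "2 * (Suc j + 1)" "n + Suc j + 1"] by auto
  hence "2 * real (Suc j + 1) \<le> real (n - Suc j) * real (n + Suc j + 1)"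
    by (metis of_nat_le_iff of_nat_mult of_nat_numeral)
  also have "\<dots> = real (n * (n + 1)) - real (Suc j * (Suc j + 1))"
    using Suc.prems by (simp add: of_nat_diff algebra_simps)
  finally have "1 \<le> (real (n * (n + 1)) - real (Suc j * (Suc j + 1))) / (2 * real (Suc (Suc j)))"
    by (simp add: le_divide_eq)
  from mult_left_mono[OF this, of "ha n (Suc j)"] p show ?case by simp
qed

lemma ha_pos: "j \<le> n ==> ha n j > 0"
  using ha_mono[of "j - 1" n] by (cases j) (auto intro: less_le_trans)

lemma ha_le: "j \<le> n ==> ha n j \<le> ha n n"
proof (induction rule: inc_induct)
  case (step m) thus ?case using ha_mono[of m n] by simp
qed simp

lemma hb_Suc: "k \<noteq> 0 ==> 2 * \<i> * of_real k * of_nat (Suc j) * hb n k (Suc j) = (of_nat (j * (j + 1)) - of_nat (n * (n + 1))) * hb n k j"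
proof -
  assume k: "k \<noteq> 0"
  have "2 * \<i> * of_real k * of_nat (Suc j) * hb n k (Suc j) = (2 * \<i> * (of_real k * (\<i> / of_real k))) * (of_real (real (Suc j) * ha n (Suc j))) * (\<i> / of_real k) ^ j"
    unfolding hb_def power_Suc of_real_mult of_real_of_nat_eq by (simp only: mult_ac)
  also have "of_real k * (\<i> / of_real k) = \<i>" using k by simp
  also have "real (Suc j) * ha n (Suc j) = ha n j * (real (n * (n + 1)) - real (j * (j + 1))) / 2"
    by (simp del: of_nat_Suc of_nat_mult of_nat_add)
  finally have E: "2 * \<i> * of_real k * of_nat (Suc j) * hb n k (Suc j)
    = 2 * \<i> * \<i> * of_real (ha n j * (real (n * (n + 1)) - real (j * (j + 1))) / 2) * (\<i> / of_real k) ^ j" .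
  have half: "2 * \<i> * \<i> * complex_of_real (x / 2) = - of_real x" for x :: real by simp
  show ?thesis unfolding E half unfolding hb_def by (simp add: algebra_simps)
qed

lemma hw_deriv:
  assumes r: "r > 0"
  shows "(hw n k hvd hw' n k r) (at r)" "(hw' n k hvd hw'' n k r) (at r)"
proof -
  have d: "((%r. complex_of_real (1 / r) ^ j) hvd - (of_nat j * of_real (1 / r) ^ (j + 1))) (at r)" for j
  proof -
    have "((%r. (1 / r) ^ j) has_real_derivative real j * (1 / r) ^ (j - 1) * (- (1 / r\<^sup>2))) (at r)"
      using r by (auto intro!: derivative_eq_intros simp: power2_eq_square)
    moreover have "real j * (1 / r) ^ (j - 1) * (- (1 / r\<^sup>2)) = - (real j * (1 / r) ^ (j + 1))"
      using r by (cases j) (simp_all add: power2_eq_square)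
    ultimately have "((%r. (1 / r) ^ j) has_real_derivative - (real j * (1 / r) ^ (j + 1))) (at r)" by simp
    from has_vector_derivative_of_real[OF this, where 'a = complex] show ?thesis by simp
  qed
  show "(hw n k hvd hw' n k r) (at r)"
    unfolding hw_def[abs_def] hw'_def
  proof (intro hvd_sum)
    fix j
    show "((%r. hb n k j * of_real (1 / r) ^ j) hvd - (of_nat j * hb n k j * of_real (1 / r) ^ (j + 1))) (at r)"
      using hvd_mult_right[OF d[of j], of "hb n k j"] by (simp add: mult_ac)
  qed
  show "(hw' n k hvd hw'' n k r) (at r)"
    unfolding hw'_def[abs_def] hw''_def
  proof (intro hvd_sum)
    fix j
    show "((%r. - (of_nat j * hb n k j * of_real (1 / r) ^ (j + 1))) hvd of_nat (j * (j + 1)) * hb n k j * of_real (1 / r) ^ (j + 2)) (at r)"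
      by (rule has_vector_derivative_rhs[OF hvd_minus[OF hvd_mult_right[OF d]]])
         (simp add: algebra_simps add_divide_distrib)
  qed
qed

text \<open>By \<open>hb_Suc\<close> the j-th term of one sum equals the next term of the other, so
  their difference telescopes; it ends at j = n because n(n+1) - j(j+1) vanishes there.\<close>

lemma hw_ode:
  assumes k: "k \<noteq> 0"
  shows "hw'' n k r + 2 * \<i> * of_real k * hw' n k r = of_nat (n * (n + 1)) * of_real (1 / r) ^ 2 * hw n k r"
proof -
  let ?q = "complex_of_real (1 / r)"
  define G where "G j = of_nat (j * (j + 1)) * hb n k j * ?q ^ (j + 2) - of_nat (n * (n + 1)) * hb n k j * ?q ^ (j + 2)" for j
  define H where "H j = 2 * \<i> * of_real k * of_nat j * hb n k j * ?q ^ (j + 1)" for j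
  have GH: "G j = H (Suc j)" for j
    unfolding G_def H_def hb_Suc[OF k] by (simp add: algebra_simps)
  have "(\<Sum>j\<le>n. G j) - (\<Sum>j\<le>n. H j) = (\<Sum>j\<le>n. H (Suc j) - H j)" unfolding GH by (simp add: sum_subtractf)
  also have "\<dots> = H (Suc n) - H 0" by (rule sum_lessThan_telescope[of H "Suc n", unfolded lessThan_Suc_atMost])
  also have "\<dots> = 0" unfolding GH[symmetric] by (simp add: G_def H_def)
  finally have "(\<Sum>j\<le>n. G j) = (\<Sum>j\<le>n. H j)" by simp
  moreover have "(\<Sum>j\<le>n. G j) = hw'' n k r - of_nat (n * (n + 1)) * ?q ^ 2 * hw n k r"
    unfolding G_def hw''_def hw_def sum_subtractf sum_distrib_left by (simp add: power_add power2_eq_square mult_ac)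
  moreover have "(\<Sum>j\<le>n. H j) = - (2 * \<i> * of_real k * hw' n k r)"
    unfolding H_def hw'_def sum_distrib_left sum_negf[symmetric] by (simp add: mult_ac)
  ultimately show ?thesis by (simp add: algebra_simps)
qed

lemma Zh_deriv:
  assumes r: "r > 0" and k: "k \<noteq> 0"
  shows "(Zh n k hvd Zh' n k r) (at r)"
    and "(Zh' n k hvd of_real (real (n * (n + 1)) / r\<^sup>2 - k\<^sup>2) * Zh n k r) (at r)"
proof -
  have dc: "((%r. cis (k * r)) hvd \<i> * of_real k * cis (k * r)) (at r)"
  proof -
    have "((%r. k * r) has_real_derivative k) (at r)" by (auto intro!: derivative_eq_intros)
    hence "((%r. k * r) hvd k) (at r)" by (simp add: has_real_derivative_iff_has_vector_derivative)
    moreover have "(cis hvd \<i> * cis t) (at t)" for t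
      unfolding has_vector_derivative_complex_iff by (auto intro!: derivative_eq_intros)
    ultimately have "((cis \<circ> (%r. k * r)) hvd k *\<^sub>R (\<i> * cis (k * r))) (at r)"
      by (intro vector_diff_chain_at)
    thus ?thesis by (simp add: o_def scaleR_conv_of_real mult_ac)
  qed
  show "(Zh n k hvd Zh' n k r) (at r)"
    using hvd_mult[OF dc hw_deriv(1)[OF r]] unfolding Zh_def[abs_def] Zh'_def
    by (rule has_vector_derivative_rhs) (simp add: algebra_simps)
  have "(Zh' n k hvd cis (k * r) * (hw'' n k r + \<i> * of_real k * hw' n k r) + \<i> * of_real k * cis (k * r) * (hw' n k r + \<i> * of_real k * hw n k r)) (at r)"
    unfolding Zh'_def[abs_def]
    by (intro hvd_mult[OF dc] hvd_add hvd_mult_right hw_deriv r)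
  moreover have "cis (k * r) * (hw'' n k r + \<i> * of_real k * hw' n k r) + \<i> * of_real k * cis (k * r) * (hw' n k r + \<i> * of_real k * hw n k r)
     = cis (k * r) * ((hw'' n k r + 2 * \<i> * of_real k * hw' n k r) - (of_real k)\<^sup>2 * hw n k r)"
    by (simp add: algebra_simps power2_eq_square)
  moreover have "\<dots> = of_real (real (n * (n + 1)) / r\<^sup>2 - k\<^sup>2) * Zh n k r"
    unfolding hw_ode[OF k] Zh_def by (simp add: algebra_simps power_divide)
  ultimately show "(Zh' n k hvd of_real (real (n * (n + 1)) / r\<^sup>2 - k\<^sup>2) * Zh n k r) (at r)"
    by simp
qed

lemma hw_lim: "(hw n k ---> 1) at_top" "(hw' n k ---> 0) at_top"
proof -
  have q: "((%r. complex_of_real (1 / r)) ---> 0) at_top"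
    using tendsto_of_real[OF tendsto_inverse_0_at_top[OF filterlim_ident], where 'a = complex] by (simp add: inverse_eq_divide)
  have "((%r. \<Sum>j\<le>n. hb n k j * of_real (1 / r) ^ j) ---> (\<Sum>j\<le>n. hb n k j * 0 ^ j)) at_top"
    by (intro tendsto_sum tendsto_mult tendsto_const tendsto_power q)
  moreover have "(\<Sum>j\<le>n. hb n k j * 0 ^ j) = 1"
    by (subst sum.remove[of _ 0]) (auto simp: hb_def intro!: sum.neutral)
  ultimately show "(hw n k ---> 1) at_top" by (simp add: hw_def[abs_def])
  have "((%r. \<Sum>j\<le>n. - (of_nat j * hb n k j * of_real (1 / r) ^ (j + 1))) ---> (\<Sum>j\<le>n. - (of_nat j * hb n k j * 0 ^ (j + 1)))) at_top"
    by (intro tendsto_sum tendsto_mult tendsto_minus tendsto_const tendsto_power q)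
  thus "(hw' n k ---> 0) at_top" by (simp add: hw'_def[abs_def])
qed

lemma Zh_radiating: "((%r. Zh' n k r - \<i> * of_real k * Zh n k r) ---> 0) at_top"
proof -
  have "((%r. cmod (hw' n k r)) ---> 0) at_top" using hw_lim(2) tendsto_norm_zero by blast
  moreover have "cmod (Zh' n k r - \<i> * of_real k * Zh n k r) = cmod (hw' n k r)" for r
  proof -
    have "Zh' n k r - \<i> * of_real k * Zh n k r = cis (k * r) * hw' n k r"
      unfolding Zh_def Zh'_def by (simp add: algebra_simps)
    thus ?thesis by (simp add: norm_mult)
  qed
  ultimately have "((%r. cmod (Zh' n k r - \<i> * of_real k * Zh n k r)) ---> 0) at_top" by simp
  thus ?thesis by (rule tendsto_norm_zero_cancel)
qed

text \<open>\<open>radial_radiating\<close> makes the Wronskian nonnegative, and a zero value would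
  force the function to vanish, against \<open>hw\<close> tending to 1. That lemma speaks of r > 1;
  continuity carries the value to r = 1.\<close>

lemma Zh_wronskian_pos:
  assumes k: "k > 0"
  shows "Im (cnj (Zh n k 1) * Zh' n k 1) > 0"
proof -
  have "\<exists>W\<ge>0. (\<forall>r>1. Im (cnj (Zh n k r) * Zh' n k r) = W) \<and> (W = 0 \<longrightarrow> (\<forall>r>1. Zh n k r = 0))"
  proof (rule radial_radiating[OF k, where l = "real (n * (n + 1))"])
    fix r :: real assume "r > 1"
    hence "r > 0" by simp
    thus "(Zh n k hvd Zh' n k r) (at r)"
      "(Zh' n k hvd of_real (real (n * (n + 1)) / r\<^sup>2 - k\<^sup>2) * Zh n k r) (at r)"
      using k by (intro Zh_deriv; simp)+
  qed (use Zh_radiating in auto)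
  then obtain W where W: "W \<ge> 0" "\<forall>r>1. Im (cnj (Zh n k r) * Zh' n k r) = W" "W = 0 \<longrightarrow> (\<forall>r>1. Zh n k r = 0)" by blast
  have "W \<noteq> 0"
  proof
    assume "W = 0"
    hence "\<forall>\<^sub>F r in at_top. 0 = cmod (hw n k r)"
      by (intro eventually_mono[OF eventually_gt_at_top[of 1]]) (use W(3) in \<open>simp add: Zh_def\<close>)
    hence "((%r. cmod (hw n k r)) ---> 0) at_top" by (rule Lim_transform_eventually[OF tendsto_const])
    moreover have "((%r. cmod (hw n k r)) ---> cmod 1) at_top" by (intro tendsto_norm hw_lim)
    ultimately show False using tendsto_unique[OF trivial_limit_at_top_linorder] by fastforce
  qed
  moreover have "Im (cnj (Zh n k 1) * Zh' n k 1) = W"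
  proof (rule tendsto_unique[of "at_right (1::real)"])
    have "isCont (Zh n k) 1" "isCont (Zh' n k) 1"
      using Zh_deriv[of 1 k n] k by (auto intro!: has_vector_derivative_continuous)
    hence "(Zh n k ---> Zh n k 1) (at_right 1)" "(Zh' n k ---> Zh' n k 1) (at_right 1)"
      by (auto simp: isCont_def intro: tendsto_within_subset)
    thus "((%r. Im (cnj (Zh n k r) * Zh' n k r)) ---> Im (cnj (Zh n k 1) * Zh' n k 1)) (at_right 1)"
      by (intro tendsto_intros)
    have "\<forall>\<^sub>F r in at_right 1. W = Im (cnj (Zh n k r) * Zh' n k r)"
      by (rule eventually_at_rightI[of 1 2]) (use W(2) in auto)
    thus "((%r. Im (cnj (Zh n k r) * Zh' n k r)) ---> W) (at_right 1)"
      by (rule Lim_transform_eventually[OF tendsto_const])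
  qed simp
  ultimately show ?thesis using W(1) by simp
qed

text \<open>Relative to the top term the remaining ones are at most t + t^2 + ..., hence at most 2 t
  for t = k r \<le> 1/2. The largest coefficient being the top one makes this independent of
  n.\<close>

lemma hw_bound:
  assumes k: "0 < k" "0 < r" "k * r \<le> 1/2"
  shows "\<bar>cmod (hw n k r) - ha n n / (k * r) ^ n\<bar> \<le> 2 * (k * r) * (ha n n / (k * r) ^ n)"
proof -
  define t where "t = k * r"
  have t: "0 < t" "t \<le> 1/2" using k by (auto simp: t_def)
  have trm: "cmod (hb n k j * of_real (1 / r) ^ j) = ha n j / t ^ j" if "j \<le> n" for j
    using ha_pos[OF that] k by (simp add: hb_def norm_mult norm_power norm_divide t_def power_divide power_mult_distrib)
  have "hw n k r = (\<Sum>j<n. hb n k j * of_real (1 / r) ^ j) + hb n k n * of_real (1 / r) ^ n"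
    unfolding hw_def by (simp add: lessThan_Suc_atMost[symmetric])
  hence "\<bar>cmod (hw n k r) - cmod (hb n k n * of_real (1 / r) ^ n)\<bar> \<le> cmod (\<Sum>j<n. hb n k j * of_real (1 / r) ^ j)"
    using norm_triangle_ineq3[of "hw n k r" "hb n k n * of_real (1 / r) ^ n"] by simp
  also have "\<dots> \<le> (\<Sum>j<n. ha n j / t ^ j)" by (rule sum_norm_le, rule eq_refl, rule trm) simp
  also have "\<dots> \<le> (\<Sum>j<n. ha n n / t ^ n * t ^ (n - j))"
  proof (rule sum_mono)
    fix j assume "j \<in> {..<n}"
    hence j: "j < n" by simp
    have "ha n j / t ^ j \<le> ha n n / t ^ j" using t ha_le[of j n] j by (intro divide_right_mono) auto
    also have "\<dots> = ha n n / t ^ n * t ^ (n - j)" using t j by (simp add: power_diff)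
    finally show "ha n j / t ^ j \<le> ha n n / t ^ n * t ^ (n - j)" .
  qed
  also have "\<dots> = ha n n / t ^ n * (\<Sum>j<n. t ^ Suc j)"
    unfolding sum_distrib_left[symmetric] by (subst sum.nat_diff_reindex[symmetric]) (intro arg_cong[where f = "%x. _ * x"] sum.cong; simp)
  also have "\<dots> \<le> ha n n / t ^ n * (2 * t)"
  proof (rule mult_left_mono)
    have "(\<Sum>j<n. t ^ Suc j) = t * (\<Sum>j<n. t ^ j)" by (simp add: sum_distrib_left)
    also have "(\<Sum>j<n. t ^ j) = (1 - t ^ n) / (1 - t)" using t by (subst sum_gp_strict) auto
    also have "t * ((1 - t ^ n) / (1 - t)) \<le> t * 2"
    proof (rule mult_left_mono)
      have "0 \<le> t ^ n" using t by simp
      hence "1 - t ^ n \<le> 1" by simp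
      also have "1 \<le> 2 * (1 - t)" using t by (simp add: algebra_simps)
      finally have "1 - t ^ n \<le> 2 * (1 - t)" .
      thus "(1 - t ^ n) / (1 - t) \<le> 2" using t by (subst pos_divide_le_eq) auto
    qed (use t in simp)
    finally show "(\<Sum>j<n. t ^ Suc j) \<le> 2 * t" by simp
    show "0 \<le> ha n n / t ^ n" using t ha_pos[of n n] by simp
  qed
  finally show ?thesis unfolding trm[OF order_refl] t_def by (simp add: mult_ac)
qed

text \<open>\<open>hw_bound\<close> at both radii: the leading terms have quotient exactly g^(-n),
  and the two factors are the relative errors. The exponential has modulus 1.\<close>

lemma Zh_ratio:
  assumes k: "0 < k" "0 < r" "k * (g * r) \<le> 1/2" and g: "1 \<le> g"
  shows "cmod (Zh n k (g * r)) * g ^ n * (1 - 2 * (k * r)) \<le> (1 + 2 * (k * (g * r))) * cmod (Zh n k r)"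
proof -
  have "1 * (k * r) \<le> g * (k * r)" using k g by (intro mult_right_mono) auto
  moreover have "g * (k * r) = k * (g * r)" by simp
  ultimately have kr: "k * r \<le> 1/2" using k by linarith
  let ?A = "ha n n / (k * r) ^ n"
  have A: "?A > 0" using ha_pos[of n n] k by simp
  have eq: "ha n n / (k * (g * r)) ^ n * g ^ n = ?A" using g k by (simp add: power_mult_distrib)
  have "cmod (hw n k (g * r)) \<le> (1 + 2 * (k * (g * r))) * (ha n n / (k * (g * r)) ^ n)"
  proof -
    have "\<bar>cmod (hw n k (g * r)) - ha n n / (k * (g * r)) ^ n\<bar> \<le> 2 * (k * (g * r)) * (ha n n / (k * (g * r)) ^ n)"
      using k g by (intro hw_bound) auto
    thus ?thesis unfolding distrib_right by linarith
  qed
  hence "cmod (hw n k (g * r)) * g ^ n \<le> (1 + 2 * (k * (g * r))) * (ha n n / (k * (g * r)) ^ n) * g ^ n"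
    using g by (intro mult_right_mono) auto
  hence 1: "cmod (hw n k (g * r)) * g ^ n \<le> (1 + 2 * (k * (g * r))) * ?A" using eq by (simp only: mult.assoc)
  have 2: "(1 - 2 * (k * r)) * ?A \<le> cmod (hw n k r)"
    using hw_bound[OF k(1,2) kr, of n] unfolding left_diff_distrib by linarith
  have "cmod (hw n k (g * r)) * g ^ n * (1 - 2 * (k * r)) \<le> (1 + 2 * (k * (g * r))) * ?A * (1 - 2 * (k * r))"
    using 1 kr by (intro mult_right_mono) auto
  also have "\<dots> = (1 + 2 * (k * (g * r))) * ((1 - 2 * (k * r)) * ?A)" by (simp only: mult_ac)
  also have "\<dots> \<le> (1 + 2 * (k * (g * r))) * cmod (hw n k r)"
    using 2 k g by (intro mult_left_mono) auto
  finally show ?thesis by (simp add: Zh_def norm_mult)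
qed

section \<open>Spherical harmonics\<close>

text \<open>For p = (x^2 - 1)^n one has (x^2 - 1) p' = 2 n x p; the identity is this relation
  differentiated k + 1 times.\<close>

lemma legendre_ode_step:
  fixes n k :: nat
  defines "D \<equiv> %k. (pderiv ^^ k) ([:-1, 0, 1:] ^ n) :: real poly"
  shows "[:-1, 0, 1:] * D (k + 2) + smult (2 * real k + 2 - 2 * real n) ([:0, 1:] * D (k + 1))
     + smult (real k * (real k + 1) - 2 * real n * (real k + 1)) (D k) = 0"
proof (induction k)
  case 0
  have D0: "[:-1, 0, 1:] * D 1 = smult (2 * real n) ([:0, 1:] * D 0)"
  proof (cases n)
    case 0 thus ?thesis by (simp add: D_def)
  next
    case (Suc m)
    show ?thesis unfolding D_def Suc by (simp add: pderiv_power_Suc pderiv_pCons algebra_simps del: power_Suc) (simp add: algebra_simps flip: smult_add_left)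
  qed
  have "pderiv ([:-1, 0, 1:] * D 1) = pderiv (smult (2 * real n) ([:0, 1:] * D 0))" by (simp only: D0)
  moreover have "pderiv (D 0) = D 1" "pderiv (D 1) = D 2" by (simp_all add: D_def numeral_2_eq_2)
  ultimately have "poly ([:-1, 0, 1:] * D 2 + [:0, 2:] * D 1) = poly (smult (2 * real n) ([:0, 1:] * D 1 + D 0))"
    unfolding pderiv_mult pderiv_smult by (simp add: pderiv_pCons algebra_simps)
  thus ?case unfolding poly_eq_poly_eq_iff[symmetric] fun_eq_iff
    by (simp add: algebra_simps numeral_2_eq_2)
next
  case (Suc k)
  have dD: "pderiv (D k) = D (Suc k)" for k by (simp add: D_def)
  have "pderiv ([:-1, 0, 1:] * D (k + 2) + smult (2 * real k + 2 - 2 * real n) ([:0, 1:] * D (k + 1))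
     + smult (real k * (real k + 1) - 2 * real n * (real k + 1)) (D k)) = 0" using Suc by simp
  hence "poly ([:-1, 0, 1:] * D (k + 3) + [:0, 2:] * D (k + 2) + smult (2 * real k + 2 - 2 * real n) ([:0, 1:] * D (k + 2) + D (k + 1))
     + smult (real k * (real k + 1) - 2 * real n * (real k + 1)) (D (k + 1))) = poly 0"
    unfolding pderiv_add pderiv_mult pderiv_smult dD by (simp add: pderiv_pCons numeral_3_eq_3 algebra_simps)
  thus ?case unfolding poly_eq_poly_eq_iff[symmetric] fun_eq_iff
    by (simp add: algebra_simps numeral_3_eq_3 numeral_2_eq_2)
qed

lemma three_neq: "((1::3) = 2) = False" "((1::3) = 3) = False" "((2::3) = 1) = False"
    "((2::3) = 3) = False" "((3::3) = 1) = False" "((3::3) = 2) = False"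
  by simp_all

definition legd :: "nat => nat => real poly" where
  "legd n m = (pderiv ^^ m) (legendre_poly n)"

lemma pderiv_legd: "pderiv (legd n m) = legd n (Suc m)" by (simp add: legd_def)

lemma legd_eq: "legd n m = smult (1 / (2 ^ n * fact n)) ((pderiv ^^ (m + n)) ([:-1, 0, 1:] ^ n))"
proof -
  have "(pderiv ^^ m) (smult c p) = smult c ((pderiv ^^ m) p)" for c and p :: "real poly"
    by (induction m) (simp_all add: pderiv_smult)
  thus ?thesis by (simp add: legd_def legendre_poly_def funpow_add)
qed

text \<open>\<open>legendre_ode_step\<close> at k = m + n, since by Rodrigues' formula n of the
  derivatives already occur in the Legendre polynomial.\<close>

lemma legendre_ode:
  "(1 - t\<^sup>2) * poly (legd n (m + 2)) t - 2 * (real m + 1) * t * poly (legd n (m + 1)) t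
    = (real (m * (m + 1)) - real (n * (n + 1))) * poly (legd n m) t"
proof -
  let ?D = "%k. (pderiv ^^ k) ([:-1, 0, 1:] ^ n) :: real poly"
  have I: "m + n + 2 = m + 2 + n" "m + n + 1 = m + 1 + n" by simp_all
  have "poly ([:-1, 0, 1:] * ?D (m + n + 2) + smult (2 * real (m + n) + 2 - 2 * real n) ([:0, 1:] * ?D (m + n + 1))
     + smult (real (m + n) * (real (m + n) + 1) - 2 * real n * (real (m + n) + 1)) (?D (m + n))) t = 0"
    by (simp only: legendre_ode_step poly_0)
  hence E: "(t * t - 1) * poly (?D (m + 2 + n)) t + (2 * real m + 2) * t * poly (?D (m + 1 + n)) t
     + (real m * real m + real m - real n * real n - real n) * poly (?D (m + n)) t = 0"
    unfolding I by (simp add: algebra_simps)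
  have "c * ((t * t - 1) * poly (?D (m + 2 + n)) t + (2 * real m + 2) * t * poly (?D (m + 1 + n)) t
     + (real m * real m + real m - real n * real n - real n) * poly (?D (m + n)) t) = 0" for c
    unfolding E by simp
  from this[of "1 / (2 ^ n * fact n)"] show ?thesis
    unfolding legd_eq poly_smult by (simp add: algebra_simps power2_eq_square add_divide_distrib diff_divide_distrib)
qed

text \<open>The polynomial (x^2 - 1)^n has degree 2n, and m + n \<le> 2n derivatives leave degree n
  - m.\<close>

lemma legd_nonzero: assumes "m \<le> n" shows "legd n m \<noteq> 0"
proof -
  have deg: "degree ((pderiv ^^ k) p) = degree p - k" for k and p :: "real poly"
    by (induction k) (simp_all add: degree_pderiv)
  have "degree ([:-1, 0, 1:] ^ n :: real poly) = 2 * n" by (simp add: degree_power_eq)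
  hence d: "degree ((pderiv ^^ (m + n)) ([:-1, 0, 1:] ^ n) :: real poly) = n - m" by (simp add: deg)
  have nz: "(pderiv ^^ k) p \<noteq> 0" if "k \<le> degree p" "p \<noteq> 0" for k and p :: "real poly"
    using that
  proof (induction k)
    case (Suc k) thus ?case using deg[of k p] by (simp add: pderiv_eq_0_iff)
  qed simp
  have "(pderiv ^^ (m + n)) ([:-1, 0, 1:] ^ n :: real poly) \<noteq> 0"
    by (rule nz) (use assms in \<open>simp_all add: degree_power_eq\<close>)
  thus ?thesis by (simp add: legd_eq)
qed

section \<open>Harmonics as Cartesian polynomials\<close>

definition rp :: "real poly => sfield" where
  "rp P x = of_real (poly P (x $ 3))"

lemma has_derivative_rp: "(rp P has_derivative (%v. cx 3 v * rp (pderiv P) x)) (at x)"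
proof -
  have "((%x. poly P (x $ 3)) has_derivative (%v. v $ 3 * poly (pderiv P) (x $ 3))) (at x)"
    by (rule has_derivative_compose[OF bounded_linear_imp_has_derivative[OF bounded_linear_vec_nth] poly_DERIV[unfolded has_field_derivative_def], THEN has_derivative_eq_rhs])
       (simp add: fun_eq_iff mult_ac)
  from has_derivative_of_real[OF this, where 'a = complex]
  show ?thesis unfolding rp_def[abs_def] by simp
qed

lemma rp_differentiable [simp]: "rp P differentiable (at x)"
  using has_derivative_rp by (auto simp: differentiable_def)

lemma partial_rp: "partial j (rp P) x = (if j = 3 then rp (pderiv P) x else 0)"
  unfolding partial_has_derivative[OF has_derivative_rp] by (simp add: axis_def)

lemma continuous_on_rp: "continuous_on S (rp P)"
  unfolding rp_def[abs_def] by (intro continuous_intros)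

lemma C1_on_rp: "C1_on (rp P) S"
proof -
  have "continuous_on S (partial j (rp P))" for j
    unfolding partial_rp[abs_def] by (cases "j = 3") (simp_all add: continuous_on_rp)
  thus ?thesis by (auto simp: C1_on_def)
qed

lemma tg_rp: "tg j (rp P) x = rp (pderiv P) x * tg j (cx 3) x"
  unfolding tg_def partial_rp partial_cx sum_3 by (simp add: algebra_simps)

text \<open>The spherical harmonic \<open>Y\<^sub>n\<^sup>m\<close> is a constant times \<open>(x\<^sub>1 + \<sigma> \<i> x\<^sub>2)\<^sup>|\<^sup>m\<^sup>| P(x\<^sub>3)\<close>, where \<open>P\<close> is the \<open>|m|\<close>-th
  derivative of the Legendre polynomial and \<open>\<sigma>\<close> the sign of \<open>m\<close>.\<close>

definition zs :: "complex => sfield" where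
  "zs \<sigma> x = cx 1 x + \<sigma> * \<i> * cx 2 x"

text \<open>The constant gradient of \<open>zs\<close>. When \<sigma>^2 = 1 it is isotropic, 1 +
  (\<sigma> \<i>)^2 = 0, which is what makes powers of \<open>zs\<close> harmonic.\<close>

definition ev :: "complex => 3 => complex" where
  "ev \<sigma> i = (if i = 1 then 1 else if i = 2 then \<sigma> * \<i> else 0)"

lemma zs_differentiable [simp]: "zs \<sigma> differentiable (at x)"
  unfolding zs_def[abs_def] by (intro differentiable_add differentiable_mult differentiable_cx differentiable_const)

lemma C1_on_zs: "C1_on (zs \<sigma>) S"
  unfolding zs_def[abs_def] by (intro C1_on_add C1_on_mult C1_on_cx C1_on_const)

lemma tg_zs: "tg i (zs \<sigma>) x = ev \<sigma> i - cx i x * zs \<sigma> x"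
  unfolding zs_def[abs_def] ev_def using exhaust_3[of i]
  by (elim disjE) (simp_all add: tg_add tg_mult differentiable_mult algebra_simps)

definition qf :: "complex => nat => real poly => sfield" where
  "qf \<sigma> m P x = zs \<sigma> x ^ m * rp P x"

definition qg :: "complex => nat => real poly => 3 => sfield" where
  "qg \<sigma> m P i x = (of_nat m * zs \<sigma> x ^ (m - 1) * rp P x) * (ev \<sigma> i - cx i x * zs \<sigma> x)
     + qf \<sigma> m (pderiv P) x * ((if i = 3 then 1 else 0) - cx i x * cx 3 x)"

lemma tg_qf: "tg i (qf \<sigma> m P) x = qg \<sigma> m P i x"
  unfolding qf_def[abs_def] qg_def by (simp add: tg_mult tg_power tg_rp tg_zs algebra_simps)

lemma C1_on_qf: "C1_on (qf \<sigma> m P) S"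
  unfolding qf_def[abs_def] by (intro C1_on_mult C1_on_power C1_on_zs C1_on_rp)

lemma qf_differentiable [simp]: "qf \<sigma> m P differentiable (at x)"
  using C1_on_qf[of \<sigma> m P UNIV] by (auto simp: C1_on_def)

lemma C1_on_qg: "C1_on (qg \<sigma> m P i) S"
  unfolding qg_def[abs_def]
  by (intro C1_on_add C1_on_diff C1_on_mult C1_on_power C1_on_zs C1_on_rp C1_on_const C1_on_cx C1_on_qf)

lemma tg_qg: "tg j (qg \<sigma> m P i) x =
   (of_nat (m * (m - 1)) * zs \<sigma> x ^ (m - 2) * rp P x * (ev \<sigma> j - cx j x * zs \<sigma> x)
      + of_nat m * zs \<sigma> x ^ (m - 1) * rp (pderiv P) x * ((if j = 3 then 1 else 0) - cx j x * cx 3 x)) * (ev \<sigma> i - cx i x * zs \<sigma> x)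
   - (of_nat m * zs \<sigma> x ^ (m - 1) * rp P x) * (((if j = i then 1 else 0) - cx j x * cx i x) * zs \<sigma> x + cx i x * (ev \<sigma> j - cx j x * zs \<sigma> x))
   + qg \<sigma> m (pderiv P) j x * ((if i = 3 then 1 else 0) - cx i x * cx 3 x)
   - qf \<sigma> m (pderiv P) x * (((if j = i then 1 else 0) - cx j x * cx i x) * cx 3 x + cx i x * ((if j = 3 then 1 else 0) - cx j x * cx 3 x))"
proof -
  let ?e = "%i. ev \<sigma> i - cx i x * zs \<sigma> x" and ?n = "%i j. (if i = j then 1 else 0) - cx i x * cx j x" and ?b = "of_nat m * zs \<sigma> x ^ (m - 1) * rp P x"
  have dz: "(%x. zs \<sigma> x ^ (m - 1)) differentiable (at x)" by simp
  have dm: "(%x. of_nat m * zs \<sigma> x ^ (m - 1)) differentiable (at x)"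
    by (intro differentiable_mult dz differentiable_const)
  have A: "tg j (%x. of_nat m * zs \<sigma> x ^ (m - 1) * rp P x) x
    = of_nat (m * (m - 1)) * zs \<sigma> x ^ (m - 2) * rp P x * ?e j
      + of_nat m * zs \<sigma> x ^ (m - 1) * rp (pderiv P) x * ?n j 3"
  proof -
    have "tg j (%x. zs \<sigma> x ^ (m - 1)) x = of_nat (m - 1) * zs \<sigma> x ^ (m - 2) * ?e j"
      by (simp add: tg_power tg_zs numeral_2_eq_2)
    thus ?thesis unfolding tg_mult[OF dm rp_differentiable] tg_mult[OF differentiable_const dz] tg_const tg_rp tg_cx of_nat_mult
      by (simp only: mult_zero_left add_0_right mult_ac) (simp only: add_ac)
  qed
  have de: "(%x. ev \<sigma> i - cx i x * zs \<sigma> x) differentiable (at x)"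
    by (intro differentiable_diff differentiable_mult differentiable_const differentiable_cx zs_differentiable)
  have dt: "(%x. (if i = 3 then 1 else 0) - cx i x * cx 3 x) differentiable (at x)"
    by (intro differentiable_diff differentiable_mult differentiable_const differentiable_cx)
  have B: "tg j (%x. ev \<sigma> i - cx i x * zs \<sigma> x) x = - (?n j i * zs \<sigma> x + cx i x * ?e j)"
    unfolding tg_diff[OF differentiable_const differentiable_mult[OF differentiable_cx zs_differentiable]]
      tg_mult[OF differentiable_cx zs_differentiable] tg_zs tg_const tg_cx by (simp add: algebra_simps)
  have C: "tg j (%x. (if i = 3 then 1 else 0) - cx i x * cx 3 x) x = - (?n j i * cx 3 x + cx i x * ?n j 3)"
    unfolding tg_diff[OF differentiable_const differentiable_mult[OF differentiable_cx differentiable_cx]]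
      tg_mult[OF differentiable_cx differentiable_cx] tg_const tg_cx by (simp add: algebra_simps)
  have db: "(%x. of_nat m * zs \<sigma> x ^ (m - 1) * rp P x) differentiable (at x)"
    by (intro differentiable_mult dm rp_differentiable)
  have "tg j (qg \<sigma> m P i) x = (?b * tg j (%x. ev \<sigma> i - cx i x * zs \<sigma> x) x
      + tg j (%x. of_nat m * zs \<sigma> x ^ (m - 1) * rp P x) x * ?e i)
    + (qf \<sigma> m (pderiv P) x * tg j (%x. (if i = 3 then 1 else 0) - cx i x * cx 3 x) x + tg j (qf \<sigma> m (pderiv P)) x * ?n i 3)"
    unfolding qg_def[abs_def]
      tg_add[OF differentiable_mult[OF db de] differentiable_mult[OF qf_differentiable dt]]
      tg_mult[OF db de] tg_mult[OF qf_differentiable dt] ..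
  thus ?thesis unfolding A B C tg_qf by (simp only: mult_minus_right) (simp only: diff_conv_add_uminus add_ac)
qed

lemma x_dot_qg:
  assumes x: "norm x = 1"
  shows "cdot cx (qg \<sigma> m P) x = 0"
proof -
  have E: "zs \<sigma> x = cx 1 x + \<sigma> * \<i> * cx 2 x" by (simp add: zs_def)
  have "x1 * (A * (1 - x1 * z) + B * (0 - x1 * x3)) + x2 * (A * (s * \<i> - x2 * z) + B * (0 - x2 * x3)) + x3 * (A * (0 - x3 * z) + B * (1 - x3 * x3)) = 0"
    if "x1 * x1 + x2 * x2 + x3 * x3 = 1" "z = x1 + s * \<i> * x2" for x1 x2 x3 z s A B :: complex
    using that by algebra
  from this[OF unit3[OF x] E, where A = "of_nat m * zs \<sigma> x ^ (m - 1) * rp P x" and B = "qf \<sigma> m (pderiv P) x"]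
  show ?thesis unfolding sum_3 qg_def ev_def three_neq if_True if_False simp_thms(6) .
qed

text \<open>Isotropy of \<open>ev\<close> gives the squared surface gradient of z =
  \<open>zs\<close> the value -z^2, and that of x_3 is 1 - x_3^2. The second derivative of P
  therefore appears with the coefficient of Legendre's equation, which turns the sum into an
  eigenvalue relation.\<close>

lemma div_qg:
  assumes x: "norm x = 1" and \<sigma>: "\<sigma> * \<sigma> = 1"
  shows "(\<Sum>i\<in>UNIV. tg i (qg \<sigma> m (legd n m) i) x) = - of_nat (n * (n + 1)) * qf \<sigma> m (legd n m) x"
proof -
  let ?z = "zs \<sigma> x"
  have E: "zs \<sigma> x = cx 1 x + \<sigma> * \<i> * cx 2 x" by (simp add: zs_def)
  define A where "A = of_nat (m * (m - 1)) * ?z ^ (m - 2) * rp (legd n m) x"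
  define A1 where "A1 = of_nat m * ?z ^ (m - 1) * rp (legd n (Suc m)) x"
  define B where "B = of_nat m * ?z ^ (m - 1) * rp (legd n m) x"
  define C where "C = qf \<sigma> m (legd n (Suc m)) x"
  define F where "F = qf \<sigma> m (legd n (Suc (Suc m))) x"
  have A2: "A * (?z * ?z) = of_nat (m * (m - 1)) * qf \<sigma> m (legd n m) x"
  proof (cases "m \<ge> 2")
    case True
    then obtain k where "m = k + 2" by (metis le_add_diff_inverse2)
    thus ?thesis by (simp add: A_def qf_def)
  next
    case False hence "m = 0 \<or> m = 1" by auto
    thus ?thesis by (auto simp: A_def)
  qed
  have B1: "B * ?z = of_nat m * qf \<sigma> m (legd n m) x" "A1 * ?z = of_nat m * C"
    by (cases m; simp add: B_def A1_def C_def qf_def)+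
  have cs: "(\<Sum>i\<in>UNIV. tg i (qg \<sigma> m (legd n m) i) x)
     = - (A * (?z * ?z)) - 2 * (B * ?z) - 2 * (A1 * ?z) * cx 3 x + F * (1 - cx 3 x * cx 3 x) - 2 * cx 3 x * C"
  proof -
    have "((A * (1 - x1 * z) + A1 * (0 - x1 * x3)) * (1 - x1 * z) - B * ((1 - x1 * x1) * z + x1 * (1 - x1 * z))
        + (A1 * (1 - x1 * z) + F * (0 - x1 * x3)) * (0 - x1 * x3) - C * ((1 - x1 * x1) * x3 + x1 * (0 - x1 * x3)))
      + ((A * (s * i - x2 * z) + A1 * (0 - x2 * x3)) * (s * i - x2 * z) - B * ((1 - x2 * x2) * z + x2 * (s * i - x2 * z))
        + (A1 * (s * i - x2 * z) + F * (0 - x2 * x3)) * (0 - x2 * x3) - C * ((1 - x2 * x2) * x3 + x2 * (0 - x2 * x3)))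
      + ((A * (0 - x3 * z) + A1 * (1 - x3 * x3)) * (0 - x3 * z) - B * ((1 - x3 * x3) * z + x3 * (0 - x3 * z))
        + (A1 * (0 - x3 * z) + F * (1 - x3 * x3)) * (1 - x3 * x3) - C * ((1 - x3 * x3) * x3 + x3 * (1 - x3 * x3)))
      = - (A * (z * z)) - 2 * (B * z) - 2 * (A1 * z) * x3 + F * (1 - x3 * x3) - 2 * x3 * C"
      if "x1 * x1 + x2 * x2 + x3 * x3 = 1" "z = x1 + s * i * x2" "s * s = 1" "i * i = -1" for x1 x2 x3 z s i A A1 B C F :: complex
      using that by algebra
    from this[OF unit3[OF x] E \<sigma> i_squared, where A = A and ?A1.0 = A1 and B = B and C = C and F = F]
    show ?thesis
      unfolding sum_3 tg_qg unfolding qg_def pderiv_legd three_neq ev_def if_True if_False simp_thms(6)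
      unfolding A_def A1_def B_def C_def F_def .
  qed
  have "(1 - cx 3 x * cx 3 x) * rp (legd n (Suc (Suc m))) x = 2 * (of_nat m + 1) * cx 3 x * rp (legd n (Suc m)) x
      + (of_nat (m * (m + 1)) - of_nat (n * (n + 1))) * rp (legd n m) x"
    using arg_cong[OF legendre_ode[of "x $ 3" n m], of complex_of_real]
    by (simp add: rp_def power2_eq_square algebra_simps)
  hence "F * (1 - cx 3 x * cx 3 x) = ?z ^ m * (2 * (of_nat m + 1) * cx 3 x * rp (legd n (Suc m)) x
      + (of_nat (m * (m + 1)) - of_nat (n * (n + 1))) * rp (legd n m) x)"
    unfolding F_def qf_def by (simp add: mult_ac)
  also have "\<dots> = 2 * (of_nat m + 1) * cx 3 x * C + (of_nat (m * (m + 1)) - of_nat (n * (n + 1))) * qf \<sigma> m (legd n m) x"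
    unfolding C_def qf_def by (simp add: algebra_simps)
  finally have FF: "F * (1 - cx 3 x * cx 3 x) = 2 * (of_nat m + 1) * cx 3 x * C + (of_nat (m * (m + 1)) - of_nat (n * (n + 1))) * qf \<sigma> m (legd n m) x" .
  have mm: "complex_of_nat (m * (m + 1)) = of_nat (m * (m - 1)) + 2 * of_nat m" by (cases m) (simp_all add: algebra_simps)
  show ?thesis unfolding cs A2 B1 FF mm by (simp add: algebra_simps)
qed

text \<open>\<open>sI_tg\<close> is applied to g times each component of V and summed; the curvature
  term contains x\<bullet>V and drops out.\<close>

lemma sI_tangential_ibp:
  assumes g: "C1_on g UNIV" and V: "\<And>i. C1_on (V i) UNIV" "\<And>x. norm x = 1 ==> (cdot cx V x) = 0"
  shows "sI (%x. \<Sum>i\<in>UNIV. tg i g x * V i x) = - sI (%x. g x * (\<Sum>i\<in>UNIV. tg i (V i) x))"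
proof -
  have dg: "g differentiable (at x)" "V i differentiable (at x)" for x i
    using C1_onD(1)[OF g] C1_onD(1)[OF V(1)] by simp_all
  have C: "C1_on (%x. g x * V i x) UNIV" for i by (intro C1_on_mult g V)
  have "(\<Sum>i\<in>UNIV. sI (tg i (%x. g x * V i x))) = (\<Sum>i\<in>UNIV. 2 * sI (%x. cx i x * (g x * V i x)))"
    by (intro sum.cong refl sI_tg C1_on_subset[OF C]) simp
  also have "\<dots> = 2 * (\<Sum>i\<in>UNIV. sI (%x. cx i x * (g x * V i x)))" by (simp add: sum_distrib_left)
  also have "(\<Sum>i\<in>UNIV. sI (%x. cx i x * (g x * V i x))) = sI (%x. \<Sum>i\<in>UNIV. cx i x * (g x * V i x))"
    by (intro sI_sum[symmetric] continuous_on_mult C1_cont[OF g] C1_cont[OF V(1)] continuous_intros) simp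
  also have "\<dots> = sI (%x. 0)"
  proof (rule sI_cong)
    fix x :: "real^3" assume x: "norm x = 1"
    have "(\<Sum>i\<in>UNIV. cx i x * (g x * V i x)) = g x * (cdot cx V x)"
      by (simp add: sum_distrib_left mult_ac)
    thus "(\<Sum>i\<in>UNIV. cx i x * (g x * V i x)) = 0" by (simp only: V(2)[OF x] mult_zero_right)
  qed
  finally have "(\<Sum>i\<in>UNIV. sI (tg i (%x. g x * V i x))) = 0" by simp
  moreover have "(\<Sum>i\<in>UNIV. sI (tg i (%x. g x * V i x))) = sI (%x. \<Sum>i\<in>UNIV. tg i (%x. g x * V i x) x)"
    by (intro sI_sum[symmetric] C1_tg_cont C) simp
  moreover have "(%x. \<Sum>i\<in>UNIV. tg i (%x. g x * V i x) x) = (%x. (\<Sum>i\<in>UNIV. tg i g x * V i x) + g x * (\<Sum>i\<in>UNIV. tg i (V i) x))"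
    by (rule ext) (simp add: tg_mult dg sum.distrib sum_distrib_left add.commute)
  moreover have "sI (%x. (\<Sum>i\<in>UNIV. tg i g x * V i x) + g x * (\<Sum>i\<in>UNIV. tg i (V i) x))
    = sI (%x. \<Sum>i\<in>UNIV. tg i g x * V i x) + sI (%x. g x * (\<Sum>i\<in>UNIV. tg i (V i) x))"
    by (intro sI_add continuous_on_mult continuous_on_sum C1_tg_cont C1_cont g V)
  ultimately show ?thesis by (simp add: eq_neg_iff_add_eq_0)
qed

section \<open>The angular pattern of the incident field\<close>

lemma tg_sum:
  assumes "\<And>i. i \<in> I ==> f i differentiable (at x)"
  shows "tg k (%x. \<Sum>i\<in>I. f i x) x = (\<Sum>i\<in>I. tg k (f i) x)"
  using assms by (induction I rule: infinite_finite_induct) (simp_all add: tg_add differentiable_sum)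

lemma tg_cmult:
  assumes "f differentiable (at x)"
  shows "tg k (%x. c * f x) x = c * tg k f x"
  using assms by (simp add: tg_mult)

definition shc :: "nat => int => complex" where
  "shc n m = of_real (sqrt ((2 * real n + 1) / (4 * pi) * (fact (n - nat \<bar>m\<bar>) / fact (n + nat \<bar>m\<bar>))))"

definition sgc :: "int => complex" where
  "sgc m = (if m \<ge> 0 then 1 else - 1)"

abbreviation mode :: "(complex => nat => real poly => 'a) => nat => int => 'a" where
  "mode q n m \<equiv> q (sgc m) (nat \<bar>m\<bar>) (legd n (nat \<bar>m\<bar>))"

text \<open>On the unit sphere \<open>Qh\<close> is the sum of f_m Y_n^m; \<open>Qg\<close> will be
  its surface gradient and \<open>Tc\<close> the cross product of \<open>Qg\<close> with x, that is,
  the vector multiplying j_n in the incident field.\<close>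

definition Qh :: "(int => complex) => nat => sfield" where
  "Qh f n x = (\<Sum>m\<in>{- int n..int n}. (f m * shc n m) * mode qf n m x)"

definition Qg :: "(int => complex) => nat => 3 => sfield" where
  "Qg f n i x = (\<Sum>m\<in>{- int n..int n}. (f m * shc n m) * mode qg n m i x)"

definition Tc :: "(int => complex) => nat => 3 => sfield" where
  "Tc f n i x = (if i = 1 then Qg f n 2 x * cx 3 x - Qg f n 3 x * cx 2 x
     else if i = 2 then Qg f n 3 x * cx 1 x - Qg f n 1 x * cx 3 x
     else Qg f n 1 x * cx 2 x - Qg f n 2 x * cx 1 x)"

lemma Tc_simps [simp]:
  "Tc f n 1 x = Qg f n 2 x * cx 3 x - Qg f n 3 x * cx 2 x"
  "Tc f n 2 x = Qg f n 3 x * cx 1 x - Qg f n 1 x * cx 3 x"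
  "Tc f n 3 x = Qg f n 1 x * cx 2 x - Qg f n 2 x * cx 1 x"
  by (simp_all add: Tc_def)

lemma C1_on_Qh: "C1_on (Qh f n) S"
  unfolding Qh_def[abs_def] by (intro C1_on_sum C1_on_mult C1_on_const C1_on_qf)

lemma C1_on_Qg: "C1_on (Qg f n i) S"
  unfolding Qg_def[abs_def] by (intro C1_on_sum C1_on_mult C1_on_const C1_on_qg)

lemma C1_on_Tc: "C1_on (Tc f n i) S"
  using exhaust_3[of i]
  by (elim disjE) (simp_all add: Tc_def[abs_def], (intro C1_on_diff C1_on_mult C1_on_cx C1_on_Qg)+)

lemma tg_Qh: "tg i (Qh f n) x = Qg f n i x"
proof -
  have d: "qf \<sigma> m P differentiable (at x)" for \<sigma> m P by simp
  show ?thesis unfolding Qh_def[abs_def] Qg_def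
    by (subst tg_sum, (intro differentiable_mult differentiable_const d)) (simp only: tg_cmult[OF d] tg_qf)
qed

lemma x_dot_Qg:
  assumes "norm x = 1" shows "cdot cx (Qg f n) x = 0"
proof -
  have "cdot cx (Qg f n) x = (\<Sum>m\<in>{- int n..int n}. (f m * shc n m) * (cdot cx (mode qg n m) x))"
    unfolding Qg_def sum_distrib_left by (subst sum.swap) (simp add: mult_ac)
  thus ?thesis by (simp only: x_dot_qg[OF assms] mult_zero_right sum.neutral_const)
qed

lemma div_Qg:
  assumes "norm x = 1" shows "(\<Sum>i\<in>UNIV. tg i (Qg f n i) x) = - of_nat (n * (n + 1)) * Qh f n x"
proof -
  have d: "qg \<sigma> m P i differentiable (at x)" for \<sigma> m P i using C1_onD(1)[OF C1_on_qg[of _ _ _ _ UNIV]] by simp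
  have s: "sgc m * sgc m = 1" for m by (simp add: sgc_def)
  have "tg i (Qg f n i) x = (\<Sum>m\<in>{- int n..int n}. (f m * shc n m) * tg i (mode qg n m i) x)" for i
    unfolding Qg_def[abs_def]
    by (subst tg_sum, (intro differentiable_mult differentiable_const d)) (simp only: tg_cmult[OF d])
  hence "(\<Sum>i\<in>UNIV. tg i (Qg f n i) x) = (\<Sum>m\<in>{- int n..int n}. (f m * shc n m) * (\<Sum>i\<in>UNIV. tg i (mode qg n m i) x))"
    unfolding sum_distrib_left by (subst sum.swap) simp
  thus ?thesis unfolding div_qg[OF assms s] Qh_def sum_distrib_left by (simp add: mult_ac)
qed

text \<open>The toroidal moment of the incident pattern, up to the sign in
  \<open>Tc_moments\<close>; the factor n(n+1) is the eigenvalue released by integrating by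
  parts.\<close>

definition Nm :: "(int => complex) => nat => real^3 => nat => complex" where
  "Nm f n y d = of_nat (n * (n + 1)) * sI (%x. Qh f n x * ph y d x)"

text \<open>Green's second identity on the sphere: the Dirichlet pairing of \<open>Qh\<close> with
  the test function is evaluated in both orders, one of them through the eigenvalue of
  \<open>Qh\<close>.\<close>

lemma sI_Qh_lap: "sI (%x. Qh f n x * lap y d x) = - Nm f n y d"
proof -
  have "sI (%x. \<Sum>i\<in>UNIV. tg i (Qh f n) x * gS y d i x) = - sI (%x. Qh f n x * (\<Sum>i\<in>UNIV. tg i (gS y d i) x))"
    by (rule sI_tangential_ibp) (simp_all add: C1_on_Qh C1_on_test x_dot_gS)
  also have "sI (%x. Qh f n x * (\<Sum>i\<in>UNIV. tg i (gS y d i) x)) = sI (%x. Qh f n x * lap y d x)"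
    by (rule sI_cong) (simp only: div_gS)
  finally have A: "sI (%x. \<Sum>i\<in>UNIV. tg i (Qh f n) x * gS y d i x) = - sI (%x. Qh f n x * lap y d x)" .
  have "sI (%x. \<Sum>i\<in>UNIV. tg i (ph y d) x * Qg f n i x) = - sI (%x. ph y d x * (\<Sum>i\<in>UNIV. tg i (Qg f n i) x))"
    by (rule sI_tangential_ibp) (simp_all add: C1_on_Qg C1_on_test x_dot_Qg)
  also have "sI (%x. ph y d x * (\<Sum>i\<in>UNIV. tg i (Qg f n i) x)) = sI (%x. - of_nat (n * (n + 1)) * (Qh f n x * ph y d x))"
    by (rule sI_cong) (simp only: div_Qg mult_ac)
  finally have B: "sI (%x. \<Sum>i\<in>UNIV. tg i (ph y d) x * Qg f n i x) = Nm f n y d"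
    by (simp only: mult_minus_left sI_minus sI_cmult Nm_def minus_minus)
  have E: "sI (%x. \<Sum>i\<in>UNIV. tg i (Qh f n) x * gS y d i x) = sI (%x. \<Sum>i\<in>UNIV. tg i (ph y d) x * Qg f n i x)"
    by (rule sI_cong) (simp only: tg_Qh tg_ph mult.commute)
  have "S = - N" if "L = - S" "R = N" "L = R" for S N L R :: complex using that by simp
  from this[OF A B E] show ?thesis .
qed

text \<open>As a sequence in d these moments are an eigenvector of \<open>lc\<close>. In this way
  the index n enters the radial equations although the test functions are not harmonics of degree
  n.\<close>

lemma lc_Nm: "lc y d (Nm f n y) = - of_nat (n * (n + 1)) * Nm f n y d"
proof -
  have c: "contS (%x. Qh f n x * (of_nat (e * (e - 1)) * of_real ((norm y)\<^sup>2) * ph y (e - 2) x))"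
    "contS (%x. Qh f n x * (of_nat (e * (e + 1)) * ph y e x))" for e
    by (intro continuous_on_mult continuous_on_const C1_cont[OF C1_on_Qh] C1_cont[OF C1_on_test(1)])+
  have "sI (%x. Qh f n x * lap y d x) = lc y d (%d. sI (%x. Qh f n x * ph y d x))"
  proof -
    have cm: "sI (%x. Qh f n x * (c * ph y e x)) = c * sI (%x. Qh f n x * ph y e x)" for c e
      unfolding sI_cmult[symmetric] by (rule sI_cong) (rule mult.left_commute)
    show ?thesis unfolding lap_def[abs_def] lc_def right_diff_distrib sI_diff[OF c] cm ..
  qed
  hence l: "lc y d (%d. sI (%x. Qh f n x * ph y d x)) = - Nm f n y d" by (simp only: sI_Qh_lap)
  have "lc y d (Nm f n y) = of_nat (n * (n + 1)) * lc y d (%d. sI (%x. Qh f n x * ph y d x))"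
    unfolding lc_def Nm_def by (simp only: right_diff_distrib mult_ac)
  thus ?thesis by (simp only: l mult_minus_left mult_minus_right)
qed

lemma x_dot_Tc: "cdot cx (Tc f n) x = 0"
  unfolding sum_3 Tc_simps by algebra

lemma Tc_dot_gL:
  assumes x: "norm x = 1"
  shows "(cdot (Tc f n) (gL y d) x) = - (cdot (Qg f n) (gS y d) x)"
proof -
  note g = gL_cross_x[OF x, where y = y and d = d, symmetric]
  show ?thesis unfolding sum_3 Tc_simps g by algebra
qed

lemma Tc_dot_gS:
  assumes x: "norm x = 1"
  shows "(cdot (Tc f n) (gS y d) x) = (\<Sum>i\<in>UNIV. tg i (Qh f n) x * gL y d i x)"
proof -
  note g = gS_cross_x[OF x, where y = y and d = d]
  have g': "gL y d 1 x = gS y d 3 x * cx 2 x - gS y d 2 x * cx 3 x" "gL y d 2 x = gS y d 1 x * cx 3 x - gS y d 3 x * cx 1 x"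
    "gL y d 3 x = gS y d 2 x * cx 1 x - gS y d 1 x * cx 2 x" using g by (simp_all add: algebra_simps)
  show ?thesis unfolding sum_3 Tc_simps tg_Qh g' by algebra
qed

text \<open>\<open>Tc\<close> is tangential, which removes the \<open>gX\<close> moment. It is a
  rotated gradient and \<open>gL\<close> is divergence free, which removes the \<open>gS\<close>
  moment. Against \<open>gL\<close> both factors are rotated, so a Dirichlet pairing
  remains.\<close>

lemma Tc_moments:
  "sI (cdot (Tc f n) (gX y d)) = 0"
  "sI (cdot (Tc f n) (gS y d)) = 0"
  "sI (cdot (Tc f n) (gL y d)) = - Nm f n y d"
proof -
  have "(cdot (Tc f n) (gX y d) x) = ph y d x * (cdot cx (Tc f n) x)" for x
    unfolding gX_def sum_distrib_left by (simp add: mult_ac)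
  thus "sI (cdot (Tc f n) (gX y d)) = 0" by (simp add: x_dot_Tc)
  have "sI (cdot (Tc f n) (gS y d)) = sI (%x. \<Sum>i\<in>UNIV. tg i (Qh f n) x * gL y d i x)"
    by (rule sI_cong) (rule Tc_dot_gS)
  also have "\<dots> = - sI (%x. Qh f n x * (\<Sum>i\<in>UNIV. tg i (gL y d i) x))"
    by (rule sI_tangential_ibp) (simp_all add: C1_on_Qh C1_on_test x_dot_gL)
  also have "sI (%x. Qh f n x * (\<Sum>i\<in>UNIV. tg i (gL y d i) x)) = sI (%x. 0)"
    by (rule sI_cong) (simp only: div_gL mult_zero_right)
  finally show "sI (cdot (Tc f n) (gS y d)) = 0" by simp
  have "sI (cdot (Tc f n) (gL y d)) = sI (%x. - (\<Sum>i\<in>UNIV. tg i (Qh f n) x * gS y d i x))"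
    by (rule sI_cong) (simp only: Tc_dot_gL tg_Qh)
  also have "\<dots> = sI (%x. Qh f n x * (\<Sum>i\<in>UNIV. tg i (gS y d i) x))"
    unfolding sI_minus
    by (subst sI_tangential_ibp) (simp_all add: C1_on_Qh C1_on_test x_dot_gS)
  also have "\<dots> = sI (%x. Qh f n x * lap y d x)"
    by (rule sI_cong) (simp only: div_gS)
  finally show "sI (cdot (Tc f n) (gL y d)) = - Nm f n y d" unfolding sI_Qh_lap .
qed

text \<open>sin \<theta> exp(\<i> \<phi>) is x_1 + \<i> x_2, and negative m conjugates it. At the
  poles this number is 0, consistent with the default azimuth 0.\<close>

lemma sph_harm_unit:
  assumes y: "norm y = 1"
  shows "sph_harm n m (polar_angle y) (azimuth y) = shc n m * mode qf n m y"
proof -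
  have y3: "\<bar>y $ 3\<bar> \<le> 1" using component_le_norm_cart[of y 3] y by simp
  hence c: "cos (polar_angle y) = y $ 3" using y by (simp add: polar_angle_def cos_arccos_abs)
  define z where "z = Complex (y $ 1) (y $ 2)"
  have nz: "sqrt (1 - (y $ 3)\<^sup>2) = cmod z"
  proof -
    have "1 - (y $ 3)\<^sup>2 = (y $ 1)\<^sup>2 + (y $ 2)\<^sup>2" using norm3_eq[of y] unfolding y by simp
    thus ?thesis by (simp add: z_def cmod_def)
  qed
  have zr: "z = of_real (cmod z) * cis (Arg z)" using rcis_cmod_Arg[of z] by (simp add: rcis_def)
  have zz: "zs 1 y = z" "zs (-1) y = cnj z"
    by (simp_all add: zs_def z_def complex_eq_iff)
  define k where "k = nat \<bar>m\<bar>"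
  have zk: "of_real (cmod z) ^ k * cis (of_int m * Arg z) = zs (sgc m) y ^ k"
  proof (cases "m \<ge> 0")
    case True
    hence "of_int m * Arg z = real k * Arg z" by (simp add: k_def)
    hence "of_real (cmod z) ^ k * cis (of_int m * Arg z) = (of_real (cmod z) * cis (Arg z)) ^ k"
      by (simp only: power_mult_distrib Complex.DeMoivre)
    thus ?thesis using True unfolding zr[symmetric] by (simp add: sgc_def zz)
  next
    case False
    hence "of_int m * Arg z = real k * (- Arg z)" by (simp add: k_def)
    hence "of_real (cmod z) ^ k * cis (of_int m * Arg z) = (of_real (cmod z) * cis (- Arg z)) ^ k"
      by (simp only: power_mult_distrib Complex.DeMoivre)
    also have "of_real (cmod z) * cis (- Arg z) = cnj (of_real (cmod z) * cis (Arg z))" by (simp add: cis_cnj)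
    finally show ?thesis using False unfolding zr[symmetric] by (simp add: sgc_def zz)
  qed
  show ?thesis
    unfolding sph_harm_def c assoc_legendre_def nz k_def[symmetric] azimuth_def z_def[symmetric] qf_def
      zk[symmetric] shc_def rp_def legd_def by (simp add: mult_ac)
qed

text \<open>The derivative of \<open>sgn\<close> at a unit vector is the projection onto the tangent
  plane, so the radially constant extension has the tangential gradient.\<close>

lemma surface_grad_nth:
  assumes f: "f differentiable (at x)" and x: "norm x = 1"
  shows "surface_grad f x $ i = tg i f x"
proof -
  have D: "((%x::real^3. sgn x) has_derivative (%v. v - (x \<bullet> v) *\<^sub>R x)) (at x)"
    unfolding sgn_div_norm
    by (rule derivative_eq_intros has_derivative_norm | use x in \<open>force simp: fun_eq_iff sgn_div_norm x inner_commute\<close>)+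
  have "((%x. f (sgn x)) has_derivative (%v. \<Sum>j\<in>UNIV. ((v - (x \<bullet> v) *\<^sub>R x) $ j) *\<^sub>R partial j f x)) (at x)"
    using has_derivative_compose[OF D, of f] has_derivative_partials[OF f] x by (simp only: sgn_div_norm inverse_1 scaleR_one)
  hence "partial i (%x. f (sgn x)) x = (\<Sum>j\<in>UNIV. ((axis i 1 - (x \<bullet> axis i 1) *\<^sub>R x) $ j) *\<^sub>R partial j f x)"
    by (rule partial_has_derivative)
  also have "\<dots> = tg i f x"
  proof -
    have "(axis i 1 - (x \<bullet> axis i 1) *\<^sub>R x) $ j = (if i = j then 1 else 0) - x $ i * x $ j" for j
      unfolding inner_axis by (simp add: axis_def)
    thus ?thesis unfolding tg_eq by (simp only: scaleR_conv_of_real)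
  qed
  finally show ?thesis by (simp add: surface_grad_def cgrad_def)
qed

lemma surface_grad_cong:
  assumes "\<And>y. norm y = 1 ==> f y = g y" "norm x = 1"
  shows "surface_grad f x = surface_grad g x"
proof -
  have "partial i (%x. f (sgn x)) x = partial i (%x. g (sgn x)) x" for i
    by (rule partial_cong[of "- {0}"]) (use assms in \<open>auto simp: norm_sgn\<close>)
  thus ?thesis by (simp add: surface_grad_def cgrad_def)
qed

lemma incident_field_nth:
  assumes "x \<noteq> 0"
  shows "incident_field n f k x $ i = of_real (spherical_bessel_j n (k * norm x)) * Tc f n i (sgn x)"
proof -
  let ?v = "sgn x"
  have v: "norm ?v = 1" using assms by (simp add: norm_sgn)
  have sg: "surface_grad (%y. sph_harm n m (polar_angle y) (azimuth y)) ?v $ j = shc n m * mode qg n m j ?v" for m j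
  proof -
    have "surface_grad (%y. sph_harm n m (polar_angle y) (azimuth y)) ?v = surface_grad (%y. shc n m * mode qf n m y) ?v"
      by (rule surface_grad_cong[OF sph_harm_unit v])
    moreover have "surface_grad (%y. shc n m * mode qf n m y) ?v $ j = tg j (%y. shc n m * mode qf n m y) ?v"
      by (rule surface_grad_nth[OF _ v]) (intro differentiable_mult differentiable_const qf_differentiable)
    ultimately show ?thesis by (simp add: tg_cmult tg_qf)
  qed
  have T: "f m * T_sph n m x $ i = (if i = 1 then f m * shc n m * mode qg n m 2 ?v * cx 3 ?v - f m * shc n m * mode qg n m 3 ?v * cx 2 ?v
     else if i = 2 then f m * shc n m * mode qg n m 3 ?v * cx 1 ?v - f m * shc n m * mode qg n m 1 ?v * cx 3 ?v
     else f m * shc n m * mode qg n m 1 ?v * cx 2 ?v - f m * shc n m * mode qg n m 2 ?v * cx 1 ?v)" for m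
    unfolding T_sph_def ccross_def sgn_sgn cvec_def using exhaust_3[of i]
    by (elim disjE) (simp_all add: sg algebra_simps)
  have "(\<Sum>m\<in>{- int n..int n}. f m * T_sph n m x $ i) = Tc f n i ?v"
    unfolding T Tc_def Qg_def using exhaust_3[of i]
    by (elim disjE) (simp_all add: sum_distrib_right sum_subtractf mult.assoc)
  hence "of_real (spherical_bessel_j n (k * norm x)) * Tc f n i (sgn x)
     = (\<Sum>m\<in>{- int n..int n}. of_real (spherical_bessel_j n (k * norm x)) * (f m * T_sph n m x $ i))"
    by (simp only: sum_distrib_left[symmetric])
  thus ?thesis unfolding incident_field_def by (simp add: mult_ac)
qed

section \<open>Regularity of the incident field away from the origin\<close>

lemma has_derivative_radial:
  fixes h :: "real => real"
  assumes "(h has_real_derivative d) (at ((norm x)\<^sup>2))"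
  shows "((%x::real^3. complex_of_real (h ((norm x)\<^sup>2))) has_derivative (%v. of_real (d * (2 * (x \<bullet> v))))) (at x)"
proof -
  have N: "((%x::real^3. (norm x)\<^sup>2) has_derivative (%v. 2 * (x \<bullet> v))) (at x)"
    unfolding power2_norm_eq_inner
    by (rule has_derivative_inner[OF has_derivative_ident has_derivative_ident, THEN has_derivative_eq_rhs])
       (simp add: fun_eq_iff inner_commute)
  have "((%x::real^3. h ((norm x)\<^sup>2)) has_derivative (%v. d * (2 * (x \<bullet> v)))) (at x)"
    using has_derivative_compose[OF N assms[unfolded has_field_derivative_def]] .
  from has_derivative_of_real[OF this, where 'a = complex] show ?thesis .
qed

lemma continuous_on_radial:
  assumes "continuous_on {0<..} h"
  shows "continuous_on (- {0}) (%x::real^3. complex_of_real (h ((norm x)\<^sup>2)))"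
  by (intro continuous_on_of_real continuous_on_compose2[OF assms] continuous_intros) auto

lemma partial_radial:
  assumes "(h has_real_derivative d) (at ((norm x)\<^sup>2))"
  shows "partial j (%x::real^3. complex_of_real (h ((norm x)\<^sup>2))) x = of_real d * (2 * cx j x)"
  unfolding partial_has_derivative[OF has_derivative_radial[OF assms]] by (simp add: inner_axis)

lemma C1_on_radial:
  assumes h: "\<And>s. s > 0 ==> (h has_real_derivative h' s) (at s)" and h': "continuous_on {0<..} h'"
  shows "C1_on (%x::real^3. complex_of_real (h ((norm x)\<^sup>2))) (- {0})"
  unfolding C1_on_def
proof (intro conjI ballI allI)
  fix x :: "real^3" assume "x \<in> - {0}"
  hence "(norm x)\<^sup>2 > 0" by simp
  from has_derivative_radial[OF h[OF this]]
  show "(%x::real^3. complex_of_real (h ((norm x)\<^sup>2))) differentiable (at x)" by (auto simp: differentiable_def)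
next
  fix j
  have "continuous_on (- {0}) (%x::real^3. complex_of_real (h' ((norm x)\<^sup>2)) * (2 * cx j x))"
    by (intro continuous_on_mult continuous_on_radial h' continuous_intros)
  thus "continuous_on (- {0}) (partial j (%x::real^3. complex_of_real (h ((norm x)\<^sup>2))))"
    by (rule continuous_on_eq) (use partial_radial[OF h] in auto)
qed

lemma C2_on_radial:
  assumes h: "\<And>s. s > 0 ==> (h has_real_derivative h' s) (at s)" "\<And>s. s > 0 ==> (h' has_real_derivative h'' s) (at s)"
    and h'': "continuous_on {0<..} h''"
  shows "C2_on (%x::real^3. complex_of_real (h ((norm x)\<^sup>2))) (- {0})"
  unfolding C2_on_iff
proof (intro conjI allI)
  have "continuous_on {0<..} h'"
    by (rule continuous_at_imp_continuous_on) (use h(2) DERIV_isCont in auto)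
  from C1_onD(1)[OF C1_on_radial[OF h(1) this]]
  show "\<forall>x\<in>- {0}. (%x::real^3. complex_of_real (h ((norm x)\<^sup>2))) differentiable at x" by simp
  fix j
  have "C1_on (%x::real^3. complex_of_real (h' ((norm x)\<^sup>2)) * (2 * cx j x)) (- {0})"
    by (intro C1_on_mult C1_on_const C1_on_cx C1_on_radial[OF h(2) h''])
  thus "C1_on (partial j (%x::real^3. complex_of_real (h ((norm x)\<^sup>2)))) (- {0})"
    by (rule C1_on_cong) (use partial_radial[OF h(1)] in auto)
qed

lemma C2_on_subset: "C2_on f S ==> T \<subseteq> S ==> C2_on f T"
  unfolding C2_on_iff by (blast intro: C1_on_subset)

lemma C2_on_norm: "C2_on (%x::real^3. complex_of_real (norm x)) (- {0})"
proof -
  have "C2_on (%x::real^3. complex_of_real (sqrt ((norm x)\<^sup>2))) (- {0})"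
  proof (rule C2_on_radial)
    show "(sqrt has_real_derivative 1 / (2 * sqrt s)) (at s)" if "s > 0" for s
      using that by (auto intro!: derivative_eq_intros simp: field_simps)
    show "((%s. 1 / (2 * sqrt s)) has_real_derivative - (1 / (4 * s * sqrt s))) (at s)" if "s > 0" for s
      using that by (auto intro!: derivative_eq_intros simp: field_simps)
    show "continuous_on {0<..} (%s. - (1 / (4 * s * sqrt s)))"
      by (intro continuous_intros) auto
  qed
  thus ?thesis by simp
qed

lemma C2_on_inverse_norm: "C2_on (%x::real^3. complex_of_real (1 / norm x)) (- {0})"
proof -
  have "C2_on (%x::real^3. complex_of_real (1 / sqrt ((norm x)\<^sup>2))) (- {0})"
  proof (rule C2_on_radial)
    show "((%s. 1 / sqrt s) has_real_derivative - (1 / (2 * s * sqrt s))) (at s)" if "s > 0" for s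
      using that by (auto intro!: derivative_eq_intros simp: field_simps)
    show "((%s. - (1 / (2 * s * sqrt s))) has_real_derivative 3 / (4 * s\<^sup>2 * sqrt s)) (at s)" if "s > 0" for s
    proof -
      obtain q where q: "q > 0" "s = q\<^sup>2" using \<open>s > 0\<close> by (metis real_sqrt_gt_zero real_sqrt_pow2 less_imp_le)
      show ?thesis using q by (auto intro!: derivative_eq_intros simp: field_simps power2_eq_square)
    qed
    show "continuous_on {0<..} (%s. 3 / (4 * s\<^sup>2 * sqrt s))"
      by (intro continuous_intros) auto
  qed
  thus ?thesis by simp
qed

lemma C2_on_sgn: "C2_on (%x. cx i (sgn x)) (- {0})"
proof -
  have "(%x. cx i (sgn x)) = (%x. complex_of_real (1 / norm x) * cx i x)"
    by (simp add: sgn_div_norm divide_inverse)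
  moreover have "C2_on (%x. complex_of_real (1 / norm x) * cx i x) (- {0})"
    by (intro C2_on_mult C2_on_inverse_norm C2_on_cx) auto
  ultimately show ?thesis by simp
qed

lemma C2_on_rp_sgn: "C2_on (%x. rp P (sgn x)) (- {0})"
proof -
  have "(%x. rp P (sgn x)) = (%x. \<Sum>i\<le>degree P. of_real (coeff P i) * cx 3 (sgn x) ^ i)"
    unfolding rp_def poly_altdef by simp
  moreover have "C2_on (%x. \<Sum>i\<le>degree P. of_real (coeff P i) * cx 3 (sgn x) ^ i) (- {0})"
    by (intro C2_on_sum C2_on_mult C2_on_const C2_on_power C2_on_sgn) auto
  ultimately show ?thesis by simp
qed

lemma C2_on_Tc_sgn: "C2_on (%x. Tc f n i (sgn x)) (- {0})"
proof -
  have o: "open (- {0::real^3})" by (simp add: open_Compl)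
  have z: "C2_on (%x. zs \<sigma> (sgn x)) (- {0})" for \<sigma>
    unfolding zs_def by (rule C2_on_add[OF o C2_on_sgn C2_on_mult[OF o C2_on_const C2_on_sgn]])
  have q: "C2_on (%x. Qg f n i (sgn x)) (- {0})" for i
  proof -
    have e: "C2_on (%x. ev \<sigma> i - cx i (sgn x) * zs \<sigma> (sgn x)) (- {0})" for \<sigma>
      by (rule C2_on_diff[OF o C2_on_const C2_on_mult[OF o C2_on_sgn z]])
    have t: "C2_on (%x. (if i = 3 then 1 else 0) - cx i (sgn x) * cx 3 (sgn x)) (- {0})"
      by (rule C2_on_diff[OF o C2_on_const C2_on_mult[OF o C2_on_sgn C2_on_sgn]])
    have g: "C2_on (%x. qf \<sigma> m P (sgn x)) (- {0})" for \<sigma> m P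
      unfolding qf_def by (rule C2_on_mult[OF o C2_on_power[OF o z] C2_on_rp_sgn])
    have "C2_on (%x. qg \<sigma> m P i (sgn x)) (- {0})" for \<sigma> m P
      unfolding qg_def
      by (rule C2_on_add[OF o C2_on_mult[OF o C2_on_mult[OF o C2_on_mult[OF o C2_on_const C2_on_power[OF o z]] C2_on_rp_sgn] e] C2_on_mult[OF o g t]])
    thus ?thesis unfolding Qg_def by (rule C2_on_sum[OF o C2_on_mult[OF o C2_on_const]])
  qed
  have "C2_on (%x. Qg f n j (sgn x) * cx k (sgn x) - Qg f n j' (sgn x) * cx k' (sgn x)) (- {0})" for j k j' k'
    by (rule C2_on_diff[OF o C2_on_mult[OF o q C2_on_sgn] C2_on_mult[OF o q C2_on_sgn]])
  thus ?thesis
    using exhaust_3[of i] by (elim disjE) (simp_all only: Tc_simps)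
qed

text \<open>The field is a power of |x|, times \<open>bF\<close> of |x|^2, times a polynomial in
  x/|x|; each factor is C^2 off the origin. The incident field is compared with \<open>u\<close> in
  the exterior, which this covers.\<close>

lemma C2_on_incident: "C2_on (%x. incident_field n f k x $ i) (- {0})"
proof -
  have o: "open (- {0::real^3})" by (simp add: open_Compl)
  have B: "C2_on (%x::real^3. complex_of_real (bF n (k\<^sup>2 * (norm x)\<^sup>2))) (- {0})"
  proof (rule C2_on_radial)
    have l: "((%s. k\<^sup>2 * s) has_real_derivative k\<^sup>2) (at s)" for s by (auto intro!: derivative_eq_intros)
    show "((%s. bF n (k\<^sup>2 * s)) has_real_derivative bF' n (k\<^sup>2 * s) * k\<^sup>2) (at s)" for s
      by (rule DERIV_chain2[OF bF_deriv(1) l])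
    show "((%s. bF' n (k\<^sup>2 * s) * k\<^sup>2) has_real_derivative (bF'' n (k\<^sup>2 * s) * k\<^sup>2) * k\<^sup>2) (at s)" for s
      by (intro DERIV_cmult_right DERIV_chain2[OF bF_deriv(2) l])
    have "continuous_on UNIV (bF'' n)"
    proof -
      have "isCont (bF'' n) s" for s
        unfolding bF''_def[abs_def]
        by (rule isCont_powser_converges_everywhere[OF diffs_summable[OF diffs_summable[OF bc_summable[of n]]]])
      thus ?thesis by (intro continuous_at_imp_continuous_on ballI)
    qed
    from continuous_on_compose2[OF this continuous_on_mult[OF continuous_on_const continuous_on_id] subset_UNIV, of "{0<..}" "k\<^sup>2"]
    show "continuous_on {0<..} (%s. (bF'' n (k\<^sup>2 * s) * k\<^sup>2) * k\<^sup>2)"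
      by (intro continuous_on_mult continuous_on_const)
  qed
  have "C2_on (%x. of_real k ^ n * of_real (norm x) ^ n * of_real (bF n (k\<^sup>2 * (norm x)\<^sup>2)) * Tc f n i (sgn x)) (- {0})"
    by (rule C2_on_mult[OF o C2_on_mult[OF o C2_on_mult[OF o C2_on_const C2_on_power[OF o C2_on_norm]] B] C2_on_Tc_sgn])
  thus ?thesis
    by (rule C2_on_cong[OF _ o]) (simp add: incident_field_nth spherical_bessel_j_eq power_mult_distrib)
qed

lemma vm_Tc:
  assumes "\<And>x i. norm x = 1 ==> w (r *\<^sub>R x) $ i = c * Tc f n i x"
    and "\<And>i. C1_on (G i) UNIV"
  shows "vm w G r = c * sI (cdot (Tc f n) G)"
proof -
  have "vm w G r = (\<Sum>i\<in>UNIV. sI (%x. c * (Tc f n i x * G i x)))"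
    unfolding vm_def mom_def by (intro sum.cong refl sI_cong) (simp add: assms(1))
  also have "\<dots> = c * cinner (Tc f n) G" by (simp add: sI_cmult sum_distrib_left)
  also have "cinner (Tc f n) G = sI (cdot (Tc f n) G)"
    by (intro sI_sum[symmetric] continuous_on_mult C1_cont[OF C1_on_Tc] C1_cont[OF assms(2)]) simp
  finally show ?thesis .
qed

lemma Tc_vm:
  assumes "\<And>x i. norm x = 1 ==> w (r *\<^sub>R x) $ i = c * Tc f n i x"
  shows "mU w y d r = 0" "mD w y d r = 0" "mX w y d r = c * Nm f n y d"
  unfolding mU_def mD_def mX_def
  by (subst vm_Tc[OF assms], assumption, rule C1_on_test, simp add: Tc_moments)+

lemma incident_moments:
  assumes "r > 0"
  shows "mU (incident_field n f k) y d r = 0" "mD (incident_field n f k) y d r = 0"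
    "mX (incident_field n f k) y d r = of_real (spherical_bessel_j n (k * r)) * Nm f n y d"
proof -
  have E: "incident_field n f k (r *\<^sub>R x) $ i = of_real (spherical_bessel_j n (k * r)) * Tc f n i x" if "norm x = 1" for x i
  proof -
    have "x \<noteq> 0" using that by auto
    thus ?thesis using assms that by (simp add: incident_field_nth sgn_scaleR) (simp add: sgn_div_norm)
  qed
  show "mU (incident_field n f k) y d r = 0" "mD (incident_field n f k) y d r = 0"
    "mX (incident_field n f k) y d r = of_real (spherical_bessel_j n (k * r)) * Nm f n y d"
    by (rule Tc_vm, erule E)+
qed

section \<open>The incident pattern does not vanish\<close>

lemma C1_on_cnj: assumes "C1_on f S" shows "C1_on (%x. cnj (f x)) S"
proof -
  have D: "((%x. cnj (f x)) has_derivative (%v. cnj (\<Sum>j\<in>UNIV. (v $ j) *\<^sub>R partial j f x))) (at x)" if "x \<in> S" for x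
    by (rule bounded_linear.has_derivative[OF bounded_linear_cnj has_derivative_partials[OF C1_onD(1)[OF assms that]]])
  have P: "partial j (%x. cnj (f x)) x = cnj (partial j f x)" if "x \<in> S" for x j
    unfolding partial_has_derivative[OF D[OF that]]
    by (simp add: axis_def if_distrib[of "%a. a *\<^sub>R _"] cong: if_cong)
  have "continuous_on S (%x. cnj (partial j f x))" for j
    by (intro continuous_on_cnj C1_onD(2)[OF assms])
  hence "continuous_on S (partial j (%x. cnj (f x)))" for j
    by (rule continuous_on_eq) (simp add: P)
  thus ?thesis using D by (auto simp: C1_on_def differentiable_def)
qed

text \<open>A tangential vector with zero cross product with x is zero, so the surface gradient of
  \<open>Qh\<close> vanishes. Integrating it by parts against the conjugate of \<open>Qh\<close>
  leaves n(n+1) times the integral of |Qh|^2, and n \<ge> 1.\<close>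

lemma Qh_zero_if_Tc_zero:
  assumes n: "n \<ge> 1" and T: "\<And>x i. norm x = 1 ==> Tc f n i x = 0" and x: "norm x = 1"
  shows "Qh f n x = 0"
proof -
  have Q0: "Qg f n i x = 0" if x: "norm x = 1" for x i
  proof -
    have t: "Qg f n 2 x * cx 3 x - Qg f n 3 x * cx 2 x = 0" "Qg f n 3 x * cx 1 x - Qg f n 1 x * cx 3 x = 0"
      "Qg f n 1 x * cx 2 x - Qg f n 2 x * cx 1 x = 0"
      using T[OF x, of 1] T[OF x, of 2] T[OF x, of 3] by simp_all
    have d: "cx 1 x * Qg f n 1 x + cx 2 x * Qg f n 2 x + cx 3 x * Qg f n 3 x = 0"
      using x_dot_Qg[OF x, of f n] by (simp add: sum_3)
    have "q1 = 0 \<and> q2 = 0 \<and> q3 = 0"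
      if "q2 * x3 - q3 * x2 = 0" "q3 * x1 - q1 * x3 = 0" "q1 * x2 - q2 * x1 = 0" "x1 * q1 + x2 * q2 + x3 * q3 = 0"
        "x1 * x1 + x2 * x2 + x3 * x3 = 1" for q1 q2 q3 x1 x2 x3 :: complex
      using that by algebra
    from this[OF t d unit3[OF x]] show ?thesis using exhaust_3[of i] by auto
  qed
  have "sI (%x. \<Sum>i\<in>UNIV. tg i (%x. cnj (Qh f n x)) x * Qg f n i x)
    = - sI (%x. cnj (Qh f n x) * (\<Sum>i\<in>UNIV. tg i (Qg f n i) x))"
    by (rule sI_tangential_ibp) (simp_all add: C1_on_cnj C1_on_Qh C1_on_Qg x_dot_Qg)
  moreover have "sI (%x. \<Sum>i\<in>UNIV. tg i (%x. cnj (Qh f n x)) x * Qg f n i x) = sI (%x. 0)"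
    by (rule sI_cong) (simp add: Q0)
  moreover have "sI (%x. cnj (Qh f n x) * (\<Sum>i\<in>UNIV. tg i (Qg f n i) x))
      = sI (%x. - of_nat (n * (n + 1)) * of_real ((cmod (Qh f n x))\<^sup>2))"
    by (rule sI_cong) (simp only: div_Qg complex_norm_square mult_ac)
  ultimately have "of_nat (n * (n + 1)) * sI (%x. of_real ((cmod (Qh f n x))\<^sup>2)) = 0"
    unfolding sI_cmult by (simp del: of_nat_mult of_nat_add)
  hence "sI (%x. of_real ((cmod (Qh f n x))\<^sup>2)) = 0" using n by (simp del: of_nat_mult of_nat_add)
  hence "(cmod (Qh f n x))\<^sup>2 = 0"
    by (rule sI_nonneg_eq_0D[rotated 2]) (auto intro!: continuous_intros C1_cont[OF C1_on_Qh] simp: x)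
  thus ?thesis by simp
qed

text \<open>Restriction to a circle of latitude x_3 = t chosen off the zeros of the m-th Legendre
  factor gives a trigonometric polynomial in \<phi> whose m-th coefficient is not zero.\<close>

lemma Qh_nonzero:
  assumes m: "m \<in> {- int n..int n}" "f m \<noteq> 0"
  shows "\<exists>x. norm x = 1 \<and> Qh f n x \<noteq> 0"
proof (rule ccontr)
  assume "\<not> ?thesis"
  hence Q: "Qh f n x = 0" if "norm x = 1" for x using that by blast
  have "finite {t. poly (legd n (nat \<bar>m\<bar>)) t = 0}"
    by (rule poly_roots_finite, rule legd_nonzero) (use m in auto)
  moreover have "infinite {-1<..<1::real}" by simp
  ultimately obtain t where t: "-1 < t" "t < 1" "poly (legd n (nat \<bar>m\<bar>)) t \<noteq> 0"
    by (metis (mono_tags, lifting) finite_subset greaterThanLessThan_iff mem_Collect_eq subsetI)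
  define s where "s = sqrt (1 - t\<^sup>2)"
  have t2: "t\<^sup>2 < 1" using t by (simp add: abs_square_less_1)
  have s: "s > 0" "s\<^sup>2 = 1 - t\<^sup>2" using t2 by (simp_all add: s_def)
  define a where "a j = f j * shc n j * (of_real s ^ nat \<bar>j\<bar> * of_real (poly (legd n (nat \<bar>j\<bar>)) t))" for j
  have E: "(\<Sum>j\<in>{- int n..int n}. a j * cis (of_int j * \<phi>)) = 0" for \<phi>
  proof -
    define x :: "real^3" where "x = vector [s * cos \<phi>, s * sin \<phi>, t]"
    have "(norm x)\<^sup>2 = s\<^sup>2 * ((sin \<phi>)\<^sup>2 + (cos \<phi>)\<^sup>2) + t\<^sup>2"
      unfolding norm3_eq distrib_left by (simp add: x_def vector_3 power_mult_distrib)
    hence "(norm x)\<^sup>2 = 1" by (simp add: s)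
    hence x1: "norm x = 1" using norm_ge_zero[of x] by (auto simp: power2_eq_1_iff)
    have "mode qf n j x = (of_real s ^ nat \<bar>j\<bar> * of_real (poly (legd n (nat \<bar>j\<bar>)) t)) * cis (of_int j * \<phi>)" for j
    proof -
      have "zs (sgc j) x = of_real s * cis ((if j \<ge> 0 then 1 else -1) * \<phi>)"
        by (simp add: zs_def sgc_def x_def vector_3 complex_eq_iff)
      moreover have "real (nat \<bar>j\<bar>) * ((if j \<ge> 0 then 1 else -1) * \<phi>) = of_int j * \<phi>" by simp
      ultimately have "zs (sgc j) x ^ nat \<bar>j\<bar> = of_real s ^ nat \<bar>j\<bar> * cis (of_int j * \<phi>)"
        by (simp only: power_mult_distrib Complex.DeMoivre)
      thus ?thesis by (simp add: qf_def rp_def x_def vector_3)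
    qed
    thus ?thesis using Q[OF x1] by (simp add: Qh_def a_def mult_ac)
  qed
  \<comment> \<open>Multiplication by exp(\<i> n \<phi>) shifts the frequencies -n..n to exponents
    0..2n; the resulting polynomial vanishes on an arc of the unit circle, hence has infinitely many
    roots.\<close>
  have P: "(\<Sum>i\<le>2 * n. a (int i - int n) * z ^ i) = 0" if z: "z \<in> cis ` {0<..<1}" for z
  proof -
    obtain \<phi> where z: "z = cis \<phi>" using z by auto
    have "(\<Sum>i\<le>2 * n. a (int i - int n) * z ^ i) = (\<Sum>j\<in>{- int n..int n}. a j * z ^ nat (j + int n))"
      by (rule sum.reindex_bij_witness[of _ "%j. nat (j + int n)" "%i. int i - int n"]) auto
    also have "\<dots> = (\<Sum>j\<in>{- int n..int n}. cis (real n * \<phi>) * (a j * cis (of_int j * \<phi>)))"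
    proof (intro sum.cong refl)
      fix j assume j: "j \<in> {- int n..int n}"
      have "real (nat (j + int n)) = of_int j + real n" using j by simp
      hence "z ^ nat (j + int n) = cis (real n * \<phi> + of_int j * \<phi>)"
        by (simp only: z Complex.DeMoivre) (simp add: algebra_simps)
      thus "a j * z ^ nat (j + int n) = cis (real n * \<phi>) * (a j * cis (of_int j * \<phi>))"
        by (simp add: mult_ac flip: cis_mult)
    qed
    also have "\<dots> = 0" by (simp add: E flip: sum_distrib_left)
    finally show ?thesis .
  qed
  have "inj_on cis {0<..<1}"
    by (rule inj_on_inverseI[of _ Arg]) (use pi_gt3 in \<open>auto intro!: cis_Arg_unique Arg_unique[of 1]\<close>)
  hence "infinite (cis ` {0<..<1})" by (simp add: finite_image_iff)
  hence inf: "infinite {z. (\<Sum>i\<le>2 * n. a (int i - int n) * z ^ i) = 0}"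
    by (rule infinite_super[rotated]) (use P in auto)
  have "a (int (nat (m + int n)) - int n) = 0"
  proof (rule ccontr)
    assume "a (int (nat (m + int n)) - int n) \<noteq> 0"
    moreover have "nat (m + int n) \<le> 2 * n" using m by auto
    ultimately show False using inf Transcendental.polyfun_finite_roots[of "%i. a (int i - int n)" "2 * n"] by auto
  qed
  hence "a m = 0" using m by simp
  moreover have "shc n m \<noteq> 0"
    unfolding shc_def of_real_eq_0_iff real_sqrt_eq_zero_cancel_iff by simp
  ultimately show False using m t s by (simp add: a_def)
qed

lemma Tc_nonzero:
  assumes "n \<ge> 1" "m \<in> {- int n..int n}" "f m \<noteq> 0"
  shows "\<exists>x i. norm x = 1 \<and> Tc f n i x \<noteq> 0"
  using Qh_nonzero[OF assms(2), of f, OF assms(3)] Qh_zero_if_Tc_zero[OF assms(1)] by blast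

section \<open>Radial equations for the moments of a solution\<close>

lemma lc_lower:
  assumes "d \<ge> 2 ==> F (d - 2) = 0"
  shows "lc y d F = - of_nat (d * (d + 1)) * F d"
proof (cases "d \<ge> 2")
  case True
  show ?thesis unfolding lc_def assms[OF True] mult_zero_right diff_0 mult_minus_left ..
next
  case False
  hence "d * (d - 1) = 0" by (cases d) auto
  thus ?thesis unfolding lc_def by (simp del: of_nat_mult of_nat_add)
qed

text \<open>Once the moments of degree d - 2 vanish, \<open>lc\<close> is multiplication by -d(d+1),
  and the general moment equations close to a system in degree d.\<close>

lemma spheroidal_moments:
  assumes sh: "shell T S" and w: "C2_on w S" and am: "a > 0" "m > 0"
    and eq: "\<And>x i. x \<in> S ==> of_real a * partial i (cdiv w) x - of_real m * ccurl (ccurl w) x $ i + of_real k * w x $ i = 0"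
    and low: "\<And>r. r \<in> T ==> d \<ge> 2 ==> mU w y (d - 2) r = 0 \<and> mP w y (d - 2) r = 0"
  shows "spheroidal T a m k (real (d * (d + 1))) (mU w y d) (mD w y d) (mP w y d) (mX (ccurl w) y d)"
  unfolding spheroidal_def
proof (intro ballI conjI)
  fix r assume r: "r \<in> T"
  have S: "open S" and r0: "r > 0" using sh r by (auto simp: shell_def)
  have C1w: "C1_on (cmp w i) S" for i by (rule C2_on_C1[OF C2_on_vec_nth[OF S(1) w]])
  have C1c: "C1_on (cmp (ccurl w) i) S" for i by (rule C1_on_ccurl[OF C2_on_vec_nth[OF S(1) w]])
  have a0: "complex_of_real a \<noteq> 0" using am by simp
  have L: "(mP w y d hvd (of_real m / of_real r * mX (ccurl w) y d r - of_real k * mU w y d r) / of_real a) (at r)"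
    "of_real m * mD (ccurl (ccurl w)) y d r = of_real a / of_real r * lc y d (%e. mP w y e r) + of_real k * mD w y d r"
    by (rule lame_moments[OF sh w r a0], erule eq)+
  show "(mU w y d hvd mP w y d r - 2 / of_real r * mU w y d r - 1 / of_real r * mD w y d r) (at r)"
    by (rule mU_deriv[OF sh C1w r])
  have lU: "lc y d (%e. mU w y e r) = - of_nat (d * (d + 1)) * mU w y d r"
    by (rule lc_lower) (use low[OF r] in auto)
  show "(mD w y d hvd mX (ccurl w) y d r - 1 / of_real r * mD w y d r - of_real (real (d * (d + 1))) / of_real r * mU w y d r) (at r)"
    by (rule has_vector_derivative_rhs[OF mD_deriv[OF sh C1w r]]) (unfold lU, simp del: of_nat_mult of_nat_add)
  show "(mP w y d hvd (of_real m / of_real r * mX (ccurl w) y d r - of_real k * mU w y d r) / of_real a) (at r)"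
    by (rule L(1))
  have lP: "lc y d (%e. mP w y e r) = - of_nat (d * (d + 1)) * mP w y d r"
    by (rule lc_lower) (use low[OF r] in auto)
  have m0: "complex_of_real m \<noteq> 0" using am by simp
  have "mD (ccurl (ccurl w)) y d r = (of_real a / of_real r * (- of_nat (d * (d + 1)) * mP w y d r) + of_real k * mD w y d r) / of_real m"
    using L(2)[unfolded lP] m0 by (metis nonzero_mult_div_cancel_left)
  hence E: "- mD (ccurl (ccurl w)) y d r = (of_real a * of_nat (d * (d + 1)) / of_real r * mP w y d r - of_real k * mD w y d r) / of_real m"
    by (simp add: divide_simps) (simp add: algebra_simps)
  show "(mX (ccurl w) y d hvd (of_real a * of_real (real (d * (d + 1))) / of_real r * mP w y d r - of_real k * mD w y d r) / of_real m - 1 / of_real r * mX (ccurl w) y d r) (at r)"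
    by (rule has_vector_derivative_rhs[OF mX_deriv[OF sh C1c r]]) (unfold E of_real_of_nat_eq, rule refl)
qed

text \<open>The factor r removes the first-order term, exactly as for \<open>Zj\<close>;
  \<open>Zv\<close> below is the derivative, expressed by a moment of the curl.\<close>

definition Zw :: "vfield => real^3 => nat => real => complex" where
  "Zw w y d r = of_real r * mX w y d r"

definition Zv :: "vfield => real^3 => nat => real => complex" where
  "Zv w y d r = - (of_real r * mD (ccurl w) y d r)"

lemma has_vector_derivative_times_id:
  fixes f :: "real => complex"
  assumes "(f hvd f') (at r)"
  shows "((%r. of_real r * f r) hvd (of_real r * f' + f r)) (at r)"
proof -
  have "((%r::real. complex_of_real r) hvd of_real 1) (at r)"
    by (rule has_vector_derivative_of_real) (rule DERIV_ident)
  from hvd_mult[OF this assms] show ?thesis by simp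
qed

lemma Zw_deriv:
  assumes sh: "shell T S" and w: "\<And>i. C2_on (cmp w i) S" and r: "r \<in> T"
  shows "(Zw w y d hvd Zv w y d r) (at r)"
    "(Zv w y d hvd - (of_real r * mX (ccurl (ccurl w)) y d r) - lc y d (%e. mX w y e r) / of_real r) (at r)"
proof -
  have r0: "complex_of_real r \<noteq> 0" using sh r by (auto simp: shell_def)
  have C1w: "C1_on (cmp w i) S" for i by (rule C2_on_C1[OF w])
  have C1c: "C1_on (cmp (ccurl w) i) S" for i by (rule C1_on_ccurl[OF w])
  show "(Zw w y d hvd Zv w y d r) (at r)"
    unfolding Zw_def[abs_def]
    by (rule has_vector_derivative_rhs[OF has_vector_derivative_times_id[OF mX_deriv[OF sh C1w r]]])
       (use r0 in \<open>simp add: Zv_def algebra_simps\<close>)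
  have mU: "lc y d (%e. mU (ccurl w) y e r) = lc y d (%e. mX w y e r) / of_real r"
    unfolding lc_def mU_curl[OF sh C1w r] by (simp add: diff_divide_distrib mult_ac)
  show "(Zv w y d hvd - (of_real r * mX (ccurl (ccurl w)) y d r) - lc y d (%e. mX w y e r) / of_real r) (at r)"
    unfolding Zv_def[abs_def]
    by (rule has_vector_derivative_rhs[OF hvd_minus[OF has_vector_derivative_times_id[OF mD_deriv[OF sh C1c r]]]])
       (unfold mU, use r0 in \<open>simp add: algebra_simps\<close>)
qed

text \<open>The moment obeys an equation with d(d+1) and a source of degree d - 2, the profile A one
  with n(n+1). By \<open>lc_Nm\<close> the product of A with \<open>Nm\<close> obeys the sourced
  equation too; if the two agree in degree d - 2 the sources cancel in the difference.\<close>

lemma toroidal_diff: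
  assumes sh: "shell T S" and w: "\<And>i. C2_on (cmp w i) S" and r: "r \<in> T"
    and X: "mX (ccurl (ccurl w)) y d r = of_real \<kappa> * mX w y d r"
    and A: "(A hvd A' r) (at r)" "(A' hvd of_real (real (n * (n + 1)) / r\<^sup>2 - \<kappa>) * A r) (at r)"
    and low: "d \<ge> 2 ==> Zw w y (d - 2) r = A r * Nm f n y (d - 2)"
  shows "((%r. Zw w y d r - A r * Nm f n y d) hvd (Zv w y d r - A' r * Nm f n y d)) (at r)"
    "((%r. Zv w y d r - A' r * Nm f n y d) hvd
        of_real (real (d * (d + 1)) / r\<^sup>2 - \<kappa>) * (Zw w y d r - A r * Nm f n y d)) (at r)"
proof -
  have r0: "complex_of_real r \<noteq> 0" using sh r by (auto simp: shell_def)
  show "((%r. Zw w y d r - A r * Nm f n y d) hvd (Zv w y d r - A' r * Nm f n y d)) (at r)"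
    by (intro hvd_diff Zw_deriv[OF sh w r] hvd_mult_left A)
  have N: "of_nat (d * (d - 1)) * of_real ((norm y)\<^sup>2) * Nm f n y (d - 2) = of_nat (d * (d + 1)) * Nm f n y d - of_nat (n * (n + 1)) * Nm f n y d"
    using lc_Nm[of y d f n] unfolding lc_def by (simp add: algebra_simps)
  have l: "of_real r * lc y d (%e. mX w y e r) = - of_nat (d * (d + 1)) * (Zw w y d r - A r * Nm f n y d) - of_nat (n * (n + 1)) * (A r * Nm f n y d)"
  proof -
    have "of_real r * lc y d (%e. mX w y e r) = of_nat (d * (d - 1)) * of_real ((norm y)\<^sup>2) * Zw w y (d - 2) r - of_nat (d * (d + 1)) * Zw w y d r"
      unfolding lc_def Zw_def by (simp add: algebra_simps)
    also have "of_nat (d * (d - 1)) * of_real ((norm y)\<^sup>2) * Zw w y (d - 2) r = A r * (of_nat (d * (d - 1)) * of_real ((norm y)\<^sup>2) * Nm f n y (d - 2))"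
    proof (cases "d \<ge> 2")
      case True thus ?thesis using low by simp
    next
      case False
      hence "d = 0 \<or> d = 1" by auto
      thus ?thesis by auto
    qed
    finally show ?thesis unfolding N by (simp add: algebra_simps)
  qed
  have E: "- (R * (K * X)) - L / R - (N / R\<^sup>2 - K) * A * M = (D / R\<^sup>2 - K) * (R * X - A * M)"
    if "R * L = - D * (R * X - A * M) - N * (A * M)" "R \<noteq> 0" for R K X L N A M D :: complex
  proof -
    have "L / R = (- D * (R * X - A * M) - N * (A * M)) / R\<^sup>2"
      unfolding that(1)[symmetric] using that(2) by (simp add: power2_eq_square)
    thus ?thesis by (simp add: divide_inverse algebra_simps)
  qed
  show "((%r. Zv w y d r - A' r * Nm f n y d) hvd
        of_real (real (d * (d + 1)) / r\<^sup>2 - \<kappa>) * (Zw w y d r - A r * Nm f n y d)) (at r)"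
    by (rule has_vector_derivative_rhs[OF hvd_diff[OF Zw_deriv(2)[OF sh w r] hvd_mult_left[OF A(2)]]])
       (use E[OF l[unfolded Zw_def] r0] in \<open>simp add: X Zw_def\<close>)
qed

text \<open>The traction with normal x, formed from an array f j i in place of the derivatives
  \<partial>_j w_i. The same expression thus serves the field at radius r and the boundary traces of
  its derivatives.\<close>

definition tau :: "real => real => (3 => 3 => sfield) => 3 => sfield" where
  "tau lam \<mu> f i x = of_real lam * (\<Sum>k\<in>UNIV. f k k x) * cx i x + of_real \<mu> * (\<Sum>j\<in>UNIV. (f j i x + f i j x) * cx j x)"

definition tauI :: "real => real => (3 => 3 => sfield) => (3 => sfield) => complex" where
  "tauI lam \<mu> f G = sI (cdot (tau lam \<mu> f) G)"

lemma tau_expand: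
  assumes f: "\<And>j i. contS (f j i)" and G: "\<And>i. contS (G i)"
  shows "tauI lam \<mu> f G = (\<Sum>i\<in>UNIV. of_real lam * (\<Sum>k\<in>UNIV. sI (%x. f k k x * (cx i x * G i x)))
     + of_real \<mu> * (\<Sum>j\<in>UNIV. sI (%x. f j i x * (cx j x * G i x)) + sI (%x. f i j x * (cx j x * G i x))))"
proof -
  have c: "contS (%x. c * (f j i x * (cx k x * G l x)))" for c j i k l
    by (intro continuous_on_mult f G continuous_intros)
  have c1: "contS (%x. of_real \<mu> * (f j i x * (cx k x * G l x)) + of_real \<mu> * (f j' i' x * (cx k x * G l x)))" for j i k l j' i'
    by (intro continuous_on_add c)
  have "tauI lam \<mu> f G = sI (%x. \<Sum>i\<in>UNIV. (\<Sum>k\<in>UNIV. of_real lam * (f k k x * (cx i x * G i x)))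
     + (\<Sum>j\<in>UNIV. of_real \<mu> * (f j i x * (cx j x * G i x)) + of_real \<mu> * (f i j x * (cx j x * G i x))))"
    unfolding tauI_def tau_def
    by (rule sI_cong) (simp only: sum_distrib_left sum_distrib_right distrib_left distrib_right mult.assoc mult.left_commute mult.commute)
  also have "\<dots> = (\<Sum>i\<in>UNIV. (\<Sum>k\<in>UNIV. sI (%x. of_real lam * (f k k x * (cx i x * G i x))))
     + (\<Sum>j\<in>UNIV. sI (%x. of_real \<mu> * (f j i x * (cx j x * G i x))) + sI (%x. of_real \<mu> * (f i j x * (cx j x * G i x)))))"
    by (subst sI_sum, simp, intro continuous_on_add continuous_on_sum c,
        subst sI_add, (intro continuous_on_sum c c1)+, (subst sI_sum, simp, (intro c c1)+)+, subst sI_add, (intro c)+, rule refl)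
  finally show ?thesis by (simp only: sI_cmult sum_distrib_left distrib_left)
qed

lemma tau_tendsto:
  assumes F: "\<forall>\<^sub>F r in L. \<forall>j i. contS (F r j i)" and f: "\<And>j i. contS (f j i)"
    and G: "\<And>i. contS (G i)"
    and lim: "\<And>j i g. contS g ==> ((%r. sI (%x. F r j i x * g x)) ---> sI (%x. f j i x * g x)) L"
  shows "((%r. tauI lam \<mu> (F r) G) ---> tauI lam \<mu> f G) L"
proof -
  have c: "contS (%x. cx k x * G l x)" for k l
    by (intro continuous_on_mult G continuous_intros)
  have "((%r. \<Sum>i\<in>UNIV. of_real lam * (\<Sum>k\<in>UNIV. sI (%x. F r k k x * (cx i x * G i x)))
     + of_real \<mu> * (\<Sum>j\<in>UNIV. sI (%x. F r j i x * (cx j x * G i x)) + sI (%x. F r i j x * (cx j x * G i x)))) ---> tauI lam \<mu> f G) L"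
    unfolding tau_expand[OF f G]
    by (intro tendsto_sum tendsto_add tendsto_mult tendsto_const lim c)
  moreover have "\<forall>\<^sub>F r in L. (\<Sum>i\<in>UNIV. of_real lam * (\<Sum>k\<in>UNIV. sI (%x. F r k k x * (cx i x * G i x)))
     + of_real \<mu> * (\<Sum>j\<in>UNIV. sI (%x. F r j i x * (cx j x * G i x)) + sI (%x. F r i j x * (cx j x * G i x)))) = tauI lam \<mu> (F r) G"
    using F by (rule eventually_mono) (rule tau_expand[symmetric], auto intro: G)
  ultimately show ?thesis by (simp add: tendsto_cong)
qed

section \<open>Moments of the traction\<close>

lemma crx_simps:
  "crx G 1 x = cx 3 x * G 2 x - cx 2 x * G 3 x" "crx G 2 x = cx 1 x * G 3 x - cx 3 x * G 1 x"
  "crx G 3 x = cx 2 x * G 1 x - cx 1 x * G 2 x"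
  by (simp_all add: crx_def)

lemma vm_radial_deriv:
  assumes sh: "shell T S" and w: "\<And>i. C1_on (cmp w i) S" and G: "\<And>i. contS (G i)" and r: "r \<in> T"
  shows "(vm w G hvd (\<Sum>i\<in>UNIV. sI (%x. (\<Sum>j\<in>UNIV. cx j x * partial j (cmp w i) (r *\<^sub>R x)) * G i x))) (at r)"
  unfolding vm_def[abs_def]
  by (intro hvd_sum mom_has_vector_derivative[OF sh w G r])

text \<open>For a unit normal x, twice the symmetrized gradient applied to x equals twice the
  derivative along x plus x \<times> curl w. The traction is thereby reduced to moments of
  divergence, curl and the field itself.\<close>

lemma tau_moments:
  assumes sh: "shell T S" and w: "\<And>i. C1_on (cmp w i) S" and G: "\<And>i. C1_on (G i) UNIV" and r: "r \<in> T"
    and D: "(vm w G hvd D) (at r)"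
  shows "tauI lam \<mu> (%j i x. partial j (cmp w i) (r *\<^sub>R x)) G
    = of_real lam * mom (cdiv w) (cdot cx G) r + 2 * of_real \<mu> * D + of_real \<mu> * vm (ccurl w) (crx G) r"
proof -
  let ?p = "%j i x. partial j (cmp w i) (r *\<^sub>R x)"
  have cG: "contS (G i)" for i by (rule C1_cont[OF G])
  have cp: "contS (?p j i)" for j i
    using conts_C1(2)[OF sh r w] by (simp add: conts_def)
  have cX: "contS (crx G i)" for i
    unfolding crx_def[abs_def] using exhaust_3[of i]
    by (elim disjE) (simp_all, (intro continuous_on_diff continuous_on_mult cG continuous_intros)+)
  have cc: "contS (%x. ccurl w (r *\<^sub>R x) $ i)" for i
    using exhaust_3[of i] by (elim disjE) (simp_all add: continuous_on_diff cp)
  have Dv: "D = sI (%x. \<Sum>i\<in>UNIV. (\<Sum>j\<in>UNIV. cx j x * ?p j i x) * G i x)"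
  proof -
    have "D = (\<Sum>i\<in>UNIV. sI (%x. (\<Sum>j\<in>UNIV. cx j x * ?p j i x) * G i x))"
      by (rule vector_derivative_unique_at[OF D vm_radial_deriv[OF sh w cG r]])
    thus ?thesis
      by (subst sI_sum) (auto intro!: continuous_on_mult continuous_on_sum cp cG continuous_intros)
  qed
  have Cv: "vm (ccurl w) (crx G) r = sI (%x. \<Sum>i\<in>UNIV. ccurl w (r *\<^sub>R x) $ i * crx G i x)"
    unfolding vm_def mom_def
    by (subst sI_sum) (auto intro!: continuous_on_mult cc cX)
  have "tauI lam \<mu> ?p G = sI (%x. of_real lam * (cdiv w (r *\<^sub>R x) * (cdot cx G x))
      + (2 * of_real \<mu> * (\<Sum>i\<in>UNIV. (\<Sum>j\<in>UNIV. cx j x * ?p j i x) * G i x)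
      + of_real \<mu> * (\<Sum>i\<in>UNIV. ccurl w (r *\<^sub>R x) $ i * crx G i x)))"
  proof -
    have "(l * (a + e + i) * x + m * ((a + a) * x + (b + d) * y + (c + g) * z)) * u
        + (l * (a + e + i) * y + m * ((d + b) * x + (e + e) * y + (f + h) * z)) * v
        + (l * (a + e + i) * z + m * ((g + c) * x + (h + f) * y + (i + i) * z)) * w
      = l * ((a + e + i) * (x * u + y * v + z * w)) + (2 * m * ((x * a + y * b + z * c) * u + (x * d + y * e + z * f) * v + (x * g + y * h + z * i) * w)
        + m * ((h - f) * (z * v - y * w) + (c - g) * (x * w - z * u) + (d - b) * (y * u - x * v)))"
      for l m a b c d e f g h i x y z u v w :: complex by algebra
    note A = this
    show ?thesis
      unfolding tauI_def tau_def cdiv_def sum_3 ccurl_nth crx_simps by (intro sI_cong) (rule A)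
  qed
  also have "\<dots> = sI (%x. of_real lam * (cdiv w (r *\<^sub>R x) * (cdot cx G x)))
     + (sI (%x. 2 * of_real \<mu> * (\<Sum>i\<in>UNIV. (\<Sum>j\<in>UNIV. cx j x * ?p j i x) * G i x))
     + sI (%x. of_real \<mu> * (\<Sum>i\<in>UNIV. ccurl w (r *\<^sub>R x) $ i * crx G i x)))"
    unfolding cdiv_def
    by (subst sI_add, (intro continuous_on_add continuous_on_mult continuous_on_sum cp cc cX cG continuous_intros)+,
        subst sI_add, (intro continuous_on_add continuous_on_mult continuous_on_sum cp cc cX cG continuous_intros)+, rule refl)
  finally show ?thesis unfolding Dv Cv sI_cmult mom_def by simp
qed

lemma vm_crx_gS: "vm w (crx (gS y d)) r = mX w y d r"
proof -
  have "vm w (crx (gS y d)) r = vm w (%i x. - gL y d i x) r"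
  proof (rule vm_cong)
    fix i :: 3 and x :: "real^3" assume x: "norm x = 1"
    from gS_cross_x[OF x, where y = y and d = d] show "crx (gS y d) i x = - gL y d i x"
      using exhaust_3[of i] by (elim disjE) (simp_all add: crx_def mult.commute)
  qed
  thus ?thesis by (simp add: vm_minus mX_def)
qed

lemma vm_crx_gL: "vm w (crx (gL y d)) r = - mD w y d r"
proof -
  have "vm w (crx (gL y d)) r = vm w (gS y d) r"
  proof (rule vm_cong)
    fix i :: 3 and x :: "real^3" assume x: "norm x = 1"
    from gL_cross_x[OF x, where y = y and d = d] show "crx (gL y d) i x = gS y d i x"
      using exhaust_3[of i] by (elim disjE) (simp_all add: crx_def mult.commute)
  qed
  thus ?thesis by (simp add: mD_def)
qed

lemma tau_moments_test:
  assumes sh: "shell T S" and w: "\<And>i. C1_on (cmp w i) S" and r: "r \<in> T"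
  shows "tauI lam \<mu> (%j i x. partial j (cmp w i) (r *\<^sub>R x)) (gX y d)
      = of_real lam * mP w y d r + 2 * of_real \<mu> * (mP w y d r - 2 / of_real r * mU w y d r - 1 / of_real r * mD w y d r)" (is ?A)
    "tauI lam \<mu> (%j i x. partial j (cmp w i) (r *\<^sub>R x)) (gS y d)
      = of_real \<mu> * (2 / of_real r * mD w y d r - 2 / of_real r * lc y d (%e. mU w y e r) - mX (ccurl w) y d r)" (is ?B)
    "tauI lam \<mu> (%j i x. partial j (cmp w i) (r *\<^sub>R x)) (gL y d)
      = of_real \<mu> * (mD (ccurl w) y d r + 2 / of_real r * mX w y d r)" (is ?C)
proof -
  have d: "(vm w (gS y d) hvd - v) (at r)" if "(mD w y d hvd v) (at r)" for v
    using hvd_minus[OF that] by (simp add: mD_def[abs_def])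
  have d': "(vm w (gL y d) hvd - v) (at r)" if "(mX w y d hvd v) (at r)" for v
    using hvd_minus[OF that] by (simp add: mX_def[abs_def])
  have 1: "vm (ccurl w) (crx (gX y d)) r = 0"
  proof -
    have "vm (ccurl w) (crx (gX y d)) r = vm (ccurl w) (%i x. 0) r"
      by (rule vm_cong) (simp add: crx_def gX_def)
    thus ?thesis by (simp add: vm_def)
  qed
  have m1: "mom (cdiv w) (cdot cx (gX y d)) r = mP w y d r"
    unfolding mP_def
  proof (rule mom_cong)
    fix x :: "real^3" assume x: "norm x = 1"
    have "cdot cx (gX y d) x = (cx 1 x * cx 1 x + cx 2 x * cx 2 x + cx 3 x * cx 3 x) * ph y d x"
      unfolding gX_def sum_3 by (simp add: algebra_simps)
    thus "cdot cx (gX y d) x = ph y d x" by (simp add: unit3[OF x])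
  qed
  have m2: "mom (cdiv w) (cdot cx (gS y d)) r = 0" "mom (cdiv w) (cdot cx (gL y d)) r = 0"
    using mom_cong[of "%x. \<Sum>i\<in>UNIV. cx i x * gS y d i x" "%x. 0" "cdiv w" r] mom_cong[of "%x. \<Sum>i\<in>UNIV. cx i x * gL y d i x" "%x. 0" "cdiv w" r]
    by (simp_all add: x_dot_gS x_dot_gL)
  show ?A
    using tau_moments[OF sh w C1_on_test(2) r mU_deriv[OF sh w r, unfolded mU_def[abs_def]], of lam \<mu>]
    by (simp add: mU_def[abs_def] m1 1)
  show ?B
    using tau_moments[OF sh w C1_on_test(3) r d[OF mD_deriv[OF sh w r]], of lam \<mu>]
    by (simp add: m2 vm_crx_gS algebra_simps)
  show ?C
    using tau_moments[OF sh w C1_on_test(4) r d'[OF mX_deriv[OF sh w r]], of lam \<mu>]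
    by (simp add: m2 vm_crx_gL algebra_simps)
qed

section \<open>Boundary values and radiation\<close>

text \<open>\<open>F\<close> is the continuous trace of \<open>f\<close> on the unit sphere from
  within \<open>S\<close>, together with convergence of the sphere moments along the radii in
  \<open>T\<close>.\<close>

definition bval :: "(real^3) set => real set => (sfield) => (sfield) => bool" where
  "bval S T f F \<longleftrightarrow> contS F \<and> (\<forall>x. norm x = 1 \<longrightarrow> (f ---> F x) (at x within S)) \<and>
    (\<forall>g. contS g \<longrightarrow> (mom f g ---> sI (%x. F x * g x)) (at 1 within T))"

text \<open>A function of pointwise boundary limits is automatically continuous, so f extends
  continuously to \<open>S\<close> united with the sphere. Its moments are then continuous up to r =
  1, without a uniform rate being assumed.\<close>

lemma boundary_extension:
  fixes f :: "sfield"
  assumes f: "continuous_on S f" and S: "open S" "S \<inter> sphere 0 1 = {}" "sphere 0 1 \<subseteq> closure S"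
    and lim: "\<And>x. norm x = 1 ==> \<exists>l. (f ---> l) (at x within S)"
    and T: "\<And>r x. r \<in> T ==> norm x = 1 ==> r *\<^sub>R x \<in> S"
  shows "\<exists>F. bval S T f F"
proof -
  obtain F where F: "\<And>x. norm x = 1 ==> (f ---> F x) (at x within S)" using lim by metis
  have nb: "at x within S \<noteq> bot" if x: "norm x = 1" for x
  proof -
    have "x \<in> closure S" "x \<notin> S" using S(2,3) x by auto
    thus ?thesis by (auto simp: trivial_limit_within closure_def)
  qed
  have FF: "(F ---> F x) (at x within sphere 0 1)" if x: "norm x = 1" for x
  proof (rule tendstoI)
    fix e :: real assume "e > 0"
    hence "\<forall>\<^sub>F y in at x within S. dist (f y) (F x) < e / 2" by (intro tendstoD[OF F[OF x]]) simp
    then obtain d where d: "d > 0" "\<And>y. y \<in> S ==> y \<noteq> x ==> dist y x < d ==> dist (f y) (F x) < e / 2"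
      unfolding eventually_at by blast
    have "dist (F z) (F x) < e" if z: "norm z = 1" "dist z x < d" for z
    proof -
      have "dist (F z) (F x) \<le> e / 2"
      proof (rule tendsto_upperbound[OF tendsto_dist[OF F[OF z(1)] tendsto_const] _ nb[OF z(1)]])
        have "\<forall>\<^sub>F y in at z within S. y \<in> ball x d \<and> y \<in> S"
        proof (rule eventually_conj)
          show "\<forall>\<^sub>F y in at z within S. y \<in> ball x d"
            by (rule topological_tendstoD[OF tendsto_ident_at]) (use z in \<open>auto simp: dist_commute\<close>)
          show "\<forall>\<^sub>F y in at z within S. y \<in> S" by (simp add: eventually_at_filter)
        qed
        thus "\<forall>\<^sub>F y in at z within S. dist (f y) (F x) \<le> e / 2"
        proof (rule eventually_mono)
          fix y assume y: "y \<in> ball x d \<and> y \<in> S"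
          hence "y \<noteq> x" using S(2) x by auto
          with y d(2)[of y] show "dist (f y) (F x) \<le> e / 2" by (simp add: dist_commute less_imp_le)
        qed
      qed
      thus ?thesis using \<open>e > 0\<close> by simp
    qed
    thus "\<forall>\<^sub>F y in at x within sphere 0 1. dist (F y) (F x) < e"
      unfolding eventually_at using d(1) by (intro exI[of _ d]) auto
  qed
  define h where "h x = (if x \<in> S then f x else F x)" for x
  have hS: "(h ---> l) (at x within S) \<longleftrightarrow> (f ---> l) (at x within S)" for x l
    by (rule Lim_cong_within) (simp_all add: h_def)
  have hN: "(h ---> l) (at x within sphere 0 1) \<longleftrightarrow> (F ---> l) (at x within sphere 0 1)" for x l
    by (rule Lim_cong_within) (use S(2) in \<open>auto simp: h_def\<close>)
  have ch: "continuous_on (S \<union> sphere 0 1) h"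
    unfolding continuous_on_def
  proof
    fix x assume "x \<in> S \<union> sphere 0 1"
    then consider "x \<in> S" | "norm x = 1" "x \<notin> S" by auto
    thus "(h ---> h x) (at x within S \<union> sphere 0 1)"
    proof cases
      case 1
      have "(f ---> f x) (at x within S)" using f 1 by (simp add: continuous_on_def)
      hence "(h ---> h x) (at x within S)" unfolding hS using 1 by (simp add: h_def)
      moreover have "at x within (S \<union> sphere 0 1) = at x within S"
        by (rule at_within_nhd[OF 1 S(1)]) (use S(2) in auto)
      ultimately show ?thesis by simp
    next
      case 2
      hence "(h ---> h x) (at x within S)" "(h ---> h x) (at x within sphere 0 1)"
        unfolding hS hN using F FF by (simp_all add: h_def)
      thus ?thesis by (rule Lim_Un)
    qed
  qed
  have "(mom f g ---> sI (%x. F x * g x)) (at 1 within T)" if g: "contS g" for g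
  proof -
    have "continuous_on (insert 1 T) (mom h g)"
      by (rule mom_continuous_on[OF ch g]) (use T in auto)
    hence "(mom h g ---> mom h g 1) (at 1 within insert 1 T)" by (simp add: continuous_on_def)
    hence "(mom h g ---> mom h g 1) (at 1 within T)" by (rule tendsto_within_subset) auto
    moreover have "mom h g 1 = sI (%x. F x * g x)"
      unfolding mom_def by (rule sI_cong) (use S(2) in \<open>auto simp: h_def\<close>)
    moreover have "mom f g r = mom h g r" if "r \<in> T" for r
      by (rule mom_cong_left) (use T that in \<open>simp add: h_def\<close>)
    ultimately show ?thesis by (simp cong: Lim_cong_within)
  qed
  moreover have "contS F" unfolding continuous_on_def using FF by simp
  ultimately show ?thesis unfolding bval_def using F by (intro exI[of _ F]) simp
qed

lemma boundary_data:
  fixes w :: "vfield"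
  assumes w: "C2_on w S" and S: "open S" "frontier S = sphere 0 1" and B: "C1_up_to_boundary w S"
    and T: "\<And>r x. r \<in> T ==> norm x = 1 ==> r *\<^sub>R x \<in> S"
  obtains W f where "\<And>i. contS (W i)" "\<And>j i. contS (f j i)"
    "\<And>i x. norm x = 1 ==> (cmp w i ---> W i x) (at x within S)"
    "\<And>j i x. norm x = 1 ==> (partial j (cmp w i) ---> f j i x) (at x within S)"
    "\<And>i g. contS g ==> (mom (cmp w i) g ---> sI (%x. W i x * g x)) (at 1 within T)"
    "\<And>j i g. contS g ==> (mom (partial j (cmp w i)) g ---> sI (%x. f j i x * g x)) (at 1 within T)"
proof -
  have D: "S \<inter> sphere 0 1 = {}" "sphere 0 1 \<subseteq> closure S"
    using S frontier_disjoint_eq[of S] by (auto simp: frontier_def)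
  have C1: "C1_on (cmp w i) S" for i by (rule C2_on_C1[OF C2_on_vec_nth[OF S(1) w]])
  have "\<exists>F. bval S T (cmp w i) F" for i
  proof (rule boundary_extension[OF C1_on_imp_continuous_on[OF C1] S(1) D _ T])
    fix x :: "real^3" assume "norm x = 1"
    hence "x \<in> frontier S" using S(2) by simp
    then obtain l where "(w ---> l) (at x within S)" using B unfolding C1_up_to_boundary_def by blast
    thus "\<exists>l. (cmp w i ---> l) (at x within S)" by (intro exI) (rule tendsto_vec_nth)
  qed
  then obtain W where W: "\<And>i. bval S T (cmp w i) (W i)" by metis
  have "\<exists>F. bval S T (partial j (cmp w i)) F" for j i
  proof (rule boundary_extension[OF C1_onD(2)[OF C1] S(1) D _ T])
    fix x :: "real^3" assume "norm x = 1"
    hence "x \<in> frontier S" using S(2) by simp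
    then obtain l where "(partial j w ---> l) (at x within S)" using B unfolding C1_up_to_boundary_def by blast
    hence "((%y. partial j w y $ i) ---> l $ i) (at x within S)" by (rule tendsto_vec_nth)
    moreover have "partial j (cmp w i) y = partial j w y $ i" if "y \<in> S" for y
      by (rule partial_vec_nth) (use w that in \<open>auto simp: C2_on_def\<close>)
    ultimately have "(partial j (cmp w i) ---> l $ i) (at x within S)" by (simp cong: Lim_cong_within)
    thus "\<exists>l. (partial j (cmp w i) ---> l) (at x within S)" by (rule exI)
  qed
  then obtain f where f: "\<And>j i. bval S T (partial j (cmp w i)) (f j i)" by metis
  show ?thesis by (rule that[of W f]) (use W f in \<open>simp_all add: bval_def\<close>)
qed

lemma traction_nth:
  "traction lam \<mu> w \<nu> y $ i = tau lam \<mu> (%j i \<nu>. partial j (cmp w i) y) i \<nu>"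
  unfolding traction_def tau_def cdiv_def cjac_def matrix_vector_mult_def transpose_def cvec_def
  by (simp only: vector_scaleR_component vector_add_component vector_smult_component vec_lambda_beta)
     (simp add: scaleR_conv_of_real mult.assoc)

definition cf :: "(3 => 3 => sfield) => 3 => sfield" where
  "cf f i x = (if i = 1 then f 2 3 x - f 3 2 x else if i = 2 then f 3 1 x - f 1 3 x else f 1 2 x - f 2 1 x)"

text \<open>The transmission conditions enter only through the last three clauses, which express the moments of the
  boundary traction \<open>t\<close> by one-sided limits of moments of \<open>w\<close>.\<close>

definition one_sided :: "real set => (real^3) set => vfield => (3 => sfield) =>
    (real^3 => nat => complex) => (real^3 => nat => complex) => (real^3 => nat => complex) => (real => real => vfield) => bool" where
  "one_sided T S w W P s c t \<longleftrightarrow>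
    (\<forall>i x. norm x = 1 \<longrightarrow> (cmp w i ---> W i x) (at x within S)) \<and>
    (\<forall>G. (\<forall>i. contS (G i)) \<longrightarrow> (vm w G ---> cinner W G) (at 1 within T)) \<and>
    (\<forall>y d. (mP w y d ---> P y d) (at 1 within T)) \<and>
    (\<forall>y d. (mX (ccurl w) y d ---> s y d) (at 1 within T)) \<and>
    (\<forall>y d. (mD (ccurl w) y d ---> c y d) (at 1 within T)) \<and>
    (\<forall>lam \<mu> x. norm x = 1 \<longrightarrow> (traction lam \<mu> w x ---> t lam \<mu> x) (at x within S)) \<and>
    (\<forall>lam \<mu> y d U V. (mU w y d ---> U) (at 1 within T) \<longrightarrow> (mD w y d ---> V) (at 1 within T) \<longrightarrow>
      sI (%x. \<Sum>i\<in>UNIV. t lam \<mu> x $ i * gX y d i x) = of_real lam * P y d + 2 * of_real \<mu> * (P y d - 2 * U - V)) \<and>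
    (\<forall>lam \<mu> y d U V. (\<forall>e. (mU w y e ---> U e) (at 1 within T)) \<longrightarrow> (mD w y d ---> V) (at 1 within T) \<longrightarrow>
      sI (%x. \<Sum>i\<in>UNIV. t lam \<mu> x $ i * gS y d i x) = of_real \<mu> * (2 * V - 2 * lc y d U - s y d)) \<and>
    (\<forall>lam \<mu> y d X. (mX w y d ---> X) (at 1 within T) \<longrightarrow>
      sI (%x. \<Sum>i\<in>UNIV. t lam \<mu> x $ i * gL y d i x) = of_real \<mu> * (c y d + 2 * X))"

text \<open>The traction has a pointwise limit built from the traces of the derivatives, and the
  moments of this limit are also limits of the formulas in \<open>tau_moments_test\<close>. Equating
  the two carries a pointwise boundary condition over to the moments.\<close>

lemma one_side:
  assumes sh: "shell T S" and w: "C2_on w S" and S: "frontier S = sphere 0 1" and B: "C1_up_to_boundary w S"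
    and N: "at 1 within T \<noteq> bot"
  shows "\<exists>W P s c t. one_sided T S w W P s c t"
proof -
  let ?L = "at 1 within T"
  have oS: "open S" and T: "\<And>r x. r \<in> T ==> norm x = 1 ==> r *\<^sub>R x \<in> S" and T0: "\<And>r. r \<in> T ==> r > 0"
    using sh by (auto simp: shell_def)
  have C1: "C1_on (cmp w i) S" for i by (rule C2_on_C1[OF C2_on_vec_nth[OF oS w]])
  obtain W f where WF: "\<And>i. contS (W i)" "\<And>j i. contS (f j i)"
    "\<And>i x. norm x = 1 ==> (cmp w i ---> W i x) (at x within S)"
    "\<And>j i x. norm x = 1 ==> (partial j (cmp w i) ---> f j i x) (at x within S)"
    "\<And>i g. contS g ==> (mom (cmp w i) g ---> sI (%x. W i x * g x)) ?L"
    "\<And>j i g. contS g ==> (mom (partial j (cmp w i)) g ---> sI (%x. f j i x * g x)) ?L"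
    using boundary_data[OF w oS S B T] by blast
  have evT: "\<forall>\<^sub>F r in ?L. r \<in> T" by (simp add: eventually_at_filter)
  have cp: "conts (partial j (cmp w i)) r" if "r \<in> T" for j i r by (rule conts_C1(2)[OF sh that C1])
  define P where "P y d = (\<Sum>k\<in>UNIV. sI (%x. f k k x * ph y d x))" for y d
  define s where "s y d = - cinner (cf f) (gL y d)" for y d
  define c where "c y d = - cinner (cf f) (gS y d)" for y d
  define t where "t lam \<mu> x = (\<chi> i. tau lam \<mu> f i x)" for lam \<mu> x
  have v: "(vm w G ---> cinner W G) ?L" if "\<And>i. contS (G i)" for G
    unfolding vm_def[abs_def] by (intro tendsto_sum WF that)
  have p: "(mP w y d ---> P y d) ?L" for y d
  proof -
    have "((%r. \<Sum>k\<in>UNIV. mom (partial k (cmp w k)) (ph y d) r) ---> P y d) ?L"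
      unfolding P_def by (intro tendsto_sum WF test_cont)
    moreover have "\<forall>\<^sub>F r in ?L. (\<Sum>k\<in>UNIV. mom (partial k (cmp w k)) (ph y d) r) = mP w y d r"
    proof (rule eventually_mono[OF evT])
      fix r assume r: "r \<in> T"
      have "mP w y d r = sI (%x. \<Sum>k\<in>UNIV. partial k (cmp w k) (r *\<^sub>R x) * ph y d x)"
        unfolding mP_def mom_def cdiv_def sum_distrib_right ..
      also have "\<dots> = (\<Sum>k\<in>UNIV. mom (partial k (cmp w k)) (ph y d) r)"
        unfolding mom_def by (rule sI_sum) (use cp[OF r] in \<open>auto simp: conts_def intro!: continuous_on_mult test_cont\<close>)
      finally show "(\<Sum>k\<in>UNIV. mom (partial k (cmp w k)) (ph y d) r) = mP w y d r" by simp
    qed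
    ultimately show ?thesis by (simp add: tendsto_cong)
  qed
  have cc: "(vm (ccurl w) G ---> cinner (cf f) G) ?L" if G: "\<And>i. contS (G i)" for G
  proof -
    have m: "(mom (%y. partial j (cmp w i) y - partial j' (%y. w y $ i') y) g ---> sI (%x. (f j i x - f j' i' x) * g x)) ?L"
      if g: "contS g" for g j i j' i'
    proof -
      have "((%r. mom (partial j (cmp w i)) g r - mom (partial j' (%y. w y $ i')) g r) ---> sI (%x. f j i x * g x) - sI (%x. f j' i' x * g x)) ?L"
        by (intro tendsto_diff WF g)
      moreover have "sI (%x. f j i x * g x) - sI (%x. f j' i' x * g x) = sI (%x. (f j i x - f j' i' x) * g x)"
        unfolding left_diff_distrib by (rule sI_diff[symmetric]) (intro continuous_on_mult WF g)+
      moreover have "\<forall>\<^sub>F r in ?L. mom (partial j (cmp w i)) g r - mom (partial j' (%y. w y $ i')) g r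
          = mom (%y. partial j (cmp w i) y - partial j' (%y. w y $ i') y) g r"
        by (rule eventually_mono[OF evT]) (rule mom_diff_left[symmetric], (intro cp, assumption)+, rule g)
      ultimately show ?thesis by (simp add: tendsto_cong)
    qed
    show ?thesis
      unfolding vm_def[abs_def] sum_3 ccurl_nth cf_def
      by (intro tendsto_add) (simp_all, (intro m G)+)
  qed
  have "(mX (ccurl w) y d ---> s y d) ?L" "(mD (ccurl w) y d ---> c y d) ?L" for y d
    unfolding mX_def[abs_def] mD_def[abs_def] s_def c_def by (intro tendsto_minus cc test_cont)+
  note sc = this
  have tr: "(traction lam \<mu> w x ---> t lam \<mu> x) (at x within S)" if x: "norm x = 1" for lam \<mu> x
  proof (rule vec_tendstoI)
    fix i
    show "((%y. traction lam \<mu> w x y $ i) ---> t lam \<mu> x $ i) (at x within S)"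
      unfolding traction_nth t_def tau_def vec_lambda_beta
      by (intro tendsto_add tendsto_mult tendsto_sum tendsto_const WF x)
  qed
  have tI: "sI (%x. \<Sum>i\<in>UNIV. t lam \<mu> x $ i * G i x) = tauI lam \<mu> f G" for lam \<mu> G
    by (simp add: tauI_def t_def)
  have tl: "((%r. tauI lam \<mu> (%j i x. partial j (cmp w i) (r *\<^sub>R x)) G) ---> tauI lam \<mu> f G) ?L"
    if G: "\<And>i. contS (G i)" for lam \<mu> G
  proof (rule tau_tendsto[OF _ WF(2) G])
    show "\<forall>\<^sub>F r in ?L. \<forall>j i. contS (%x. partial j (cmp w i) (r *\<^sub>R x))"
      by (rule eventually_mono[OF evT]) (use cp in \<open>auto simp: conts_def\<close>)
  qed (use WF(6) in \<open>simp add: mom_def[abs_def]\<close>)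
  have r1: "((%r::real. complex_of_real r) ---> 1) ?L"
    using tendsto_of_real[OF tendsto_ident_at, of 1 T, where 'a = complex] by simp
  \<comment> \<open>Uniqueness of limits; this is where \<open>N\<close> is used, that is, that 1 is
    a limit point of the radii.\<close>
  have fin: "tauI lam \<mu> f G = v" if "\<And>i. contS (G i)" "(F ---> v) ?L"
    "\<And>r. r \<in> T ==> tauI lam \<mu> (%j i x. partial j (cmp w i) (r *\<^sub>R x)) G = F r" for lam \<mu> G v F
  proof -
    have "(F ---> tauI lam \<mu> f G) ?L"
      by (rule Lim_transform_eventually[OF tl[OF that(1)]]) (rule eventually_mono[OF evT], rule that(3))
    thus ?thesis by (rule tendsto_unique[OF N _ that(2)])
  qed
  have X: "tauI lam \<mu> f (gX y d) = of_real lam * P y d + 2 * of_real \<mu> * (P y d - 2 * U - V)"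
    if "(mU w y d ---> U) ?L" "(mD w y d ---> V) ?L" for lam \<mu> y d U V
  proof -
    have "((%r. of_real lam * mP w y d r + 2 * of_real \<mu> * (mP w y d r - 2 / of_real r * mU w y d r - 1 / of_real r * mD w y d r))
        ---> of_real lam * P y d + 2 * of_real \<mu> * (P y d - 2 / 1 * U - 1 / 1 * V)) ?L"
      by (intro tendsto_add tendsto_mult tendsto_diff tendsto_divide tendsto_const p r1 that) simp_all
    from fin[OF test_cont(2) this tau_moments_test(1)[OF sh C1]] show ?thesis by simp
  qed
  have S: "tauI lam \<mu> f (gS y d) = of_real \<mu> * (2 * V - 2 * lc y d U - s y d)"
    if "\<And>e. (mU w y e ---> U e) ?L" "(mD w y d ---> V) ?L" for lam \<mu> y d U V
  proof -
    have "((%r. of_real \<mu> * (2 / of_real r * mD w y d r - 2 / of_real r * lc y d (%e. mU w y e r) - mX (ccurl w) y d r))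
        ---> of_real \<mu> * (2 / 1 * V - 2 / 1 * lc y d U - s y d)) ?L"
      unfolding lc_def by (intro tendsto_add tendsto_mult tendsto_diff tendsto_divide tendsto_const sc r1 that) simp_all
    from fin[OF test_cont(3) this tau_moments_test(2)[OF sh C1]] show ?thesis by simp
  qed
  have L: "tauI lam \<mu> f (gL y d) = of_real \<mu> * (c y d + 2 * X)"
    if "(mX w y d ---> X) ?L" for lam \<mu> y d X
  proof -
    have "((%r. of_real \<mu> * (mD (ccurl w) y d r + 2 / of_real r * mX w y d r)) ---> of_real \<mu> * (c y d + 2 / 1 * X)) ?L"
      by (intro tendsto_add tendsto_mult tendsto_diff tendsto_divide tendsto_const sc r1 that) simp_all
    from fin[OF test_cont(4) this tau_moments_test(3)[OF sh C1]] show ?thesis by simp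
  qed
  have "one_sided T S w W P s c t"
    unfolding one_sided_def tI
  proof (intro conjI allI impI, goal_cases)
    case 1 thus ?case by (rule WF(3))
  next
    case 2 show ?case by (rule v) (use 2 in simp)
  next
    case 3 show ?case by (rule p)
  next
    case 4 show ?case by (rule sc(1))
  next
    case 5 show ?case by (rule sc(2))
  next
    case 6 thus ?case by (rule tr)
  next
    case 7 thus ?case by (rule X)
  next
    case 8 show ?case by (rule S) (use 8 in simp_all)
  next
    case 9 thus ?case by (rule L)
  qed
  thus ?thesis by blast
qed

text \<open>The moment is an integral over the unit sphere of directions, so an error of order
  r^(-2) keeps that order and still tends to 0 after multiplication by r.\<close>

lemma radiation_moment:
  assumes O: "(%x. norm (e x)) \<in> O[at_infinity](%x::real^3. 1 / norm x ^ 2)"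
    and e: "\<And>r. r > 1 ==> conts e r" and g: "contS g"
  shows "((%r. of_real r * mom e g r) ---> 0) at_top"
proof -
  obtain c where c: "c > 0" "\<forall>\<^sub>F x in at_infinity. norm (norm (e x)) \<le> c * norm (1 / norm (x::real^3) ^ 2)"
    using landau_o.bigE[OF O] by blast
  then obtain b where b: "\<And>x::real^3. b \<le> norm x ==> norm (e x) \<le> c * (1 / norm x ^ 2)"
    by (auto simp: eventually_at_infinity)
  have "compact (sphere (0::real^3) 1)" by simp
  hence "bounded (g ` sphere 0 1)" using compact_continuous_image[OF g] compact_imp_bounded by blast
  then obtain B where "\<forall>x\<in>sphere 0 1. cmod (g x) \<le> B" unfolding bounded_iff by auto
  hence B: "cmod (g x) \<le> B" if "norm x = 1" for x using that by simp
  have B0: "B \<ge> 0" using order_trans[OF norm_ge_zero B[of "sph 0 0"]] by simp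
  define K where "K = 2 * pi\<^sup>2 * (c * B)"
  have bd: "cmod (of_real r * mom e g r) \<le> K / r" if r: "r > 1" "r \<ge> b" for r
  proof -
    have "cmod (mom e g r) \<le> 2 * pi\<^sup>2 * (c / r\<^sup>2 * B)"
      unfolding mom_def
    proof (rule norm_sI_le)
      show "contS (%x. e (r *\<^sub>R x) * g x)"
        using e[OF r(1)] unfolding conts_def by (intro continuous_on_mult g)
      fix x :: "real^3" assume x: "norm x = 1"
      have "cmod (e (r *\<^sub>R x)) \<le> c / r\<^sup>2" using b[of "r *\<^sub>R x"] r x by simp
      thus "cmod (e (r *\<^sub>R x) * g x) \<le> c / r\<^sup>2 * B"
        unfolding norm_mult by (intro mult_mono B x) (use c in auto)
    qed
    hence "r * cmod (mom e g r) \<le> r * (2 * pi\<^sup>2 * (c / r\<^sup>2 * B))" using r by (intro mult_left_mono) auto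
    also have "\<dots> = K / r" using r by (simp add: K_def power2_eq_square)
    finally show ?thesis using r by (simp add: norm_mult)
  qed
  show ?thesis
  proof (rule Lim_null_comparison)
    show "\<forall>\<^sub>F r in at_top. cmod (of_real r * mom e g r) \<le> K / r"
      using eventually_gt_at_top[of 1] eventually_ge_at_top[of b] by eventually_elim (rule bd)
    show "((%r. K / r) ---> 0) at_top"
      by (rule tendsto_divide_0[OF tendsto_const]) (rule filterlim_at_top_imp_at_infinity[OF filterlim_ident])
  qed
qed

lemma radiation_vm:
  fixes E :: "vfield"
  assumes O: "(%x. norm (E x)) \<in> O[at_infinity](%x::real^3. 1 / norm x ^ 2)"
    and e: "\<And>r i. r > 1 ==> conts (cmp E i) r" and G: "\<And>i. contS (G i)"
  shows "((%r. of_real r * vm E G r) ---> 0) at_top"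
proof -
  have C: "((%r. of_real r * mom (cmp E i) (G i) r) ---> 0) at_top" for i
  proof (rule radiation_moment[OF _ e G])
    show "(%x. norm (E x $ i)) \<in> O[at_infinity](%x::real^3. 1 / norm x ^ 2)"
      by (rule landau_o.big_trans[OF _ O]) (rule landau_o.big_mono, simp add: component_le_norm_cart Finite_Cartesian_Product.norm_nth_le)
  qed
  have "((%r. \<Sum>i\<in>UNIV. of_real r * mom (cmp E i) (G i) r) ---> (\<Sum>i\<in>(UNIV::3 set). 0)) at_top"
    by (rule tendsto_sum) (rule C)
  thus ?thesis by (simp add: vm_def sum_distrib_left)
qed

section \<open>The radiation condition in terms of moments\<close>

lemma exterior_shell: "shell {1<..} (- cball 0 1)"
  unfolding shell_def by (auto simp: open_Compl)

lemma interior_shell: "shell {0<..<1} (ball 0 1)"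
  unfolding shell_def by auto

lemma conts_sgn: "r > 0 ==> conts (%x. cx i (sgn x)) r"
  unfolding conts_def
  by (rule continuous_on_eq[of _ "cx i"]) (auto simp: sgn_scaleR sgn_div_norm intro!: continuous_intros)

lemma conts_closure:
  "conts f r ==> conts g r ==> conts (%x. f x * g x) r" "conts f r ==> conts g r ==> conts (%x. f x - g x) r"
  "conts (%x. c) r"
  by (simp_all add: conts_def continuous_on_mult continuous_on_diff)

lemma conts_cross:
  assumes "\<And>i. conts (cmp v i) r" "\<And>i. conts (cmp s i) r" "r > 0"
  shows "conts (%x. (ccross (v x) (cvec (sgn x)) - c *s s x) $ i) r"
  using exhaust_3[of i]
  by (elim disjE) (simp_all add: ccross_def cvec_def conts_closure conts_sgn assms)

lemma vm_cross:
  assumes v: "\<And>i. conts (cmp v i) r" and s: "\<And>i. conts (cmp s i) r" and G: "\<And>i. C1_on (G i) UNIV" and r: "r > 0"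
  shows "vm (%x. ccross (v x) (cvec (sgn x)) - c *s s x) G r = - vm v (crx G) r - c * vm s G r"
proof -
  have cG: "contS (G i)" for i by (rule C1_cont[OF G])
  have cX: "contS (crx G i)" for i
    unfolding crx_def[abs_def] using exhaust_3[of i]
    by (elim disjE) (simp_all, (intro continuous_on_diff continuous_on_mult cG continuous_intros)+)
  note cv = v[unfolded conts_def] and cs = s[unfolded conts_def]
  have cr: "contS (%x. (ccross (v (r *\<^sub>R x)) (cvec (sgn (r *\<^sub>R x))) - c *s s (r *\<^sub>R x)) $ i)" for i
    using conts_cross[OF v s r] by (simp only: conts_def)
  have V: "vm w H r = sI (%x. \<Sum>i\<in>UNIV. w (r *\<^sub>R x) $ i * H i x)"
    if "\<And>i. contS (%x. w (r *\<^sub>R x) $ i)" "\<And>i. contS (H i)" for w H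
    unfolding vm_def mom_def by (rule sI_sum[symmetric]) (use that in \<open>auto intro!: continuous_on_mult\<close>)
  have "sI (%x. \<Sum>i\<in>UNIV. (ccross (v (r *\<^sub>R x)) (cvec (sgn (r *\<^sub>R x))) - c *s s (r *\<^sub>R x)) $ i * G i x)
    = sI (%x. - (\<Sum>i\<in>UNIV. v (r *\<^sub>R x) $ i * crx G i x) - c * (\<Sum>i\<in>UNIV. s (r *\<^sub>R x) $ i * G i x))"
  proof (rule sI_cong)
    fix x :: "real^3" assume x: "norm x = 1"
    have "sgn (r *\<^sub>R x) = x" using x r by (simp add: sgn_scaleR sgn_div_norm)
    thus "(\<Sum>i\<in>UNIV. (ccross (v (r *\<^sub>R x)) (cvec (sgn (r *\<^sub>R x))) - c *s s (r *\<^sub>R x)) $ i * G i x)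
      = - (\<Sum>i\<in>UNIV. v (r *\<^sub>R x) $ i * crx G i x) - c * (\<Sum>i\<in>UNIV. s (r *\<^sub>R x) $ i * G i x)"
      by (simp add: sum_3 crx_simps ccross_def cvec_def algebra_simps)
  qed
  also have "\<dots> = - sI (%x. \<Sum>i\<in>UNIV. v (r *\<^sub>R x) $ i * crx G i x) - c * sI (%x. \<Sum>i\<in>UNIV. s (r *\<^sub>R x) $ i * G i x)"
    by (subst sI_diff, (intro continuous_on_minus continuous_on_mult continuous_on_sum continuous_on_const cv cX cs cG)+)
       (simp only: sI_minus sI_cmult)
  finally show ?thesis by (simp only: V[OF cr cG] V[OF cv cX] V[OF cs cG])
qed

text \<open>The pressure condition is tested with \<open>ph\<close>. The shear condition tested with
  \<open>gL\<close> gives the spheroidal relation, and tested with \<open>gS\<close> the toroidal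
  one, because the cross product with x interchanges these two families.\<close>

lemma radiating_moments:
  assumes rad: "radiation_condition lam \<mu> \<rho> \<omega> us" and us: "\<And>i. C2_on (cmp us i) (- cball 0 1)"
  shows "((%r. of_real r * (vm (cgrad (cdiv us)) (gX y d) r - \<i> * of_real (k_p lam \<mu> \<rho> \<omega>) * mP us y d r)) ---> 0) at_top"
    "((%r. of_real r * (mD (ccurl (ccurl us)) y d r + \<i> * of_real (k_s \<mu> \<rho> \<omega>) * mX (ccurl us) y d r)) ---> 0) at_top"
    "((%r. of_real r * (\<i> * of_real (k_s \<mu> \<rho> \<omega>) * mD (ccurl us) y d r - mX (ccurl (ccurl us)) y d r)) ---> 0) at_top"
proof -
  let ?S = "- cball (0::real^3) 1"
  note sh = exterior_shell
  have T: "r \<in> {1<..}" if "r > 1" for r :: real using that by simp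
  have C1: "C1_on (cmp us i) ?S" for i by (rule C2_on_C1[OF us])
  have C1c: "C1_on (cmp (ccurl us) i) ?S" for i by (rule C1_on_ccurl[OF us])
  have C1d: "C1_on (cdiv us) ?S" unfolding cdiv_def[abs_def] by (intro C1_on_sum C2_on_partial us)
  have cs: "conts (cmp (ccurl us) i) r" if "r > 1" for r i by (rule conts_C1(1)[OF sh T[OF that] C1c])
  have cc: "conts (cmp (ccurl (ccurl us)) i) r" if "r > 1" for r i
  proof -
    have "conts (%x. partial j (cmp (ccurl us) i) x - partial j' (%x. ccurl us x $ i') x) r" for j i j' i'
      by (intro conts_closure conts_C1(2)[OF sh T[OF that] C1c])
    thus ?thesis using exhaust_3[of i]
      by (elim disjE) (simp_all only: ccurl_nth[of "ccurl us"])
  qed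
  define E where "E = (%x. ccross (ccurl (ccurl us) x) (cvec (sgn x)) - (\<i> * of_real (k_s \<mu> \<rho> \<omega>)) *s ccurl us x)"
  have O: "(%x. norm (E x)) \<in> O[at_infinity](%x. 1 / norm x ^ 2)"
    using rad unfolding radiation_condition_def E_def by blast
  have cE: "conts (cmp E i) r" if r: "r > 1" for r i
    unfolding E_def by (rule conts_cross[OF cc[OF r] cs[OF r]]) (use r in simp)
  have vE: "vm E G r = - vm (ccurl (ccurl us)) (crx G) r - \<i> * of_real (k_s \<mu> \<rho> \<omega>) * vm (ccurl us) G r"
    if "r > 1" "\<And>i. C1_on (G i) UNIV" for r G
    unfolding E_def by (rule vm_cross[OF cc cs]) (use that in auto)
  have L: "((%r. of_real r * F r) ---> 0) at_top" if "\<And>i. C1_on (G i) UNIV" "\<And>r. r > 1 ==> vm E G r = F r" for F G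
  proof -
    have "((%r. of_real r * vm E G r) ---> 0) at_top"
      by (rule radiation_vm[OF O cE]) (auto intro: C1_cont that)
    thus ?thesis
      by (rule Lim_transform_eventually, intro eventually_mono[OF eventually_gt_at_top[of 1]]) (simp add: that(2))
  qed
  show "((%r. of_real r * (mD (ccurl (ccurl us)) y d r + \<i> * of_real (k_s \<mu> \<rho> \<omega>) * mX (ccurl us) y d r)) ---> 0) at_top"
    by (rule L[of "gL y d"]) (simp_all add: C1_on_test vE vm_crx_gL mX_def)
  show "((%r. of_real r * (\<i> * of_real (k_s \<mu> \<rho> \<omega>) * mD (ccurl us) y d r - mX (ccurl (ccurl us)) y d r)) ---> 0) at_top"
    by (rule L[of "gS y d"]) (simp_all add: C1_on_test vE vm_crx_gS mD_def)
  define p where "p x = (\<Sum>i\<in>UNIV. cvec (sgn x) $ i * cgrad (cdiv us) x $ i) - \<i> * of_real (k_p lam \<mu> \<rho> \<omega>) * cdiv us x" for x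
  have Op: "(%x. norm (p x)) \<in> O[at_infinity](%x. 1 / norm x ^ 2)"
    using rad unfolding radiation_condition_def p_def by blast
  have cg: "conts (partial i (cdiv us)) r" "conts (cdiv us) r" if "r > 1" for r i
    using conts_C1[OF sh T[OF that] C1d] by simp_all
  have cp: "contS (%x. p (r *\<^sub>R x))" if r: "r > 1" for r
    unfolding p_def cvec_def cgrad_def vec_lambda_beta
    using cg[OF r] conts_sgn[of r] r unfolding conts_def
    by (intro continuous_on_diff continuous_on_sum continuous_on_mult continuous_on_const) auto
  have Pm: "mom p (ph y d) r = vm (cgrad (cdiv us)) (gX y d) r - \<i> * of_real (k_p lam \<mu> \<rho> \<omega>) * mP us y d r" if r: "r > 1" for r
  proof -
    note cg' = cg[OF r, unfolded conts_def]
    have "mom p (ph y d) r = sI (%x. (\<Sum>i\<in>UNIV. partial i (cdiv us) (r *\<^sub>R x) * gX y d i x) - \<i> * of_real (k_p lam \<mu> \<rho> \<omega>) * (cdiv us (r *\<^sub>R x) * ph y d x))"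
      unfolding mom_def
    proof (rule sI_cong)
      fix x :: "real^3" assume x: "norm x = 1"
      have "sgn (r *\<^sub>R x) = x" using x r by (simp add: sgn_scaleR sgn_div_norm)
      thus "p (r *\<^sub>R x) * ph y d x = (\<Sum>i\<in>UNIV. partial i (cdiv us) (r *\<^sub>R x) * gX y d i x) - \<i> * of_real (k_p lam \<mu> \<rho> \<omega>) * (cdiv us (r *\<^sub>R x) * ph y d x)"
        by (simp add: p_def cvec_def cgrad_def gX_def sum_3 algebra_simps)
    qed
    also have "\<dots> = sI (%x. \<Sum>i\<in>UNIV. partial i (cdiv us) (r *\<^sub>R x) * gX y d i x) - \<i> * of_real (k_p lam \<mu> \<rho> \<omega>) * sI (%x. cdiv us (r *\<^sub>R x) * ph y d x)"
      by (subst sI_diff, (intro continuous_on_sum continuous_on_mult continuous_on_const cg' test_cont)+) (simp only: sI_cmult)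
    also have "sI (%x. \<Sum>i\<in>UNIV. partial i (cdiv us) (r *\<^sub>R x) * gX y d i x) = vm (cgrad (cdiv us)) (gX y d) r"
      unfolding vm_def mom_def cgrad_def vec_lambda_beta
      by (rule sI_sum) (auto intro!: continuous_on_mult cg' test_cont)
    finally show ?thesis by (simp add: mP_def mom_def)
  qed
  have "((%r. of_real r * mom p (ph y d) r) ---> 0) at_top"
    by (rule radiation_moment[OF Op]) (auto simp: conts_def cp intro: test_cont)
  thus "((%r. of_real r * (vm (cgrad (cdiv us)) (gX y d) r - \<i> * of_real (k_p lam \<mu> \<rho> \<omega>) * mP us y d r)) ---> 0) at_top"
    by (rule Lim_transform_eventually, intro eventually_mono[OF eventually_gt_at_top[of 1]]) (simp add: Pm)
qed

section \<open>The scattering problem\<close>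

lemma vector_derivative_unique_on:
  fixes F :: "real => complex"
  assumes "(F hvd a) (at r)" "(G hvd b) (at r)" "open T" "r \<in> T" "\<And>t. t \<in> T ==> F t = G t"
  shows "a = b"
proof -
  have "(G hvd a) (at r)"
    by (rule hvd_transform_within_open[OF assms(1,3,4)]) (rule assms(5))
  thus ?thesis by (rule vector_derivative_unique_at[OF _ assms(2)])
qed

text \<open>Differentiating the known moments determines the others: \<open>mU_deriv\<close> and
  \<open>mD_deriv\<close> force the divergence and the curl part, and two derivatives of
  \<open>Zw\<close> give the second curl. For the incident field this replaces an explicit
  computation of curls.\<close>

lemma toroidal_field_moments:
  assumes sh: "shell T S" and w: "\<And>i. C2_on (cmp w i) S" and r: "r \<in> T"
    and U: "\<And>y d r. r \<in> T ==> mU w y d r = 0" "\<And>y d r. r \<in> T ==> mD w y d r = 0"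
    and Z: "\<And>y d r. r \<in> T ==> Zw w y d r = A r * Nm f n y d"
    and A: "\<And>r. r \<in> T ==> (A hvd A' r) (at r)"
      "\<And>r. r \<in> T ==> (A' hvd of_real (real (n * (n + 1)) / r\<^sup>2 - \<kappa>) * A r) (at r)"
  shows "mP w y d r = 0" "mX (ccurl w) y d r = 0" "mD (ccurl (ccurl w)) y d r = 0"
    "Zv w y d r = A' r * Nm f n y d" "mX (ccurl (ccurl w)) y d r = of_real \<kappa> * mX w y d r"
proof -
  have oT: "open T" and T0: "\<And>r. r \<in> T ==> r > 0" using sh by (auto simp: shell_def)
  have C1: "C1_on (cmp w i) S" for i by (rule C2_on_C1[OF w])
  have C1c: "C1_on (cmp (ccurl w) i) S" for i by (rule C1_on_ccurl[OF w])
  have z: "((%r::real. 0::complex) hvd 0) (at r)" for r by simp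
  have lc0: "lc y d (%e. mU w y e r) = 0" if "r \<in> T" for r by (simp add: lc_def U that)
  show "mP w y d r = 0"
    using vector_derivative_unique_on[OF mU_deriv[OF sh C1 r, of y d] z oT r U(1)] U r by simp
  have X: "mX (ccurl w) y d r = 0" if r: "r \<in> T" for r
    using vector_derivative_unique_on[OF mD_deriv[OF sh C1 r, of y d] z oT r U(2)] U lc0 r by simp
  from X[OF r] show "mX (ccurl w) y d r = 0" .
  show "mD (ccurl (ccurl w)) y d r = 0"
    using vector_derivative_unique_on[OF mX_deriv[OF sh C1c r, of y d] z oT r X] X[OF r] by simp
  have V: "Zv w y d r = A' r * Nm f n y d" if r: "r \<in> T" for r y d
    by (rule vector_derivative_unique_on[OF Zw_deriv(1)[OF sh w r] hvd_mult_left[OF A(1)[OF r]] oT r Z])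
  from V[OF r] show "Zv w y d r = A' r * Nm f n y d" .
  have r0: "complex_of_real r \<noteq> 0" using T0[OF r] by simp
  have E: "- (of_real r * mX (ccurl (ccurl w)) y d r) - lc y d (%e. mX w y e r) / of_real r
     = of_real (real (n * (n + 1)) / r\<^sup>2 - \<kappa>) * A r * Nm f n y d"
    by (rule vector_derivative_unique_on[OF Zw_deriv(2)[OF sh w r] hvd_mult_left[OF A(2)[OF r]] oT r V])
  have mX: "mX w y e r = A r / of_real r * Nm f n y e" for e
    using Z[OF r, of y e] r0 by (simp add: Zw_def field_simps)
  have l: "lc y d (%e. mX w y e r) = A r / of_real r * (- of_nat (n * (n + 1)) * Nm f n y d)"
    unfolding lc_Nm[symmetric] mX lc_def by (simp only: right_diff_distrib mult_ac)
  have al: "X = K * (A / R * M)" if "- (R * X) - A / R * (- N * M) / R = (N / R\<^sup>2 - K) * A * M" "R \<noteq> 0" for R X A N M K :: complex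
  proof -
    have "- (R * X) = - K * A * M" using that by (simp add: power2_eq_square algebra_simps)
    thus ?thesis using that(2) by (simp add: field_simps)
  qed
  show "mX (ccurl (ccurl w)) y d r = of_real \<kappa> * mX w y d r"
    unfolding mX by (rule al[where N = "of_nat (n * (n + 1))", OF _ r0])
      (use E[unfolded l] in \<open>simp only: of_real_diff of_real_divide of_real_of_nat_eq of_real_power\<close>)
qed

lemma diff_moments:
  assumes sh: "shell T S" and r: "r \<in> T"
    and u: "\<And>i. C2_on (cmp u i) S" and v: "\<And>i. C2_on (cmp v i) S"
    and w: "\<And>x i. x \<in> S ==> w x $ i = u x $ i - v x $ i"
  shows "mU w y d r = mU u y d r - mU v y d r" "mD w y d r = mD u y d r - mD v y d r" "mX w y d r = mX u y d r - mX v y d r"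
    "mP w y d r = mP u y d r - mP v y d r"
    "mX (ccurl w) y d r = mX (ccurl u) y d r - mX (ccurl v) y d r"
    "mD (ccurl (ccurl w)) y d r = mD (ccurl (ccurl u)) y d r - mD (ccurl (ccurl v)) y d r"
proof -
  have oS: "open S" and S: "\<And>x. norm x = 1 ==> r *\<^sub>R x \<in> S" using sh r by (auto simp: shell_def)
  have V: "vm w G r = vm u G r - vm v G r"
    if "\<And>x i. x \<in> S ==> w x $ i = u x $ i - v x $ i" "\<And>i. conts (cmp u i) r" "\<And>i. conts (cmp v i) r"
      "\<And>i. contS (G i)" for u v w G
  proof -
    have "mom (cmp w i) (G i) r = mom (cmp u i) (G i) r - mom (cmp v i) (G i) r" for i
      unfolding mom_diff_left[OF that(2-4), symmetric]
      by (rule mom_cong_left) (simp add: that(1) S)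
    thus ?thesis by (simp add: vm_def sum_subtractf)
  qed
  have pd: "partial j (cmp w i) x = partial j (cmp u i) x - partial j (cmp v i) x"
    if "x \<in> S" "\<And>x. x \<in> S ==> w x $ i = u x $ i - v x $ i" "C1_on (cmp u i) S" "C1_on (cmp v i) S"
    for u v w :: "vfield" and x i j
    using partial_cong[OF oS that(1), of "%x. w x $ i" "%x. u x $ i - v x $ i" j] partial_diff[OF C1_onD(1)[OF that(3,1)] C1_onD(1)[OF that(4,1)], of j] that(2)
    by simp
  have C1: "C1_on (cmp u i) S" "C1_on (cmp v i) S" for i by (rule C2_on_C1[OF u] C2_on_C1[OF v])+
  have C1c: "C1_on (cmp (ccurl u) i) S" "C1_on (cmp (ccurl v) i) S" for i by (rule C1_on_ccurl[OF u] C1_on_ccurl[OF v])+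
  have cr: "ccurl w x $ i = ccurl u x $ i - ccurl v x $ i"
    if x: "x \<in> S" and w: "\<And>x i. x \<in> S ==> w x $ i = u x $ i - v x $ i" and C: "\<And>i. C1_on (cmp u i) S" "\<And>i. C1_on (cmp v i) S"
    for u v w :: "vfield" and x i
  proof -
    have p: "partial j (cmp w i) x = partial j (cmp u i) x - partial j (cmp v i) x" for j i
      by (rule pd[OF x w C])
    show ?thesis using exhaust_3[of i] by (elim disjE) (simp_all add: p)
  qed
  have c: "conts (cmp u i) r" "conts (cmp v i) r" "conts (cmp (ccurl u) i) r" "conts (cmp (ccurl v) i) r" for i
    by (rule conts_C1(1)[OF sh r C1(1)] conts_C1(1)[OF sh r C1(2)] conts_C1(1)[OF sh r C1c(1)] conts_C1(1)[OF sh r C1c(2)])+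
  have cc: "conts (cmp (ccurl (ccurl z)) i) r" if C: "\<And>i. C1_on (cmp (ccurl z) i) S" for z i
  proof -
    have "conts (%x. partial j (cmp (ccurl z) i) x - partial j' (%x. ccurl z x $ i') x) r" for j i j' i'
      by (intro conts_closure conts_C1(2)[OF sh r C])
    thus ?thesis using exhaust_3[of i] by (elim disjE) (simp_all only: ccurl_nth[of "ccurl z"])
  qed
  show "mU w y d r = mU u y d r - mU v y d r" unfolding mU_def by (rule V[OF w c(1,2) test_cont(2)])
  show "mD w y d r = mD u y d r - mD v y d r" unfolding mD_def using V[OF w c(1,2) test_cont(3)] by simp
  show "mX w y d r = mX u y d r - mX v y d r" unfolding mX_def using V[OF w c(1,2) test_cont(4)] by simp
  have cw: "ccurl w x $ i = ccurl u x $ i - ccurl v x $ i" if "x \<in> S" for x i by (rule cr[OF that w C1])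
  show "mX (ccurl w) y d r = mX (ccurl u) y d r - mX (ccurl v) y d r"
    unfolding mX_def using V[OF cw c(3,4) test_cont(4)] by simp
  have ccw: "ccurl (ccurl w) x $ i = ccurl (ccurl u) x $ i - ccurl (ccurl v) x $ i" if "x \<in> S" for x i
    by (rule cr[OF that cw C1c])
  show "mD (ccurl (ccurl w)) y d r = mD (ccurl (ccurl u)) y d r - mD (ccurl (ccurl v)) y d r"
    unfolding mD_def using V[OF ccw cc[OF C1c(1)] cc[OF C1c(2)] test_cont(3)] by simp
  have dv: "cdiv w x = cdiv u x - cdiv v x" if "x \<in> S" for x
    unfolding cdiv_def sum_subtractf[symmetric] by (intro sum.cong refl pd[OF that w C1])
  have "mP w y d r = mom (%x. cdiv u x - cdiv v x) (ph y d) r"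
    unfolding mP_def by (rule mom_cong_left) (rule dv[OF S])
  also have "\<dots> = mP u y d r - mP v y d r"
    unfolding mP_def
  proof (rule mom_diff_left[OF _ _ test_cont(1)])
    have "C1_on (cdiv z) S" if "\<And>i. C2_on (cmp z i) S" for z
      unfolding cdiv_def[abs_def] by (intro C1_on_sum C2_on_partial that)
    thus "conts (cdiv u) r" "conts (cdiv v) r" using conts_C1(1)[OF sh r] u v by blast+
  qed
  finally show "mP w y d r = mP u y d r - mP v y d r" .
qed

lemma bounded_near_0:
  assumes "continuous_on {0..1/2::real} F"
  shows "\<exists>B. \<forall>r. 0 < r \<longrightarrow> r < 1/2 \<longrightarrow> cmod (F r) \<le> B"
proof -
  have "bounded (F ` {0..1/2})" by (intro compact_imp_bounded compact_continuous_image assms) simp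
  then obtain B where "\<forall>r\<in>{0..1/2}. cmod (F r) \<le> B" unfolding bounded_iff by auto
  thus ?thesis by (intro exI[of _ B]) auto
qed

lemma mom_bounded_near_0:
  assumes f: "continuous_on (ball 0 1) f" and g: "contS g"
  shows "continuous_on {0..1/2} (mom f g)"
  by (rule mom_continuous_on[OF f g]) auto

text \<open>The ball contains the origin, so the moments are continuous on the closed interval from
  0 to 1/2. This is the regularity at 0 from which the flux there is computed.\<close>

lemma moments_bounded:
  assumes w: "\<And>i. C2_on (cmp w i) (ball 0 1)"
  shows "\<exists>B. \<forall>r. 0 < r \<longrightarrow> r < 1/2 \<longrightarrow> cmod (mU w y d r) \<le> B \<and> cmod (mD w y d r) \<le> B \<and> cmod (mP w y d r) \<le> B
    \<and> cmod (mX (ccurl w) y d r) \<le> B \<and> cmod (mX w y d r) \<le> B \<and> cmod (mD (ccurl w) y d r) \<le> B"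
proof -
  have c: "continuous_on (ball 0 1) (cmp w i)" for i by (rule C1_on_imp_continuous_on[OF C2_on_C1[OF w]])
  have cp: "continuous_on (ball 0 1) (partial j (cmp w i))" for i j by (rule C1_onD(2)[OF C2_on_C1[OF w]])
  have cc: "continuous_on (ball 0 1) (cmp (ccurl w) i)" for i
    by (rule C1_on_imp_continuous_on[OF C1_on_ccurl[OF w]])
  have cd: "continuous_on (ball 0 1) (cdiv w)" unfolding cdiv_def[abs_def] by (rule continuous_on_sum) (rule cp)
  have V: "continuous_on {0..1/2} (vm v G)" if "\<And>i. continuous_on (ball 0 1) (cmp v i)" "\<And>i. contS (G i)" for v G
    unfolding vm_def[abs_def] by (rule continuous_on_sum) (rule mom_bounded_near_0[OF that(1) that(2)])
  obtain B1 where B1: "\<forall>r. 0 < r \<longrightarrow> r < 1/2 \<longrightarrow> cmod (mU w y d r) \<le> B1"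
    using bounded_near_0[OF V[of w "gX y d", OF c test_cont(2)]] unfolding mU_def by blast
  obtain B2 where B2: "\<forall>r. 0 < r \<longrightarrow> r < 1/2 \<longrightarrow> cmod (mD w y d r) \<le> B2"
    using bounded_near_0[OF V[of w "gS y d", OF c test_cont(3)]] unfolding mD_def norm_minus_cancel by blast
  obtain B3 where B3: "\<forall>r. 0 < r \<longrightarrow> r < 1/2 \<longrightarrow> cmod (mP w y d r) \<le> B3"
    using bounded_near_0[OF mom_bounded_near_0[OF cd test_cont(1)]] unfolding mP_def by blast
  obtain B4 where B4: "\<forall>r. 0 < r \<longrightarrow> r < 1/2 \<longrightarrow> cmod (mX (ccurl w) y d r) \<le> B4"
    using bounded_near_0[OF V[of "ccurl w" "gL y d", OF cc test_cont(4)]] unfolding mX_def norm_minus_cancel by blast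
  obtain B5 where B5: "\<forall>r. 0 < r \<longrightarrow> r < 1/2 \<longrightarrow> cmod (mX w y d r) \<le> B5"
    using bounded_near_0[OF V[of w "gL y d", OF c test_cont(4)]] unfolding mX_def norm_minus_cancel by blast
  obtain B6 where B6: "\<forall>r. 0 < r \<longrightarrow> r < 1/2 \<longrightarrow> cmod (mD (ccurl w) y d r) \<le> B6"
    using bounded_near_0[OF V[of "ccurl w" "gS y d", OF cc test_cont(3)]] unfolding mD_def norm_minus_cancel by blast
  show ?thesis using B1 B2 B3 B4 B5 B6
    by (intro exI[of _ "max B1 (max B2 (max B3 (max B4 (max B5 B6))))"]) (simp add: le_max_iff_disj)
qed

lemma Zj_vector_derivative:
  assumes "n \<ge> 1" "r \<noteq> 0"
  shows "((%r. complex_of_real (Zj n k r)) hvd of_real (Zj' n k r)) (at r)"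
    "((%r. complex_of_real (Zj' n k r)) hvd of_real (real (n * (n + 1)) / r\<^sup>2 - k\<^sup>2) * of_real (Zj n k r)) (at r)"
  using has_vector_derivative_of_real[OF Zj_deriv(1)[OF assms(1)], where 'a = complex]
    has_vector_derivative_of_real[OF Zj_deriv(2)[OF assms], where 'a = complex] by simp_all

lemma Zj_bounds: "n \<ge> 1 ==> \<exists>B. \<forall>r. 0 < r \<longrightarrow> r < 1/2 \<longrightarrow> \<bar>Zj n k r\<bar> \<le> B * r \<and> \<bar>Zj' n k r\<bar> \<le> B"
proof -
  assume n: "n \<ge> 1"
  have "continuous_on {0..1/2} (%r. complex_of_real (Zj' n k r))"
    by (intro continuous_on_of_real continuous_at_imp_continuous_on ballI Zj_deriv(3)[OF n])
  from bounded_near_0[OF this] obtain B1 where B1: "\<And>r. 0 < r ==> r < 1/2 ==> \<bar>Zj' n k r\<bar> \<le> B1" by auto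
  have "isCont (bF n) s" for s using bF_deriv(1) DERIV_isCont by blast
  hence "continuous_on UNIV (bF n)" by (intro continuous_at_imp_continuous_on ballI)
  hence "continuous_on {0..1/2} (%r. bF n ((k * r)\<^sup>2))"
    by (rule continuous_on_compose2) (auto intro!: continuous_intros)
  hence "continuous_on {0..1/2} (%r. complex_of_real (spherical_bessel_j n (k * r)))"
    unfolding spherical_bessel_j_eq by (intro continuous_intros)
  from bounded_near_0[OF this] obtain B2 where B2: "\<And>r. 0 < r ==> r < 1/2 ==> \<bar>spherical_bessel_j n (k * r)\<bar> \<le> B2" by auto
  have "\<bar>Zj n k r\<bar> \<le> max B1 B2 * r \<and> \<bar>Zj' n k r\<bar> \<le> max B1 B2" if "0 < r" "r < 1/2" for r
    using B1[OF that] mult_left_mono[OF B2[OF that], of r] that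
      mult_left_mono[of B2 "max B1 B2" r] by (auto simp: Zj_def abs_mult mult.commute intro: order_trans)
  thus ?thesis by blast
qed

lemma lame_components:
  assumes "open S" "C2_on w S" "x \<in> S" and eq: "lame lam \<mu> w x + K *\<^sub>R w x = 0"
  shows "of_real (lam + 2 * \<mu>) * partial i (cdiv w) x - of_real \<mu> * ccurl (ccurl w) x $ i + of_real K * w x $ i = 0"
proof -
  have "(lame lam \<mu> w x + K *\<^sub>R w x) $ i = 0" unfolding eq by simp
  hence "lame lam \<mu> w x $ i + K *\<^sub>R (w x $ i) = 0" by (simp only: vector_add_component vector_scaleR_component)
  thus ?thesis by (simp only: lame_nth[OF assms(1-3)] scaleR_conv_of_real)
qed

text \<open>Besides the data of the problem the locale carries amplitudes a and b. The two
  \<open>match\<close> conditions are continuity at r = 1 of the candidate profiles and of the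
  toroidal traction, which is proportional to \<mu> (Z' - 2 Z).\<close>

locale scattering =
  fixes lam \<mu> \<rho> lam' \<mu>' \<rho>' \<omega> :: real and n :: nat and f :: "int => complex" and u us :: "vfield"
    and k k' :: real and a b :: complex
  assumes pos: "\<mu> > 0" "lam + 2 * \<mu> > 0" "\<rho> > 0" "\<mu>' > 0" "lam' + 2 * \<mu>' > 0" "\<rho>' > 0" "\<omega> > 0" "n \<ge> 1"
    and k: "k = k_s \<mu> \<rho> \<omega>" and k': "k' = k_s \<mu>' \<rho>' \<omega>"
    and sol: "scattering_solution (ball 0 1) sgn lam \<mu> \<rho> lam' \<mu>' \<rho>' \<omega> (incident_field n f k) u us"
    and match: "a * of_real (Zj n k' 1) = of_real (Zj n k 1) + b * Zh n k 1"
      "of_real \<mu>' * (a * of_real (Zj' n k' 1) - 2 * (a * of_real (Zj n k' 1)))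
        = of_real \<mu> * ((of_real (Zj' n k 1) + b * Zh' n k 1) - 2 * (of_real (Zj n k 1) + b * Zh n k 1))"
begin

abbreviation "Tin \<equiv> {0<..<1::real}"
abbreviation "Tex \<equiv> {1::real<..}"
abbreviation "BI \<equiv> ball (0::real^3) 1"
abbreviation "BE \<equiv> - cball (0::real^3) 1"

lemma kpos: "k > 0" "k' > 0" and kk: "k\<^sup>2 = \<omega>\<^sup>2 * \<rho> / \<mu>" "k'\<^sup>2 = \<omega>\<^sup>2 * \<rho>' / \<mu>'"
  and ks: "k = sqrt (\<omega>\<^sup>2 * \<rho> / \<mu>)" and kp: "k_p lam \<mu> \<rho> \<omega> = sqrt (\<omega>\<^sup>2 * \<rho> / (lam + 2 * \<mu>))"
  unfolding k k' k_s_def k_p_def using pos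
  by (simp_all add: power_mult_distrib power_divide real_sqrt_mult real_sqrt_divide)

lemma closures: "closure BI = cball 0 1" "frontier BI = sphere 0 1" "frontier BE = sphere 0 1"
  by (simp_all add: frontier_complement)

lemma u2: "C2_on u BI" "C2_on u BE"
  using sol by (simp_all add: scattering_solution_def closures)

lemma u2n: "C2_on (cmp u i) BI" "C2_on (cmp u i) BE"
  by (rule C2_on_vec_nth[OF _ u2(1)] C2_on_vec_nth[OF _ u2(2)], simp add: open_Compl)+

lemma eq_in: "x \<in> BI ==> of_real (lam' + 2 * \<mu>') * partial i (cdiv u) x - of_real \<mu>' * ccurl (ccurl u) x $ i + of_real (\<omega>\<^sup>2 * \<rho>') * u x $ i = 0"
  by (rule lame_components[OF _ u2(1)]) (use sol in \<open>auto simp: scattering_solution_def\<close>)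

lemma eq_ex: "x \<in> BE ==> of_real (lam + 2 * \<mu>) * partial i (cdiv u) x - of_real \<mu> * ccurl (ccurl u) x $ i + of_real (\<omega>\<^sup>2 * \<rho>) * u x $ i = 0"
  by (rule lame_components[OF _ u2(2)]) (use sol in \<open>auto simp: scattering_solution_def closures open_Compl\<close>)

abbreviation "ui \<equiv> incident_field n f k"

lemma ui2: "C2_on (cmp ui i) BE"
  by (rule C2_on_subset[OF C2_on_incident]) auto

lemma us_eq: "x \<in> BE ==> us x $ i = u x $ i - ui x $ i"
  using sol by (simp add: scattering_solution_def closures)

lemma us2: "C2_on (cmp us i) BE"
  by (rule C2_on_cong[OF C2_on_diff[OF _ u2n(2) ui2]]) (simp_all add: open_Compl us_eq)

lemma ui_Zw: "r \<in> Tex ==> Zw ui y d r = of_real (Zj n k r) * Nm f n y d"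
  by (simp add: Zw_def incident_moments Zj_def)

lemma ui_moments:
  assumes r: "r \<in> Tex"
  shows "mU ui y d r = 0" "mD ui y d r = 0" "mP ui y d r = 0" "mX (ccurl ui) y d r = 0" "mD (ccurl (ccurl ui)) y d r = 0"
    "Zv ui y d r = of_real (Zj' n k r) * Nm f n y d" "mX (ccurl (ccurl ui)) y d r = of_real (k\<^sup>2) * mX ui y d r"
proof -
  have U: "mU ui y d r = 0" "mD ui y d r = 0" if "r \<in> Tex" for y d r using that by (simp_all add: incident_moments)
  have A: "((%r. complex_of_real (Zj n k r)) hvd of_real (Zj' n k r)) (at r)"
    "((%r. complex_of_real (Zj' n k r)) hvd of_real (real (n * (n + 1)) / r\<^sup>2 - k\<^sup>2) * of_real (Zj n k r)) (at r)" if "r \<in> Tex" for r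
    using Zj_vector_derivative[OF pos(8), of r k] that by simp_all
  show "mU ui y d r = 0" "mD ui y d r = 0" by (rule U[OF r])+
  show "mP ui y d r = 0" "mX (ccurl ui) y d r = 0" "mD (ccurl (ccurl ui)) y d r = 0"
    "Zv ui y d r = of_real (Zj' n k r) * Nm f n y d" "mX (ccurl (ccurl ui)) y d r = of_real (k\<^sup>2) * mX ui y d r"
    by (rule toroidal_field_moments[OF exterior_shell ui2 r U ui_Zw A], assumption+)+
qed

text \<open>The incident field is purely toroidal, so outside the ball the spheroidal moments of
  \<open>us\<close> and \<open>u\<close> coincide and the radiation condition on \<open>us\<close>
  passes to \<open>u\<close>; the toroidal moment is shifted by the incident one.\<close>

lemma us_moments:
  assumes r: "r \<in> Tex"
  shows "mU us y d r = mU u y d r" "mD us y d r = mD u y d r" "mP us y d r = mP u y d r"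
    "mX (ccurl us) y d r = mX (ccurl u) y d r" "mD (ccurl (ccurl us)) y d r = mD (ccurl (ccurl u)) y d r"
    "Zw us y d r = Zw u y d r - of_real (Zj n k r) * Nm f n y d"
proof -
  note D = diff_moments[OF exterior_shell r u2n(2) ui2 us_eq, of y d]
  show "mU us y d r = mU u y d r" "mD us y d r = mD u y d r" "mP us y d r = mP u y d r"
    "mX (ccurl us) y d r = mX (ccurl u) y d r" "mD (ccurl (ccurl us)) y d r = mD (ccurl (ccurl u)) y d r"
    using D ui_moments[OF r, of y d] by simp_all
  show "Zw us y d r = Zw u y d r - of_real (Zj n k r) * Nm f n y d"
    unfolding ui_Zw[OF r, symmetric] Zw_def right_diff_distrib[symmetric] using D(3) by simp
qed

lemma mX_cc:
  "r \<in> Tin ==> mX (ccurl (ccurl u)) y d r = of_real (k'\<^sup>2) * mX u y d r"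
  "r \<in> Tex ==> mX (ccurl (ccurl u)) y d r = of_real (k\<^sup>2) * mX u y d r"
proof -
  have a0: "complex_of_real (lam' + 2 * \<mu>') \<noteq> 0" "complex_of_real (lam + 2 * \<mu>) \<noteq> 0" "complex_of_real \<mu>' \<noteq> 0" "complex_of_real \<mu> \<noteq> 0"
    using pos by (simp_all only: of_real_eq_0_iff)
  { assume "r \<in> Tin"
    hence "of_real \<mu>' * mX (ccurl (ccurl u)) y d r = of_real (\<omega>\<^sup>2 * \<rho>') * mX u y d r"
      by (rule lame_moments(3)[OF interior_shell u2(1) _ a0(1) eq_in])
    thus "mX (ccurl (ccurl u)) y d r = of_real (k'\<^sup>2) * mX u y d r"
      unfolding kk using a0 by (simp add: field_simps) }
  { assume "r \<in> Tex"
    hence "of_real \<mu> * mX (ccurl (ccurl u)) y d r = of_real (\<omega>\<^sup>2 * \<rho>) * mX u y d r"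
      by (rule lame_moments(3)[OF exterior_shell u2(2) _ a0(2) eq_ex])
    thus "mX (ccurl (ccurl u)) y d r = of_real (k\<^sup>2) * mX u y d r"
      unfolding kk using a0 by (simp add: field_simps) }
qed

text \<open>Prepares the toroidal radiation condition: it involves a second curl of
  \<open>us\<close>, which is replaced here by k^2 times the moment itself.\<close>

lemma us_more:
  assumes r: "r \<in> Tex"
  shows "Zv us y d r = Zv u y d r - of_real (Zj' n k r) * Nm f n y d"
    "mX (ccurl (ccurl us)) y d r = of_real (k\<^sup>2) * mX us y d r"
proof -
  have oE: "open Tex" by simp
  have V: "Zv us y d r = Zv u y d r - of_real (Zj' n k r) * Nm f n y d" if r: "r \<in> Tex" for r y d
  proof (rule vector_derivative_unique_on[OF Zw_deriv(1)[OF exterior_shell us2 r] _ oE r us_moments(6)])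
    show "((%r. Zw u y d r - of_real (Zj n k r) * Nm f n y d) hvd Zv u y d r - of_real (Zj' n k r) * Nm f n y d) (at r)"
      by (intro hvd_diff hvd_mult_left Zw_deriv(1)[OF exterior_shell u2n(2) r] Zj_vector_derivative(1) pos)
         (use r in auto)
  qed
  from V[OF r] show "Zv us y d r = Zv u y d r - of_real (Zj' n k r) * Nm f n y d" .
  have r0: "complex_of_real r \<noteq> 0" using r by auto
  have E: "- (of_real r * mX (ccurl (ccurl us)) y d r) - lc y d (%e. mX us y e r) / of_real r
    = (- (of_real r * mX (ccurl (ccurl u)) y d r) - lc y d (%e. mX u y e r) / of_real r)
      - (- (of_real r * mX (ccurl (ccurl ui)) y d r) - lc y d (%e. mX ui y e r) / of_real r)"
  proof (rule vector_derivative_unique_on[OF Zw_deriv(2)[OF exterior_shell us2 r] _ oE r])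
    show "((%r. Zv u y d r - Zv ui y d r) hvd
      (- (of_real r * mX (ccurl (ccurl u)) y d r) - lc y d (%e. mX u y e r) / of_real r)
      - (- (of_real r * mX (ccurl (ccurl ui)) y d r) - lc y d (%e. mX ui y e r) / of_real r)) (at r)"
      by (intro hvd_diff Zw_deriv(2)[OF exterior_shell u2n(2) r] Zw_deriv(2)[OF exterior_shell ui2 r])
    show "Zv us y d t = Zv u y d t - Zv ui y d t" if "t \<in> Tex" for t
      unfolding V[OF that] ui_moments(6)[OF that] ..
  qed
  have X: "mX us y e r = mX u y e r - mX ui y e r" for e
    by (rule diff_moments(3)[OF exterior_shell r u2n(2) ui2 us_eq])
  have l: "lc y d (%e. mX us y e r) = lc y d (%e. mX u y e r) - lc y d (%e. mX ui y e r)"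
    unfolding lc_def X by (simp add: algebra_simps)
  have al: "A = B - C" if "- A - L / R = (- B - M / R) - (- C - N / R)" "L = M - N" for A B C L M N R :: complex
    using that by (simp add: diff_divide_distrib algebra_simps)
  have "of_real r * mX (ccurl (ccurl us)) y d r = of_real r * (mX (ccurl (ccurl u)) y d r - mX (ccurl (ccurl ui)) y d r)"
    unfolding right_diff_distrib by (rule al[OF E l])
  hence "mX (ccurl (ccurl us)) y d r = mX (ccurl (ccurl u)) y d r - mX (ccurl (ccurl ui)) y d r" using r0 by simp
  thus "mX (ccurl (ccurl us)) y d r = of_real (k\<^sup>2) * mX us y d r"
    unfolding X mX_cc(2)[OF r] ui_moments(7)[OF r] by (simp add: algebra_simps)
qed

lemma left_filter: "at 1 within Tin = at_left 1"
  by (rule at_within_nhd[of 1 "{0<..}"]) auto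

text \<open>U, V, X are limits common to both sides. P, s and c are one-sided limits (1 inside, 2
  outside) of divergence and curl moments, which may jump. The last three clauses are the radial,
  the spheroidal tangential and the toroidal part of the traction condition.\<close>

definition transmission_data where
  "transmission_data U V X P1 P2 s1 s2 c1 c2 \<longleftrightarrow> (\<forall>y d.
    ((mU u y d ---> U y d) (at_left 1)) \<and>
    ((mU u y d ---> U y d) (at_right 1)) \<and>
    ((mD u y d ---> V y d) (at_left 1)) \<and>
    ((mD u y d ---> V y d) (at_right 1)) \<and>
    ((mX u y d ---> X y d) (at_left 1)) \<and>
    ((mX u y d ---> X y d) (at_right 1)) \<and>
    ((mP u y d ---> P1 y d) (at_left 1)) \<and>
    ((mP u y d ---> P2 y d) (at_right 1)) \<and>
    ((mX (ccurl u) y d ---> s1 y d) (at_left 1)) \<and>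
    ((mX (ccurl u) y d ---> s2 y d) (at_right 1)) \<and>
    ((mD (ccurl u) y d ---> c1 y d) (at_left 1)) \<and>
    ((mD (ccurl u) y d ---> c2 y d) (at_right 1)) \<and>
    (of_real lam' * P1 y d + 2 * of_real \<mu>' * (P1 y d - 2 * U y d - V y d) = of_real lam * P2 y d + 2 * of_real \<mu> * (P2 y d - 2 * U y d - V y d)) \<and>
    (of_real \<mu>' * (2 * V y d - 2 * lc y d (U y) - s1 y d) = of_real \<mu> * (2 * V y d - 2 * lc y d (U y) - s2 y d)) \<and>
    (of_real \<mu>' * (c1 y d + 2 * X y d) = of_real \<mu> * (c2 y d + 2 * X y d)))"

lemma transmission_dataD:
  assumes "transmission_data U V X P1 P2 s1 s2 c1 c2"
  shows "(mU u y d ---> U y d) (at_left 1)"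
    "(mU u y d ---> U y d) (at_right 1)"
    "(mD u y d ---> V y d) (at_left 1)"
    "(mD u y d ---> V y d) (at_right 1)"
    "(mX u y d ---> X y d) (at_left 1)"
    "(mX u y d ---> X y d) (at_right 1)"
    "(mP u y d ---> P1 y d) (at_left 1)"
    "(mP u y d ---> P2 y d) (at_right 1)"
    "(mX (ccurl u) y d ---> s1 y d) (at_left 1)"
    "(mX (ccurl u) y d ---> s2 y d) (at_right 1)"
    "(mD (ccurl u) y d ---> c1 y d) (at_left 1)"
    "(mD (ccurl u) y d ---> c2 y d) (at_right 1)"
    "of_real lam' * P1 y d + 2 * of_real \<mu>' * (P1 y d - 2 * U y d - V y d) = of_real lam * P2 y d + 2 * of_real \<mu> * (P2 y d - 2 * U y d - V y d)"
    "of_real \<mu>' * (2 * V y d - 2 * lc y d (U y) - s1 y d) = of_real \<mu> * (2 * V y d - 2 * lc y d (U y) - s2 y d)"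
    "of_real \<mu>' * (c1 y d + 2 * X y d) = of_real \<mu> * (c2 y d + 2 * X y d)"
  using assms unfolding transmission_data_def by blast+

lemma transmission:
  obtains U V X P1 P2 s1 s2 c1 c2 where "transmission_data U V X P1 P2 s1 s2 c1 c2"
proof -
  have B: "C1_up_to_boundary u BI" "C1_up_to_boundary u BE"
    using sol by (simp_all add: scattering_solution_def closures)
  have N1: "at 1 within Tin \<noteq> bot" unfolding left_filter by simp
  have N2: "at 1 within Tex \<noteq> bot" by simp
  obtain W1 P1 s1 c1 t1 where "one_sided Tin BI u W1 P1 s1 c1 t1"
    using one_side[OF interior_shell u2(1) closures(2) B(1) N1] by blast
  note s1 = this[unfolded one_sided_def left_filter]
  obtain W2 P2 s2 c2 t2 where "one_sided Tex BE u W2 P2 s2 c2 t2"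
    using one_side[OF exterior_shell u2(2) closures(3) B(2) N2] by blast
  note s2 = this[unfolded one_sided_def]
  have P: "(mP u y d ---> P1 y d) (at_left 1)" "(mP u y d ---> P2 y d) (at_right 1)"
    "(mX (ccurl u) y d ---> s1 y d) (at_left 1)" "(mX (ccurl u) y d ---> s2 y d) (at_right 1)"
    "(mD (ccurl u) y d ---> c1 y d) (at_left 1)" "(mD (ccurl u) y d ---> c2 y d) (at_right 1)" for y d
    using s1 s2 by simp_all
  have nb: "at x within BI \<noteq> bot" "at x within BE \<noteq> bot" if x: "norm x = 1" for x
  proof -
    have "x \<in> frontier BI" "x \<in> frontier BE" unfolding closures using x by simp_all
    hence "x \<in> closure BI" "x \<in> closure BE" by (auto simp: frontier_def)
    moreover have "x \<notin> BI" "x \<notin> BE" using x by simp_all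
    ultimately show "at x within BI \<noteq> bot" "at x within BE \<noteq> bot" unfolding trivial_limit_within closure_def by blast+
  qed
  have W: "W1 i x = W2 i x" if x: "norm x = 1" for i x
  proof -
    have "x \<in> frontier BI" unfolding closures using x by simp
    then obtain l where l: "(u ---> l) (at x within BI)" "(u ---> l) (at x within BE)"
      using sol unfolding scattering_solution_def closures(1) by blast
    show ?thesis
      using tendsto_unique[OF nb(1)[OF x] s1[THEN conjunct1, rule_format, OF x] tendsto_vec_nth[OF l(1)]]
        tendsto_unique[OF nb(2)[OF x] s2[THEN conjunct1, rule_format, OF x] tendsto_vec_nth[OF l(2)]] by simp
  qed
  have t: "t1 lam' \<mu>' x = t2 lam \<mu> x" if x: "norm x = 1" for x
  proof -
    have "x \<in> frontier BI" unfolding closures using x by simp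
    then obtain l where l: "(traction lam' \<mu>' u (sgn x) ---> l) (at x within BI)" "(traction lam \<mu> u (sgn x) ---> l) (at x within BE)"
      using sol unfolding scattering_solution_def closures(1) by blast
    have "sgn x = x" using x by (simp add: sgn_div_norm)
    moreover have "(traction lam' \<mu>' u x ---> t1 lam' \<mu>' x) (at x within BI)" "(traction lam \<mu> u x ---> t2 lam \<mu> x) (at x within BE)"
      using s1 s2 x by simp_all
    ultimately show ?thesis
      using tendsto_unique[OF nb(1)[OF x], of "traction lam' \<mu>' u x" "t1 lam' \<mu>' x" l] tendsto_unique[OF nb(2)[OF x], of "traction lam \<mu> u x" "t2 lam \<mu> x" l] l by simp
  qed
  have tI: "sI (%x. \<Sum>i\<in>UNIV. t1 lam' \<mu>' x $ i * G i x) = sI (%x. \<Sum>i\<in>UNIV. t2 lam \<mu> x $ i * G i x)" for G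
    by (rule sI_cong) (simp add: t)
  have W2: "cinner W2 G = cinner W1 G" for G
    by (intro sum.cong refl sI_cong) (simp add: W)
  define U where "U y d = cinner W1 (gX y d)" for y d
  define V where "V y d = - cinner W1 (gS y d)" for y d
  define X where "X y d = - cinner W1 (gL y d)" for y d
  have v: "(vm u G ---> cinner W1 G) (at_left 1)" "(vm u G ---> cinner W1 G) (at_right 1)"
    if "\<And>i. contS (G i)" for G
    using s1 s2 that by (simp_all add: W2)
  have L: "(mU u y d ---> U y d) (at_left 1)" "(mU u y d ---> U y d) (at_right 1)" for y d
    unfolding mU_def[abs_def] U_def by (intro v test_cont)+
  have M: "(mD u y d ---> V y d) (at_left 1)" "(mD u y d ---> V y d) (at_right 1)" for y d
    unfolding mD_def[abs_def] V_def by (intro tendsto_minus v test_cont)+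
  have K: "(mX u y d ---> X y d) (at_left 1)" "(mX u y d ---> X y d) (at_right 1)" for y d
    unfolding mX_def[abs_def] X_def by (intro tendsto_minus v test_cont)+
  have Q: "of_real lam' * P1 y d + 2 * of_real \<mu>' * (P1 y d - 2 * U y d - V y d)
       = of_real lam * P2 y d + 2 * of_real \<mu> * (P2 y d - 2 * U y d - V y d)" (is "?a = ?b")
    "of_real \<mu>' * (2 * V y d - 2 * lc y d (U y) - s1 y d) = of_real \<mu> * (2 * V y d - 2 * lc y d (U y) - s2 y d)" (is "?c = ?d")
    "of_real \<mu>' * (c1 y d + 2 * X y d) = of_real \<mu> * (c2 y d + 2 * X y d)" (is "?e = ?f") for y d
  proof -
    have "sI (%x. \<Sum>i\<in>UNIV. t1 lam' \<mu>' x $ i * gX y d i x) = ?a" "sI (%x. \<Sum>i\<in>UNIV. t2 lam \<mu> x $ i * gX y d i x) = ?b"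
      using s1 s2 L M by simp_all
    thus "?a = ?b" using tI by simp
    have "sI (%x. \<Sum>i\<in>UNIV. t1 lam' \<mu>' x $ i * gS y d i x) = ?c" "sI (%x. \<Sum>i\<in>UNIV. t2 lam \<mu> x $ i * gS y d i x) = ?d"
      using s1 s2 L M by simp_all
    thus "?c = ?d" using tI by simp
    have "sI (%x. \<Sum>i\<in>UNIV. t1 lam' \<mu>' x $ i * gL y d i x) = ?e" "sI (%x. \<Sum>i\<in>UNIV. t2 lam \<mu> x $ i * gL y d i x) = ?f"
      using s1 s2 K by simp_all
    thus "?e = ?f" using tI by simp
  qed
  show ?thesis
    by (rule that[of U V X P1 P2 s1 s2 c1 c2], unfold transmission_data_def) (intro allI conjI L M K P Q)
qed

end

section \<open>Identification of all moments of the solution\<close>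

context scattering
begin

text \<open>r times the radial profiles of the candidates. \<open>A2\<close> describes the total
  exterior field and so contains the incident wave next to the outgoing one.\<close>

definition A1 :: "real => complex" where "A1 r = a * of_real (Zj n k' r)"
definition A1' :: "real => complex" where "A1' r = a * of_real (Zj' n k' r)"
definition A2 :: "real => complex" where "A2 r = of_real (Zj n k r) + b * Zh n k r"
definition A2' :: "real => complex" where "A2' r = of_real (Zj' n k r) + b * Zh' n k r"

lemma A1_deriv:
  assumes "r \<noteq> 0"
  shows "(A1 hvd A1' r) (at r)" "(A1' hvd of_real (real (n * (n + 1)) / r\<^sup>2 - k'\<^sup>2) * A1 r) (at r)"
  unfolding A1_def[abs_def] A1'_def[abs_def]
  using hvd_mult_right[OF Zj_vector_derivative(1)[OF pos(8) assms, of k'], of a]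
    hvd_mult_right[OF Zj_vector_derivative(2)[OF pos(8) assms, of k'], of a]
  by (simp_all add: mult.left_commute)

lemma A2_deriv:
  assumes "r > 0"
  shows "(A2 hvd A2' r) (at r)" "(A2' hvd of_real (real (n * (n + 1)) / r\<^sup>2 - k\<^sup>2) * A2 r) (at r)"
proof -
  have r0: "r \<noteq> 0" and k0: "k \<noteq> 0" using assms kpos by auto
  show "(A2 hvd A2' r) (at r)"
    unfolding A2_def[abs_def] A2'_def
    by (intro hvd_add hvd_mult_right Zj_vector_derivative(1)[OF pos(8) r0] Zh_deriv(1)[OF assms k0])
  show "(A2' hvd of_real (real (n * (n + 1)) / r\<^sup>2 - k\<^sup>2) * A2 r) (at r)"
    unfolding A2'_def[abs_def] A2_def
    by (rule has_vector_derivative_rhs[OF hvd_add[OF Zj_vector_derivative(2)[OF pos(8) r0]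
          hvd_mult_right[OF Zh_deriv(2)[OF assms k0]]]])
       (simp only: distrib_left mult.left_commute)
qed

lemma at_1_limits:
  "(A1 ---> A1 1) (at_left 1)" "(A1' ---> A1' 1) (at_left 1)" "(A2 ---> A2 1) (at_right 1)" "(A2' ---> A2' 1) (at_right 1)"
proof -
  have c: "isCont A1 1" "isCont A1' 1" "isCont A2 1" "isCont A2' 1"
    using A1_deriv[of 1] A2_deriv[of 1] has_vector_derivative_continuous by auto
  show "(A1 ---> A1 1) (at_left 1)" "(A1' ---> A1' 1) (at_left 1)" "(A2 ---> A2 1) (at_right 1)" "(A2' ---> A2' 1) (at_right 1)"
    using c by (auto simp: isCont_def intro: filterlim_at_within_not_equal filterlim_mono[OF _ order_refl] at_le)
qed

text \<open>Nothing is subtracted here: since the incident field has no spheroidal moments, those of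
  \<open>u\<close> solve the homogeneous problem themselves.\<close>

lemma spheroidal_vanish:
  assumes lowI: "\<And>r. r \<in> Tin ==> d \<ge> 2 ==> mU u y (d - 2) r = 0 \<and> mP u y (d - 2) r = 0"
    and lowE: "\<And>r. r \<in> Tex ==> d \<ge> 2 ==> mU u y (d - 2) r = 0 \<and> mP u y (d - 2) r = 0"
  shows "(\<forall>r. 0 < r \<and> r < 1 \<longrightarrow> mU u y d r = 0 \<and> mD u y d r = 0 \<and> mP u y d r = 0 \<and> mX (ccurl u) y d r = 0)
       \<and> (\<forall>r>1. mU u y d r = 0 \<and> mD u y d r = 0 \<and> mP u y d r = 0 \<and> mX (ccurl u) y d r = 0)"
proof -
  let ?l = "real (d * (d + 1))"
  let ?K1 = "\<omega>\<^sup>2 * \<rho>'" and ?K2 = "\<omega>\<^sup>2 * \<rho>" and ?a1 = "lam' + 2 * \<mu>'" and ?a2 = "lam + 2 * \<mu>"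
  obtain U V X P1 P2 s1 s2 c1 c2 where "transmission_data U V X P1 P2 s1 s2 c1 c2"
    using transmission by blast
  note tm = transmission_dataD[OF this]
  have spI: "spheroidal Tin ?a1 \<mu>' ?K1 ?l (mU u y d) (mD u y d) (mP u y d) (mX (ccurl u) y d)"
    by (rule spheroidal_moments[OF interior_shell u2(1) pos(5,4) eq_in lowI])
  have spE: "spheroidal Tex ?a2 \<mu> ?K2 ?l (mU u y d) (mD u y d) (mP u y d) (mX (ccurl u) y d)"
    by (rule spheroidal_moments[OF exterior_shell u2(2) pos(2,1) eq_ex lowE])
  have KK: "?K1 > 0" "?K2 > 0" using pos by simp_all
  have l0: "\<forall>r. mX (ccurl u) y d r = 0 \<and> mD u y d r = 0 \<and> mX (ccurl u) y d r = 0 \<and> mD u y d r = 0" if "?l = 0"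
  proof -
    have "d = 0" using that unfolding of_nat_eq_0_iff by simp
    moreover have "gS y 0 i = (%x. 0)" "gL y 0 i = (%x. 0)" for i by (simp_all add: gS_def gL_def fun_eq_iff)
    ultimately show ?thesis by (simp add: mX_def mD_def vm_def)
  qed
  have lcU: "lc y d (U y) = - of_real ?l * U y d"
  proof -
    have "U y (d - 2) = 0" if d: "d \<ge> 2"
    proof (rule tendsto_unique[OF _ tm(1)])
      have "\<forall>\<^sub>F r in at_left (1::real). mU u y (d - 2) r = 0"
        by (rule eventually_at_leftI[of 0]) (use lowI d in auto)
      thus "(mU u y (d - 2) ---> 0) (at_left 1)" by (rule tendsto_eventually)
    qed simp
    from lc_lower[of d "U y" y, OF this] show ?thesis by simp
  qed
  have tr1: "of_real ?a1 * P1 y d - 2 * of_real \<mu>' * (2 * U y d + V y d) = of_real ?a2 * P2 y d - 2 * of_real \<mu> * (2 * U y d + V y d)"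
    using tm(13)[of y d] by (simp add: algebra_simps)
  have al: "m1 * s1 - 2 * m1 * (v + l * u) = m2 * s2 - 2 * m2 * (v + l * u)"
    if "m1 * (2 * v - 2 * (- l * u) - s1) = m2 * (2 * v - 2 * (- l * u) - s2)" for m1 m2 s1 s2 v l u :: complex
    using that by algebra
  have tr2: "of_real \<mu>' * s1 y d - 2 * of_real \<mu>' * (V y d + of_real ?l * U y d) = of_real \<mu> * s2 y d - 2 * of_real \<mu> * (V y d + of_real ?l * U y d)"
    by (rule al) (use tm(14)[of y d] in \<open>simp only: lcU\<close>)
  obtain B where B: "\<forall>r. 0 < r \<longrightarrow> r < 1/2 \<longrightarrow> cmod (mU u y d r) \<le> B \<and> cmod (mD u y d r) \<le> B \<and> cmod (mP u y d r) \<le> B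
    \<and> cmod (mX (ccurl u) y d r) \<le> B \<and> cmod (mX u y d r) \<le> B \<and> cmod (mD (ccurl u) y d r) \<le> B"
    using moments_bounded[OF u2n(1), of y d] by blast
  have bdd: "cmod (mU u y d r) \<le> B \<and> cmod (mD u y d r) \<le> B \<and> cmod (mP u y d r) \<le> B \<and> cmod (mX (ccurl u) y d r) \<le> B"
    if "0 < r" "r < 1/2" for r using B that by blast
  have rc: "radiation_condition lam \<mu> \<rho> \<omega> us" using sol by (simp add: scattering_solution_def)
  note R = radiating_moments[OF rc us2, where y = y and d = d]
  have a0: "complex_of_real ?a2 \<noteq> 0" "complex_of_real \<mu> \<noteq> 0" using pos by (simp_all only: of_real_eq_0_iff)
  have oE: "open Tex" by simp
  \<comment> \<open>The divergence moments of \<open>us\<close> and \<open>u\<close> agree, hence so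
    do their derivatives; computing that derivative from the equation for \<open>u\<close> rewrites
    the condition on \<open>us\<close> as one on \<open>u\<close>.\<close>
  have rad1: "((%r. of_real r * ((of_real \<mu> / of_real r * mX (ccurl u) y d r - of_real ?K2 * mU u y d r) / of_real ?a2
      - \<i> * of_real (sqrt (?K2 / ?a2)) * mP u y d r)) ---> 0) at_top"
  proof (rule Lim_transform_eventually[OF R(1)], intro eventually_mono[OF eventually_gt_at_top[of 1]])
    fix r :: real assume "r > 1"
    hence r: "r \<in> Tex" by simp
    have C1u: "C1_on (cmp us i) BE" for i by (rule C2_on_C1[OF us2])
    have C1d: "C1_on (cdiv us) BE" unfolding cdiv_def[abs_def] by (intro C1_on_sum C2_on_partial us2)
    have "vm (cgrad (cdiv us)) (gX y d) r = (of_real \<mu> / of_real r * mX (ccurl u) y d r - of_real ?K2 * mU u y d r) / of_real ?a2"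
    proof (rule vector_derivative_unique_on[OF _ lame_moments(1)[OF exterior_shell u2(2) r a0(1) eq_ex] oE r])
      show "(mP us y d hvd vm (cgrad (cdiv us)) (gX y d) r) (at r)"
        unfolding mP_def[abs_def] by (rule grad_moments(1)[OF exterior_shell C1u r C1d])
      show "mP us y d t = mP u y d t" if "t \<in> Tex" for t by (rule us_moments(3)[OF that])
    qed
    thus "of_real r * (vm (cgrad (cdiv us)) (gX y d) r - \<i> * of_real (k_p lam \<mu> \<rho> \<omega>) * mP us y d r)
      = of_real r * ((of_real \<mu> / of_real r * mX (ccurl u) y d r - of_real ?K2 * mU u y d r) / of_real ?a2
      - \<i> * of_real (sqrt (?K2 / ?a2)) * mP u y d r)"
      by (simp only: kp us_moments(3)[OF r])
  qed
  have rad2: "((%r. (of_real ?a2 * of_real ?l * mP u y d r - of_real ?K2 * (of_real r * mD u y d r)) / of_real \<mu>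
      - \<i> * of_real (sqrt (?K2 / \<mu>)) * (of_real r * mX (ccurl u) y d r)) ---> 0) at_top"
  proof (rule Lim_transform_eventually[OF tendsto_minus[OF R(2), unfolded minus_zero]], intro eventually_mono[OF eventually_gt_at_top[of 1]])
    fix r :: real assume "r > 1"
    hence r: "r \<in> Tex" and r0: "complex_of_real r \<noteq> 0" by auto
    have lP: "lc y d (%e. mP u y e r) = - of_nat (d * (d + 1)) * mP u y d r"
      by (rule lc_lower) (use lowE[OF r] in auto)
    have "of_real \<mu> * mD (ccurl (ccurl u)) y d r = of_real ?a2 / of_real r * lc y d (%e. mP u y e r) + of_real ?K2 * mD u y d r"
      by (rule lame_moments(2)[OF exterior_shell u2(2) r a0(1) eq_ex])
    hence M: "of_real \<mu> * mD (ccurl (ccurl u)) y d r = of_real ?a2 / of_real r * (- of_real ?l * mP u y d r) + of_real ?K2 * mD u y d r"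
      unfolding lP of_real_of_nat_eq .
    have al: "- (R * (C + i * q * S)) = (A * L * P - K * (R * D)) / M - i * q * (R * S)"
      if "M * C = A / R * (- L * P) + K * D" "M \<noteq> 0" "R \<noteq> 0" for R C i q S A L P K D M :: complex
    proof -
      have "R * (M * C) = - (A * L * P) + K * (R * D)" unfolding that(1) using that(3) by (simp add: algebra_simps)
      hence "(A * L * P - K * (R * D)) / M = - (R * C)" using that(2) by (simp add: field_simps)
      thus ?thesis by (simp add: algebra_simps)
    qed
    show "- (of_real r * (mD (ccurl (ccurl us)) y d r + \<i> * of_real (k_s \<mu> \<rho> \<omega>) * mX (ccurl us) y d r))
      = (of_real ?a2 * of_real ?l * mP u y d r - of_real ?K2 * (of_real r * mD u y d r)) / of_real \<mu>
      - \<i> * of_real (sqrt (?K2 / \<mu>)) * (of_real r * mX (ccurl u) y d r)"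
      unfolding us_moments(4,5)[OF r] k[symmetric] ks[symmetric] by (rule al[OF M a0(2) r0])
  qed
  show ?thesis
    by (rule spheroidal_unique[OF spI pos(5,4) KK(1) _ spE pos(2,1) KK(2) l0 tm(1) tm(3) tm(7) tm(9) tm(2) tm(4) tm(8) tm(10) tr1 tr2 bdd rad1 rad2])
       simp_all
qed

text \<open>The candidates satisfy the same equations, interface relations and radiation condition
  as the moments, so the differences fall under \<open>toroidal_unique\<close>; regularity at 0
  holds for both terms of the interior difference.\<close>

lemma toroidal_vanish:
  assumes lowI: "\<And>r. r \<in> Tin ==> d \<ge> 2 ==> Zw u y (d - 2) r = A1 r * Nm f n y (d - 2)"
    and lowE: "\<And>r. r \<in> Tex ==> d \<ge> 2 ==> Zw u y (d - 2) r = A2 r * Nm f n y (d - 2)"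
  shows "(\<forall>r. 0 < r \<and> r < 1 \<longrightarrow> Zw u y d r - A1 r * Nm f n y d = 0) \<and> (\<forall>r>1. Zw u y d r - A2 r * Nm f n y d = 0)"
proof -
  let ?l = "real (d * (d + 1))" and ?N = "Nm f n y d"
  obtain U V X P1 P2 s1 s2 c1 c2 where "transmission_data U V X P1 P2 s1 s2 c1 c2"
    using transmission by blast
  note tm = transmission_dataD[OF this]
  have dI: "((%r. Zw u y d r - A1 r * ?N) hvd (Zv u y d r - A1' r * ?N)) (at r)"
    "((%r. Zv u y d r - A1' r * ?N) hvd of_real (?l / r\<^sup>2 - k'\<^sup>2) * (Zw u y d r - A1 r * ?N)) (at r)"
    if r: "0 < r" "r < 1" for r
    using toroidal_diff[OF interior_shell u2n(1) _ mX_cc(1) A1_deriv lowI, of r] r by auto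
  have dE: "((%r. Zw u y d r - A2 r * ?N) hvd (Zv u y d r - A2' r * ?N)) (at r)"
    "((%r. Zv u y d r - A2' r * ?N) hvd of_real (?l / r\<^sup>2 - k\<^sup>2) * (Zw u y d r - A2 r * ?N)) (at r)"
    if r: "r > 1" for r
    using toroidal_diff[OF exterior_shell u2n(2) _ mX_cc(2) A2_deriv lowE, of r] r by auto
  have r1: "((%r::real. complex_of_real r) ---> of_real 1) (at 1 within S)" for S
    by (rule tendsto_of_real[OF tendsto_ident_at])
  have A21: "A1 1 = A2 1" unfolding A1_def A2_def by (rule match(1))
  have L1: "((%r. Zw u y d r - A1 r * ?N) ---> of_real 1 * X y d - A1 1 * ?N) (at_left 1)"
    "((%r. Zv u y d r - A1' r * ?N) ---> - (of_real 1 * c1 y d) - A1' 1 * ?N) (at_left 1)"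
    unfolding Zw_def Zv_def by (intro tendsto_diff tendsto_minus tendsto_mult tendsto_const r1 tm at_1_limits)+
  have L2: "((%r. Zw u y d r - A2 r * ?N) ---> of_real 1 * X y d - A1 1 * ?N) (at_right 1)"
    "((%r. Zv u y d r - A2' r * ?N) ---> - (of_real 1 * c2 y d) - A2' 1 * ?N) (at_right 1)"
    unfolding Zw_def Zv_def A21 by (intro tendsto_diff tendsto_minus tendsto_mult tendsto_const r1 tm at_1_limits)+
  have M2: "of_real \<mu>' * (A1' 1 - 2 * A1 1) = of_real \<mu> * (A2' 1 - 2 * A1 1)"
    unfolding A21 using match(2) unfolding A21[symmetric] by (simp add: A1_def A1'_def A2'_def match(1))
  have al: "m1 * ((- (1 * c1) - a1' * N) - 2 * (1 * x - a1 * N)) = m2 * ((- (1 * c2) - a2' * N) - 2 * (1 * x - a1 * N))"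
    if "m1 * (c1 + 2 * x) = m2 * (c2 + 2 * x)" "m1 * (a1' - 2 * a1) = m2 * (a2' - 2 * a1)" for m1 m2 c1 c2 x a1 a1' a2' N :: complex
    using that by algebra
  have tr: "of_real \<mu>' * ((- (of_real 1 * c1 y d) - A1' 1 * ?N) - 2 * (of_real 1 * X y d - A1 1 * ?N))
    = of_real \<mu> * ((- (of_real 1 * c2 y d) - A2' 1 * ?N) - 2 * (of_real 1 * X y d - A1 1 * ?N))"
    unfolding of_real_1 by (rule al[OF tm(15) M2])
  obtain B1 where B1: "\<forall>r. 0 < r \<longrightarrow> r < 1/2 \<longrightarrow> cmod (mU u y d r) \<le> B1 \<and> cmod (mD u y d r) \<le> B1 \<and> cmod (mP u y d r) \<le> B1
    \<and> cmod (mX (ccurl u) y d r) \<le> B1 \<and> cmod (mX u y d r) \<le> B1 \<and> cmod (mD (ccurl u) y d r) \<le> B1"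
    using moments_bounded[OF u2n(1), of y d] by blast
  obtain B2 where B2: "\<forall>r. 0 < r \<longrightarrow> r < 1/2 \<longrightarrow> \<bar>Zj n k' r\<bar> \<le> B2 * r \<and> \<bar>Zj' n k' r\<bar> \<le> B2"
    using Zj_bounds[OF pos(8), of k'] by blast
  define B where "B = B1 + cmod a * B2 * cmod ?N"
  have bdd: "cmod (Zw u y d r - A1 r * ?N) \<le> B * r \<and> cmod (Zv u y d r - A1' r * ?N) \<le> B" if r: "0 < r" "r < 1/2" for r
  proof
    have b1: "cmod (mX u y d r) \<le> B1" "cmod (mD (ccurl u) y d r) \<le> B1" using B1 r by auto
    have b2: "\<bar>Zj n k' r\<bar> \<le> B2 * r" "\<bar>Zj' n k' r\<bar> \<le> B2" using B2 r by auto
    have "cmod (A1 r * ?N) \<le> cmod a * (B2 * r) * cmod ?N"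
      unfolding A1_def norm_mult norm_of_real by (intro mult_right_mono mult_left_mono b2) auto
    moreover have "cmod (Zw u y d r) \<le> r * B1"
      unfolding Zw_def norm_mult norm_of_real using r b1 by (intro mult_mono) auto
    ultimately show "cmod (Zw u y d r - A1 r * ?N) \<le> B * r"
      by (intro order_trans[OF norm_triangle_ineq4]) (simp add: B_def algebra_simps)
    have "cmod (A1' r * ?N) \<le> cmod a * B2 * cmod ?N"
      unfolding A1'_def norm_mult norm_of_real by (intro mult_right_mono mult_left_mono b2) auto
    moreover have "cmod (Zv u y d r) \<le> 1 * B1"
      unfolding Zv_def norm_minus_cancel norm_mult norm_of_real using r b1 by (intro mult_mono) auto
    ultimately show "cmod (Zv u y d r - A1' r * ?N) \<le> B"
      by (intro order_trans[OF norm_triangle_ineq4]) (simp add: B_def)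
  qed
  have rc: "radiation_condition lam \<mu> \<rho> \<omega> us" using sol by (simp add: scattering_solution_def)
  note R = radiating_moments(3)[OF rc us2, where y = y and d = d]
  have k0: "\<i> * complex_of_real k \<noteq> 0" using kpos by simp
  \<comment> \<open>Division by -\<i> k turns the third radiation limit into the outgoing condition
    for \<open>Zw us\<close>; the Hankel part obeys the same condition and can be
    subtracted.\<close>
  have R': "((%r. (of_real r * (\<i> * of_real k * mD (ccurl us) y d r - mX (ccurl (ccurl us)) y d r)) / (- (\<i> * of_real k))
      - b * (Zh' n k r - \<i> * of_real k * Zh n k r) * ?N) ---> 0) at_top"
  proof -
    have "((%r. (of_real r * (\<i> * of_real k * mD (ccurl us) y d r - mX (ccurl (ccurl us)) y d r)) / (- (\<i> * of_real k))
      - b * (Zh' n k r - \<i> * of_real k * Zh n k r) * ?N) ---> 0 / (- (\<i> * of_real k)) - b * 0 * ?N) at_top"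
      using k0 by (intro tendsto_diff tendsto_divide tendsto_mult tendsto_const R[folded k] Zh_radiating) simp
    thus ?thesis by simp
  qed
  have rad: "((%r. (Zv u y d r - A2' r * ?N) - \<i> * of_real k * (Zw u y d r - A2 r * ?N)) ---> 0) at_top"
  proof (rule Lim_transform_eventually[OF R'], intro eventually_mono[OF eventually_gt_at_top[of 1]])
    fix r :: real assume "r > 1"
    hence r: "r \<in> Tex" by simp
    have z: "Zv u y d r = Zv us y d r + of_real (Zj' n k r) * ?N" "Zw u y d r = Zw us y d r + of_real (Zj n k r) * ?N"
      using us_more(1)[OF r, of y d] us_moments(6)[OF r, of y d] by simp_all
    have e: "of_real r * (\<i> * of_real k * mD (ccurl us) y d r - mX (ccurl (ccurl us)) y d r)
      = - (\<i> * of_real k) * (Zv us y d r - \<i> * of_real k * Zw us y d r)"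
    proof -
      have g: "R * (i * K * D - K\<^sup>2 * X) = - (i * K) * (- (R * D) - i * K * (R * X))" if "i * i = -1" for R i K D X :: complex
        using that by algebra
      show ?thesis unfolding us_more(2)[OF r] Zv_def Zw_def of_real_power by (rule g) simp
    qed
    have "(of_real r * (\<i> * of_real k * mD (ccurl us) y d r - mX (ccurl (ccurl us)) y d r)) / (- (\<i> * of_real k))
      = Zv us y d r - \<i> * of_real k * Zw us y d r"
      unfolding e by (rule nonzero_mult_div_cancel_left) (use k0 in simp)
    thus "(of_real r * (\<i> * of_real k * mD (ccurl us) y d r - mX (ccurl (ccurl us)) y d r)) / (- (\<i> * of_real k))
      - b * (Zh' n k r - \<i> * of_real k * Zh n k r) * ?N = (Zv u y d r - A2' r * ?N) - \<i> * of_real k * (Zw u y d r - A2 r * ?N)"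
      unfolding z A2_def A2'_def by (simp add: algebra_simps)
  qed
  show ?thesis
    by (rule toroidal_unique[OF dI dE pos(4,1) kpos(1) _ L1 L2 tr bdd rad]) simp_all
qed

theorem moments:
  "(\<forall>r. 0 < r \<and> r < 1 \<longrightarrow> mU u y d r = 0 \<and> mD u y d r = 0 \<and> Zw u y d r = A1 r * Nm f n y d)
   \<and> (\<forall>r>1. mU u y d r = 0 \<and> mD u y d r = 0 \<and> Zw u y d r = A2 r * Nm f n y d)"
proof -
  have S: "(\<forall>r. 0 < r \<and> r < 1 \<longrightarrow> mU u y d r = 0 \<and> mD u y d r = 0 \<and> mP u y d r = 0 \<and> mX (ccurl u) y d r = 0)
       \<and> (\<forall>r>1. mU u y d r = 0 \<and> mD u y d r = 0 \<and> mP u y d r = 0 \<and> mX (ccurl u) y d r = 0)" for d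
  proof (induction d rule: less_induct)
    case (less d)
    have "d - 2 < d" if "d \<ge> 2" using that by simp
    with less.IH[of "d - 2"] show ?case by (intro spheroidal_vanish) auto
  qed
  have "(\<forall>r. 0 < r \<and> r < 1 \<longrightarrow> Zw u y d r - A1 r * Nm f n y d = 0) \<and> (\<forall>r>1. Zw u y d r - A2 r * Nm f n y d = 0)"
  proof (induction d rule: less_induct)
    case (less d)
    have "d - 2 < d" if "d \<ge> 2" using that by simp
    with less.IH[of "d - 2"] show ?case by (intro toroidal_vanish) auto
  qed
  with S[of d] show ?thesis by auto
qed

end

section \<open>Completeness of the moments\<close>

text \<open>Powers of x\<bullet>y are not closed under multiplication, whereas products of
  exponentials are exponentials. As generating functions of the powers they carry the same
  information and form a point-separating algebra.\<close>

inductive expspan :: "(real^3 => real) => bool" where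
  exp: "expspan (%x. c * exp (y \<bullet> x))"
| add: "expspan f ==> expspan g ==> expspan (%x. f x + g x)"

lemma expspan_mult: "expspan f ==> expspan g ==> expspan (%x. f x * g x)"
proof (induction f rule: expspan.induct)
  case (exp c y)
  from exp show ?case
  proof (induction g rule: expspan.induct)
    case (exp c' y')
    have "(%x. c * exp (y \<bullet> x) * (c' * exp (y' \<bullet> x))) = (%x. (c * c') * exp ((y + y') \<bullet> x))"
      by (simp add: inner_add_left exp_add mult_ac)
    thus ?case by (simp only: expspan.exp)
  next
    case (add f g) thus ?case by (simp only: distrib_left expspan.add)
  qed
next
  case (add f g) thus ?case by (simp only: distrib_right expspan.add)
qed

lemma continuous_on_expspan: "expspan f ==> continuous_on S f"
  by (induction rule: expspan.induct) (auto intro!: continuous_intros)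

lemma expspan_const: "expspan (%x. c)"
  using expspan.exp[of c 0] by simp

lemma sphere_bound:
  fixes g :: "sfield"
  assumes "contS g"
  obtains B where "B > 0" "\<And>x. norm x = 1 ==> cmod (g x) \<le> B"
proof -
  have "bounded (g ` sphere 0 1)" by (intro compact_imp_bounded compact_continuous_image assms) simp
  then obtain B where "B > 0" "\<forall>x\<in>sphere 0 1. cmod (g x) \<le> B" unfolding bounded_pos by auto
  thus ?thesis by (intro that[of B]) auto
qed

lemma dt_eq: "dt y x = of_real (y \<bullet> x)"
  by (simp add: dt_def inner_vec_def sum_3)

text \<open>On the sphere the Taylor remainder of order N is at most |y|^N / N! times exp |y|,
  uniformly, and the partial sums integrate to 0.\<close>

lemma sI_exp_zero:
  assumes g: "contS g" and m: "\<And>d. sI (%x. g x * ph y d x) = 0"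
  shows "sI (%x. g x * of_real (exp (y \<bullet> x))) = 0"
proof -
  obtain B where B: "B > 0" "\<And>x. norm x = 1 ==> cmod (g x) \<le> B" by (rule sphere_bound[OF g]) blast
  define q where "q N x = (\<Sum>d<N. of_real (1 / fact d) * ph y d x)" for N x
  have c: "contS (%x. g x * (of_real (1 / fact d) * ph y d x))" for d
    by (intro continuous_on_mult g continuous_on_const test_cont)
  have q0: "sI (%x. g x * q N x) = 0" for N
  proof -
    have "sI (%x. g x * q N x) = (\<Sum>d<N. sI (%x. g x * (of_real (1 / fact d) * ph y d x)))"
      unfolding q_def sum_distrib_left by (rule sI_sum[OF _ c]) simp
    also have "\<dots> = (\<Sum>d<N. of_real (1 / fact d) * sI (%x. g x * ph y d x))"
      by (simp add: mult.left_commute[of "g _"] flip: sI_cmult)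
    finally show ?thesis by (simp add: m)
  qed
  have bd: "cmod (sI (%x. g x * of_real (exp (y \<bullet> x)))) \<le> 2 * pi\<^sup>2 * (B * (norm y ^ N / fact N * exp (norm y)))" for N
  proof -
    have ce: "contS (%x. g x * of_real (exp (y \<bullet> x)))" "contS (%x. g x * q N x)"
      unfolding q_def by (intro continuous_on_mult g continuous_on_sum continuous_on_const test_cont continuous_intros)+
    have "sI (%x. g x * of_real (exp (y \<bullet> x))) = sI (%x. g x * of_real (exp (y \<bullet> x)) - g x * q N x)"
      unfolding sI_diff[OF ce] q0 by simp
    also have "cmod \<dots> \<le> 2 * pi\<^sup>2 * (B * (norm y ^ N / fact N * exp (norm y)))"
    proof (rule norm_sI_le)
      show "contS (%x. g x * of_real (exp (y \<bullet> x)) - g x * q N x)"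
        by (intro continuous_on_diff ce)
      fix x :: "real^3" assume x: "norm x = 1"
      let ?t = "y \<bullet> x"
      have t: "\<bar>?t\<bar> \<le> norm y" using Cauchy_Schwarz_ineq2[of y x] x by simp
      obtain s where s: "\<bar>s\<bar> \<le> \<bar>?t\<bar>" "exp ?t = (\<Sum>m<N. ?t ^ m / fact m) + exp s / fact N * ?t ^ N"
        using Maclaurin_exp_le[of ?t N] by blast
      have "q N x = of_real (\<Sum>m<N. ?t ^ m / fact m)"
        unfolding q_def ph_def dt_eq of_real_sum by (intro sum.cong refl) simp
      hence "of_real (exp ?t) - q N x = of_real (exp s / fact N * ?t ^ N)" unfolding s(2) by simp
      hence "cmod (of_real (exp ?t) - q N x) = \<bar>exp s / fact N * ?t ^ N\<bar>" by (simp only: norm_of_real)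
      also have "\<dots> = exp s * \<bar>?t\<bar> ^ N / fact N" by (simp add: abs_mult power_abs)
      also have "\<dots> \<le> exp (norm y) * norm y ^ N / fact N"
        using s(1) t by (intro divide_right_mono mult_mono power_mono) auto
      finally have "cmod (of_real (exp ?t) - q N x) \<le> norm y ^ N / fact N * exp (norm y)" by (simp add: mult.commute)
      thus "cmod (g x * of_real (exp (y \<bullet> x)) - g x * q N x) \<le> B * (norm y ^ N / fact N * exp (norm y))"
        unfolding right_diff_distrib[symmetric] norm_mult using B x by (intro mult_mono) auto
    qed
    finally show ?thesis .
  qed
  have "(%N. norm y ^ N / fact N) \<longlonglongrightarrow> 0"
    using summable_LIMSEQ_zero[OF summable_exp[of "norm y"]] by (simp add: divide_inverse mult.commute)
  hence "(%N. 2 * pi\<^sup>2 * (B * (norm y ^ N / fact N * exp (norm y)))) \<longlonglongrightarrow> 2 * pi\<^sup>2 * (B * (0 * exp (norm y)))"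
    by (intro tendsto_mult tendsto_const)
  from tendsto_le[OF _ this tendsto_const, of "cmod (sI (%x. g x * of_real (exp (y \<bullet> x))))"]
  have "cmod (sI (%x. g x * of_real (exp (y \<bullet> x)))) \<le> 0" using bd by simp
  thus ?thesis by simp
qed

text \<open>Stone-Weierstrass extends the orthogonality from exponentials to every real continuous
  function; the real and imaginary parts of g are admissible test functions.\<close>

lemma sphere_complete:
  assumes g: "contS g" and m: "\<And>y d. sI (%x. g x * ph y d x) = 0" and x: "norm x = 1"
  shows "g x = 0"
proof -
  obtain B where B: "B > 0" "\<And>x. norm x = 1 ==> cmod (g x) \<le> B" by (rule sphere_bound[OF g]) blast
  have ch: "contS (%x. g x * of_real (h x))" if "contS h" for h :: "real^3 => real"
    by (intro continuous_on_mult g continuous_on_of_real that)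
  have span: "sI (%x. g x * of_real (h x)) = 0" if "expspan h" for h
    using that
  proof (induction h rule: expspan.induct)
    case (exp c y)
    have "sI (%x. g x * of_real (c * exp (y \<bullet> x))) = of_real c * sI (%x. g x * of_real (exp (y \<bullet> x)))"
      unfolding sI_cmult[symmetric] by (rule sI_cong) simp
    thus ?case by (simp add: sI_exp_zero[OF g m])
  next
    case (add f h)
    have "sI (%x. g x * of_real (f x + h x)) = sI (%x. g x * of_real (f x)) + sI (%x. g x * of_real (h x))"
      unfolding of_real_add distrib_left
      by (intro sI_add ch continuous_on_expspan add.hyps)
    thus ?case by (simp add: add.IH)
  qed
  have all: "sI (%x. g x * of_real (h x)) = 0" if h: "contS h" for h
  proof -
    have "cmod (sI (%x. g x * of_real (h x))) \<le> 2 * pi\<^sup>2 * (B * e)" if e: "e > 0" for e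
    proof -
      have "\<exists>q. expspan q \<and> (\<forall>x\<in>sphere 0 1. \<bar>h x - q x\<bar> < e)"
      proof (rule Stone_Weierstrass_HOL)
        fix x y :: "real^3" assume xy: "x \<in> sphere 0 1 \<and> y \<in> sphere 0 1 \<and> x \<noteq> y"
        have "(x - y) \<bullet> (x - y) \<noteq> 0" using xy by simp
        hence "(x - y) \<bullet> x \<noteq> (x - y) \<bullet> y" unfolding inner_diff_right[of "x - y"] by simp
        hence "1 * exp ((x - y) \<bullet> x) \<noteq> 1 * exp ((x - y) \<bullet> y)" by simp
        thus "\<exists>f. expspan f \<and> f x \<noteq> f y" using expspan.exp[of 1 "x - y"] by blast
      qed (use h e in \<open>auto intro: expspan_const continuous_on_expspan expspan.add expspan_mult\<close>)
      then obtain q where q: "expspan q" "\<And>x. norm x = 1 ==> \<bar>h x - q x\<bar> < e" by auto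
      have cq: "contS q" by (rule continuous_on_expspan[OF q(1)])
      have "sI (%x. g x * of_real (h x)) = sI (%x. g x * of_real (h x - q x))"
        unfolding of_real_diff right_diff_distrib sI_diff[OF ch[OF h] ch[OF cq]] span[OF q(1)] by simp
      also have "cmod \<dots> \<le> 2 * pi\<^sup>2 * (B * e)"
      proof (rule norm_sI_le)
        show "contS (%x. g x * of_real (h x - q x))" by (intro ch continuous_on_diff h cq)
        fix x :: "real^3" assume x: "norm x = 1"
        show "cmod (g x * of_real (h x - q x)) \<le> B * e"
          unfolding norm_mult norm_of_real using B q(2)[OF x] x by (intro mult_mono) auto
      qed
      finally show ?thesis .
    qed
    note b = this
    have "cmod (sI (%x. g x * of_real (h x))) \<le> 0 + e" if "e > 0" for e
      using b[of "e / (2 * pi\<^sup>2 * B)"] B(1) that by simp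
    hence "cmod (sI (%x. g x * of_real (h x))) \<le> 0" by (rule field_le_epsilon)
    thus ?thesis by simp
  qed
  have cR: "contS (%x. Re (g x))" "contS (%x. Im (g x))"
    by (intro continuous_intros g)+
  \<comment> \<open>This combination of the two tests is the integral of g times its
    conjugate.\<close>
  have "sI (%x. g x * of_real (Re (g x)) - \<i> * (g x * of_real (Im (g x)))) = 0"
    by (subst sI_diff) (auto simp: sI_cmult all cR intro!: ch continuous_on_mult continuous_on_const)
  also have "(%x. g x * of_real (Re (g x)) - \<i> * (g x * of_real (Im (g x)))) = (%x. of_real ((cmod (g x))\<^sup>2))"
  proof
    fix x
    have "g x * of_real (Re (g x)) - \<i> * (g x * of_real (Im (g x))) = g x * cnj (g x)"
      by (simp add: complex_eq_iff algebra_simps)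
    thus "g x * of_real (Re (g x)) - \<i> * (g x * of_real (Im (g x))) = of_real ((cmod (g x))\<^sup>2)"
      by (simp only: complex_norm_square)
  qed
  finally have "sI (%x. of_real ((cmod (g x))\<^sup>2)) = 0" .
  hence "(cmod (g x))\<^sup>2 = 0"
    by (rule sI_nonneg_eq_0D[rotated 2]) (auto intro!: continuous_intros g simp: x)
  thus ?thesis by simp
qed

section \<open>Polarization and recovery of the tangential part\<close>

lemma poly_zero_on_reals:
  assumes "\<And>t::real. (\<Sum>k\<le>n. h k * complex_of_real t ^ k) = 0" "k \<le> n"
  shows "h k = 0"
proof (rule ccontr)
  assume "h k \<noteq> 0"
  hence "finite {z. (\<Sum>i\<le>n. h i * z ^ i) = 0}" using Transcendental.polyfun_finite_roots assms(2) by blast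
  moreover have "range complex_of_real \<subseteq> {z. (\<Sum>i\<le>n. h i * z ^ i) = 0}" using assms(1) by auto
  ultimately have "finite (range complex_of_real)" by (rule rev_finite_subset)
  hence "finite (UNIV :: real set)" by (rule finite_imageD) (simp add: inj_on_def)
  thus False by (simp add: infinite_UNIV_char_0)
qed

text \<open>With y + t z in place of y, the moment of degree d + 1 is a polynomial in t that
  vanishes identically; its linear coefficient is d + 1 times the mixed moment. The operator is kept
  abstract so that the argument covers both the surface gradient and its rotation.\<close>

lemma polarize:
  assumes op: "\<And>i x c. op i (%x. \<Sum>k\<le>Suc d. c k * (dt z x ^ k * dt y x ^ (Suc d - k))) x
      = (\<Sum>k\<le>Suc d. c k * op i (%x. dt z x ^ k * dt y x ^ (Suc d - k)) x)"
    and cop: "\<And>i k. contS (op i (%x. dt z x ^ k * dt y x ^ (Suc d - k)))"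
    and G: "\<And>i. contS (G i)"
    and m: "\<And>y d. (\<Sum>i\<in>(UNIV::3 set). sI (%x. G i x * op i (ph y d) x)) = 0"
  shows "(\<Sum>i\<in>UNIV. sI (%x. G i x * op i (%x. dt z x * dt y x ^ d) x)) = 0"
proof -
  define h where "h k = of_nat (Suc d choose k) * (\<Sum>i\<in>UNIV. sI (%x. G i x * op i (%x. dt z x ^ k * dt y x ^ (Suc d - k)) x))" for k
  have "(\<Sum>k\<le>Suc d. h k * of_real t ^ k) = 0" for t
  proof -
    have P: "ph (y + t *\<^sub>R z) (Suc d) = (%x. \<Sum>k\<le>Suc d. (of_nat (Suc d choose k) * of_real t ^ k) * (dt z x ^ k * dt y x ^ (Suc d - k)))"
    proof
      fix x
      have "dt (y + t *\<^sub>R z) x = of_real t * dt z x + dt y x" by (simp add: dt_eq inner_add_left)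
      thus "ph (y + t *\<^sub>R z) (Suc d) x = (\<Sum>k\<le>Suc d. (of_nat (Suc d choose k) * of_real t ^ k) * (dt z x ^ k * dt y x ^ (Suc d - k)))"
        unfolding ph_def by (simp only: binomial_ring power_mult_distrib mult_ac)
    qed
    have "sI (%x. G i x * op i (ph (y + t *\<^sub>R z) (Suc d)) x)
      = (\<Sum>k\<le>Suc d. of_nat (Suc d choose k) * of_real t ^ k * sI (%x. G i x * op i (%x. dt z x ^ k * dt y x ^ (Suc d - k)) x))" for i
    proof -
      have "sI (%x. G i x * op i (ph (y + t *\<^sub>R z) (Suc d)) x)
        = sI (%x. \<Sum>k\<le>Suc d. of_nat (Suc d choose k) * of_real t ^ k * (G i x * op i (%x. dt z x ^ k * dt y x ^ (Suc d - k)) x))"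
        unfolding P op by (rule sI_cong) (simp only: sum_distrib_left mult.left_commute mult.assoc)
      also have "\<dots> = (\<Sum>k\<le>Suc d. sI (%x. of_nat (Suc d choose k) * of_real t ^ k * (G i x * op i (%x. dt z x ^ k * dt y x ^ (Suc d - k)) x)))"
        by (rule sI_sum) (simp, intro continuous_on_mult continuous_on_const G cop)
      finally show ?thesis by (simp only: sI_cmult)
    qed
    hence "(\<Sum>i\<in>UNIV. sI (%x. G i x * op i (ph (y + t *\<^sub>R z) (Suc d)) x)) = (\<Sum>k\<le>Suc d. h k * of_real t ^ k)"
      unfolding h_def by (simp only:) (subst sum.swap, simp only: sum_distrib_left sum_distrib_right mult_ac)
    thus ?thesis using m by simp
  qed
  from poly_zero_on_reals[where n = "Suc d" and h = h and k = 1, OF this] have "h 1 = 0" by simp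
  thus ?thesis unfolding h_def by (simp del: of_nat_Suc)
qed

text \<open>The components of x \<times> surface gradient; on a power of x\<bullet>y this is
  \<open>gL\<close>, and in this form it also applies to the polarized products.\<close>

definition rot :: "3 => (sfield) => sfield" where
  "rot i f x = (if i = 1 then cx 2 x * tg 3 f x - cx 3 x * tg 2 f x
    else if i = 2 then cx 3 x * tg 1 f x - cx 1 x * tg 3 f x else cx 1 x * tg 2 f x - cx 2 x * tg 1 f x)"

lemma rot_simps:
  "rot 1 f x = cx 2 x * tg 3 f x - cx 3 x * tg 2 f x" "rot 2 f x = cx 3 x * tg 1 f x - cx 1 x * tg 3 f x"
  "rot 3 f x = cx 1 x * tg 2 f x - cx 2 x * tg 1 f x"
  by (simp_all add: rot_def)

lemma rot_ph: "rot i (ph y d) x = gL y d i x"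
proof -
  have "rot 1 (ph y d) x = gL y d 1 x" "rot 2 (ph y d) x = gL y d 2 x" "rot 3 (ph y d) x = gL y d 3 x"
    unfolding rot_simps tg_ph gL_def gS_def xcr_simps by algebra+
  thus ?thesis using exhaust_3[of i] by auto
qed

lemma C1_on_pol: "C1_on (%x. dt z x ^ k * dt y x ^ d) S"
  by (intro C1_on_mult C1_on_power C1_on_dt)

lemma tg_pol_sum:
  "tg i (%x. \<Sum>k\<le>n. c k * (dt z x ^ k * dt y x ^ (n - k))) x = (\<Sum>k\<le>n. c k * tg i (%x. dt z x ^ k * dt y x ^ (n - k)) x)"
proof -
  have d: "(%x. dt z x ^ k * dt y x ^ d) differentiable (at x)" for k d
    using C1_onD(1)[OF C1_on_pol[of z k y d UNIV]] by simp
  show ?thesis by (subst tg_sum) (auto intro!: differentiable_mult d simp: tg_cmult d)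
qed

lemma rot_pol_sum:
  "rot i (%x. \<Sum>k\<le>n. c k * (dt z x ^ k * dt y x ^ (n - k))) x = (\<Sum>k\<le>n. c k * rot i (%x. dt z x ^ k * dt y x ^ (n - k)) x)"
  unfolding rot_def tg_pol_sum using exhaust_3[of i]
  by (elim disjE) (simp_all add: right_diff_distrib sum_subtractf sum_distrib_left mult.left_commute)

lemma tg_polarized:
  "tg i (%x. dt z x * dt y x ^ d) x = dt z x * gS y d i x + (cx i z - cx i x * dt z x) * ph y d x"
proof -
  have "tg i (%x. dt z x * ph y d x) x = dt z x * tg i (ph y d) x + tg i (dt z) x * ph y d x"
    by (rule tg_mult) (use C1_onD(1)[OF C1_on_test(1)[of y d UNIV]] in simp_all)
  thus ?thesis by (simp add: tg_ph ph_def)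
qed

definition crv :: "real^3 => real^3 => real^3" where
  "crv y z = vector [y$2 * z$3 - y$3 * z$2, y$3 * z$1 - y$1 * z$3, y$1 * z$2 - y$2 * z$1]"

text \<open>On the unit sphere, \<open>z \<Delta>\<^sub>S (x\<bullet>y)\<^sup>d\<close> is, up to a radial field, a surface gradient plus a surface curl.\<close>

lemma hodge_identity:
  assumes x: "norm x = 1" and G: "(\<Sum>i\<in>UNIV. cx i x * G i) = 0"
  shows "(\<Sum>i\<in>UNIV. cx i z * G i) * lap y (Suc d) x
    = of_nat (Suc d) * dt y z * (\<Sum>i\<in>UNIV. G i * gS y d i x)
      - of_nat (Suc d) * (\<Sum>i\<in>UNIV. G i * tg i (%x. dt z x * dt y x ^ Suc d) x)
      + of_nat (Suc d) * (\<Sum>i\<in>UNIV. G i * rot i (%x. dt (crv y z) x * dt y x ^ d) x)"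
proof -
  define P where "P = of_nat d * dt y x ^ (d - 1)"
  define Q where "Q = dt y x ^ d"
  \<comment> \<open>True for d = 0 as well, where both sides are 0; it is the relation between P and
    Q that the algebra below relies on.\<close>
  have PQ: "of_nat d * Q = P * dt y x" by (cases d) (simp_all add: P_def Q_def)
  have gS: "gS y d i x = P * (cx i y - cx i x * dt y x)" for i by (simp add: gS_def P_def)
  have gS': "gS y (Suc d) i x = (of_nat d + 1) * Q * (cx i y - cx i x * dt y x)" for i by (simp add: gS_def Q_def)
  have phs: "ph y (Suc d) x = Q * dt y x" "ph y d x = Q" by (simp_all add: ph_def Q_def)
  have lap: "lap y (Suc d) x = (of_nat d + 1) * (P * (cx 1 y * cx 1 y + cx 2 y * cx 2 y + cx 3 y * cx 3 y - dt y x * dt y x) - Q * (2 * dt y x))"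
  proof (cases d)
    case (Suc e)
    show ?thesis unfolding lap_eq[OF x, where d = "Suc d"] P_def Q_def by (simp add: Suc algebra_simps)
  qed (simp add: lap_eq[OF x] P_def Q_def)
  note T = tg_polarized[where x = x]
  have core: "(z1 * g1 + z2 * g2 + z3 * g3) * ((n + 1) * (P * (y1 * y1 + y2 * y2 + y3 * y3 - s * s) - Q * (2 * s)))
    = (n + 1) * yz * (g1 * (P * (y1 - x1 * s)) + g2 * (P * (y2 - x2 * s)) + g3 * (P * (y3 - x3 * s)))
      - (n + 1) * (g1 * (p * ((n + 1) * Q * (y1 - x1 * s)) + (z1 - x1 * p) * (Q * s)) + g2 * (p * ((n + 1) * Q * (y2 - x2 * s)) + (z2 - x2 * p) * (Q * s)) + g3 * (p * ((n + 1) * Q * (y3 - x3 * s)) + (z3 - x3 * p) * (Q * s)))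
      + (n + 1) * (g1 * (x2 * (b * (P * (y3 - x3 * s)) + (c3 - x3 * b) * Q) - x3 * (b * (P * (y2 - x2 * s)) + (c2 - x2 * b) * Q))
         + g2 * (x3 * (b * (P * (y1 - x1 * s)) + (c1 - x1 * b) * Q) - x1 * (b * (P * (y3 - x3 * s)) + (c3 - x3 * b) * Q))
         + g3 * (x1 * (b * (P * (y2 - x2 * s)) + (c2 - x2 * b) * Q) - x2 * (b * (P * (y1 - x1 * s)) + (c1 - x1 * b) * Q)))"
    if xx: "x1 * x1 + x2 * x2 + x3 * x3 = 1" and xg: "x1 * g1 + x2 * g2 + x3 * g3 = 0" and s: "s = y1 * x1 + y2 * x2 + y3 * x3"
      and p: "p = z1 * x1 + z2 * x2 + z3 * x3" and yz: "yz = y1 * z1 + y2 * z2 + y3 * z3" and nQ: "n * Q = P * s"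
      and c: "c1 = y2 * z3 - y3 * z2" "c2 = y3 * z1 - y1 * z3" "c3 = y1 * z2 - y2 * z1" and b: "b = c1 * x1 + c2 * x2 + c3 * x3"
    for x1 x2 x3 y1 y2 y3 z1 z2 z3 g1 g2 g3 c1 c2 c3 b s p yz n P Q :: complex
  proof -
    define yg where "yg = y1 * g1 + y2 * g2 + y3 * g3"
    define zg where "zg = z1 * g1 + z2 * g2 + z3 * g3"
    define e where "e = g1 * (x2 * y3 - x3 * y2) + g2 * (x3 * y1 - x1 * y3) + g3 * (x1 * y2 - x2 * y1)"
    \<comment> \<open>b is the triple product of y, z, x and e that of g, x, y; their product is a
      Gram determinant, simplified by |x| = 1 and x\<bullet>g = 0.\<close>
    have gram: "b * e = (y1 * y1 + y2 * y2 + y3 * y3) * zg - yg * yz - s * (s * zg - yg * p)"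
      unfolding e_def zg_def yg_def b c using xx xg s p yz by algebra
    have cc: "g1 * (x2 * c3 - x3 * c2) + g2 * (x3 * c1 - x1 * c3) + g3 * (x1 * c2 - x2 * c1) = yg * p - zg * s"
      unfolding yg_def zg_def c p s by algebra
    have t1: "g1 * (P * (y1 - x1 * s)) + g2 * (P * (y2 - x2 * s)) + g3 * (P * (y3 - x3 * s)) = P * yg"
      unfolding yg_def using xg by algebra
    have t2: "g1 * (p * ((n + 1) * Q * (y1 - x1 * s)) + (z1 - x1 * p) * (Q * s)) + g2 * (p * ((n + 1) * Q * (y2 - x2 * s)) + (z2 - x2 * p) * (Q * s)) + g3 * (p * ((n + 1) * Q * (y3 - x3 * s)) + (z3 - x3 * p) * (Q * s))
      = p * (n + 1) * Q * yg + Q * s * zg"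
      unfolding yg_def zg_def using xg by algebra
    have t3: "g1 * (x2 * (b * (P * (y3 - x3 * s)) + (c3 - x3 * b) * Q) - x3 * (b * (P * (y2 - x2 * s)) + (c2 - x2 * b) * Q))
         + g2 * (x3 * (b * (P * (y1 - x1 * s)) + (c1 - x1 * b) * Q) - x1 * (b * (P * (y3 - x3 * s)) + (c3 - x3 * b) * Q))
         + g3 * (x1 * (b * (P * (y2 - x2 * s)) + (c2 - x2 * b) * Q) - x2 * (b * (P * (y1 - x1 * s)) + (c1 - x1 * b) * Q))
       = P * (b * e) + Q * (yg * p - zg * s)"
      unfolding cc[symmetric] e_def by algebra
    show ?thesis unfolding t1 t2 t3 gram zg_def[symmetric] using nQ by algebra
  qed
  have s: "dt y x = cx 1 y * cx 1 x + cx 2 y * cx 2 x + cx 3 y * cx 3 x" "dt z x = cx 1 z * cx 1 x + cx 2 z * cx 2 x + cx 3 z * cx 3 x"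
    "dt y z = cx 1 y * cx 1 z + cx 2 y * cx 2 z + cx 3 y * cx 3 z" by (simp_all add: dt_def)
  have cc: "cx 1 (crv y z) = cx 2 y * cx 3 z - cx 3 y * cx 2 z" "cx 2 (crv y z) = cx 3 y * cx 1 z - cx 1 y * cx 3 z"
    "cx 3 (crv y z) = cx 1 y * cx 2 z - cx 2 y * cx 1 z" by (simp_all add: crv_def vector_3)
  have b: "dt (crv y z) x = cx 1 (crv y z) * cx 1 x + cx 2 (crv y z) * cx 2 x + cx 3 (crv y z) * cx 3 x" by (simp add: dt_def)
  have sd: "complex_of_nat (Suc d) = of_nat d + 1" by simp
  show ?thesis
    unfolding lap sum_3 rot_simps T gS gS' phs sd
    by (rule core[OF unit3[OF x] G[unfolded sum_3] s PQ cc b])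
qed

text \<open>The Hodge-type identity makes each Cartesian component of G orthogonal to all Laplacians
  of test functions, hence constant. A tangential field with constant components vanishes.\<close>

lemma tangential_moments_zero:
  assumes G: "\<And>i. contS (G i)" and tan: "\<And>x. norm x = 1 ==> (cdot cx G x) = 0"
    and S: "\<And>y d. cinner G (gS y d) = 0" and L: "\<And>y d. cinner G (gL y d) = 0"
    and x: "norm x = 1"
  shows "G j x = 0"
proof -
  have pS: "(\<Sum>i\<in>UNIV. sI (%x. G i x * tg i (%x. dt z x * dt y x ^ d) x)) = 0" for y z d
  proof (rule polarize[of tg])
    show "tg i (%x. \<Sum>k\<le>Suc d. c k * (dt z x ^ k * dt y x ^ (Suc d - k))) x = (\<Sum>k\<le>Suc d. c k * tg i (%x. dt z x ^ k * dt y x ^ (Suc d - k)) x)" for i x c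
      by (rule tg_pol_sum)
  qed (use S in \<open>auto intro!: C1_tg_cont C1_on_pol G simp: tg_ph\<close>)
  have crot: "continuous_on A (rot i f)" if "C1_on f UNIV" for A i f
    unfolding rot_def[abs_def] using exhaust_3[of i]
    by (elim disjE) (simp_all, (intro continuous_on_diff continuous_on_mult C1_tg_cont that continuous_intros)+)
  have pL: "(\<Sum>i\<in>UNIV. sI (%x. G i x * rot i (%x. dt z x * dt y x ^ d) x)) = 0" for y z d
  proof (rule polarize[of rot])
    show "rot i (%x. \<Sum>k\<le>Suc d. c k * (dt z x ^ k * dt y x ^ (Suc d - k))) x = (\<Sum>k\<le>Suc d. c k * rot i (%x. dt z x ^ k * dt y x ^ (Suc d - k)) x)" for i x c
      by (rule rot_pol_sum)
  qed (use L in \<open>auto intro!: crot C1_on_pol G simp: rot_ph\<close>)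
  \<comment> \<open>The fixed vector z is the j-th unit vector, which selects the component G_j;
    each term on the right integrates to 0, directly or by polarization.\<close>
  have I: "sI (%x. G j x * lap y (Suc d) x) = 0" for j y d
  proof -
    define z :: "real^3" where "z = axis j 1"
    have z: "(\<Sum>i\<in>UNIV. cx i z * g i) = g j" for g
      by (simp add: z_def axis_def if_distrib[of "%a. a * _"] if_distrib[of complex_of_real] cong: if_cong)
    have C1: "C1_on (%x. dt z x * dt y x ^ d) UNIV" for z d using C1_on_pol[of z 1 y d UNIV] by simp
    define V1 where "V1 i x = G i x * gS y d i x" for i x
    define V2 where "V2 i x = G i x * tg i (%x. dt z x * dt y x ^ Suc d) x" for i x
    define V3 where "V3 i x = G i x * rot i (%x. dt (crv y z) x * dt y x ^ d) x" for i x
    have c: "contS (V1 i)" "contS (V2 i)" "contS (V3 i)" for i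
      unfolding V1_def[abs_def] V2_def[abs_def] V3_def[abs_def]
      by (intro continuous_on_mult G test_cont C1_tg_cont crot C1)+
    have s: "sI (%x. \<Sum>i\<in>UNIV. V1 i x) = 0" "sI (%x. \<Sum>i\<in>UNIV. V2 i x) = 0" "sI (%x. \<Sum>i\<in>UNIV. V3 i x) = 0"
      using S[of y d] pS[of z y "Suc d"] pL[of "crv y z" y d] unfolding V1_def[symmetric] V2_def[symmetric] V3_def[symmetric]
      by (simp_all add: sI_sum c)
    have "sI (%x. G j x * lap y (Suc d) x) = sI (%x. of_nat (Suc d) * dt y z * (\<Sum>i\<in>UNIV. V1 i x)
        - of_nat (Suc d) * (\<Sum>i\<in>UNIV. V2 i x) + of_nat (Suc d) * (\<Sum>i\<in>UNIV. V3 i x))"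
    proof (rule sI_cong)
      fix x :: "real^3" assume x: "norm x = 1"
      from hodge_identity[OF x tan[OF x], of z y d]
      show "G j x * lap y (Suc d) x = of_nat (Suc d) * dt y z * (\<Sum>i\<in>UNIV. V1 i x)
        - of_nat (Suc d) * (\<Sum>i\<in>UNIV. V2 i x) + of_nat (Suc d) * (\<Sum>i\<in>UNIV. V3 i x)"
        unfolding z V1_def V2_def V3_def .
    qed
    also have "\<dots> = of_nat (Suc d) * dt y z * sI (%x. \<Sum>i\<in>UNIV. V1 i x)
        - of_nat (Suc d) * sI (%x. \<Sum>i\<in>UNIV. V2 i x) + of_nat (Suc d) * sI (%x. \<Sum>i\<in>UNIV. V3 i x)"
      by (subst sI_add, (intro continuous_on_diff continuous_on_mult continuous_on_const continuous_on_sum c)+,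
          subst sI_diff, (intro continuous_on_diff continuous_on_mult continuous_on_const continuous_on_sum c)+)
         (simp only: sI_cmult)
    also have "\<dots> = 0" unfolding s by simp
    finally show ?thesis .
  qed
  have lapsI: "sI (%x. h x * lap y d x) = lc y d (%e. sI (%x. h x * ph y e x))" if h: "contS h" for h y d
    using mom_lap[of h 1 y d] h by (simp add: conts_def mom_def)
  have one: "sI (%x. 1 * lap y d x) = 0" for y d
  proof -
    have "sI (%x. \<Sum>i\<in>UNIV. tg i (%x. 1) x * gS y d i x) = - sI (%x. 1 * (\<Sum>i\<in>UNIV. tg i (gS y d i) x))"
      by (rule sI_tangential_ibp) (simp_all add: C1_on_const C1_on_test x_dot_gS)
    moreover have "sI (%x. 1 * (\<Sum>i\<in>UNIV. tg i (gS y d i) x)) = sI (%x. 1 * lap y d x)"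
      by (rule sI_cong) (simp only: div_gS)
    ultimately show ?thesis by simp
  qed
  have s1: "sI (%x. 1) \<noteq> 0"
    using sI_nonneg_eq_0D[of "%x. 1" x] x by auto
  \<comment> \<open>Subtracting the mean handles degree 0; for larger degrees
    \<open>lc_lower\<close> divides by d(d+1), and completeness then gives that the difference is
    0.\<close>
  have const: "\<exists>c. \<forall>x. norm x = 1 \<longrightarrow> G j x = c" for j
  proof -
    define c where "c = sI (G j) / sI (%x. 1)"
    define h where "h x = G j x - c" for x
    have ch: "contS h" unfolding h_def[abs_def] by (intro continuous_on_diff G continuous_on_const)
    have "sI (%x. h x * ph y d x) = 0" for y d
    proof (induction d rule: less_induct)
      case (less d)
      show ?case
      proof (cases d)
        case 0
        have "sI (%x. h x * ph y 0 x) = sI (G j) - sI (%x. c * 1)"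
          unfolding h_def ph_def by (subst sI_diff[symmetric]) (auto intro: G)
        also have "\<dots> = 0" using s1 by (simp only: sI_cmult) (simp add: c_def)
        finally show ?thesis using 0 by simp
      next
        case (Suc e)
        have c1: "contS (%x. G j x * lap y (Suc e) x)" "contS (%x. c * (1 * lap y (Suc e) x))"
          by (intro continuous_on_mult continuous_on_const G test_cont)+
        have "sI (%x. h x * lap y (Suc e) x) = sI (%x. G j x * lap y (Suc e) x - c * (1 * lap y (Suc e) x))"
          by (rule sI_cong) (simp add: h_def algebra_simps)
        also have "\<dots> = 0" unfolding sI_diff[OF c1] sI_cmult I using one[of y "Suc e"] by simp
        finally have "lc y d (%e. sI (%x. h x * ph y e x)) = 0" unfolding lapsI[OF ch] Suc .
        moreover have "lc y d (%e. sI (%x. h x * ph y e x)) = - of_nat (d * (d + 1)) * sI (%x. h x * ph y d x)"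
          by (rule lc_lower) (use less.IH in simp)
        ultimately show ?thesis using Suc by (simp del: of_nat_mult of_nat_add of_nat_Suc)
      qed
    qed
    from sphere_complete[OF ch this] show ?thesis by (intro exI[of _ c]) (simp add: h_def)
  qed
  then obtain c where c: "\<And>j x. norm x = 1 ==> G j x = c j" by metis
  \<comment> \<open>At the point x = e_j tangency says that the j-th component is 0.\<close>
  have n1: "norm (axis j 1 :: real^3) = 1" by simp
  have "c j = 0"
    using tan[OF n1] unfolding c[OF n1]
    by (simp add: axis_def if_distrib[of "%a. a * _"] if_distrib[of complex_of_real] cong: if_cong)
  thus ?thesis using c[OF x] by simp
qed

text \<open>The \<open>gX\<close> moments are the scalar moments of the radial component, which
  therefore vanishes by \<open>sphere_complete\<close>; what is left is a tangential field.\<close>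

lemma moments_determine:
  assumes G: "\<And>i. contS (G i)"
    and X: "\<And>y d. cinner G (gX y d) = 0"
    and S: "\<And>y d. cinner G (gS y d) = 0" and L: "\<And>y d. cinner G (gL y d) = 0"
    and x: "norm x = 1"
  shows "G j x = 0"
proof (rule tangential_moments_zero[OF G _ S L x])
  fix x :: "real^3" assume x: "norm x = 1"
  show "cdot cx G x = 0"
  proof (rule sphere_complete[OF _ _ x])
    show "contS (cdot cx G)"
      by (intro continuous_on_sum continuous_on_mult G continuous_intros)
    fix y d
    have "sI (%x. (cdot cx G x) * ph y d x) = sI (cdot G (gX y d))"
      by (rule sI_cong) (simp add: gX_def sum_distrib_right sum_distrib_left mult_ac)
    also have "\<dots> = cinner G (gX y d)"
      by (rule sI_sum) (auto intro!: continuous_on_mult G test_cont)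
    finally show "sI (%x. (cdot cx G x) * ph y d x) = 0" by (simp add: X)
  qed
qed

section \<open>Energy localization\<close>

context
  fixes n :: nat and \<delta> k k' :: real
  assumes n2: "n \<ge> 2" and d: "0 < \<delta>" "\<delta> < 1" and kk: "0 < k'" "k' < k" "k \<le> 1"
begin

text \<open>A linear system for a and b. The determinant (\<alpha> + 2) H - H' is nonzero because
  \<alpha> is real while H'/H is not, by the positive Wronskian. That b is nonzero uses k' < k and
  \<delta> < 1; that a is nonzero uses that j_n is real and the Hankel function is not.\<close>

lemma matching_coefficients:
  obtains a b :: complex where "a \<noteq> 0" "b \<noteq> 0" "a * of_real (Zj n k' 1) = of_real (Zj n k 1) + b * Zh n k 1"
    "a * of_real (Zj' n k' 1) - 2 * (a * of_real (Zj n k' 1))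
        = of_real \<delta> * ((of_real (Zj' n k 1) + b * Zh' n k 1) - 2 * (of_real (Zj n k 1) + b * Zh n k 1))"
proof -
  define J J' Jt Jt' where "J = Zj n k 1" "J' = Zj' n k 1" "Jt = Zj n k' 1" "Jt' = Zj' n k' 1"
  note Jdef = this
  define H H' where "H = Zh n k 1" "H' = Zh' n k 1"
  note Hdef = this
  have pos: "J > 0" "Jt > 0" unfolding Jdef using kk by (auto intro!: Zj_pos)
  have tp: "Jt' > 2 * Jt" unfolding Jdef using Zj_traction_pos[OF n2, of k'] kk by simp
  have st: "Jt * J' < Jt' * J" unfolding Jdef using Zj_sturm[of n k' k] n2 kk by simp
  have wr: "Im (cnj H * H') > 0" unfolding Hdef using Zh_wronskian_pos[of k n] kk by simp
  \<comment> \<open>Eliminating a, the interior prescribes the quotient \<alpha> of A' - 2 A and A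
    at r = 1 for the exterior total profile A.\<close>
  define \<alpha> where "\<alpha> = (Jt' - 2 * Jt) / (\<delta> * Jt)"
  have al: "\<delta> * (\<alpha> * Jt) = Jt' - 2 * Jt" unfolding \<alpha>_def using pos d by simp
  \<comment> \<open>This is where \<delta> < 1 enters, through the positivity of the interior
    traction; the strict inequality that follows is the Sturm comparison.\<close>
  have "J * (Jt' - 2 * Jt) / Jt \<le> \<alpha> * J"
  proof -
    have "(Jt' - 2 * Jt) / Jt \<le> \<alpha>"
      unfolding \<alpha>_def using pos d tp by (intro divide_left_mono) auto
    thus ?thesis using pos mult_left_mono[of "(Jt' - 2 * Jt) / Jt" \<alpha> J] by (simp add: mult.commute)
  qed
  moreover have "J' - 2 * J < J * (Jt' - 2 * Jt) / Jt"
    unfolding pos_less_divide_eq[OF pos(2)] using st by (simp add: algebra_simps)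
  ultimately have num: "J' - 2 * J - \<alpha> * J < 0" by linarith
  have D0: "of_real (\<alpha> + 2) * H - H' \<noteq> 0"
  proof
    assume "of_real (\<alpha> + 2) * H - H' = 0"
    hence "H' = of_real (\<alpha> + 2) * H" by simp
    hence "cnj H * H' = of_real (\<alpha> + 2) * (H * cnj H)" by simp
    also have "H * cnj H = of_real ((cmod H)\<^sup>2)" by (rule complex_norm_square[symmetric])
    finally show False using wr by (simp only: of_real_mult[symmetric] Im_complex_of_real)
  qed
  define b where "b = of_real (J' - 2 * J - \<alpha> * J) / (of_real (\<alpha> + 2) * H - H')"
  define a where "a = (of_real J + b * H) / of_real Jt"
  have b0: "b \<noteq> 0" unfolding b_def using num D0 by (simp only: divide_eq_0_iff of_real_eq_0_iff) simp
  have b1: "b * (of_real (\<alpha> + 2) * H - H') = of_real (J' - 2 * J - \<alpha> * J)" unfolding b_def using D0 by simp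
  have a1: "a * of_real Jt = of_real J + b * H" unfolding a_def using pos by simp
  have tr: "of_real \<alpha> * (of_real J + b * H) = (of_real J' + b * H') - 2 * (of_real J + b * H)"
    using b1 by (simp add: algebra_simps)
  have m2: "a * of_real Jt' - 2 * (a * of_real Jt) = of_real \<delta> * ((of_real J' + b * H') - 2 * (of_real J + b * H))"
  proof -
    have "a * of_real Jt' - 2 * (a * of_real Jt) = a * of_real (Jt' - 2 * Jt)" by (simp add: algebra_simps)
    also have "\<dots> = of_real \<delta> * (of_real \<alpha> * (a * of_real Jt))" unfolding al[symmetric] by simp
    finally show ?thesis unfolding a1 tr .
  qed
  \<comment> \<open>For a = 0 both b H and b H' would be real, contradicting the positive imaginary
    part of the Wronskian.\<close>
  have a0: "a \<noteq> 0"
  proof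
    assume "a = 0"
    hence 1: "b * H = - of_real J" using a1 by (simp add: eq_neg_iff_add_eq_0 add.commute)
    hence 2: "b * H' = - of_real J'" using tr by (simp add: eq_neg_iff_add_eq_0 add.commute)
    have "of_real ((cmod b)\<^sup>2) * (cnj H * H') = cnj (b * H) * (b * H')"
      unfolding complex_norm_square by (simp add: mult_ac)
    also have "\<dots> = of_real (J * J')" unfolding 1 2 by simp
    finally have "Im (of_real ((cmod b)\<^sup>2) * (cnj H * H')) = 0" by (simp only: Im_complex_of_real)
    hence "(cmod b)\<^sup>2 * Im (cnj H * H') = 0" by (simp only: times_complex.sel Im_complex_of_real Re_complex_of_real)
    thus False using wr b0 by simp
  qed
  show ?thesis by (rule that[OF a0 b0]) (use a1 m2 in \<open>simp_all add: Jdef Hdef\<close>)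
qed

end

section \<open>The solution coincides with the candidates\<close>

context scattering
begin

text \<open>On the sphere of radius r, the field minus the candidate has vanishing moments against
  all three test families.\<close>

lemma field_determined:
  assumes c: "\<And>i. conts (cmp u i) r" and r: "r > 0"
    and m: "\<And>y d. mU u y d r = 0" "\<And>y d. mD u y d r = 0" "\<And>y d. Zw u y d r = A * Nm f n y d"
    and x: "norm x = 1"
  shows "u (r *\<^sub>R x) $ i = A / of_real r * Tc f n i x"
proof -
  let ?c = "A / of_real r"
  define G where "G i x = u (r *\<^sub>R x) $ i - ?c * Tc f n i x" for i x
  have cT: "contS (Tc f n i)" for i by (rule C1_cont[OF C1_on_Tc])
  have cu: "contS (%x. u (r *\<^sub>R x) $ i)" for i using c by (simp add: conts_def)
  have cG: "contS (G i)" for i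
    unfolding G_def[abs_def] by (intro continuous_on_diff continuous_on_mult continuous_on_const cu cT)
  have E: "cinner G V = vm u V r - ?c * sI (cdot (Tc f n) V)"
    if V: "\<And>i. contS (V i)" for V
  proof -
    have "sI (%x. G i x * V i x) = mom (cmp u i) (V i) r - ?c * sI (%x. Tc f n i x * V i x)" for i
      unfolding G_def left_diff_distrib mom_def sI_cmult[symmetric] mult.assoc
      by (rule sI_diff) (intro continuous_on_mult continuous_on_const cu cT V)+
    thus ?thesis
      unfolding vm_def by (subst sI_sum) (auto intro!: continuous_on_mult cT V simp: sum_subtractf sum_distrib_left)
  qed
  have "G i x = 0"
  proof (rule moments_determine[OF cG _ _ _ x])
    fix y d
    show "cinner G (gX y d) = 0"
      using m(1)[of y d] by (simp add: E[OF test_cont(2)] Tc_moments mU_def)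
    show "cinner G (gS y d) = 0"
      using m(2)[of y d] by (simp add: E[OF test_cont(3)] Tc_moments mD_def)
    have "mX u y d r = ?c * Nm f n y d" using m(3)[of y d] r by (simp add: Zw_def field_simps)
    thus "cinner G (gL y d) = 0"
      by (simp add: E[OF test_cont(4)] Tc_moments mX_def eq_neg_iff_add_eq_0 add.commute minus_equation_iff[of "vm _ _ _"])
  qed
  thus ?thesis by (simp add: G_def)
qed

lemma u_interior:
  assumes "0 < norm x" "norm x < 1"
  shows "u x $ i = a * of_real (Zj n k' (norm x) / norm x) * Tc f n i (sgn x)"
proof -
  have r: "norm x \<in> Tin" using assms by auto
  have "u (norm x *\<^sub>R sgn x) $ i = A1 (norm x) / of_real (norm x) * Tc f n i (sgn x)"
    by (rule field_determined) (use conts_C1(1)[OF interior_shell r C2_on_C1[OF u2n(1)]] moments assms in \<open>auto simp: norm_sgn\<close>)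
  thus ?thesis using assms by (simp add: A1_def sgn_div_norm)
qed

lemma us_exterior:
  assumes "norm x > 1"
  shows "us x $ i = b * Zh n k (norm x) / of_real (norm x) * Tc f n i (sgn x)"
proof -
  have r: "norm x \<in> Tex" using assms by auto
  have "u (norm x *\<^sub>R sgn x) $ i = A2 (norm x) / of_real (norm x) * Tc f n i (sgn x)"
    by (rule field_determined) (use conts_C1(1)[OF exterior_shell r C2_on_C1[OF u2n(2)]] moments assms in \<open>auto simp: norm_sgn\<close>)
  moreover have "x \<noteq> 0" using assms by auto
  hence "norm x *\<^sub>R sgn x = x" by (simp add: sgn_div_norm)
  moreover have "us x $ i = u x $ i - ui x $ i" by (rule us_eq) (use assms in auto)
  moreover have "ui x $ i = of_real (Zj n k (norm x) / norm x) * Tc f n i (sgn x)"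
    using assms by (subst incident_field_nth) (auto simp: Zj_def)
  ultimately show ?thesis by (simp add: A2_def add_divide_distrib algebra_simps)
qed

end

section \<open>Energies and scaling\<close>

definition energy :: "(real^3 => real) => (real^3) set => ennreal" where
  "energy w S = (\<integral>\<^sup>+x. ennreal (w x) * indicator S x \<partial>lborel)"

text \<open>The substitution x -> c x with Jacobian c^3. Energies take values in the extended
  nonnegative reals, so that finiteness is a separate matter, and the almost-everywhere comparison
  allows bounding spheres to be ignored.\<close>

lemma energy_scale:
  assumes w: "w \<in> borel_measurable borel" and S: "S \<in> sets borel" "S' \<in> sets borel" and c: "c > 0" and q: "q \<ge> 0"
    and le: "AE x in lborel. c *\<^sub>R x \<in> S \<longrightarrow> x \<in> S' \<and> w (c *\<^sub>R x) \<le> q * w x"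
  shows "energy w S \<le> ennreal (c ^ 3 * q) * energy w S'"
proof -
  have lb: "lborel = density (distr lborel borel (%x::real^3. 0 + c *\<^sub>R x)) (%_. \<bar>c\<bar> ^ DIM(real^3))"
    by (rule lborel_affine) (use c in simp)
  have sc: "(%x::real^3. 0 + c *\<^sub>R x) \<in> borel_measurable borel" by measurable
  note [measurable] = w S
  have "energy w S = (\<integral>\<^sup>+x. ennreal (c ^ 3) * (ennreal (w (c *\<^sub>R x)) * indicator S (c *\<^sub>R x)) \<partial>lborel)"
    unfolding energy_def using c
    by (subst lb, subst nn_integral_density, simp, simp, subst nn_integral_distr) (simp_all add: ennreal_power)
  also have "\<dots> \<le> (\<integral>\<^sup>+x. ennreal (c ^ 3 * q) * (ennreal (w x) * indicator S' x) \<partial>lborel)"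
  proof (rule nn_integral_mono_AE)
    show "AE x in lborel. ennreal (c ^ 3) * (ennreal (w (c *\<^sub>R x)) * indicator S (c *\<^sub>R x)) \<le> ennreal (c ^ 3 * q) * (ennreal (w x) * indicator S' x)"
      using le
    proof eventually_elim
      fix x assume h: "c *\<^sub>R x \<in> S \<longrightarrow> x \<in> S' \<and> w (c *\<^sub>R x) \<le> q * w x"
      have "ennreal (c ^ 3) * ennreal (w (c *\<^sub>R x)) \<le> ennreal (c ^ 3) * (ennreal q * ennreal (w x))" if "w (c *\<^sub>R x) \<le> q * w x"
        using that q by (intro mult_left_mono) (auto simp: ennreal_leI simp flip: ennreal_mult')
      thus "ennreal (c ^ 3) * (ennreal (w (c *\<^sub>R x)) * indicator S (c *\<^sub>R x)) \<le> ennreal (c ^ 3 * q) * (ennreal (w x) * indicator S' x)"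
        using h c q by (auto split: split_indicator simp: ennreal_mult' mult.assoc)
    qed
  qed
  also have "\<dots> = ennreal (c ^ 3 * q) * energy w S'"
    unfolding energy_def by (rule nn_integral_cmult) measurable
  finally show ?thesis .
qed

lemma energy_finite:
  assumes "\<And>x. x \<in> S ==> w x \<le> B" "S \<in> sets borel" "bounded S"
  shows "energy w S < \<infinity>"
proof -
  have "energy w S \<le> (\<integral>\<^sup>+x. ennreal B * indicator S x \<partial>lborel)"
    unfolding energy_def using assms(1) by (intro nn_integral_mono) (auto split: split_indicator intro: ennreal_leI)
  also have "\<dots> = ennreal B * emeasure lborel S" using assms(2) by (simp add: nn_integral_cmult_indicator)
  also have "\<dots> < \<infinity>" using emeasure_bounded_finite[OF assms(3)] by (simp add: ennreal_mult_less_top)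
  finally show ?thesis .
qed

text \<open>A continuous density that is positive at a point is positive on a nonempty open set, and
  such a set is not null.\<close>

lemma energy_nonzero:
  assumes w: "w \<in> borel_measurable borel" and U: "open U" "U \<subseteq> S" "S \<in> sets borel" "continuous_on U w" and x: "x \<in> U" "w x > 0"
  shows "energy w S \<noteq> 0"
proof
  assume "energy w S = 0"
  note [measurable] = w U(3)
  have "AE x in lborel. ennreal (w x) * indicator S x = 0"
    using \<open>energy w S = 0\<close> unfolding energy_def by (subst (asm) nn_integral_0_iff_AE) auto
  hence AE: "AE x in lborel. x \<notin> {x\<in>U. w x > 0}"
    by eventually_elim (use U(2) in \<open>auto split: split_indicator_asm simp: ennreal_eq_0_iff\<close>)
  have o: "open {x\<in>U. w x > 0}"
    using continuous_openin_preimage_gen[OF U(4), of "{0<..}"] U(1)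
    by (simp add: openin_open_eq vimage_def Int_def conj_commute cong: conj_cong)
  have "{x\<in>U. w x > 0} \<in> null_sets lborel"
    by (subst AE_iff_null_sets) (use AE o in \<open>simp_all add: borel_open\<close>)
  hence "negligible {x\<in>U. w x > 0}"
    by (simp add: negligible_iff_null_sets null_sets_completionI)
  thus False using open_not_negligible[OF o] x by auto
qed

lemma AE_norm_neq: "AE x in lborel. norm (x::real^3) \<noteq> r"
proof -
  have "negligible (sphere (0::real^3) r)" by (rule negligible_sphere)
  hence "AE x in lebesgue. x \<notin> sphere (0::real^3) r"
    unfolding negligible_iff_null_sets by (rule AE_not_in)
  hence "AE x in lborel. x \<notin> sphere (0::real^3) r" by (simp add: AE_completion_iff)
  thus ?thesis by eventually_elim simp
qed

text \<open>The field is replaced by a Borel density on the whole space that agrees with |v|^2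
  almost everywhere on \<open>S\<close>; off \<open>S\<close> no information about v is
  available.\<close>

lemma L2_energy:
  assumes w: "w \<in> borel_measurable borel" "\<And>x. w x \<ge> 0" and S: "S \<in> sets borel"
    and eq: "AE x in lborel. x \<in> S \<longrightarrow> (norm (v x))\<^sup>2 = w x" and v: "(%x. indicator S x *\<^sub>R (norm (v x))\<^sup>2) \<in> borel_measurable lborel"
  shows "L2_norm_sq v S = enn2real (energy w S)"
proof -
  note [measurable] = w(1) S
  have "L2_norm_sq v S = (\<integral>x. indicator S x *\<^sub>R w x \<partial>lborel)"
    unfolding L2_norm_sq_def set_lebesgue_integral_def
    by (rule integral_cong_AE[OF v]) (use eq in \<open>auto split: split_indicator\<close>)
  also have "\<dots> = enn2real (\<integral>\<^sup>+x. ennreal (indicator S x *\<^sub>R w x) \<partial>lborel)"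
    by (rule integral_eq_nn_integral) (use w in auto)
  also have "(\<integral>\<^sup>+x. ennreal (indicator S x *\<^sub>R w x) \<partial>lborel) = energy w S"
    unfolding energy_def by (rule nn_integral_cong) (auto split: split_indicator)
  finally show ?thesis .
qed

lemma L2_ratio:
  assumes "L2_norm_sq v S = enn2real (energy w S)" "L2_norm_sq v S' = enn2real (energy w S')"
    and le: "energy w S \<le> ennreal C * energy w S'" and fin: "energy w S' < \<infinity>" "energy w S' \<noteq> 0" and C: "C \<ge> 0"
  shows "L2_norm_sq v S' \<noteq> 0 \<and> L2_norm_sq v S / L2_norm_sq v S' \<le> C"
proof -
  have p: "enn2real (energy w S') > 0" using fin by (simp add: enn2real_positive_iff zero_less_iff_neq_zero)
  have "enn2real (energy w S) \<le> enn2real (ennreal C * energy w S')"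
    using fin by (intro enn2real_mono le) (simp add: ennreal_mult_less_top)
  also have "\<dots> = C * enn2real (energy w S')" using C by (simp add: enn2real_mult)
  finally show ?thesis using p unfolding assms(1,2) by (simp add: pos_divide_le_eq)
qed

definition tauT :: "(int => complex) => nat => real^3 => real" where
  "tauT f n x = (\<Sum>i\<in>UNIV. (cmod (Tc f n i x))\<^sup>2)"

lemma continuous_on_tauT: "continuous_on A (tauT f n)"
  unfolding tauT_def[abs_def] by (intro continuous_intros C1_cont[OF C1_on_Tc])

lemma tauT_nonneg: "tauT f n x \<ge> 0"
  unfolding tauT_def by (intro sum_nonneg) auto

lemma borel_measurable_sgn3 [measurable]: "(sgn :: real^3 => real^3) \<in> borel_measurable borel"
  unfolding sgn_div_norm[abs_def] by measurable

lemma borel_measurable_tauT_sgn [measurable]: "(%x. tauT f n (sgn x)) \<in> borel_measurable borel"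
  by (rule measurable_compose[OF borel_measurable_sgn3 borel_measurable_continuous_onI[OF continuous_on_tauT]])

lemma norm_vec_squared: "(norm (v :: complex^3))\<^sup>2 = (\<Sum>i\<in>UNIV. (cmod (v $ i))\<^sup>2)"
  by (simp add: norm_vec_def L2_set_def sum_nonneg)

lemma tauT_bounded: obtains M where "M > 0" "\<And>x. tauT f n (sgn x) \<le> M"
proof -
  have "bounded (tauT f n ` cball 0 1)"
    by (intro compact_imp_bounded compact_continuous_image continuous_on_tauT) simp
  then obtain M where M: "M > 0" "\<forall>x\<in>cball 0 1. norm (tauT f n x) \<le> M" unfolding bounded_pos by auto
  show ?thesis
  proof (rule that[OF M(1)])
    fix x :: "real^3"
    have "sgn x \<in> cball 0 1" by (simp add: norm_sgn)
    with M(2) show "tauT f n (sgn x) \<le> M" by fastforce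
  qed
qed

lemma measurable_norm_squared:
  fixes v :: "vfield"
  assumes "\<And>i. continuous_on U (cmp v i)" "S \<subseteq> U" "S \<in> sets borel"
  shows "(%x. indicator S x *\<^sub>R (norm (v x))\<^sup>2) \<in> borel_measurable lborel"
proof -
  have "continuous_on S (%x. (norm (v x))\<^sup>2)"
    unfolding norm_vec_squared by (intro continuous_intros continuous_on_subset[OF assms(1,2)])
  from borel_measurable_continuous_on_indicator[OF assms(3) this] show ?thesis
    by (subst measurable_cong_sets[OF sets_lborel refl])
qed

lemma sgn_scale: "c > 0 ==> sgn (c *\<^sub>R x) = sgn (x :: real^3)"
  by (simp add: sgn_scaleR)

text \<open>The radial projection of x is a point of the sphere at exactly this distance. Points of
  the ball beyond the inner layer thus have norm at most \<gamma>, and exterior points beyond the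
  outer layer at least \<gamma>.\<close>

lemma infdist_sphere_le: "x \<noteq> 0 ==> infdist x (sphere 0 1) \<le> \<bar>norm x - 1\<bar>" for x :: "real^3"
proof -
  assume x: "x \<noteq> 0"
  have "infdist x (sphere 0 1) \<le> dist x (sgn x)" by (rule infdist_le) (simp add: norm_sgn x)
  also have "x - sgn x = (norm x - 1) *\<^sub>R sgn x" using x by (simp add: sgn_div_norm algebra_simps)
  hence "dist x (sgn x) = \<bar>norm x - 1\<bar>" by (simp add: dist_norm norm_sgn x)
  finally show ?thesis .
qed

lemma measurable_infdist_set: "A \<in> sets borel ==> {x\<in>A. infdist x B < c} \<in> sets borel" for A B :: "(real^3) set"
proof -
  assume A [measurable]: "A \<in> sets borel"
  have [measurable]: "(%x. infdist x B) \<in> borel_measurable borel"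
    by (intro borel_measurable_continuous_onI continuous_on_infdist continuous_on_id)
  show ?thesis by measurable
qed

section \<open>Localization of the interior and the scattered field\<close>

context scattering
begin

text \<open>\<open>w1\<close> and \<open>w2\<close> are the explicit densities of |u|^2 and |us|^2,
  defined and measurable on the whole space although they describe the fields in one region
  each.\<close>

definition w1 :: "real^3 => real" where
  "w1 x = (cmod a)\<^sup>2 * (Zj n k' (norm x) / norm x)\<^sup>2 * tauT f n (sgn x)"

definition w2 :: "real^3 => real" where
  "w2 x = (cmod b)\<^sup>2 * (cmod (Zh n k (norm x)) / norm x)\<^sup>2 * tauT f n (sgn x)"

lemma w_nonneg: "w1 x \<ge> 0" "w2 x \<ge> 0"
  unfolding w1_def w2_def by (simp_all add: tauT_nonneg)

lemma continuous_on_Zj: "continuous_on A (Zj n \<kappa>)"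
  by (intro continuous_at_imp_continuous_on ballI DERIV_isCont[OF Zj_deriv(1)[OF pos(8)]])

lemma w_measurable: "w1 \<in> borel_measurable borel" "w2 \<in> borel_measurable borel"
proof -
  have [measurable]: "Zj n k' \<in> borel_measurable borel"
    by (intro borel_measurable_continuous_onI continuous_on_Zj)
  have [measurable]: "(%r. cis (k * r)) \<in> borel_measurable borel"
    by (intro borel_measurable_continuous_onI continuous_intros)
  have [measurable]: "(%r. complex_of_real (1 / r)) \<in> borel_measurable borel" by measurable
  have [measurable]: "Zh n k \<in> borel_measurable borel"
    unfolding Zh_def[abs_def] hw_def by measurable
  show "w1 \<in> borel_measurable borel" unfolding w1_def[abs_def] by measurable
  show "w2 \<in> borel_measurable borel" unfolding w2_def[abs_def] by measurable
qed

lemma u_norm: "0 < norm x ==> norm x < 1 ==> (norm (u x))\<^sup>2 = w1 x"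
  by (simp add: norm_vec_squared u_interior w1_def tauT_def norm_mult power_mult_distrib power_divide sum_distrib_left mult.assoc del: of_real_divide)

lemma us_norm: "norm x > 1 ==> (norm (us x))\<^sup>2 = w2 x"
  unfolding norm_vec_squared us_exterior w2_def tauT_def norm_mult norm_divide norm_of_real power_mult_distrib sum_distrib_left
  by (simp add: power_divide power_mult_distrib)

lemma w1_bounded: obtains B where "\<And>x. x \<in> BI ==> w1 x \<le> B"
proof -
  obtain M where M: "M > 0" "\<And>x. tauT f n (sgn x) \<le> M" by (rule tauT_bounded) blast
  have "isCont (bF n) s" for s using bF_deriv(1) DERIV_isCont by blast
  hence "continuous_on UNIV (bF n)" by (intro continuous_at_imp_continuous_on ballI)
  hence "continuous_on {0..1} (%r. bF n ((k' * r)\<^sup>2))"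
    by (rule continuous_on_compose2) (auto intro!: continuous_intros)
  hence "continuous_on {0..1} (%r. spherical_bessel_j n (k' * r))"
    unfolding spherical_bessel_j_eq by (intro continuous_intros)
  hence "bounded ((%r. spherical_bessel_j n (k' * r)) ` {0..1})"
    by (intro compact_imp_bounded compact_continuous_image) simp_all
  then obtain K where K: "K > 0" "\<forall>r\<in>{0..1}. \<bar>spherical_bessel_j n (k' * r)\<bar> \<le> K" unfolding bounded_pos by auto
  show ?thesis
  proof (rule that[of "(cmod a)\<^sup>2 * K\<^sup>2 * M"])
    fix x assume x: "x \<in> BI"
    have "\<bar>Zj n k' (norm x) / norm x\<bar> \<le> K" using K x by (auto simp: Zj_def)
    hence "(Zj n k' (norm x) / norm x)\<^sup>2 \<le> K\<^sup>2" using K(1) by (simp add: abs_le_square_iff[symmetric])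
    thus "w1 x \<le> (cmod a)\<^sup>2 * K\<^sup>2 * M"
      unfolding w1_def by (intro mult_mono M) (auto simp: tauT_nonneg)
  qed
qed

lemma continuous_on_w2: "continuous_on (- {0}) w2"
proof -
  have "continuous_on {0<..} (Zh n k)"
    by (intro continuous_at_imp_continuous_on ballI has_vector_derivative_continuous[OF Zh_deriv(1)]) (use kpos in auto)
  hence "continuous_on (- {0}) (%x::real^3. Zh n k (norm x))"
    by (rule continuous_on_compose2) (auto intro!: continuous_intros)
  thus ?thesis
    unfolding w2_def[abs_def]
    by (intro continuous_intros continuous_on_compose2[OF continuous_on_tauT[of UNIV]]) auto
qed

lemma w2_bounded: obtains B where "\<And>x. x \<in> ball 0 R - cball 0 1 ==> w2 x \<le> B"
proof -
  have "compact (cball (0::real^3) R - ball 0 1)" by (intro compact_diff) auto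
  moreover have "continuous_on (cball (0::real^3) R - ball 0 1) w2"
    by (rule continuous_on_subset[OF continuous_on_w2]) auto
  ultimately have "bounded (w2 ` (cball (0::real^3) R - ball 0 1))"
    by (intro compact_imp_bounded compact_continuous_image)
  then obtain B where "\<forall>x\<in>cball (0::real^3) R - ball 0 1. \<bar>w2 x\<bar> \<le> B" unfolding bounded_pos by auto
  thus ?thesis by (intro that[of B]) (rule order_trans[OF abs_ge_self], auto)
qed

text \<open>Passing from x to \<gamma> x, the profile j_n yields \<gamma>^n, of which one power is
  spent through \<open>gk\<close> on the correction factors. Squaring and the Jacobian give 2(n - 1)
  + 3 = 2n + 1.\<close>

lemma inner_localization:
  assumes f0: "\<exists>m\<in>{- int n..int n}. f m \<noteq> 0" and a: "a \<noteq> 0" and g: "0 < \<gamma>" "\<gamma> < 1"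
    and k1: "k' \<le> 1" and gk: "\<gamma> * (1 + k' / 5) \<le> 1 - k' / 5"
  shows "L2_norm_sq u BI \<noteq> 0 \<and> L2_norm_sq u (BI - inner_layer BI (1 - \<gamma>)) / L2_norm_sq u BI \<le> \<gamma> ^ (2 * n + 1)"
proof -
  let ?S = "BI - inner_layer BI (1 - \<gamma>)"
  have S: "?S \<in> sets borel" unfolding inner_layer_def by (intro sets.Diff measurable_infdist_set) auto
  have Sg: "norm x \<le> \<gamma>" if "x \<in> ?S" for x
  proof (cases "x = 0")
    case False
    have "1 - \<gamma> \<le> infdist x (sphere 0 1)" "norm x < 1" using that by (auto simp: inner_layer_def not_less)
    thus ?thesis using infdist_sphere_le[OF False] by linarith
  qed (use g in simp)
  have ae: "AE x in lborel. x \<in> T \<longrightarrow> (norm (u x))\<^sup>2 = w1 x" if "T \<subseteq> BI" for T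
    using AE_lborel_singleton[of "0::real^3"] by eventually_elim (use that in \<open>auto intro!: u_norm\<close>)
  have cu: "continuous_on BI (cmp u i)" for i by (rule C1_on_imp_continuous_on[OF C2_on_C1[OF u2n(1)]])
  have L: "L2_norm_sq u T = enn2real (energy w1 T)" if "T \<subseteq> BI" "T \<in> sets borel" for T
    by (rule L2_energy[OF w_measurable(1) w_nonneg(1) that(2) ae[OF that(1)] measurable_norm_squared[OF cu that]])
  obtain B where "\<And>x. x \<in> BI ==> w1 x \<le> B" by (rule w1_bounded) blast
  hence fin: "energy w1 BI < \<infinity>" by (rule energy_finite) auto
  have nz: "energy w1 BI \<noteq> 0"
  proof -
    obtain x i where x: "norm x = 1" "Tc f n i x \<noteq> 0" using f0 Tc_nonzero[OF pos(8)] by blast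
    have tp: "tauT f n x > 0" unfolding tauT_def by (rule sum_pos2[of _ i]) (use x in auto)
    have "sgn ((1/2) *\<^sub>R x) = x" using x by (simp add: sgn_scale sgn_div_norm)
    moreover have "Zj n k' (1/2) > 0" by (rule Zj_pos) (use kpos k1 in auto)
    ultimately have wp: "w1 ((1/2) *\<^sub>R x) > 0" using x a tp by (simp add: w1_def)
    have c: "continuous_on (ball 0 1 - {0}) w1"
    proof -
      have "continuous_on (ball 0 1 - {0}) (%x::real^3. Zj n k' (norm x))"
        by (rule continuous_on_compose2[OF continuous_on_Zj[of UNIV]]) (auto intro!: continuous_intros)
      thus ?thesis
        unfolding w1_def[abs_def]
        by (intro continuous_intros continuous_on_compose2[OF continuous_on_tauT[of UNIV]]) auto
    qed
    show ?thesis
      by (rule energy_nonzero[OF w_measurable(1) _ _ _ c, of _ "(1/2) *\<^sub>R x"]) (use wp x in auto)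
  qed
  have le: "energy w1 ?S \<le> ennreal (\<gamma> ^ 3 * \<gamma> ^ (2 * n - 2)) * energy w1 BI"
  proof (rule energy_scale[OF w_measurable(1) S])
    show "AE x in lborel. \<gamma> *\<^sub>R x \<in> ?S \<longrightarrow> x \<in> BI \<and> w1 (\<gamma> *\<^sub>R x) \<le> \<gamma> ^ (2 * n - 2) * w1 x"
      using AE_norm_neq[of 1] AE_norm_neq[of 0]
    proof eventually_elim
      fix x :: "real^3" assume x1: "norm x \<noteq> 1" and x0: "norm x \<noteq> 0"
      show "\<gamma> *\<^sub>R x \<in> ?S \<longrightarrow> x \<in> BI \<and> w1 (\<gamma> *\<^sub>R x) \<le> \<gamma> ^ (2 * n - 2) * w1 x"
      proof
        assume "\<gamma> *\<^sub>R x \<in> ?S"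
        hence "\<gamma> * norm x \<le> \<gamma> * 1" using Sg g by fastforce
        hence "norm x \<le> 1" using g by simp
        with x1 have r1: "norm x < 1" by simp
        have r0: "norm x > 0" using x0 by simp
        define r where "r = norm x"
        have r: "0 < r" "r < 1" using r0 r1 by (simp_all add: r_def)
        have kr: "k' * r \<le> k'" "0 < k' * r" using kpos r mult_left_mono[of r 1 k'] by auto
        define A where "A = Zj n k' (\<gamma> * r) / (\<gamma> * r)"
        define Z where "Z = Zj n k' r / r"
        have kgr: "k' * (\<gamma> * r) \<le> 1"
          using mult_mono[of "\<gamma>" 1 "k' * r" 1] kr k1 g by (simp add: mult.left_commute)
        have A0: "A > 0" unfolding A_def using Zj_pos[of "\<gamma> * r" k' n] r g kpos kgr by simp
        have Z0: "Z > 0" unfolding Z_def using Zj_pos[of r k' n] r kpos kr k1 by simp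
        have "A * (1 - k' * r / 5) \<le> \<gamma> ^ n * (1 + k' * r / 5) * Z"
          unfolding A_def Z_def by (rule Zj_ratio) (use kpos kr k1 r g in auto)
        \<comment> \<open>Here \<open>gk\<close> pays: at the cost of one factor \<gamma> the two
          Bessel corrections become the same factor and cancel.\<close>
        moreover have "A * (\<gamma> * (1 + k' / 5)) \<le> A * (1 - k' * r / 5)"
          using A0 gk kr by (intro mult_left_mono) auto
        moreover have "\<gamma> ^ n * (1 + k' * r / 5) * Z \<le> \<gamma> ^ n * (1 + k' / 5) * Z"
          using kr g Z0 by (intro mult_right_mono mult_left_mono) auto
        ultimately have "(A * \<gamma>) * (1 + k' / 5) \<le> (\<gamma> ^ n * Z) * (1 + k' / 5)" by (simp only: mult_ac)
        hence "A * \<gamma> \<le> \<gamma> ^ n * Z" using kpos by (simp add: mult_right_le_imp_le)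
        moreover have "\<gamma> ^ n = \<gamma> * \<gamma> ^ (n - 1)" using pos(8) by (cases n) auto
        ultimately have "\<gamma> * A \<le> \<gamma> * (\<gamma> ^ (n - 1) * Z)" by (simp add: mult_ac)
        hence "A \<le> \<gamma> ^ (n - 1) * Z" using g by simp
        hence "A\<^sup>2 \<le> (\<gamma> ^ (n - 1) * Z)\<^sup>2" using A0 by (intro power_mono) auto
        also have "\<dots> = \<gamma> ^ (2 * n - 2) * Z\<^sup>2"
          by (simp add: power_mult_distrib diff_mult_distrib2 mult.commute flip: power_mult)
        finally have AZ: "A\<^sup>2 \<le> \<gamma> ^ (2 * n - 2) * Z\<^sup>2" .
        have "w1 (\<gamma> *\<^sub>R x) = (cmod a)\<^sup>2 * A\<^sup>2 * tauT f n (sgn x)"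
          unfolding w1_def sgn_scale[OF g(1)] A_def r_def using g by simp
        also have "\<dots> \<le> (cmod a)\<^sup>2 * (\<gamma> ^ (2 * n - 2) * Z\<^sup>2) * tauT f n (sgn x)"
          by (intro mult_right_mono mult_left_mono AZ) (auto simp: tauT_nonneg)
        also have "\<dots> = \<gamma> ^ (2 * n - 2) * w1 x" unfolding w1_def Z_def r_def by (simp only: mult_ac)
        finally show "x \<in> BI \<and> w1 (\<gamma> *\<^sub>R x) \<le> \<gamma> ^ (2 * n - 2) * w1 x" using r1 by simp
      qed
    qed
  qed (use g in auto)
  have "\<gamma> ^ 3 * \<gamma> ^ (2 * n - 2) = \<gamma> ^ (2 * n + 1)" using pos(8) by (simp flip: power_add)
  thus ?thesis
    using L2_ratio[OF L[OF _ S] L[of BI] le fin nz] g by auto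
qed

text \<open>The profile \<open>Zh\<close> / r decays like r^(-n-1); one power is spent through
  \<open>gk\<close> on the Hankel corrections. The squared amplitude then yields \<gamma>^(-2n), and
  the Jacobian adds \<gamma>^3.\<close>

lemma outer_localization:
  assumes f0: "\<exists>m\<in>{- int n..int n}. f m \<noteq> 0" and b: "b \<noteq> 0" and g: "1 < \<gamma>" "\<gamma> < R"
    and gk: "1 + 2 * (k * R) \<le> \<gamma> * (1 - 2 * (k * R))"
  shows "L2_norm_sq us (ball 0 R - closure BI) \<noteq> 0 \<and>
    L2_norm_sq us ((ball 0 R - closure BI) - outer_layer BI R (\<gamma> - 1)) / L2_norm_sq us (ball 0 R - closure BI) \<le> \<gamma> ^ 3 / \<gamma> ^ (2 * n)"
proof -
  let ?U = "ball (0::real^3) R - closure BI"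
  let ?S = "?U - outer_layer BI R (\<gamma> - 1)"
  have U: "?U = ball 0 R - cball 0 1" by (simp add: closures)
  have Ub: "?U \<in> sets borel" "open ?U" "?U \<subseteq> BE" "bounded ?U"
    unfolding U by (auto intro: open_Diff bounded_subset[OF bounded_ball])
  have S: "?S \<in> sets borel" unfolding outer_layer_def by (rule sets.Diff[OF Ub(1) measurable_infdist_set[OF Ub(1)]])
  have Sg: "\<gamma> \<le> norm x \<and> norm x < R" if "x \<in> ?S" for x
  proof -
    have x: "1 < norm x" "norm x < R" and "\<gamma> - 1 \<le> infdist x (sphere 0 1)"
      using that unfolding U by (auto simp: outer_layer_def closures not_less)
    moreover have "x \<noteq> 0" using x by auto
    ultimately show ?thesis using infdist_sphere_le[of x] by linarith
  qed
  have ae: "AE x in lborel. x \<in> T \<longrightarrow> (norm (us x))\<^sup>2 = w2 x" if "T \<subseteq> BE" for T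
    by (rule AE_I2) (use that in \<open>auto intro!: us_norm\<close>)
  have cu: "continuous_on BE (cmp us i)" for i by (rule C1_on_imp_continuous_on[OF C2_on_C1[OF us2]])
  have L: "L2_norm_sq us T = enn2real (energy w2 T)" if "T \<subseteq> BE" "T \<in> sets borel" for T
    by (rule L2_energy[OF w_measurable(2) w_nonneg(2) that(2) ae[OF that(1)] measurable_norm_squared[OF cu that]])
  obtain B where "\<And>x. x \<in> ball 0 R - cball 0 1 ==> w2 x \<le> B" by (rule w2_bounded) blast
  hence fin: "energy w2 ?U < \<infinity>" by (intro energy_finite) (use Ub U in auto)
  have kR: "k * R > 0" using kpos g by simp
  \<comment> \<open>Forced by \<open>gk\<close>, whose left side is positive; it places all
    arguments k r of the region in the range up to 1/2 required by \<open>Zh_ratio\<close>.\<close>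
  have kR1: "2 * (k * R) < 1"
  proof (rule ccontr)
    assume "\<not> 2 * (k * R) < 1"
    hence "\<gamma> * (1 - 2 * (k * R)) \<le> 0" using g by (intro mult_nonneg_nonpos) auto
    thus False using gk kR by linarith
  qed
  have nz: "energy w2 ?U \<noteq> 0"
  proof -
    obtain x i where x: "norm x = 1" "Tc f n i x \<noteq> 0" using f0 Tc_nonzero[OF pos(8)] by blast
    have tp: "tauT f n x > 0" unfolding tauT_def by (rule sum_pos2[of _ i]) (use x in auto)
    \<comment> \<open>The positive Wronskian excludes a zero at 1, hence also just outside, which
      provides a point of the exterior region with positive density.\<close>
    have "Zh n k 1 \<noteq> 0" using Zh_wronskian_pos[OF kpos(1), of n] by auto
    moreover have "isCont (Zh n k) 1"
      by (rule has_vector_derivative_continuous[OF Zh_deriv(1)]) (use kpos in auto)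
    hence "(Zh n k ---> Zh n k 1) (at_right 1)" by (auto simp: isCont_def intro: filterlim_mono at_le)
    ultimately have "\<forall>\<^sub>F r in at_right 1. Zh n k r \<noteq> 0" by (intro tendsto_imp_eventually_ne)
    moreover have "\<forall>\<^sub>F r in at_right 1. 1 < r \<and> r < R" by (rule eventually_at_rightI[of 1 R]) (use g in auto)
    ultimately have "\<forall>\<^sub>F r in at_right 1. Zh n k r \<noteq> 0 \<and> 1 < r \<and> r < R" by eventually_elim simp
    then obtain r where r: "Zh n k r \<noteq> 0" "1 < r" "r < R" using eventually_happens[of _ "at_right (1::real)"] by force
    have "sgn (r *\<^sub>R x) = x" using x r by (simp add: sgn_scale sgn_div_norm)
    hence wp: "w2 (r *\<^sub>R x) > 0" using x b tp r by (simp add: w2_def)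
    have c: "continuous_on ?U w2" by (rule continuous_on_subset[OF continuous_on_w2]) (auto simp: U)
    show ?thesis
      by (rule energy_nonzero[OF w_measurable(2) Ub(2) order_refl Ub(1) c, of "r *\<^sub>R x"]) (use wp x r in \<open>auto simp: U\<close>)
  qed
  have le: "energy w2 ?S \<le> ennreal (\<gamma> ^ 3 * (1 / \<gamma> ^ (2 * n))) * energy w2 ?U"
  proof (rule energy_scale[OF w_measurable(2) S Ub(1)])
    show "AE x in lborel. \<gamma> *\<^sub>R x \<in> ?S \<longrightarrow> x \<in> ?U \<and> w2 (\<gamma> *\<^sub>R x) \<le> 1 / \<gamma> ^ (2 * n) * w2 x"
      using AE_norm_neq[of 1]
    proof eventually_elim
      fix x :: "real^3" assume x1: "norm x \<noteq> 1"
      show "\<gamma> *\<^sub>R x \<in> ?S \<longrightarrow> x \<in> ?U \<and> w2 (\<gamma> *\<^sub>R x) \<le> 1 / \<gamma> ^ (2 * n) * w2 x"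
      proof
        assume "\<gamma> *\<^sub>R x \<in> ?S"
        hence s: "\<gamma> * 1 \<le> \<gamma> * norm x" "\<gamma> * norm x < R" using Sg[of "\<gamma> *\<^sub>R x"] g by auto
        define r where "r = norm x"
        have r1: "r > 1" using s(1) x1 g by (simp add: r_def)
        have gr: "r < \<gamma> * r" "\<gamma> * r < R" using mult_strict_right_mono[OF g(1), of r] r1 s(2) by (simp_all add: r_def[symmetric])
        have "r \<le> R" using gr by linarith
        hence kr: "k * (\<gamma> * r) \<le> k * R" "k * r \<le> k * R"
          using kpos gr(2) by (simp_all only: mult_le_cancel_left_pos less_imp_le)
        have kr0: "0 < k * r" using kpos r1 by simp
        have kgr: "k * (\<gamma> * r) \<le> 1 / 2" using kr(1) kR1 by linarith
        define A where "A = cmod (Zh n k (\<gamma> * r))"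
        define Z where "Z = cmod (Zh n k r)"
        have "A * \<gamma> ^ n * (1 - 2 * (k * r)) \<le> (1 + 2 * (k * (\<gamma> * r))) * Z"
          unfolding A_def Z_def by (rule Zh_ratio[OF kpos(1) _ kgr]) (use r1 g in auto)
        also have "\<dots> \<le> (\<gamma> * (1 - 2 * (k * r))) * Z"
        proof (rule mult_right_mono)
          have "\<gamma> * (1 - 2 * (k * R)) \<le> \<gamma> * (1 - 2 * (k * r))" using kr g by (intro mult_left_mono) auto
          thus "1 + 2 * (k * (\<gamma> * r)) \<le> \<gamma> * (1 - 2 * (k * r))" using gk kr kr0 by linarith
        qed (simp add: Z_def)
        finally have "(A * \<gamma> ^ n) * (1 - 2 * (k * r)) \<le> (\<gamma> * Z) * (1 - 2 * (k * r))" by (simp only: mult_ac)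
        hence AZ: "A * \<gamma> ^ n \<le> \<gamma> * Z" using kr kr0 kR1 by (simp add: mult_le_cancel_right)
        have "A / (\<gamma> * r) \<le> 1 / \<gamma> ^ n * (Z / r)"
          using AZ g r1 by (simp add: divide_simps) (simp add: mult_ac)
        hence "(A / (\<gamma> * r))\<^sup>2 \<le> (1 / \<gamma> ^ n * (Z / r))\<^sup>2" using g r1 by (intro power_mono) (auto simp: A_def)
        also have "\<dots> = 1 / \<gamma> ^ (2 * n) * (Z / r)\<^sup>2" by (simp add: power_mult_distrib power_divide mult.commute flip: power_mult)
        finally have AZ2: "(A / (\<gamma> * r))\<^sup>2 \<le> 1 / \<gamma> ^ (2 * n) * (Z / r)\<^sup>2" .
        have "w2 (\<gamma> *\<^sub>R x) = (cmod b)\<^sup>2 * (A / (\<gamma> * r))\<^sup>2 * tauT f n (sgn x)"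
          unfolding w2_def A_def r_def using g by (simp add: sgn_scale)
        also have "\<dots> \<le> (cmod b)\<^sup>2 * (1 / \<gamma> ^ (2 * n) * (Z / r)\<^sup>2) * tauT f n (sgn x)"
          by (intro mult_right_mono mult_left_mono AZ2) (auto simp: tauT_nonneg)
        also have "\<dots> = 1 / \<gamma> ^ (2 * n) * w2 x" unfolding w2_def Z_def r_def by (simp only: mult_ac)
        finally show "x \<in> ?U \<and> w2 (\<gamma> *\<^sub>R x) \<le> 1 / \<gamma> ^ (2 * n) * w2 x"
          using r1 gr by (simp add: U r_def)
      qed
    qed
  qed (use g in auto)
  have SU: "?S \<subseteq> BE" using Ub(3) by auto
  show ?thesis
    using L2_ratio[OF L[OF SU S] L[OF Ub(3,1)] le fin nz] g by simp
qed

end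

text \<open>In logarithms the bound on \<delta> reads (2/\<delta> + 1) ln \<gamma> \<le> ln lvl,
  where both logarithms and the denominator are negative; n \<ge> 1/\<delta> lowers the left side
  further.\<close>

lemma inner_exponent:
  fixes \<gamma> lvl \<delta> :: real
  assumes g: "0 < \<gamma>" "\<gamma> < 1" and l: "0 < lvl" "lvl < \<gamma>" and d: "0 < \<delta>" "\<delta> \<le> 2 * ln \<gamma> / (ln lvl - ln \<gamma>)" and n: "real n \<ge> 1 / \<delta>"
  shows "\<gamma> ^ (2 * n + 1) \<le> lvl"
proof -
  have lg: "ln \<gamma> < 0" and ll: "ln lvl - ln \<gamma> < 0" using g l by auto
  have "\<delta> * (ln \<gamma> - ln lvl) \<le> - (2 * ln \<gamma>)"
  proof -
    have "\<delta> * (ln lvl - ln \<gamma>) \<ge> 2 * ln \<gamma>" using d(2) ll by (simp add: neg_le_divide_eq)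
    thus ?thesis by (simp add: algebra_simps)
  qed
  hence "(ln \<gamma> - ln lvl) \<le> - (2 * ln \<gamma>) * (1 / \<delta>)" using d(1) by (simp add: field_simps)
  also have "\<dots> \<le> - (2 * ln \<gamma>) * real n" using n lg by (intro mult_left_mono) auto
  finally have "real (2 * n + 1) * ln \<gamma> \<le> ln lvl" by (simp add: algebra_simps)
  hence "ln (\<gamma> ^ (2 * n + 1)) \<le> ln lvl" using g by (simp only: ln_realpow)
  thus ?thesis using g l by (subst (asm) ln_le_cancel_iff) auto
qed

text \<open>In logarithms the bound on \<delta> reads 3 ln \<gamma> - (2/\<delta>) ln \<gamma> \<le>
  ln lvl, and n \<ge> 1/\<delta> lowers the left side further.\<close>

lemma outer_exponent:
  fixes \<gamma> lvl \<delta> :: real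
  assumes g: "1 < \<gamma>" and l: "0 < lvl" "lvl < 1" and d: "0 < \<delta>" "\<delta> \<le> 2 * ln \<gamma> / (3 * ln \<gamma> - ln lvl)" and n: "real n \<ge> 1 / \<delta>"
  shows "\<gamma> ^ 3 / \<gamma> ^ (2 * n) \<le> lvl"
proof -
  have lg: "ln \<gamma> > 0" and ll: "3 * ln \<gamma> - ln lvl > 0" using g l by (auto intro: add_pos_pos simp: ln_less_zero less_trans[of _ 0])
  have "\<delta> * (3 * ln \<gamma> - ln lvl) \<le> 2 * ln \<gamma>" using d(2) ll by (simp add: pos_le_divide_eq)
  hence "3 * ln \<gamma> - ln lvl \<le> 2 * ln \<gamma> * (1 / \<delta>)" using d(1) by (simp add: field_simps)
  also have "\<dots> \<le> 2 * ln \<gamma> * real n" using n lg by (intro mult_left_mono) auto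
  finally have "ln (\<gamma> ^ 3) \<le> ln (lvl * \<gamma> ^ (2 * n))" using g l by (simp add: ln_mult ln_realpow algebra_simps)
  hence "\<gamma> ^ 3 \<le> lvl * \<gamma> ^ (2 * n)" using g l by (subst (asm) ln_le_cancel_iff) auto
  thus ?thesis using g by (simp add: pos_divide_le_eq)
qed

text \<open>The O-terms are rendered by C and a frequency threshold chosen before
  \<open>lvl\<close>, the contrasts, n, the coefficients and the solution, hence uniform in all of
  them; the smallness of the bound is the last clause. The nonzero denominators are asserted so that
  the quotients are meaningful.\<close>

theorem corollary3p2:
  fixes lam \<mu> \<rho> R \<gamma>\<^sub>1 \<gamma>\<^sub>2 :: real and D :: "(real^3) set"
  assumes "D = ball 0 1"
    and "\<mu> > 0" and "3 * lam + 2 * \<mu> > 0" and "\<rho> > 0"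
    and "D \<subseteq> ball 0 R"
    and "0 < \<gamma>\<^sub>1" and "\<gamma>\<^sub>1 < 1" and "1 < \<gamma>\<^sub>2" and "\<gamma>\<^sub>2 < R"
  shows "\<exists>C>0. \<exists>\<omega>\<^sub>0>0.
    (\<forall>(lvl::real) (\<delta>::real) (\<epsilon>::real) lam' \<mu>' \<rho>' (n::nat) (f::int \<Rightarrow> complex) (\<omega>::real) u us.
       0 < lvl \<and> lvl < \<gamma>\<^sub>1 \<and>
       0 < \<delta> \<and> \<delta> < 1 \<and> 0 < \<epsilon> \<and> \<epsilon> < 1 \<and> sqrt (\<delta> / \<epsilon>) < 1 \<and>
       lam' = lam / \<delta> \<and> \<mu>' = \<mu> / \<delta> \<and> \<rho>' = \<rho> / \<epsilon> \<and>
       \<delta> \<le> min (2 * ln \<gamma>\<^sub>1 / (ln lvl - ln \<gamma>\<^sub>1)) (2 * ln \<gamma>\<^sub>2 / (3 * ln \<gamma>\<^sub>2 - ln lvl)) \<and>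
       n \<ge> 1 \<and> real n \<ge> 1 / \<delta> \<and>
       (\<exists>m\<in>{- int n..int n}. f m \<noteq> 0) \<and>
       0 < \<omega> \<and> \<omega> < \<omega>\<^sub>0 \<and>
       scattering_solution D sgn lam \<mu> \<rho> lam' \<mu>' \<rho>' \<omega> (incident_field n f (k_s \<mu> \<rho> \<omega>)) u us
       \<longrightarrow>
       L2_norm_sq u D \<noteq> 0 \<and>
       L2_norm_sq u (D - inner_layer D (1 - \<gamma>\<^sub>1)) / L2_norm_sq u D \<le> lvl + C * (lvl * \<omega>\<^sup>2) \<and>
       L2_norm_sq us (ball 0 R - closure D) \<noteq> 0 \<and>
       L2_norm_sq us ((ball 0 R - closure D) - outer_layer D R (\<gamma>\<^sub>2 - 1))
         / L2_norm_sq us (ball 0 R - closure D) \<le> lvl + C * (lvl * \<omega>\<^sup>2)) \<and>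
    (\<forall>\<eta>>0. \<exists>lvl\<^sub>0>0. \<forall>lvl \<omega>. 0 < lvl \<and> lvl < lvl\<^sub>0 \<and> 0 < \<omega> \<and> \<omega> < \<omega>\<^sub>0 \<longrightarrow>
       lvl + C * (lvl * \<omega>\<^sup>2) < \<eta>)"
proof -
  have R: "R > 1" using assms(8,9) by simp
  define s where "s = sqrt (\<rho> / \<mu>)"
  have s: "s > 0" using assms by (simp add: s_def)
  \<comment> \<open>An upper bound for both wave numbers. The first entry gives \<gamma> (1 + k'/5)
    \<le> 1 - k'/5 inside; the second, solved for k, is 1 + 2 k R \<le> \<gamma> (1 - 2 k R)
    outside.\<close>
  define \<kappa> where "\<kappa> = min (1 - \<gamma>\<^sub>1) ((\<gamma>\<^sub>2 - 1) / (2 * R * (1 + \<gamma>\<^sub>2)))"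
  have \<kappa>: "\<kappa> > 0" "\<kappa> \<le> 1 - \<gamma>\<^sub>1" "\<kappa> \<le> (\<gamma>\<^sub>2 - 1) / (2 * R * (1 + \<gamma>\<^sub>2))" using assms R by (auto simp: \<kappa>_def)
  define \<omega>\<^sub>0 where "\<omega>\<^sub>0 = \<kappa> / s"
  have \<omega>0: "\<omega>\<^sub>0 > 0" using \<kappa> s by (simp add: \<omega>\<^sub>0_def)
  have main: "L2_norm_sq u D \<noteq> 0 \<and> L2_norm_sq u (D - inner_layer D (1 - \<gamma>\<^sub>1)) / L2_norm_sq u D \<le> lvl \<and>
       L2_norm_sq us (ball 0 R - closure D) \<noteq> 0 \<and>
       L2_norm_sq us ((ball 0 R - closure D) - outer_layer D R (\<gamma>\<^sub>2 - 1)) / L2_norm_sq us (ball 0 R - closure D) \<le> lvl"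
    if lvl: "0 < lvl" "lvl < \<gamma>\<^sub>1" and d: "0 < \<delta>" "\<delta> < 1" and e: "0 < \<epsilon>" "\<epsilon> < 1" "sqrt (\<delta> / \<epsilon>) < 1"
      and tilde: "lam' = lam / \<delta>" "\<mu>' = \<mu> / \<delta>" "\<rho>' = \<rho> / \<epsilon>"
      and db: "\<delta> \<le> min (2 * ln \<gamma>\<^sub>1 / (ln lvl - ln \<gamma>\<^sub>1)) (2 * ln \<gamma>\<^sub>2 / (3 * ln \<gamma>\<^sub>2 - ln lvl))"
      and n: "real n \<ge> 1 / \<delta>" and f: "\<exists>m\<in>{- int n..int n}. f m \<noteq> 0" and \<omega>: "0 < \<omega>" "\<omega> < \<omega>\<^sub>0"
      and sol: "scattering_solution D sgn lam \<mu> \<rho> lam' \<mu>' \<rho>' \<omega> (incident_field n f (k_s \<mu> \<rho> \<omega>)) u us"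
    for lvl \<delta> \<epsilon> lam' \<mu>' \<rho>' n f \<omega> u us
  proof -
    define k where "k = k_s \<mu> \<rho> \<omega>"
    define k' where "k' = k_s \<mu>' \<rho>' \<omega>"
    \<comment> \<open>From \<delta> < 1 and n \<ge> 1/\<delta> one gets n \<ge> 2, the range in
      which the interior traction is positive.\<close>
    have "1 / \<delta> > 1" using d by simp
    then have n2: "n \<ge> 2" using n by linarith
    have ks: "k = \<omega> * s" by (simp add: k_def k_s_def s_def)
    have kpos: "k > 0" using \<omega> s by (simp add: ks)
    have "\<omega> * s < \<omega>\<^sub>0 * s" using \<omega> s by (intro mult_strict_right_mono)
    then have klt: "k < \<kappa>" unfolding ks \<omega>\<^sub>0_def using s by simp
    have "\<rho>' / \<mu>' = (\<delta> / \<epsilon>) * (\<rho> / \<mu>)" unfolding tilde using d e by (simp add: field_simps)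
    then have "sqrt (\<rho>' / \<mu>') = sqrt (\<delta> / \<epsilon>) * s" unfolding s_def by (simp only: real_sqrt_mult)
    \<comment> \<open>The interior wave number is \<tau> k, and \<tau> < 1 is the strict inequality
      required by the Sturm comparison.\<close>
    then have k's: "k' = sqrt (\<delta> / \<epsilon>) * k" unfolding k'_def k_s_def ks by simp
    have k'pos: "k' > 0" unfolding k's using d e kpos by simp
    have k'k: "k' < k" unfolding k's using e kpos by simp
    have k1: "k \<le> 1" using klt \<kappa> assms by linarith
    obtain a b where ab: "a \<noteq> 0" "b \<noteq> 0" "a * of_real (Zj n k' 1) = of_real (Zj n k 1) + b * Zh n k 1"
      "a * of_real (Zj' n k' 1) - 2 * (a * of_real (Zj n k' 1))
        = of_real \<delta> * ((of_real (Zj' n k 1) + b * Zh' n k 1) - 2 * (of_real (Zj n k 1) + b * Zh n k 1))"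
      by (rule matching_coefficients[OF n2 d k'pos k'k k1]) blast
    interpret scattering lam \<mu> \<rho> lam' \<mu>' \<rho>' \<omega> n f u us k k' a b
    proof
      show "\<mu> > 0" "\<rho> > 0" "\<omega> > 0" using assms \<omega> by simp_all
      show l: "lam + 2 * \<mu> > 0" using assms by linarith
      show "\<mu>' > 0" "\<rho>' > 0" using assms d e by (simp_all add: tilde)
      have "lam' + 2 * \<mu>' = (lam + 2 * \<mu>) / \<delta>" by (simp add: tilde add_divide_distrib)
      then show "lam' + 2 * \<mu>' > 0" using l d by simp
      show "n \<ge> 1" using n2 by simp
      show "k = k_s \<mu> \<rho> \<omega>" "k' = k_s \<mu>' \<rho>' \<omega>" by (simp_all add: k_def k'_def)
      show "scattering_solution (ball 0 1) sgn lam \<mu> \<rho> lam' \<mu>' \<rho>' \<omega> (incident_field n f k) u us"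
        using sol unfolding assms(1) k_def .
      show "a * of_real (Zj n k' 1) = of_real (Zj n k 1) + b * Zh n k 1" by (rule ab(3))
      show "of_real \<mu>' * (a * of_real (Zj' n k' 1) - 2 * (a * of_real (Zj n k' 1)))
        = of_real \<mu> * ((of_real (Zj' n k 1) + b * Zh' n k 1) - 2 * (of_real (Zj n k 1) + b * Zh n k 1))"
        unfolding ab(4) tilde using d by simp
    qed
    have "\<gamma>\<^sub>1 * k' \<le> 1 * k'" using assms k'pos by (intro mult_right_mono) auto
    then have g1: "\<gamma>\<^sub>1 * (1 + k' / 5) \<le> 1 - k' / 5"
      unfolding distrib_left mult_1_right times_divide_eq_right using k'k klt \<kappa>(2) k'pos by linarith
    have k'1: "k' \<le> 1" using k'k k1 by simp
    have "k * (2 * R * (1 + \<gamma>\<^sub>2)) \<le> \<gamma>\<^sub>2 - 1"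
      using klt \<kappa>(3) R assms by (simp add: pos_le_divide_eq[symmetric])
    then have g2: "1 + 2 * (k * R) \<le> \<gamma>\<^sub>2 * (1 - 2 * (k * R))" by (simp add: algebra_simps)
    have l1: "\<gamma>\<^sub>1 ^ (2 * n + 1) \<le> lvl" by (rule inner_exponent[OF assms(6,7) lvl d(1) _ n]) (use db in simp)
    have l2: "\<gamma>\<^sub>2 ^ 3 / \<gamma>\<^sub>2 ^ (2 * n) \<le> lvl" by (rule outer_exponent[OF assms(8) lvl(1) _ d(1) _ n]) (use db lvl assms(7) in simp_all)
    show ?thesis
      unfolding assms(1)
      using inner_localization[OF f ab(1) assms(6,7) k'1 g1] outer_localization[OF f ab(2) assms(8,9) g2] l1 l2 by force
  qed
  show ?thesis
  \<comment> \<open>The quotients are bounded by \<open>lvl\<close> itself, so C = 1 merely adds a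
    nonnegative term.\<close>
  proof (rule exI[of _ 1], rule conjI, simp, rule exI[of _ \<omega>\<^sub>0], rule conjI, rule \<omega>0, rule conjI, intro allI impI)
    fix lvl \<delta> \<epsilon> lam' \<mu>' \<rho>' :: real and n :: nat and f :: "int \<Rightarrow> complex" and \<omega> :: real and u us :: "real^3 \<Rightarrow> complex^3"
    assume h: "0 < lvl \<and> lvl < \<gamma>\<^sub>1 \<and>
       0 < \<delta> \<and> \<delta> < 1 \<and> 0 < \<epsilon> \<and> \<epsilon> < 1 \<and> sqrt (\<delta> / \<epsilon>) < 1 \<and>
       lam' = lam / \<delta> \<and> \<mu>' = \<mu> / \<delta> \<and> \<rho>' = \<rho> / \<epsilon> \<and>
       \<delta> \<le> min (2 * ln \<gamma>\<^sub>1 / (ln lvl - ln \<gamma>\<^sub>1)) (2 * ln \<gamma>\<^sub>2 / (3 * ln \<gamma>\<^sub>2 - ln lvl)) \<and>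
       n \<ge> 1 \<and> real n \<ge> 1 / \<delta> \<and>
       (\<exists>m\<in>{- int n..int n}. f m \<noteq> 0) \<and>
       0 < \<omega> \<and> \<omega> < \<omega>\<^sub>0 \<and>
       scattering_solution D sgn lam \<mu> \<rho> lam' \<mu>' \<rho>' \<omega> (incident_field n f (k_s \<mu> \<rho> \<omega>)) u us"
    have m: "L2_norm_sq u D \<noteq> 0 \<and> L2_norm_sq u (D - inner_layer D (1 - \<gamma>\<^sub>1)) / L2_norm_sq u D \<le> lvl \<and>
       L2_norm_sq us (ball 0 R - closure D) \<noteq> 0 \<and>
       L2_norm_sq us ((ball 0 R - closure D) - outer_layer D R (\<gamma>\<^sub>2 - 1)) / L2_norm_sq us (ball 0 R - closure D) \<le> lvl"
      by (rule main[of lvl \<delta> \<epsilon> lam' \<mu>' \<rho>' n f \<omega> u us]) (use h in blast)+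
    have w: "lvl \<le> lvl + 1 * (lvl * \<omega>\<^sup>2)" using h by simp
    from m show "L2_norm_sq u D \<noteq> 0 \<and>
       L2_norm_sq u (D - inner_layer D (1 - \<gamma>\<^sub>1)) / L2_norm_sq u D \<le> lvl + 1 * (lvl * \<omega>\<^sup>2) \<and>
       L2_norm_sq us (ball 0 R - closure D) \<noteq> 0 \<and>
       L2_norm_sq us ((ball 0 R - closure D) - outer_layer D R (\<gamma>\<^sub>2 - 1))
         / L2_norm_sq us (ball 0 R - closure D) \<le> lvl + 1 * (lvl * \<omega>\<^sup>2)"
      using order_trans[OF _ w] by blast
  next
    have w0: "1 + \<omega>\<^sub>0\<^sup>2 > 0" by (rule add_pos_nonneg) auto
    \<comment> \<open>For frequencies below the threshold the whole bound is at most
      \<open>lvl\<close> times \<open>1 + \<omega>\<^sub>0\<^sup>2\<close>, which dictates the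
      witness.\<close>
    have "\<exists>lvl\<^sub>0>0. \<forall>lvl \<omega>. 0 < lvl \<and> lvl < lvl\<^sub>0 \<and> 0 < \<omega> \<and> \<omega> < \<omega>\<^sub>0 \<longrightarrow> lvl + 1 * (lvl * \<omega>\<^sup>2) < \<eta>" if \<eta>: "\<eta> > 0" for \<eta>
    proof (intro exI[of _ "\<eta> / (1 + \<omega>\<^sub>0\<^sup>2)"] conjI allI impI)
      show "\<eta> / (1 + \<omega>\<^sub>0\<^sup>2) > 0" using \<eta> w0 by simp
      fix lvl \<omega> assume h: "0 < lvl \<and> lvl < \<eta> / (1 + \<omega>\<^sub>0\<^sup>2) \<and> 0 < \<omega> \<and> \<omega> < \<omega>\<^sub>0"
      have "\<omega>\<^sup>2 \<le> \<omega>\<^sub>0\<^sup>2" using h by (intro power_mono) auto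
      then have "lvl + 1 * (lvl * \<omega>\<^sup>2) \<le> lvl * (1 + \<omega>\<^sub>0\<^sup>2)" using h by (simp add: algebra_simps)
      also have "\<dots> < \<eta>" using h w0 by (simp add: pos_less_divide_eq)
      finally show "lvl + 1 * (lvl * \<omega>\<^sup>2) < \<eta>" .
    qed
    then show "\<forall>\<eta>>0. \<exists>lvl\<^sub>0>0. \<forall>lvl \<omega>. 0 < lvl \<and> lvl < lvl\<^sub>0 \<and> 0 < \<omega> \<and> \<omega> < \<omega>\<^sub>0 \<longrightarrow>
       lvl + 1 * (lvl * \<omega>\<^sup>2) < \<eta>" by blast
  qed
qed

end
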